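(* Let $s\geq 1$ and let $b$ be a nondegenerate bilinear form on $\mathbb K^{s+1}$ with components $B_{\mu\nu}=b(e_\mu,e_\nu)$ in the canonical basis $(e_\lambda)_{\lambda\in\{0,\dots,s\}}$ of $\mathbb K^{s+1}$. Then the quadratic algebra $\mathcal A$ generated by the elements $x^\lambda$ $(\lambda\in\{0,\dots,s\})$ with the single relation $\sum_{\mu,\nu}B_{\mu\nu}x^\mu x^\nu=0$ is Koszul of global dimension 2 and Gorenstein. Furthermore, any connected graded algebra generated by $s+1$ elements $x^\lambda$ $(\lambda\in\{0,\dots,s\})$ of degree 1 with finitely many relations of degrees $\geq 2$ which is of global dimension 2 and Gorenstein is the quadratic algebra generated by the $x^\lambda$ with the single relation $\sum_{\mu,\nu}B_{\mu\nu}x^\mu x^\nu=0$, where $B_{\mu\nu}=b(e_\mu,e_\nu)$, for some nondegenerate bilinear form $b$ on $\mathbb K^{s+1}$.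
   Context: $\mathbb K$ is an algebraically closed field of characteristic zero; all algebras are unital associative over $\mathbb K$ and $\otimes=\otimes_{\mathbb K}$. Connected graded: $\mathcal A=\oplus_{n\geq 0}\mathcal A_n$ with $\mathcal A_0=\mathbb K$. "Generated by $s+1$ elements of degree 1 with finitely many relations of degrees $\geq 2$" means $\mathcal A\cong T(E)/I$ as graded algebra, with $E$ of dimension $s+1$ in degree 1 and $I$ a two-sided ideal generated by finitely many homogeneous elements of degrees $\geq 2$. Koszul (quadratic case): for $\mathcal A=T(E)/(R)$ with $E$ finite-dimensional and $R\subset E\otimes E$, let $\mathcal A^!=T(E^* )/(R^\perp)$, with $R^\perp\subset (E\otimes E)^*=E^*\otimes E^*$ the annihilator of $R$. Then $(\mathcal A^!_n)^*\subset E^{\otimes n}$ and the Koszul complex is $\cdots\to\mathcal A\otimes(\mathcal A^!_{n+1})^*\xrightarrow{d}\mathcal A\otimes(\mathcal A^!_n)^*\to\cdots\to\mathcal A\to 0$ with $d$ induced by $a\otimes(v_1\otimes\cdots\otimes v_{n+1})\mapsto av_1\otimes(v_2\otimes\cdots\otimes v_{n+1})$; $\mathcal A$ is Koszul if this complex is acyclic in positive degrees. Gorenstein: a connected graded algebra $\mathcal A$ of finite global dimension $D$ is Gorenstein if, for the trivial left $\mathcal A$-module $\mathbb K$, $\mathrm{Ext}^i_{\mathcal A}(\mathbb K,\mathcal A)=0$ for $i\neq D$ and $\mathrm{Ext}^D_{\mathcal A}(\mathbb K,\mathcal A)\cong\mathbb K$ (the trivial right $\mathcal A$-module, up to a shift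 of grading). *)

theory Defs
  imports
    "HOL-Library.Extended_Nat"
    "HOL-Library.Poly_Mapping"
    "HOL-Computational_Algebra.Polynomial"
    "HOL-Algebra.QuotRing"
    "HOL-Algebra.Module"
    "HOL-Analysis.Cartesian_Space"
begin

section \<open>Algebras over a field and connected gradings\<close>

text \<open>
  The base field is a type \<open>'k\<close> of class \<^class>\<open>field\<close>; an algebra is a record of type
  \<^typ>\<open>('k, 'c) module\<close>, which has both ring operations and a scalar multiplication.
  (The locale \<open>algebra\<close> of \<open>HOL-Algebra\<close> covers commutative algebras only.)
\<close>

locale k_algebra = ring A for A :: "('k::field, 'c) module" (structure) +
  assumes smult_closed: "x \<in> carrier A \<Longrightarrow> c \<odot> x \<in> carrier A"
    and smult_add_left: "x \<in> carrier A \<Longrightarrow> (c + d) \<odot> x = c \<odot> x \<oplus> d \<odot> x"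
    and smult_add_right: "x \<in> carrier A \<Longrightarrow> y \<in> carrier A \<Longrightarrow> c \<odot> (x \<oplus> y) = c \<odot> x \<oplus> c \<odot> y"
    and smult_smult: "x \<in> carrier A \<Longrightarrow> (c * d) \<odot> x = c \<odot> (d \<odot> x)"
    and smult_1: "x \<in> carrier A \<Longrightarrow> 1 \<odot> x = x"
    and smult_mult_left: "x \<in> carrier A \<Longrightarrow> y \<in> carrier A \<Longrightarrow> (c \<odot> x) \<otimes> y = c \<odot> (x \<otimes> y)"
    and smult_mult_right: "x \<in> carrier A \<Longrightarrow> y \<in> carrier A \<Longrightarrow> x \<otimes> (c \<odot> y) = c \<odot> (x \<otimes> y)"

definition homogeneous_components ::
    "('c, 'z) ring_scheme \<Rightarrow> (nat \<Rightarrow> 'c set) \<Rightarrow> 'c \<Rightarrow> (nat \<Rightarrow> 'c) \<Rightarrow> bool" where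
  "homogeneous_components A gr a f \<longleftrightarrow>
     (\<forall>n. f n \<in> gr n) \<and> finite {n. f n \<noteq> \<zero>\<^bsub>A\<^esub>} \<and> a = (\<Oplus>\<^bsub>A\<^esub>n\<in>{n. f n \<noteq> \<zero>\<^bsub>A\<^esub>}. f n)"

locale connected_graded_algebra = k_algebra A
    for A :: "('k::field, 'c) module" (structure) and gr :: "nat \<Rightarrow> 'c set" +
  assumes gr_subset: "gr n \<subseteq> carrier A"
    and gr_zero: "\<zero> \<in> gr n"
    and gr_add: "x \<in> gr n \<Longrightarrow> y \<in> gr n \<Longrightarrow> x \<oplus> y \<in> gr n"
    and gr_smult: "x \<in> gr n \<Longrightarrow> c \<odot> x \<in> gr n"
    and gr_mult: "x \<in> gr m \<Longrightarrow> y \<in> gr n \<Longrightarrow> x \<otimes> y \<in> gr (m + n)"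
    and gr_direct_sum: "a \<in> carrier A \<Longrightarrow> \<exists>!f. homogeneous_components A gr a f"
    and gr_0: "gr 0 = range (\<lambda>c. c \<odot> \<one>)"
    and one_not_zero: "\<one> \<noteq> \<zero>"

text \<open>The projection of a connected graded algebra onto its degree \<open>0\<close> part, identified with \<open>'k\<close>.\<close>

definition augmentation :: "('k::field, 'c) module \<Rightarrow> (nat \<Rightarrow> 'c set) \<Rightarrow> 'c \<Rightarrow> 'k" where
  "augmentation A gr a =
     (THE c. \<exists>f. homogeneous_components A gr a f \<and> f 0 = c \<odot>\<^bsub>A\<^esub> \<one>\<^bsub>A\<^esub>)"


section \<open>Modules, projective resolutions and global dimension\<close>

text \<open>
  Modules over a ring with elements in \<open>'c\<close> are records of type \<^typ>\<open>('c, 'm) module\<close> whose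
  multiplicative fields are irrelevant.
\<close>

locale left_module = A?: ring A + M?: abelian_group M
    for A :: "('c, 'z) ring_scheme" (structure) and M :: "('c, 'm) module" (structure) +
  assumes smult_closed: "a \<in> carrier A \<Longrightarrow> x \<in> carrier M \<Longrightarrow> a \<odot>\<^bsub>M\<^esub> x \<in> carrier M"
    and smult_l_distr: "a \<in> carrier A \<Longrightarrow> b \<in> carrier A \<Longrightarrow> x \<in> carrier M \<Longrightarrow>
      (a \<oplus> b) \<odot>\<^bsub>M\<^esub> x = a \<odot>\<^bsub>M\<^esub> x \<oplus>\<^bsub>M\<^esub> b \<odot>\<^bsub>M\<^esub> x"
    and smult_r_distr: "a \<in> carrier A \<Longrightarrow> x \<in> carrier M \<Longrightarrow> y \<in> carrier M \<Longrightarrow>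
      a \<odot>\<^bsub>M\<^esub> (x \<oplus>\<^bsub>M\<^esub> y) = a \<odot>\<^bsub>M\<^esub> x \<oplus>\<^bsub>M\<^esub> a \<odot>\<^bsub>M\<^esub> y"
    and smult_assoc: "a \<in> carrier A \<Longrightarrow> b \<in> carrier A \<Longrightarrow> x \<in> carrier M \<Longrightarrow>
      (a \<otimes> b) \<odot>\<^bsub>M\<^esub> x = a \<odot>\<^bsub>M\<^esub> (b \<odot>\<^bsub>M\<^esub> x)"
    and smult_one: "x \<in> carrier M \<Longrightarrow> \<one> \<odot>\<^bsub>M\<^esub> x = x"

text \<open>
  Homomorphisms are extensional, so that equality of homomorphisms is equality of functions.
  A right module is encoded with \<open>a \<odot> x\<close> standing for \<open>x a\<close>; as the condition
  on \<open>\<odot>\<close> reads the same on both sides, \<open>module_homs\<close> serves left and right modules.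
\<close>

definition module_homs ::
    "('c, 'z) ring_scheme \<Rightarrow> ('c, 'm) module \<Rightarrow> ('c, 'n) module \<Rightarrow> ('m \<Rightarrow> 'n) set" where
  "module_homs A M N = {h \<in> carrier M \<rightarrow>\<^sub>E carrier N.
     (\<forall>x\<in>carrier M. \<forall>y\<in>carrier M. h (x \<oplus>\<^bsub>M\<^esub> y) = h x \<oplus>\<^bsub>N\<^esub> h y) \<and>
     (\<forall>a\<in>carrier A. \<forall>x\<in>carrier M. h (a \<odot>\<^bsub>M\<^esub> x) = a \<odot>\<^bsub>N\<^esub> h x)}"

definition free_module :: "('c, 'z) ring_scheme \<Rightarrow> 'i set \<Rightarrow> ('c, 'i \<Rightarrow> 'c) module" where
  "free_module A X =
     \<lparr>carrier = {f. (\<forall>x. f x \<in> carrier A) \<and> (\<forall>x. x \<notin> X \<longrightarrow> f x = \<zero>\<^bsub>A\<^esub>) \<and> finite {x. f x \<noteq> \<zero>\<^bsub>A\<^esub>}},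
      mult = undefined, one = undefined, zero = (\<lambda>_. \<zero>\<^bsub>A\<^esub>),
      add = (\<lambda>f g x. f x \<oplus>\<^bsub>A\<^esub> g x), smult = (\<lambda>a f x. a \<otimes>\<^bsub>A\<^esub> f x)\<rparr>"

text \<open>
  Projective means direct summand of a free module. A module \<open>P\<close> with elements in \<open>'m\<close> is a
  quotient of the free module on \<open>carrier P\<close>, so index sets in \<open>'m\<close> suffice.
\<close>

definition projective_module :: "('c, 'z) ring_scheme \<Rightarrow> ('c, 'm) module \<Rightarrow> bool" where
  "projective_module A P \<longleftrightarrow> left_module A P \<and>
     (\<exists>(X :: 'm set). \<exists>i \<in> module_homs A P (free_module A X). \<exists>p \<in> module_homs A (free_module A X) P.
        \<forall>x\<in>carrier P. p (i x) = x)"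

definition projective_resolution ::
    "('c, 'z) ring_scheme \<Rightarrow> ('c, 'n) module \<Rightarrow> (nat \<Rightarrow> ('c, 'm) module) \<Rightarrow>
     (nat \<Rightarrow> 'm \<Rightarrow> 'm) \<Rightarrow> ('m \<Rightarrow> 'n) \<Rightarrow> bool" where
  "projective_resolution A M P d e \<longleftrightarrow>
     (\<forall>i. projective_module A (P i)) \<and>
     (\<forall>i. d i \<in> module_homs A (P (Suc i)) (P i)) \<and>
     e \<in> module_homs A (P 0) M \<and>
     e ` carrier (P 0) = carrier M \<and>
     d 0 ` carrier (P 1) = a_kernel (P 0) M e \<and>
     (\<forall>i. d (Suc i) ` carrier (P (Suc (Suc i))) = a_kernel (P (Suc i)) (P i) (d i))"

text \<open>
  All modules, including the terms of resolutions, have their elements in a type \<open>'m\<close>, which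
  plays the role of a universe. To make these the usual notions, \<open>'m\<close> must be infinite and at
  least as large as the ring: then \<open>'m\<close> contains a copy of every cyclic module and of every
  free module on a subset of \<open>'m\<close>. The global dimension is the left one; for connected graded
  algebras it agrees with the right one.
\<close>

definition proj_dim :: "('c, 'z) ring_scheme \<Rightarrow> ('c, 'm) module \<Rightarrow> enat" where
  "proj_dim A M = (INF n \<in> {n. \<exists>(P :: nat \<Rightarrow> ('c, 'm) module) d e.
     projective_resolution A M P d e \<and> (\<forall>i>n. carrier (P i) = {\<zero>\<^bsub>P i\<^esub>})}. enat n)"

definition global_dim :: "'m itself \<Rightarrow> ('c, 'z) ring_scheme \<Rightarrow> enat" where
  "global_dim _ A = (SUP M \<in> {M :: ('c, 'm) module. left_module A M}. proj_dim A M)"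


section \<open>Ext and the Gorenstein property\<close>

text \<open>
  The quotient of \<open>M\<close> by \<open>N\<close>, for \<open>M\<close> a (left or right) module and \<open>N\<close> a submodule, or \<open>M\<close> an
  algebra and \<open>N\<close> a two-sided ideal. The ring operations are those of \<^const>\<open>FactRing\<close>.
\<close>

definition quotient_module :: "('c, 'm) module \<Rightarrow> 'm set \<Rightarrow> ('c, 'm set) module" where
  "quotient_module M N =
     \<lparr>carrier = a_rcosets\<^bsub>M\<^esub> N, mult = rcoset_mult M N, one = N +>\<^bsub>M\<^esub> \<one>\<^bsub>M\<^esub>,
      zero = N, add = set_add M, smult = (\<lambda>a X. \<Union>x\<in>X. N +>\<^bsub>M\<^esub> (a \<odot>\<^bsub>M\<^esub> x))\<rparr>"

definition regular_module :: "('c, 'z) ring_scheme \<Rightarrow> ('c, 'c) module" where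
  "regular_module A =
     \<lparr>carrier = carrier A, mult = undefined, one = undefined, zero = \<zero>\<^bsub>A\<^esub>,
      add = add A, smult = mult A\<rparr>"

text \<open>\<open>Hom\<^sub>A(P, A)\<close> for a left module \<open>P\<close>, as a right module: \<open>(f a)(p) = f(p) a\<close>.\<close>

definition dual_module :: "('c, 'z) ring_scheme \<Rightarrow> ('c, 'm) module \<Rightarrow> ('c, 'm \<Rightarrow> 'c) module" where
  "dual_module A P =
     \<lparr>carrier = module_homs A P (regular_module A), mult = undefined, one = undefined,
      zero = (\<lambda>p\<in>carrier P. \<zero>\<^bsub>A\<^esub>),
      add = (\<lambda>f g. \<lambda>p\<in>carrier P. f p \<oplus>\<^bsub>A\<^esub> g p),
      smult = (\<lambda>a f. \<lambda>p\<in>carrier P. f p \<otimes>\<^bsub>A\<^esub> a)\<rparr>"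

definition ext_cocycles ::
    "('c, 'z) ring_scheme \<Rightarrow> (nat \<Rightarrow> ('c, 'm) module) \<Rightarrow> (nat \<Rightarrow> 'm \<Rightarrow> 'm) \<Rightarrow> nat \<Rightarrow> ('m \<Rightarrow> 'c) set" where
  "ext_cocycles A P d i =
     {f \<in> carrier (dual_module A (P i)). \<forall>p\<in>carrier (P (Suc i)). f (d i p) = \<zero>\<^bsub>A\<^esub>}"

definition ext_coboundaries ::
    "('c, 'z) ring_scheme \<Rightarrow> (nat \<Rightarrow> ('c, 'm) module) \<Rightarrow> (nat \<Rightarrow> 'm \<Rightarrow> 'm) \<Rightarrow> nat \<Rightarrow> ('m \<Rightarrow> 'c) set" where
  "ext_coboundaries A P d i = (case i of
       0 \<Rightarrow> {\<zero>\<^bsub>dual_module A (P 0)\<^esub>}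
     | Suc j \<Rightarrow> (\<lambda>g. \<lambda>p\<in>carrier (P (Suc j)). g (d j p)) ` carrier (dual_module A (P j)))"

text \<open>\<open>Ext\<^sup>i\<^sub>A(M, A)\<close> as a right module, computed from a projective resolution \<open>P\<close>, \<open>d\<close> of \<open>M\<close>.\<close>

definition ext_module ::
    "('c, 'z) ring_scheme \<Rightarrow> (nat \<Rightarrow> ('c, 'm) module) \<Rightarrow> (nat \<Rightarrow> 'm \<Rightarrow> 'm) \<Rightarrow> nat \<Rightarrow>
     ('c, ('m \<Rightarrow> 'c) set) module" where
  "ext_module A P d i =
     quotient_module ((dual_module A (P i))\<lparr>carrier := ext_cocycles A P d i\<rparr>) (ext_coboundaries A P d i)"

text \<open>
  The trivial module, on which homogeneous elements of positive degree act by \<open>0\<close>. As \<open>'k\<close> is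
  commutative, it is both the trivial left and the trivial right module.
\<close>

definition trivial_module :: "('k::field, 'c) module \<Rightarrow> (nat \<Rightarrow> 'c set) \<Rightarrow> ('c, 'k) module" where
  "trivial_module A gr =
     \<lparr>carrier = UNIV, mult = undefined, one = undefined, zero = 0, add = (+),
      smult = (\<lambda>a c. augmentation A gr a * c)\<rparr>"

text \<open>
  \<open>Ext\<close> does not depend, up to isomorphism, on the projective resolution used to compute it.
  The isomorphism with the trivial module is one of ungraded modules, that is, no condition is
  put on the degree in which the one-dimensional space \<open>Ext\<^sup>D\<^sub>A(\<bbbK>, A)\<close> sits.
\<close>

definition gorenstein ::
    "'m itself \<Rightarrow> ('k::field, 'c) module \<Rightarrow> (nat \<Rightarrow> 'c set) \<Rightarrow> bool" where
  "gorenstein U A gr \<longleftrightarrow> connected_graded_algebra A gr \<and>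
     (\<exists>D::nat. global_dim U A = enat D \<and>
       (\<exists>(P :: nat \<Rightarrow> ('c, 'm) module) d e.
          projective_resolution A (trivial_module A gr) P d e \<and>
          (\<forall>i. i \<noteq> D \<longrightarrow> carrier (ext_module A P d i) = {\<zero>\<^bsub>ext_module A P d i\<^esub>}) \<and>
          (\<exists>h \<in> module_homs A (ext_module A P d D) (trivial_module A gr).
             bij_betw h (carrier (ext_module A P d D)) (carrier (trivial_module A gr)))))"


section \<open>Tensor algebras and presentations\<close>

text \<open>
  Words under concatenation form a monoid, and \<^typ>\<open>'n list \<Rightarrow>\<^sub>0 'k\<close> with its convolution product
  is the tensor algebra of the vector space with basis \<open>'n\<close>: a word \<open>[\<lambda>\<^sub>1, \<dots>, \<lambda>\<^sub>n]\<close> stands for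
  the product \<open>x\<^bsup>\<lambda>\<^sub>1\<^esup> \<dots> x\<^bsup>\<lambda>\<^sub>n\<^esup>\<close>.
\<close>

instantiation list :: (type) monoid_add
begin
definition zero_list_def: "0 = []"
definition plus_list_def: "xs + ys = xs @ ys"
instance by standard (simp_all add: zero_list_def plus_list_def)
end

definition tensor_algebra :: "('k::field, 'n list \<Rightarrow>\<^sub>0 'k) module" where
  "tensor_algebra =
     \<lparr>carrier = UNIV, mult = (*), one = 1, zero = 0, add = (+),
      smult = (\<lambda>c p. Poly_Mapping.single [] c * p)\<rparr>"

definition homogeneous :: "nat \<Rightarrow> ('n list \<Rightarrow>\<^sub>0 'k::zero) set" where
  "homogeneous n = {p. \<forall>v \<in> Poly_Mapping.keys p. length v = n}"

text \<open>\<open>presented_algebra S\<close> is \<open>T(E)/(S)\<close>; it is graded by \<open>presented_grading S\<close> when \<open>S\<close> consists of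
  homogeneous elements.\<close>

definition presented_algebra :: "('n list \<Rightarrow>\<^sub>0 'k) set \<Rightarrow> ('k::field, ('n list \<Rightarrow>\<^sub>0 'k) set) module" where
  "presented_algebra S = quotient_module tensor_algebra (Idl\<^bsub>tensor_algebra\<^esub> S)"

definition residue_class :: "('n list \<Rightarrow>\<^sub>0 'k::field) set \<Rightarrow> ('n list \<Rightarrow>\<^sub>0 'k) \<Rightarrow> ('n list \<Rightarrow>\<^sub>0 'k) set" where
  "residue_class S p = (Idl\<^bsub>tensor_algebra\<^esub> S) +>\<^bsub>tensor_algebra\<^esub> p"

definition presented_grading ::
    "('n list \<Rightarrow>\<^sub>0 'k::field) set \<Rightarrow> nat \<Rightarrow> ('n list \<Rightarrow>\<^sub>0 'k) set set" where
  "presented_grading S n = residue_class S ` homogeneous n"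

definition presented_gen :: "('n list \<Rightarrow>\<^sub>0 'k::field) set \<Rightarrow> 'n \<Rightarrow> ('n list \<Rightarrow>\<^sub>0 'k) set" where
  "presented_gen S l = residue_class S (Poly_Mapping.single [l] 1)"

text \<open>The graded algebra \<open>A\<close> is the algebra generated by the \<open>x l\<close> with relations \<open>S\<close>.\<close>

definition has_presentation ::
    "('k::field, 'c) module \<Rightarrow> (nat \<Rightarrow> 'c set) \<Rightarrow> ('n \<Rightarrow> 'c) \<Rightarrow> ('n list \<Rightarrow>\<^sub>0 'k) set \<Rightarrow> bool" where
  "has_presentation A gr x S \<longleftrightarrow>
     (\<exists>h \<in> ring_iso (presented_algebra S) A.
        (\<forall>c. \<forall>p \<in> carrier (presented_algebra S). h (c \<odot>\<^bsub>presented_algebra S\<^esub> p) = c \<odot>\<^bsub>A\<^esub> h p) \<and>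
        (\<forall>n. h ` presented_grading S n = gr n) \<and>
        (\<forall>l. h (presented_gen S l) = x l))"


section \<open>Koszul algebras\<close>

text \<open>
  \<open>T(E\<^sup>*)\<close> is represented by the same type, using the dual basis; \<open>pairing\<close> is the resulting
  pairing of \<open>T(E\<^sup>*)\<close> with \<open>T(E)\<close>, which identifies \<open>(E\<^sup>*)\<^bsup>\<otimes>n\<^esup>\<close> with \<open>(E\<^bsup>\<otimes>n\<^esup>)\<^sup>*\<close>.
\<close>

definition pairing :: "('n list \<Rightarrow>\<^sub>0 'k::field) \<Rightarrow> ('n list \<Rightarrow>\<^sub>0 'k) \<Rightarrow> 'k" where
  "pairing f w = (\<Sum>v \<in> Poly_Mapping.keys w. Poly_Mapping.lookup f v * Poly_Mapping.lookup w v)"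

definition quadratic_perp :: "('n list \<Rightarrow>\<^sub>0 'k::field) set \<Rightarrow> ('n list \<Rightarrow>\<^sub>0 'k) set" where
  "quadratic_perp R = {f \<in> homogeneous 2. \<forall>r\<in>R. pairing f r = 0}"

text \<open>
  \<open>(A\<^sup>!\<^sub>n)\<^sup>*\<close> inside \<open>E\<^bsup>\<otimes>n\<^esup>\<close>: linear forms on the quotient \<open>A\<^sup>!\<^sub>n\<close> of \<open>(E\<^sup>*)\<^bsup>\<otimes>n\<^esup>\<close> by the degree \<open>n\<close> part
  of the ideal \<open>(R\<^sup>\<bottom>)\<close> are the elements of \<open>E\<^bsup>\<otimes>n\<^esup>\<close> annihilated by that part.
\<close>

definition koszul_dual_star :: "('n list \<Rightarrow>\<^sub>0 'k::field) set \<Rightarrow> nat \<Rightarrow> ('n list \<Rightarrow>\<^sub>0 'k) set" where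
  "koszul_dual_star R n = {w \<in> homogeneous n.
     \<forall>f \<in> (Idl\<^bsub>tensor_algebra\<^esub> (quadratic_perp R)) \<inter> homogeneous n. pairing f w = 0}"

text \<open>
  An element of \<open>A \<otimes> E\<^bsup>\<otimes>n\<^esup>\<close> is represented by its coefficients in \<open>A\<close> with respect to the basis of
  words of length \<open>n\<close>, so that \<open>a \<otimes> w\<close> is the function \<open>v \<mapsto> w\<^sub>v a\<close>. The differential maps
  \<open>a \<otimes> l v\<close>, where \<open>l\<close> is a letter and \<open>v\<close> a word, to \<open>a x\<^sup>l \<otimes> v\<close>.
\<close>

definition koszul_term ::
    "('n list \<Rightarrow>\<^sub>0 'k::field) set \<Rightarrow> nat \<Rightarrow> ('n list \<Rightarrow> ('n list \<Rightarrow>\<^sub>0 'k) set) set" where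
  "koszul_term R n = {(\<lambda>v. \<Oplus>\<^bsub>presented_algebra R\<^esub>i\<in>{..<m}. Poly_Mapping.lookup (w i) v \<odot>\<^bsub>presented_algebra R\<^esub> a i) | m a w.
     \<forall>i<(m::nat). a i \<in> carrier (presented_algebra R) \<and> w i \<in> koszul_dual_star R n}"

definition koszul_diff ::
    "('n::finite list \<Rightarrow>\<^sub>0 'k::field) set \<Rightarrow> ('n list \<Rightarrow> ('n list \<Rightarrow>\<^sub>0 'k) set) \<Rightarrow>
     'n list \<Rightarrow> ('n list \<Rightarrow>\<^sub>0 'k) set" where
  "koszul_diff R f v = (\<Oplus>\<^bsub>presented_algebra R\<^esub>l\<in>UNIV. f (l # v) \<otimes>\<^bsub>presented_algebra R\<^esub> presented_gen R l)"

text \<open>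
  Koszulness of \<open>T(E)/(R)\<close>. Here \<open>R\<close> may be a set of generators of the space of relations, as
  both \<open>(R)\<close> and \<open>R\<^sup>\<bottom>\<close> depend on the span of \<open>R\<close> only.
\<close>

definition koszul :: "('n::finite list \<Rightarrow>\<^sub>0 'k::field) set \<Rightarrow> bool" where
  "koszul R \<longleftrightarrow> R \<subseteq> homogeneous 2 \<and>
     (\<forall>n. \<forall>f \<in> koszul_term R (Suc n). koszul_diff R f = (\<lambda>_. \<zero>\<^bsub>presented_algebra R\<^esub>) \<longrightarrow>
        (\<exists>g \<in> koszul_term R (Suc (Suc n)). koszul_diff R g = f))"


section \<open>Bilinear forms\<close>

definition bilinear_form :: "('k::field ^ 'n \<Rightarrow> 'k ^ 'n \<Rightarrow> 'k) \<Rightarrow> bool" where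
  "bilinear_form b \<longleftrightarrow>
     (\<forall>u. Vector_Spaces.linear (*s) (*) (\<lambda>v. b u v)) \<and>
     (\<forall>v. Vector_Spaces.linear (*s) (*) (\<lambda>u. b u v))"

definition nondegenerate :: "('k::field ^ 'n \<Rightarrow> 'k ^ 'n \<Rightarrow> 'k) \<Rightarrow> bool" where
  "nondegenerate b \<longleftrightarrow>
     (\<forall>u. (\<forall>v. b u v = 0) \<longrightarrow> u = 0) \<and> (\<forall>v. (\<forall>u. b u v = 0) \<longrightarrow> v = 0)"

definition form_relation :: "('k::field ^ 'n::finite \<Rightarrow> 'k ^ 'n \<Rightarrow> 'k) \<Rightarrow> 'n list \<Rightarrow>\<^sub>0 'k" where
  "form_relation b =
     (\<Sum>\<mu>\<in>UNIV. \<Sum>\<nu>\<in>UNIV. Poly_Mapping.single [\<mu>, \<nu>] (b (axis \<mu> 1) (axis \<nu> 1)))"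

end

theory Submission
  imports Defs "HOL-Library.Equipollence" "HOL-Library.Countable_Set"
begin

text \<open>
  Write \<open>f = \<Sum> B\<^sub>\<mu>\<^sub>\<nu> x\<^sup>\<mu> x\<^sup>\<nu>\<close>. Nondegeneracy makes right multiplication by a nonzero linear form injective on
  \<open>\<A> = T/(f)\<close> and shows that every relation \<open>\<Sum> q\<^sub>l x\<^sup>l = 0\<close> is a multiple of the one given by \<open>f\<close>, so that
  \<open>0 \<rightarrow> \<A> \<rightarrow> \<A>\<^sup>s\<^sup>+\<^sup>1 \<rightarrow> \<A> \<rightarrow> \<bbbK> \<rightarrow> 0\<close> is exact. The dual quadratic algebra vanishes above degree \<open>2\<close>, which makes
  this the Koszul complex; reversal of words shows that the dual complex resolves \<open>\<bbbK>\<close>. For an arbitrary module \<open>M\<close>,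
  the complex \<open>0 \<rightarrow> \<A> \<otimes> M \<rightarrow> \<A> \<otimes> E \<otimes> M \<rightarrow> \<A> \<otimes> M \<rightarrow> M \<rightarrow> 0\<close> is exact since it is filtered by the degree in \<open>\<A>\<close>
  with leading part the previous one; hence the global dimension is \<open>2\<close>.

  Conversely, a minimal set of relations gives \<open>0 \<rightarrow> \<A>\<^sup>m \<rightarrow> \<A>\<^sup>s\<^sup>+\<^sup>1 \<rightarrow> \<A> \<rightarrow> \<bbbK> \<rightarrow> 0\<close>, exact at \<open>\<A>\<^sup>m\<close> because the
  projective dimension of \<open>\<bbbK>\<close> is at most \<open>2\<close>. That \<open>Ext\<^sup>2(\<bbbK>, \<A>) = \<bbbK>\<close> forces \<open>m = 1\<close> and forces each generator to
  be a combination \<open>\<Sum> (r/x\<^sup>l) v\<^sub>l\<close> of the right quotients of the single relation \<open>r\<close>. So \<open>r\<close> is quadratic and its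
  matrix of coefficients is invertible.
\<close>

text \<open>The hypothesis s >= 1 enters through the existence of a nonzero vector orthogonal to a
  given one; for s = 0 the algebra K[x]/(x^2) has infinite global dimension. All modules and
  resolutions are ungraded, so minimal graded resolutions and the graded Nakayama lemma are not at
  hand. A resolution that is merely given is compared with the complex of generators and relations
  by chain maps, and smallness is expressed by the constant term \<open>eps\<close> and by the
  filtration by lowest degree. The converse draws on two resolutions: one of length two, which the
  global dimension provides for a copy of K inside 'm and which yields injectivity on A^m, and the
  one in the Gorenstein hypothesis, possibly of infinite length, which carries Ext. Since B need not
  be symmetric, left-handed statements are derived from the right-handed ones for the transposed
  matrix. Computations take place in T modulo the ideal, on representatives; even the complex for a
  module M is first written over T, where its differentials compose to multiplication by f instead
  of 0.\<close>

abbreviation lookup :: "('a \<Rightarrow>\<^sub>0 'b::zero) \<Rightarrow> 'a \<Rightarrow> 'b" where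
  "lookup \<equiv> Poly_Mapping.lookup"

abbreviation single :: "'a \<Rightarrow> 'b::zero \<Rightarrow> 'a \<Rightarrow>\<^sub>0 'b" where
  "single \<equiv> Poly_Mapping.single"

abbreviation keys :: "('a \<Rightarrow>\<^sub>0 'b::zero) \<Rightarrow> 'a set" where
  "keys \<equiv> Poly_Mapping.keys"

abbreviation scalar :: "'k \<Rightarrow> 'n list \<Rightarrow>\<^sub>0 'k::field" where
  "scalar c \<equiv> single [] c"

abbreviation gen :: "'n \<Rightarrow> 'n list \<Rightarrow>\<^sub>0 'k::field" where
  "gen l \<equiv> single [l] 1"

section \<open>The tensor algebra\<close>

text \<open>Reduces identities that are additive in \<open>p\<close> to monomials; bilinear ones are
  treated by using it twice.\<close>

lemma poly_mapping_additive_induct [case_names zero single add]: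
  fixes p :: "'a \<Rightarrow>\<^sub>0 'b::ab_group_add"
  assumes "P 0" "\<And>w c. P (single w c)" "\<And>p q. P p \<Longrightarrow> P q \<Longrightarrow> P (p + q)"
  shows "P p"
proof (induction p rule: Poly_Mapping.update_induct)
  case const
  show ?case by fact
next
  case (update f a b)
  have "Poly_Mapping.update a b f = f + single a b"
    using update(1)
    by (auto intro!: poly_mapping_eqI simp: lookup_update lookup_add lookup_single when_def
        in_keys_iff)
  then show ?case using assms update by simp
qed

lemma single_mult_single:
  "single u a * single v b = single (u @ v) (a * b :: 'k::field)"
  by (simp add: mult_single plus_list_def)

lemma one_tensor: "(1 :: 'n list \<Rightarrow>\<^sub>0 'k::field) = scalar 1"
  by (metis single_one zero_list_def)

lemma scalar_1_mult [simp]: "scalar (1::'k::field) * p = p" "p * scalar 1 = p"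
  by (simp_all add: one_tensor [symmetric])

lemma scalar_mult_single [simp]: "scalar (c::'k::field) * single w a = single w (c * a)"
  "single w a * scalar c = single w (c * a)"
  by (simp_all add: single_mult_single mult.commute)

lemma scalar_commute: "scalar (c::'k::field) * p = p * scalar c"
  by (induction p rule: poly_mapping_additive_induct) (simp_all add: algebra_simps)

lemma scalar_left_commute: "p * (scalar (c::'k::field) * q) = scalar c * (p * q)"
  by (metis mult.assoc scalar_commute)

lemma lookup_scalar_mult: "lookup (scalar (c::'k::field) * p) w = c * lookup p w"
  by (induction p rule: poly_mapping_additive_induct)
     (simp_all add: algebra_simps lookup_add lookup_single when_def)

subsection \<open>Homogeneous components\<close>

definition component :: "nat \<Rightarrow> ('n list \<Rightarrow>\<^sub>0 'k::field) \<Rightarrow> 'n list \<Rightarrow>\<^sub>0 'k" where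
  "component n p = Abs_poly_mapping (\<lambda>w. lookup p w when length w = n)"

lemma lookup_component: "lookup (component n p) w = (if length w = n then lookup p w else 0)"
proof -
  have "finite {w. (lookup p w when length w = n) \<noteq> 0}"
    by (rule finite_subset[of _ "keys p"]) (auto simp: in_keys_iff)
  then show ?thesis
    unfolding component_def by (subst lookup_Abs_poly_mapping) (auto simp: when_def)
qed

lemma component_add: "component n (p + q) = component n p + component n q"
  by (rule poly_mapping_eqI) (simp add: lookup_component lookup_add)

lemma component_0 [simp]: "component n 0 = 0"
  by (rule poly_mapping_eqI) (simp add: lookup_component)

lemma component_diff: "component n (p - q) = component n p - component n q"
  by (rule poly_mapping_eqI) (simp add: lookup_component lookup_minus)

lemma component_sum: "component n (sum f A) = (\<Sum>a\<in>A. component n (f a))"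
  by (rule poly_mapping_eqI) (simp add: lookup_component lookup_sum)

lemma component_single: "component n (single w c) = (if length w = n then single w c else 0)"
  by (rule poly_mapping_eqI) (auto simp: lookup_component lookup_single when_def)

lemma component_component: "component m (component n p) = (if m = n then component n p else 0)"
  by (rule poly_mapping_eqI) (auto simp: lookup_component)

lemma homogeneous_iff: "p \<in> homogeneous n \<longleftrightarrow> component n p = p"
  by (auto simp: homogeneous_def poly_mapping_eq_iff fun_eq_iff lookup_component in_keys_iff)

lemma component_homogeneous: "component n p \<in> homogeneous n"
  by (simp add: homogeneous_iff component_component)

lemma component_of_homogeneous:
  "p \<in> homogeneous n \<Longrightarrow> component m p = (if m = n then p else 0)"
  by (metis component_component homogeneous_iff)

lemma component_mult:
  "component n (p * q) = (\<Sum>i\<le>n. component i p * component (n - i) q)"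
proof (induction p rule: poly_mapping_additive_induct)
  case (single w c)
  show ?case
  proof (induction q rule: poly_mapping_additive_induct)
    case (single v d)
    have "(\<Sum>i\<le>n. component i (single w c) * component (n - i) (single v d)) =
       (\<Sum>i\<le>n. if i = length w then single w c * component (n - i) (single v d) else 0)"
      by (rule sum.cong) (auto simp: component_single)
    also have "\<dots> = component n (single w c * single v d)"
      by (auto simp: component_single single_mult_single)
    finally show "component n (single w c * single v d) =
      (\<Sum>i\<le>n. component i (single w c) * component (n - i) (single v d))" ..
  qed (simp_all add: component_add algebra_simps sum.distrib)
qed (simp_all add: component_add algebra_simps sum.distrib)

text \<open>A homogeneous right factor leaves a single summand of the convolution; the guard
  excludes the truncated value of \<open>n - d\<close>.\<close>

lemma component_mult_homogeneous_right:
  assumes "q \<in> homogeneous d"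
  shows "component n (p * q) = (if d \<le> n then component (n - d) p * q else 0)"
proof -
  have "component n (p * q) = (\<Sum>i\<le>n. if i = n - d \<and> d \<le> n then component i p * q else 0)"
    unfolding component_mult
    by (intro sum.cong) (auto simp: component_of_homogeneous[OF assms])
  also have "\<dots> = (if d \<le> n then component (n - d) p * q else 0)"
    by auto
  finally show ?thesis .
qed

lemma homogeneous_mult:
  fixes p q :: "'n list \<Rightarrow>\<^sub>0 'k::field"
  shows "p \<in> homogeneous m \<Longrightarrow> q \<in> homogeneous n \<Longrightarrow> p * q \<in> homogeneous (m + n)"
  by (auto simp: homogeneous_iff component_mult_homogeneous_right)

lemma homogeneous_0 [simp]: "0 \<in> homogeneous n"
  by (simp add: homogeneous_def)

lemma homogeneous_add:
  fixes p q :: "'n list \<Rightarrow>\<^sub>0 'k::field"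
  shows "p \<in> homogeneous n \<Longrightarrow> q \<in> homogeneous n \<Longrightarrow> p + q \<in> homogeneous n"
  by (simp add: homogeneous_iff component_add)

lemma homogeneous_diff:
  fixes p q :: "'n list \<Rightarrow>\<^sub>0 'k::field"
  shows "p \<in> homogeneous n \<Longrightarrow> q \<in> homogeneous n \<Longrightarrow> p - q \<in> homogeneous n"
  by (simp add: homogeneous_iff component_diff)

lemma homogeneous_sum:
  fixes f :: "'a \<Rightarrow> 'n list \<Rightarrow>\<^sub>0 'k::field"
  shows "(\<And>a. a \<in> A \<Longrightarrow> f a \<in> homogeneous n) \<Longrightarrow> sum f A \<in> homogeneous n"
  by (simp add: homogeneous_iff component_sum)

lemma homogeneous_single: "length w = n \<Longrightarrow> single w c \<in> homogeneous n"
  by (simp add: homogeneous_def)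

lemma homogeneous_scalar_mult: "p \<in> homogeneous n \<Longrightarrow> scalar c * p \<in> homogeneous n"
  using homogeneous_mult[of "scalar c" 0 p n] by (simp add: homogeneous_single)

lemma component_0_eq: "component 0 p = scalar (lookup p [])"
  by (rule poly_mapping_eqI) (auto simp: lookup_component lookup_single when_def)

lemma homogeneous_0_eq_scalar:
  fixes p :: "'n list \<Rightarrow>\<^sub>0 'k::field"
  shows "p \<in> homogeneous 0 \<Longrightarrow> p = scalar (lookup p [])"
  by (metis component_0_eq homogeneous_iff)

text \<open>Inserting 0 gives the zero element the degree 0 instead of the maximum of an empty
  set.\<close>

definition max_degree :: "('n list \<Rightarrow>\<^sub>0 'k::field) \<Rightarrow> nat" where
  "max_degree p = Max (insert 0 (length ` keys p))"

lemma component_above_max_degree: "max_degree p < n \<Longrightarrow> component n p = 0"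
  by (rule poly_mapping_eqI) (auto simp: max_degree_def lookup_component in_keys_iff)

lemma sum_components:
  assumes "max_degree p \<le> N"
  shows "p = (\<Sum>n\<le>N. component n p)"
proof (rule poly_mapping_eqI)
  fix w
  have "lookup p w = 0" if "\<not> length w \<le> N"
    using component_above_max_degree[of p "length w"] that assms
    by (metis le_less_trans linorder_not_le lookup_component lookup_zero)
  then show "lookup p w = lookup (\<Sum>n\<le>N. component n p) w"
    by (simp add: lookup_sum lookup_component)
qed

lemma eq_0_of_components: "(\<And>n. component n p = 0) \<Longrightarrow> p = 0"
  using sum_components[of p "max_degree p"] by simp

subsection \<open>Splitting off the last letter\<close>

text \<open>The right quotient p/x^l: \<open>map_key\<close> pulls coefficients back along appending
  \<open>l\<close>, so that words with another last letter, and the empty word, are dropped.\<close>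

definition rquot :: "'n \<Rightarrow> ('n list \<Rightarrow>\<^sub>0 'k::field) \<Rightarrow> 'n list \<Rightarrow>\<^sub>0 'k" where
  "rquot l = Poly_Mapping.map_key (\<lambda>w. w @ [l])"

lemma lookup_rquot: "lookup (rquot l p) w = lookup p (w @ [l])"
  by (simp add: rquot_def map_key.rep_eq inj_def)

lemma rquot_add: "rquot l (p + q) = rquot l p + rquot l q"
  by (rule poly_mapping_eqI) (simp add: lookup_rquot lookup_add)

lemma rquot_0 [simp]: "rquot l 0 = 0"
  by (rule poly_mapping_eqI) (simp add: lookup_rquot)

lemma rquot_sum: "rquot l (sum f A) = (\<Sum>a\<in>A. rquot l (f a))"
  by (rule poly_mapping_eqI) (simp add: lookup_rquot lookup_sum)

lemma lookup_mult_gen: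
  "lookup (p * gen l) (w @ [m]) = (if l = m then lookup p w else 0)"
  by (induction p rule: poly_mapping_additive_induct)
     (auto simp: algebra_simps lookup_add single_mult_single lookup_single when_def)

lemma lookup_mult_gen_Nil: "lookup (p * gen l) [] = 0"
  by (induction p rule: poly_mapping_additive_induct)
     (auto simp: algebra_simps lookup_add single_mult_single lookup_single when_def)

lemma rquot_mult_gen: "rquot l (p * gen m) = (if l = m then p else 0)"
  by (rule poly_mapping_eqI) (auto simp: lookup_rquot lookup_mult_gen)

lemma rquot_sum_gen: "rquot l (\<Sum>m\<in>UNIV. q m * gen m) = q (l :: 'n::finite)"
  by (simp add: rquot_sum rquot_mult_gen)

lemma split_last: "p = scalar (lookup p []) + (\<Sum>l\<in>UNIV. rquot l p * gen (l :: 'n::finite))"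
proof (rule poly_mapping_eqI)
  fix w
  show "lookup p w = lookup (scalar (lookup p []) + (\<Sum>l\<in>UNIV. rquot l p * gen l)) w"
    by (cases w rule: rev_cases)
       (simp_all add: lookup_add lookup_sum lookup_mult_gen lookup_mult_gen_Nil lookup_single lookup_rquot)
qed

text \<open>The last letter of a product comes from \<open>q\<close>, except that the constant term
  of \<open>q\<close> lets the last letter of \<open>p\<close> through.\<close>

lemma rquot_mult: "rquot l (p * q) = p * rquot l q + scalar (lookup q []) * rquot l p"
proof (induction p rule: poly_mapping_additive_induct)
  case (single w c)
  show ?case
  proof (induction q rule: poly_mapping_additive_induct)
    case (single v d)
    have rs: "rquot l (single v d) = (if v \<noteq> [] \<and> last v = l then single (butlast v) d else 0)" for v and d :: 'b
      by (rule poly_mapping_eqI) (auto simp: lookup_rquot lookup_single when_def)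
    show "rquot l (single w c * single v d) =
      single w c * rquot l (single v d) + scalar (lookup (single v d) []) * rquot l (single w c)"
      by (cases v rule: rev_cases) (auto simp: rs single_mult_single lookup_single butlast_append mult.commute)
  qed (simp_all add: algebra_simps rquot_add lookup_add single_add)
qed (simp_all add: algebra_simps rquot_add)

lemma lookup_Nil_mult: "lookup (p * q) [] = lookup p [] * lookup q ([] :: 'n list) " for p :: "'n list \<Rightarrow>\<^sub>0 'k::field"
proof -
  have "component 0 (p * q) = component 0 p * component 0 q"
    by (simp add: component_mult)
  then show ?thesis
    by (simp add: component_0_eq inj_eq[OF inj_single])
qed

lemma rquot_homogeneous: "p \<in> homogeneous n \<Longrightarrow> rquot l p \<in> homogeneous (n - 1)"
proof -
  assume p: "p \<in> homogeneous n"
  have "length w = n - 1" if "lookup p (w @ [l]) \<noteq> 0" for w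
    using p that by (force simp: homogeneous_def in_keys_iff)
  then show ?thesis by (simp add: homogeneous_def in_keys_iff lookup_rquot)
qed

subsection \<open>Two-sided ideals\<close>

lemma ring_tensor_algebra: "ring (tensor_algebra :: ('k::field, 'n list \<Rightarrow>\<^sub>0 'k) module)"
proof (rule ringI)
  show "abelian_group (tensor_algebra :: ('k, 'n list \<Rightarrow>\<^sub>0 'k) module)"
    by (rule abelian_groupI) (auto simp: tensor_algebra_def algebra_simps intro: exI[of _ "- x" for x] right_minus)
  show "monoid (tensor_algebra :: ('k, 'n list \<Rightarrow>\<^sub>0 'k) module)"
    by (rule monoidI) (auto simp: tensor_algebra_def algebra_simps)
qed (auto simp: tensor_algebra_def algebra_simps)

lemma tensor_algebra_simps [simp]:
  "carrier tensor_algebra = UNIV" "mult tensor_algebra = (*)" "one tensor_algebra = 1"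
  "zero tensor_algebra = 0" "add tensor_algebra = (+)" "smult tensor_algebra = (\<lambda>c p. scalar c * p)"
  by (simp_all add: tensor_algebra_def)

abbreviation tensor_ideal :: "('n list \<Rightarrow>\<^sub>0 'k::field) set \<Rightarrow> bool" where
  "tensor_ideal J \<equiv> ideal J tensor_algebra"

lemma tensor_a_inv [simp]: "a_inv tensor_algebra p = - p"
proof -
  interpret ring tensor_algebra by (rule ring_tensor_algebra)
  show ?thesis by (rule minus_equality) auto
qed

lemma tensor_idealI:
  assumes "0 \<in> J" "\<And>p q. p \<in> J \<Longrightarrow> q \<in> J \<Longrightarrow> p + q \<in> J"
    "\<And>p q. p \<in> J \<Longrightarrow> q * p \<in> J" "\<And>p q. p \<in> J \<Longrightarrow> p * q \<in> J"
  shows "tensor_ideal J"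
proof -
  interpret ring tensor_algebra by (rule ring_tensor_algebra)
  have "- p \<in> J" if "p \<in> J" for p using assms(3)[OF that, of "-1"] by simp
  then have "subgroup J (add_monoid tensor_algebra)"
    using assms by (intro subgroup.intro) (auto simp: tensor_a_inv[unfolded a_inv_def, simplified])
  then show ?thesis using assms by (intro idealI ring_tensor_algebra) auto
qed

context
  fixes J :: "('n list \<Rightarrow>\<^sub>0 'k::field) set"
  assumes J: "tensor_ideal J"
begin

lemma tensor_ideal_0: "0 \<in> J"
  using additive_subgroup.zero_closed[OF ideal.axioms(1)[OF J]] by simp

lemma tensor_ideal_add: "p \<in> J \<Longrightarrow> q \<in> J \<Longrightarrow> p + q \<in> J"
  using additive_subgroup.a_closed[OF ideal.axioms(1)[OF J]] by simp

lemma tensor_ideal_uminus: "p \<in> J \<Longrightarrow> - p \<in> J"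
  using additive_subgroup.a_inv_closed[OF ideal.axioms(1)[OF J]] by simp

lemma tensor_ideal_diff: "p \<in> J \<Longrightarrow> q \<in> J \<Longrightarrow> p - q \<in> J"
  using tensor_ideal_add tensor_ideal_uminus by fastforce

lemma tensor_ideal_left: "p \<in> J \<Longrightarrow> q * p \<in> J"
  using ideal.I_l_closed[OF J] by simp

lemma tensor_ideal_right: "p \<in> J \<Longrightarrow> p * q \<in> J"
  using ideal.I_r_closed[OF J] by simp

lemma tensor_ideal_sum: "(\<And>a. a \<in> A \<Longrightarrow> f a \<in> J) \<Longrightarrow> sum f A \<in> J"
  by (induction A rule: infinite_finite_induct) (auto intro: tensor_ideal_0 tensor_ideal_add)

lemma tensor_ideal_diff_sym: "p - q \<in> J \<Longrightarrow> q - p \<in> J"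
  using tensor_ideal_uminus[of "p - q"] by simp

lemma tensor_ideal_cong: "p - q \<in> J \<Longrightarrow> p \<in> J \<longleftrightarrow> q \<in> J"
  using tensor_ideal_add[of "p - q" q] tensor_ideal_diff[of p "p - q"] by auto

end

lemma tensor_ideal_Idl: "tensor_ideal (Idl\<^bsub>tensor_algebra\<^esub> S)"
  by (rule ring.genideal_ideal[OF ring_tensor_algebra]) simp

lemma Idl_self: "s \<in> S \<Longrightarrow> s \<in> Idl\<^bsub>tensor_algebra\<^esub> S"
  using ring.genideal_self[OF ring_tensor_algebra, of S] by auto

lemma Idl_subset: "tensor_ideal J \<Longrightarrow> S \<subseteq> J \<Longrightarrow> Idl\<^bsub>tensor_algebra\<^esub> S \<subseteq> J"
  by (rule ring.genideal_minimal[OF ring_tensor_algebra])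

text \<open>The elements all of whose components lie in the ideal again form a two-sided ideal, by
  \<open>component_mult\<close>, and it contains \<open>S\<close>.\<close>

lemma component_Idl:
  assumes S: "\<And>s. s \<in> S \<Longrightarrow> \<exists>n. s \<in> homogeneous n"
    and p: "p \<in> Idl\<^bsub>tensor_algebra\<^esub> S"
  shows "component n p \<in> Idl\<^bsub>tensor_algebra\<^esub> S"
proof -
  note id = tensor_ideal_Idl[of S]
  have "Idl\<^bsub>tensor_algebra\<^esub> S \<subseteq> {p. \<forall>n. component n p \<in> Idl\<^bsub>tensor_algebra\<^esub> S}"
  proof (intro Idl_subset tensor_idealI)
    show "S \<subseteq> {p. \<forall>n. component n p \<in> Idl\<^bsub>tensor_algebra\<^esub> S}"
      using S by (auto simp: component_of_homogeneous intro: Idl_self tensor_ideal_0[OF id])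
         (metis Idl_self component_of_homogeneous id tensor_ideal_0)
  qed (auto simp: component_add component_mult intro!: tensor_ideal_0[OF id]
      tensor_ideal_add[OF id] tensor_ideal_sum[OF id]
      intro: tensor_ideal_left[OF id] tensor_ideal_right[OF id])
  then show ?thesis using p by auto
qed

text \<open>Having no component of degree below 2 is preserved by sums and by multiplication on
  either side.\<close>

lemma component_Idl_low:
  assumes S: "\<And>s. s \<in> S \<Longrightarrow> \<exists>n\<ge>2. s \<in> homogeneous n"
    and p: "p \<in> Idl\<^bsub>tensor_algebra\<^esub> S" and "n < 2"
  shows "component n p = 0"
proof -
  have "Idl\<^bsub>tensor_algebra\<^esub> S \<subseteq> {p. \<forall>n<2. component n p = 0}"
  proof (intro Idl_subset tensor_idealI)
    show "S \<subseteq> {p. \<forall>n<2. component n p = 0}"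
      using S by (force simp: component_of_homogeneous)
  qed (auto simp: component_add component_mult)
  then show ?thesis using p \<open>n < 2\<close> by auto
qed

text \<open>Since \<open>T = \<bbbK> \<oplus> \<Sum>\<^sub>l T x\<^sub>l\<close>, the ideal is \<open>T S T = T S + \<Sum>\<^sub>l (T S T) x\<^sub>l\<close>.\<close>

lemma Idl_decompose:
  fixes S :: "('n::finite list \<Rightarrow>\<^sub>0 'k::field) set"
  assumes p: "p \<in> Idl\<^bsub>tensor_algebra\<^esub> S" and "finite S"
  obtains t i where "\<And>l. i l \<in> Idl\<^bsub>tensor_algebra\<^esub> S"
    "p = (\<Sum>s\<in>S. t s * s) + (\<Sum>l\<in>UNIV. i l * gen l)"
proof -
  let ?I = "Idl\<^bsub>tensor_algebra\<^esub> S"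
  note id = tensor_ideal_Idl[of S]
  define J where "J = {p. \<exists>t i. (\<forall>l. i l \<in> ?I) \<and> p = (\<Sum>s\<in>S. t s * s) + (\<Sum>l\<in>UNIV. i l * gen l)}"
  have J_I: "J \<subseteq> ?I"
    unfolding J_def by (auto intro!: tensor_ideal_add[OF id] tensor_ideal_sum[OF id]
        intro: Idl_self tensor_ideal_left[OF id] tensor_ideal_right[OF id])
  have J_add: "p + q \<in> J" if pq: "p \<in> J" "q \<in> J" for p q
  proof -
    obtain t i t' i' where "\<forall>l. i l \<in> ?I" "p = (\<Sum>s\<in>S. t s * s) + (\<Sum>l\<in>UNIV. i l * gen l)"
      "\<forall>l. i' l \<in> ?I" "q = (\<Sum>s\<in>S. t' s * s) + (\<Sum>l\<in>UNIV. i' l * gen l)"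
      using pq unfolding J_def by blast
    then show ?thesis
      unfolding J_def
      by (auto intro!: exI[of _ "\<lambda>s. t s + t' s"] exI[of _ "\<lambda>l. i l + i' l"] tensor_ideal_add[OF id]
          simp: algebra_simps sum.distrib)
  qed
  have J_left: "q * p \<in> J" if pq: "p \<in> J" for p q
  proof -
    obtain t i where "\<forall>l. i l \<in> ?I" "p = (\<Sum>s\<in>S. t s * s) + (\<Sum>l\<in>UNIV. i l * gen l)"
      using pq unfolding J_def by blast
    then show ?thesis
      unfolding J_def
      by (auto intro!: exI[of _ "\<lambda>s. q * t s"] exI[of _ "\<lambda>l. q * i l"] tensor_ideal_left[OF id]
          simp: algebra_simps sum_distrib_left)
  qed
  have J_gen: "(\<Sum>l\<in>UNIV. i l * gen l) \<in> J" if "\<forall>l. i l \<in> ?I" for i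
    unfolding J_def using that by (auto intro!: exI[of _ "\<lambda>s. 0"] exI[of _ i])
  have "?I \<subseteq> J"
  proof (intro Idl_subset tensor_idealI)
    show "0 \<in> J" using J_gen[of "\<lambda>_. 0"] tensor_ideal_0[OF id] by simp
    show "S \<subseteq> J"
    proof
      fix s assume "s \<in> S"
      have "s = (\<Sum>s'\<in>S. (if s' = s then 1 else 0) * s') + (\<Sum>l\<in>UNIV. 0 * gen l)"
        using \<open>s \<in> S\<close> \<open>finite S\<close> by (simp add: if_distrib[of "\<lambda>x. x * _"] cong: if_cong)
      then show "s \<in> J" unfolding J_def using tensor_ideal_0[OF id] by (intro CollectI exI conjI allI)
    qed
    fix p q assume p: "p \<in> J"
    \<comment> \<open>Closure under right multiplication is the only real issue: the constant term
      of \<open>q\<close> may be moved to the left, and every other word of \<open>q\<close> ends in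
      a letter, in front of which stands an element of the ideal.\<close>
    have "p * q = p * (scalar (lookup q []) + (\<Sum>l\<in>UNIV. rquot l q * gen l))"
      by (simp add: split_last[symmetric])
    also have "\<dots> = scalar (lookup q []) * p + (\<Sum>l\<in>UNIV. (p * rquot l q) * gen l)"
      by (simp add: algebra_simps sum_distrib_left scalar_commute)
    also have "\<dots> \<in> J"
      using p J_I by (intro J_add J_left J_gen) (auto intro: tensor_ideal_right[OF id])
    finally show "p * q \<in> J" .
  qed (use J_add J_left in auto)
  then show thesis using that p unfolding J_def by blast
qed

text \<open>Taking right quotients in \<open>Idl_decompose\<close> removes the final letters; as no
  \<open>s\<close> has a constant term, \<open>t s * s\<close> becomes
  \<open>t s * rquot l s\<close>. In T/(S) this says that the vectors of right quotients of the
  relations generate all left syzygies of the generators.\<close>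

lemma rquot_Idl_decompose:
  fixes S :: "('n::finite list \<Rightarrow>\<^sub>0 'k::field) set"
  assumes q: "(\<Sum>l\<in>UNIV. q l * gen l) \<in> Idl\<^bsub>tensor_algebra\<^esub> S" and "finite S"
    and S: "\<And>s. s \<in> S \<Longrightarrow> lookup s [] = 0"
  obtains t where "\<And>l. q l - (\<Sum>s\<in>S. t s * rquot l s) \<in> Idl\<^bsub>tensor_algebra\<^esub> S"
proof -
  obtain i t where i: "\<And>l. i l \<in> Idl\<^bsub>tensor_algebra\<^esub> S"
    and q: "(\<Sum>l\<in>UNIV. q l * gen l) = (\<Sum>s\<in>S. t s * s) + (\<Sum>l\<in>UNIV. i l * gen l)"
    by (rule Idl_decompose[OF q \<open>finite S\<close>]) blast
  have "q l = (\<Sum>s\<in>S. rquot l (t s * s)) + i l" for l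
    using arg_cong[OF q, of "rquot l"] by (simp add: rquot_add rquot_sum rquot_mult_gen)
  then have "q l - (\<Sum>s\<in>S. t s * rquot l s) = i l" for l
    using S by (simp add: rquot_mult)
  then show thesis using i that by metis
qed

section \<open>The ideal of a nondegenerate bilinear relation\<close>

definition linear_form :: "('n::finite \<Rightarrow> 'k::field) \<Rightarrow> 'n list \<Rightarrow>\<^sub>0 'k" where
  "linear_form v = (\<Sum>l\<in>UNIV. single [l] (v l))"

definition bilinear_relation :: "('n::finite \<Rightarrow> 'n \<Rightarrow> 'k::field) \<Rightarrow> 'n list \<Rightarrow>\<^sub>0 'k" where
  "bilinear_relation B = (\<Sum>\<mu>\<in>UNIV. \<Sum>\<nu>\<in>UNIV. single [\<mu>, \<nu>] (B \<mu> \<nu>))"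

abbreviation relation_ideal :: "('n::finite \<Rightarrow> 'n \<Rightarrow> 'k::field) \<Rightarrow> ('n list \<Rightarrow>\<^sub>0 'k) set" where
  "relation_ideal B \<equiv> Idl\<^bsub>tensor_algebra\<^esub> {bilinear_relation B}"

lemma single_sum: "single w (sum f A) = (\<Sum>a\<in>A. single w (f a))"
  by (rule poly_mapping_eqI) (simp add: lookup_sum lookup_single when_def)

lemma lookup_linear_form: "lookup (linear_form v) [l] = v l"
  by (simp add: linear_form_def lookup_sum lookup_single when_def)

lemma linear_form_alt: "linear_form v = (\<Sum>l\<in>UNIV. scalar (v l) * gen l)"
  by (simp add: linear_form_def)

lemma linear_form_homogeneous: "linear_form v \<in> homogeneous 1"
  unfolding linear_form_def by (intro homogeneous_sum homogeneous_single) simp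

lemma mult_linear_form: "p * linear_form v = (\<Sum>l\<in>UNIV. (scalar (v l) * p) * gen l)"
  unfolding linear_form_alt sum_distrib_left
  by (intro sum.cong refl) (metis mult.assoc scalar_commute)

lemma linear_form_sum:
  "(\<Sum>a\<in>A. scalar (c a) * linear_form (v a)) = linear_form (\<lambda>l. \<Sum>a\<in>A. c a * v a l)"
  by (simp add: linear_form_def sum_distrib_left sum.swap[of _ A] single_sum)

lemma lookup_homogeneous: "p \<in> homogeneous n \<Longrightarrow> length w \<noteq> n \<Longrightarrow> lookup p w = 0"
  by (auto simp: homogeneous_def in_keys_iff)

lemma homogeneous_1_eq_linear_form:
  fixes p :: "'n::finite list \<Rightarrow>\<^sub>0 'k::field"
  assumes "p \<in> homogeneous 1"
  shows "p = linear_form (\<lambda>l. lookup p [l])"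
proof (rule poly_mapping_eqI)
  fix w
  have "lookup p w = 0" "lookup (linear_form (\<lambda>l. lookup p [l])) w = 0" if "length w \<noteq> 1"
    using lookup_homogeneous[OF assms] lookup_homogeneous[OF linear_form_homogeneous] that by auto
  then show "lookup p w = lookup (linear_form (\<lambda>l. lookup p [l])) w"
    by (cases "length w = 1") (auto simp: length_Suc_conv lookup_linear_form)
qed

lemma lookup_bilinear_relation: "lookup (bilinear_relation B) [\<mu>, \<nu>] = B \<mu> \<nu>"
proof -
  have "lookup (bilinear_relation B) [\<mu>, \<nu>] = (\<Sum>\<mu>'\<in>UNIV. \<Sum>\<nu>'\<in>UNIV. if \<mu>' = \<mu> then if \<nu>' = \<nu> then B \<mu> \<nu> else 0 else 0)"
    unfolding bilinear_relation_def lookup_sum by (intro sum.cong refl) (auto simp: lookup_single)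
  also have "\<dots> = (\<Sum>\<mu>'\<in>UNIV. if \<mu>' = \<mu> then B \<mu> \<nu> else 0)"
    by (intro sum.cong refl) auto
  finally show ?thesis by simp
qed

lemma bilinear_relation_homogeneous: "bilinear_relation B \<in> homogeneous 2"
  unfolding bilinear_relation_def by (intro homogeneous_sum homogeneous_single) simp

lemma lookup_Nil_bilinear_relation [simp]: "lookup (bilinear_relation B) [] = 0"
  by (rule lookup_homogeneous[OF bilinear_relation_homogeneous]) simp

lemma lookup_Nil_linear_form [simp]: "lookup (linear_form v) [] = 0"
  by (rule lookup_homogeneous[OF linear_form_homogeneous]) simp

lemma rquot_bilinear_relation: "rquot \<nu> (bilinear_relation B) = linear_form (\<lambda>\<mu>. B \<mu> \<nu>)"
  using homogeneous_1_eq_linear_form[of "rquot \<nu> (bilinear_relation B)"]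
    rquot_homogeneous[OF bilinear_relation_homogeneous, of \<nu> B]
  by (simp add: lookup_rquot lookup_bilinear_relation)

lemma homogeneous_2_eq_bilinear_relation:
  fixes p :: "'n::finite list \<Rightarrow>\<^sub>0 'k::field"
  assumes "p \<in> homogeneous 2"
  shows "p = bilinear_relation (\<lambda>\<mu> \<nu>. lookup p [\<mu>, \<nu>])"
proof (rule poly_mapping_eqI)
  fix w
  show "lookup p w = lookup (bilinear_relation (\<lambda>\<mu> \<nu>. lookup p [\<mu>, \<nu>])) w"
  proof (cases "length w = 2")
    case True
    then obtain \<mu> \<nu> where "w = [\<mu>, \<nu>]"
      by (auto simp: length_Suc_conv numeral_2_eq_2)
    then show ?thesis by (simp add: lookup_bilinear_relation)
  next
    case False
    then show ?thesis
      using lookup_homogeneous assms bilinear_relation_homogeneous by metis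
  qed
qed

lemma bilinear_relation_eq_right:
  "bilinear_relation B = (\<Sum>\<nu>\<in>UNIV. linear_form (\<lambda>\<mu>. B \<mu> \<nu>) * gen \<nu>)"
  using split_last[of "bilinear_relation B"] by (simp add: rquot_bilinear_relation)

lemma bilinear_relation_in_ideal: "bilinear_relation B \<in> relation_ideal B"
  by (rule Idl_self) simp

lemma component_relation_ideal:
  "p \<in> relation_ideal B \<Longrightarrow> component n p \<in> relation_ideal B"
  by (rule component_Idl) (auto intro: bilinear_relation_homogeneous)

lemma component_relation_ideal_low:
  "p \<in> relation_ideal B \<Longrightarrow> n < 2 \<Longrightarrow> component n p = 0"
  by (rule component_Idl_low) (auto intro: bilinear_relation_homogeneous)

lemma tensor_ideal_components:
  assumes J: "tensor_ideal J" and "\<And>n. component n p \<in> J"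
  shows "p \<in> J"
  by (subst sum_components[OF order_refl]) (auto intro!: tensor_ideal_sum[OF J] assms)

lemma tensor_ideal_scalar_cancel:
  assumes J: "tensor_ideal J" and "scalar c * p \<in> J" "c \<noteq> 0"
  shows "p \<in> J"
proof -
  have "scalar (inverse c) * (scalar c * p) \<in> J"
    by (rule tensor_ideal_left[OF J]) fact
  then show ?thesis using \<open>c \<noteq> 0\<close> by (simp add: mult.assoc[symmetric])
qed

text \<open>The right quotients of the single relation are the columns of \<open>B\<close>. This is
  exactness of A -> A^(s+1) -> A in the middle.\<close>

lemma right_syzygy:
  assumes "(\<Sum>l\<in>UNIV. q l * gen l) \<in> relation_ideal B"
  obtains t where "\<And>l. q l - t * linear_form (\<lambda>\<mu>. B \<mu> l) \<in> relation_ideal B"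
proof (rule rquot_Idl_decompose[OF assms])
  fix t
  assume "\<And>l. q l - (\<Sum>s\<in>{bilinear_relation B}. t s * rquot l s) \<in> relation_ideal B"
  then show thesis
    using that[of "t (bilinear_relation B)"] by (simp add: rquot_bilinear_relation)
qed auto

text \<open>Columns have degree 1 and the ideal is homogeneous, so the degree \<open>d\<close> part
  of the coefficient \<open>t\<close> already suffices.\<close>

lemma right_syzygy_homogeneous:
  assumes q: "(\<Sum>l\<in>UNIV. q l * gen l) \<in> relation_ideal B" and "\<And>l. q l \<in> homogeneous (Suc d)"
  obtains t where "t \<in> homogeneous d" "\<And>l. q l - t * linear_form (\<lambda>\<mu>. B \<mu> l) \<in> relation_ideal B"
proof -
  obtain t where t: "\<And>l. q l - t * linear_form (\<lambda>\<mu>. B \<mu> l) \<in> relation_ideal B"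
    by (rule right_syzygy[OF q]) blast
  have "q l - component d t * linear_form (\<lambda>\<mu>. B \<mu> l) \<in> relation_ideal B" for l
    using component_relation_ideal[OF t, of "Suc d" l] assms(2)[of l]
    by (simp add: component_diff component_mult_homogeneous_right[OF linear_form_homogeneous] homogeneous_iff)
  then show thesis using that component_homogeneous by metis
qed

text \<open>This is where at least two generators are used: on a line only 0 is orthogonal to a
  nonzero vector.\<close>

lemma exists_orthogonal_vector:
  fixes v :: "'n::finite \<Rightarrow> 'k::field"
  assumes "CARD('n) \<ge> 2"
  obtains c where "c \<noteq> (\<lambda>_. 0)" "(\<Sum>l\<in>UNIV. c l * v l) = 0"
proof -
  have "\<not> is_singleton (UNIV :: 'n set)"
    using assms by (auto simp: is_singleton_altdef)
  then obtain a b :: 'n where ab: "a \<noteq> b"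
    using is_singletonI'[of "UNIV :: 'n set"] by blast
  show thesis
  proof (cases "v a = 0")
    case True
    have "(\<Sum>l\<in>UNIV. (if l = a then 1 else 0) * v l) = (\<Sum>l\<in>UNIV. if l = a then v l else 0)"
      by (intro sum.cong) auto
    then show ?thesis
      using True that[of "\<lambda>l. if l = a then 1 else 0"] by (auto simp: fun_eq_iff)
  next
    case False
    let ?c = "\<lambda>l. if l = a then v b else if l = b then - v a else 0"
    have "(\<Sum>l\<in>UNIV. ?c l * v l) = (\<Sum>l\<in>UNIV. (if l = a then v b * v a else 0) - (if l = b then v a * v b else 0))"
      using ab by (intro sum.cong) auto
    also have "\<dots> = 0" by (simp add: sum_subtractf mult.commute)
    finally show ?thesis
      using that[of ?c] ab False by (metis (mono_tags, lifting) neg_equal_0_iff_equal)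
  qed
qed

text \<open>The inverse is a parameter and is two-sided, so that the transposed pair is again an
  instance and the locale can be interpreted twice.\<close>

locale nondegenerate_matrix =
  fixes B B' :: "'n::finite \<Rightarrow> 'n \<Rightarrow> 'k::field"
  assumes mult_inverse: "(\<Sum>\<nu>\<in>UNIV. B \<mu> \<nu> * B' \<nu> \<rho>) = (if \<mu> = \<rho> then 1 else 0)"
    and inverse_mult: "(\<Sum>\<nu>\<in>UNIV. B' \<mu> \<nu> * B \<nu> \<rho>) = (if \<mu> = \<rho> then 1 else 0)"
    and card_ge_2: "CARD('n) \<ge> 2"
begin

lemma kernel_trivial:
  assumes "\<And>\<mu>. (\<Sum>\<nu>\<in>UNIV. B \<mu> \<nu> * c \<nu>) = 0"
  shows "c = (\<lambda>_. 0)"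
proof
  fix l
  have "0 = (\<Sum>\<mu>\<in>UNIV. B' l \<mu> * (\<Sum>\<nu>\<in>UNIV. B \<mu> \<nu> * c \<nu>))" by (simp add: assms)
  also have "\<dots> = (\<Sum>\<mu>\<in>UNIV. \<Sum>\<nu>\<in>UNIV. B' l \<mu> * B \<mu> \<nu> * c \<nu>)"
    by (simp add: sum_distrib_left mult.assoc)
  also have "\<dots> = (\<Sum>\<nu>\<in>UNIV. \<Sum>\<mu>\<in>UNIV. B' l \<mu> * B \<mu> \<nu> * c \<nu>)"
    by (rule sum.swap)
  also have "\<dots> = (\<Sum>\<nu>\<in>UNIV. (\<Sum>\<mu>\<in>UNIV. B' l \<mu> * B \<mu> \<nu>) * c \<nu>)"
    by (simp add: sum_distrib_right)
  also have "\<dots> = c l" by (simp add: inverse_mult if_distrib[of "\<lambda>x. x * _"] cong: if_cong)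
  finally show "c l = 0" by simp
qed

text \<open>If \<open>p v = 0\<close> in the quotient, then \<open>v\<^sub>l p = t (B x)\<^sub>l\<close> for a common \<open>t\<close> of smaller degree, and a
  nonzero linear form that kills \<open>t\<close> comes from a vector orthogonal to \<open>v\<close>.\<close>

lemma mult_linear_form_cancel_homogeneous:
  assumes "p \<in> homogeneous d" "p * linear_form v \<in> relation_ideal B" "v \<noteq> (\<lambda>_. 0)"
  shows "p \<in> relation_ideal B"
  using assms
proof (induction d arbitrary: p v)
  note id = tensor_ideal_Idl[of "{bilinear_relation B}"]
  case (0 p v)
  obtain l where l: "v l \<noteq> 0" using 0(3) by auto
  obtain t where t: "\<And>l. scalar (v l) * p - t * linear_form (\<lambda>\<mu>. B \<mu> l) \<in> relation_ideal B"
    by (rule right_syzygy[OF 0(2)[unfolded mult_linear_form]]) blast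
  \<comment> \<open>The ideal has nothing in degree 0 and \<open>t\<close> times a linear form
    starts in degree 1, so only the scalar multiple of \<open>p\<close> is left.\<close>
  have "component 0 (scalar (v l) * p - t * linear_form (\<lambda>\<mu>. B \<mu> l)) = 0"
    by (rule component_relation_ideal_low[OF t]) simp
  moreover have "scalar (v l) * p \<in> homogeneous 0" using 0 by (rule_tac homogeneous_scalar_mult)
  ultimately have "scalar (v l) * p = 0"
    by (simp add: component_diff component_mult_homogeneous_right[OF linear_form_homogeneous] homogeneous_iff)
  then show ?case
    using tensor_ideal_scalar_cancel[OF id _ l] tensor_ideal_0[OF id] by metis
next
  note id = tensor_ideal_Idl[of "{bilinear_relation B}"]
  case (Suc d p v)
  obtain l where l: "v l \<noteq> 0" using Suc.prems(3) by auto
  have "scalar (v l) * p \<in> homogeneous (Suc d)" for l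
    using Suc by (rule_tac homogeneous_scalar_mult)
  then obtain t where td: "t \<in> homogeneous d"
    and t: "\<And>l. scalar (v l) * p - t * linear_form (\<lambda>\<mu>. B \<mu> l) \<in> relation_ideal B"
    by (rule right_syzygy_homogeneous[OF Suc.prems(2)[unfolded mult_linear_form]]) blast
  obtain c where c: "c \<noteq> (\<lambda>_. 0)" "(\<Sum>l\<in>UNIV. c l * v l) = 0"
    by (rule exists_orthogonal_vector[OF card_ge_2, of v]) blast
  have "scalar (c l) * (scalar (v l) * p - t * linear_form (\<lambda>\<mu>. B \<mu> l)) =
    scalar (c l * v l) * p - t * (scalar (c l) * linear_form (\<lambda>\<mu>. B \<mu> l))" for l
    by (subst scalar_left_commute[of t]) (simp add: right_diff_distrib mult.commute[of "v l"] flip: mult.assoc)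
  then have "(\<Sum>l\<in>UNIV. scalar (c l) * (scalar (v l) * p - t * linear_form (\<lambda>\<mu>. B \<mu> l))) =
    (\<Sum>l\<in>UNIV. scalar (c l * v l)) * p - t * (\<Sum>l\<in>UNIV. scalar (c l) * linear_form (\<lambda>\<mu>. B \<mu> l))"
    by (simp add: sum_subtractf sum_distrib_left sum_distrib_right)
  also have "(\<Sum>l\<in>UNIV. scalar (c l * v l)) = 0"
    using c by (simp flip: single_sum)
  finally have "- (t * (\<Sum>l\<in>UNIV. scalar (c l) * linear_form (\<lambda>\<mu>. B \<mu> l))) \<in> relation_ideal B"
    using tensor_ideal_sum[OF id] tensor_ideal_left[OF id t]
    by (metis (no_types, lifting) diff_0 mult_zero_left)
  then have "t * linear_form (\<lambda>\<mu>. \<Sum>l\<in>UNIV. B \<mu> l * c l) \<in> relation_ideal B"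
    using tensor_ideal_uminus[OF id] by (fastforce simp: linear_form_sum mult.commute)
  moreover have "(\<lambda>\<mu>. \<Sum>l\<in>UNIV. B \<mu> l * c l) \<noteq> (\<lambda>_. 0)"
    using kernel_trivial c(1) by (meson fun_cong)
  ultimately have "t \<in> relation_ideal B" using Suc.IH td by blast
  then have "scalar (v l) * p \<in> relation_ideal B"
    using tensor_ideal_cong[OF id t] tensor_ideal_right[OF id] by blast
  then show ?case using tensor_ideal_scalar_cancel[OF id _ l] by blast
qed

text \<open>Multiplication by a linear form shifts components by one degree, so the homogeneous case
  applies to each component separately.\<close>

lemma mult_linear_form_cancel:
  assumes "p * linear_form v \<in> relation_ideal B" "v \<noteq> (\<lambda>_. 0)"
  shows "p \<in> relation_ideal B"
proof (rule tensor_ideal_components[OF tensor_ideal_Idl])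
  fix n
  have "component n p * linear_form v \<in> relation_ideal B"
    using component_relation_ideal[OF assms(1), of "Suc n"]
    by (simp add: component_mult_homogeneous_right[OF linear_form_homogeneous])
  then show "component n p \<in> relation_ideal B"
    using mult_linear_form_cancel_homogeneous[OF component_homogeneous] assms(2) by blast
qed

lemma column_nonzero: "(\<lambda>\<mu>. B \<mu> \<nu>) \<noteq> (\<lambda>_. 0)"
proof
  assume "(\<lambda>\<mu>. B \<mu> \<nu>) = (\<lambda>_. 0)"
  then have "(\<Sum>\<mu>\<in>UNIV. B' \<nu> \<mu> * B \<mu> \<nu>) = 0" by (simp add: fun_eq_iff)
  then show False by (simp add: inverse_mult)
qed

lemma mult_column_cancel:
  "p * linear_form (\<lambda>\<mu>. B \<mu> \<nu>) \<in> relation_ideal B \<Longrightarrow> p \<in> relation_ideal B"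
  using mult_linear_form_cancel column_nonzero by blast

end

subsection \<open>Reversal of words\<close>

text \<open>The anti-automorphism of T that fixes the generators. It exchanges left and right and
  sends the relation of \<open>B\<close> to that of the transposed matrix.\<close>

definition reverse :: "('n list \<Rightarrow>\<^sub>0 'k::field) \<Rightarrow> 'n list \<Rightarrow>\<^sub>0 'k" where
  "reverse = Poly_Mapping.map_key rev"

lemma lookup_reverse: "lookup (reverse p) w = lookup p (rev w)"
  by (simp add: reverse_def map_key.rep_eq)

lemma reverse_reverse [simp]: "reverse (reverse p) = p"
  by (rule poly_mapping_eqI) (simp add: lookup_reverse)

lemma reverse_add: "reverse (p + q) = reverse p + reverse q"
  by (rule poly_mapping_eqI) (simp add: lookup_reverse lookup_add)

lemma reverse_diff: "reverse (p - q) = reverse p - reverse q"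
  by (rule poly_mapping_eqI) (simp add: lookup_reverse lookup_minus)

lemma reverse_0 [simp]: "reverse 0 = 0"
  by (rule poly_mapping_eqI) (simp add: lookup_reverse)

lemma reverse_sum: "reverse (sum f A) = (\<Sum>a\<in>A. reverse (f a))"
  by (rule poly_mapping_eqI) (simp add: lookup_reverse lookup_sum)

lemma reverse_single [simp]: "reverse (single w c) = single (rev w) c"
  by (rule poly_mapping_eqI) (auto simp: lookup_reverse lookup_single when_def)

lemma reverse_mult: "reverse (p * q) = reverse q * reverse p"
proof (induction p rule: poly_mapping_additive_induct)
  case (single w c)
  show ?case
    by (induction q rule: poly_mapping_additive_induct)
       (simp_all add: single_mult_single algebra_simps reverse_add)
qed (simp_all add: algebra_simps reverse_add)

lemma reverse_linear_form [simp]: "reverse (linear_form v) = linear_form v"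
  by (simp add: linear_form_def reverse_sum)

lemma reverse_bilinear_relation:
  "reverse (bilinear_relation B) = bilinear_relation (\<lambda>\<mu> \<nu>. B \<nu> \<mu>)"
  unfolding bilinear_relation_def reverse_sum by (subst sum.swap) simp

lemma reverse_relation_ideal:
  assumes "p \<in> relation_ideal B"
  shows "reverse p \<in> relation_ideal (\<lambda>\<mu> \<nu>. B \<nu> \<mu>)"
proof -
  note id = tensor_ideal_Idl[of "{bilinear_relation (\<lambda>\<mu> \<nu>. B \<nu> \<mu>)}"]
  have "relation_ideal B \<subseteq> {p. reverse p \<in> relation_ideal (\<lambda>\<mu> \<nu>. B \<nu> \<mu>)}"
    by (intro Idl_subset tensor_idealI)
       (auto simp: reverse_add reverse_mult reverse_bilinear_relation bilinear_relation_in_ideal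
        intro: tensor_ideal_0[OF id] tensor_ideal_add[OF id] tensor_ideal_left[OF id] tensor_ideal_right[OF id])
  then show ?thesis using assms by blast
qed

lemma reverse_relation_ideal_iff:
  "reverse p \<in> relation_ideal (\<lambda>\<mu> \<nu>. B \<nu> \<mu>) \<longleftrightarrow> p \<in> relation_ideal B"
  using reverse_relation_ideal[of p B] reverse_relation_ideal[of "reverse p" "\<lambda>\<mu> \<nu>. B \<nu> \<mu>"] by auto

context nondegenerate_matrix
begin

lemma transpose_nondegenerate: "nondegenerate_matrix (\<lambda>\<mu> \<nu>. B \<nu> \<mu>) (\<lambda>\<mu> \<nu>. B' \<nu> \<mu>)"
  by unfold_locales
     (use mult_inverse inverse_mult card_ge_2 in \<open>auto simp: mult.commute\<close>)

text \<open>The mirror image of \<open>mult_linear_form_cancel\<close> for the transposed matrix. It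
  yields Ext^0(K, A) = 0.\<close>

lemma gen_mult_cancel:
  assumes "gen l * p \<in> relation_ideal B"
  shows "p \<in> relation_ideal B"
proof -
  interpret t: nondegenerate_matrix "\<lambda>\<mu> \<nu>. B \<nu> \<mu>" "\<lambda>\<mu> \<nu>. B' \<nu> \<mu>"
    by (rule transpose_nondegenerate)
  have gen: "(gen l :: 'n list \<Rightarrow>\<^sub>0 'k) = linear_form (\<lambda>m. if m = l then 1 else 0)"
    using homogeneous_1_eq_linear_form[of "gen l :: 'n list \<Rightarrow>\<^sub>0 'k"]
    by (simp add: homogeneous_single lookup_single when_def) (simp add: eq_commute)
  have "reverse p * gen l \<in> relation_ideal (\<lambda>\<mu> \<nu>. B \<nu> \<mu>)"
    using reverse_relation_ideal[OF assms] by (simp add: reverse_mult)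
  then have "reverse p \<in> relation_ideal (\<lambda>\<mu> \<nu>. B \<nu> \<mu>)"
    unfolding gen by (rule t.mult_linear_form_cancel) (auto simp: fun_eq_iff)
  then show ?thesis by (simp add: reverse_relation_ideal_iff)
qed

text \<open>Exactness of the dual complex in the middle, which yields Ext^1(K, A) = 0. Collecting
  the generators on the left and reversing words turns the hypothesis into one for
  \<open>right_syzygy\<close> with the transposed matrix.\<close>

lemma left_syzygy:
  assumes "(\<Sum>\<nu>\<in>UNIV. linear_form (\<lambda>\<mu>. B \<mu> \<nu>) * q \<nu>) \<in> relation_ideal B"
  obtains t where "\<And>\<nu>. q \<nu> - gen \<nu> * t \<in> relation_ideal B"
proof -
  note id = tensor_ideal_Idl[of "{bilinear_relation B}"]
  \<comment> \<open>The vector B q: what stands to the right of each generator once the columns are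
    expanded.\<close>
  let ?r = "\<lambda>\<mu>. \<Sum>\<nu>\<in>UNIV. scalar (B \<mu> \<nu>) * q \<nu>"
  have "(\<Sum>\<nu>\<in>UNIV. linear_form (\<lambda>\<mu>. B \<mu> \<nu>) * q \<nu>) = (\<Sum>\<nu>\<in>UNIV. \<Sum>\<mu>\<in>UNIV. gen \<mu> * (scalar (B \<mu> \<nu>) * q \<nu>))"
    by (simp add: linear_form_alt sum_distrib_right scalar_left_commute mult.assoc flip: scalar_mult_single)
  also have "\<dots> = (\<Sum>\<mu>\<in>UNIV. gen \<mu> * ?r \<mu>)"
    by (subst sum.swap) (simp add: sum_distrib_left)
  finally have "(\<Sum>\<mu>\<in>UNIV. reverse (?r \<mu>) * gen \<mu>) \<in> relation_ideal (\<lambda>\<mu> \<nu>. B \<nu> \<mu>)"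
    using reverse_relation_ideal[OF assms] by (simp add: reverse_sum reverse_mult)
  then obtain t where t: "\<And>l. reverse (?r l) - t * linear_form (\<lambda>\<mu>. B l \<mu>) \<in> relation_ideal (\<lambda>\<mu> \<nu>. B \<nu> \<mu>)"
    by (rule right_syzygy) blast
  have r: "?r l - linear_form (\<lambda>\<mu>. B l \<mu>) * reverse t \<in> relation_ideal B" for l
    using reverse_relation_ideal[OF t[of l]] by (simp add: reverse_diff reverse_mult)
  have "q \<nu> - gen \<nu> * reverse t \<in> relation_ideal B" for \<nu>
  proof -
    \<comment> \<open>Multiplying by the inverse matrix recovers \<open>q\<close> from B q and at
      the same time turns the rows of \<open>B\<close> back into single generators.\<close>
    have "(\<Sum>l\<in>UNIV. scalar (B' \<nu> l) * ?r l) = (\<Sum>l\<in>UNIV. \<Sum>\<mu>\<in>UNIV. scalar (B' \<nu> l * B l \<mu>) * q \<mu>)"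
      by (simp add: sum_distrib_left mult.commute[of "B _ _"] flip: mult.assoc)
    also have "\<dots> = (\<Sum>\<mu>\<in>UNIV. scalar (\<Sum>l\<in>UNIV. B' \<nu> l * B l \<mu>) * q \<mu>)"
      by (subst sum.swap) (simp add: sum_distrib_right single_sum)
    also have "\<dots> = q \<nu>" by (simp add: inverse_mult if_distrib[of "\<lambda>x. single _ x * _"] cong: if_cong)
    finally have 1: "(\<Sum>l\<in>UNIV. scalar (B' \<nu> l) * ?r l) = q \<nu>" .
    have "(\<Sum>l\<in>UNIV. scalar (B' \<nu> l) * linear_form (\<lambda>\<mu>. B l \<mu>)) = linear_form (\<lambda>\<mu>. if \<nu> = \<mu> then 1 else 0)"
      unfolding linear_form_sum inverse_mult ..
    also have "\<dots> = gen \<nu>"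
      by (simp add: linear_form_def if_distrib[of "single _"] cong: if_cong)
    finally have "(\<Sum>l\<in>UNIV. scalar (B' \<nu> l) * linear_form (\<lambda>\<mu>. B l \<mu>)) * reverse t = gen \<nu> * reverse t"
      by simp
    then have 2: "(\<Sum>l\<in>UNIV. scalar (B' \<nu> l) * (linear_form (\<lambda>\<mu>. B l \<mu>) * reverse t)) = gen \<nu> * reverse t"
      by (simp add: sum_distrib_right mult.assoc)
    have "(\<Sum>l\<in>UNIV. scalar (B' \<nu> l) * (?r l - linear_form (\<lambda>\<mu>. B l \<mu>) * reverse t)) \<in> relation_ideal B"
      by (intro tensor_ideal_sum[OF id] tensor_ideal_left[OF id] r)
    then show ?thesis by (simp only: right_diff_distrib sum_subtractf 1 2)
  qed
  then show thesis using that by blast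
qed

text \<open>The columns of an invertible matrix span all linear forms; the coefficients are the
  entries of the inverse.\<close>

lemma gen_eq_column_combination: "gen l = (\<Sum>\<nu>\<in>UNIV. linear_form (\<lambda>\<mu>. B \<mu> \<nu>) * scalar (B' \<nu> l))"
proof -
  have "(\<Sum>\<nu>\<in>UNIV. linear_form (\<lambda>\<mu>. B \<mu> \<nu>) * scalar (B' \<nu> l)) =
    (\<Sum>\<nu>\<in>UNIV. scalar (B' \<nu> l) * linear_form (\<lambda>\<mu>. B \<mu> \<nu>))"
    by (simp add: scalar_commute)
  also have "\<dots> = linear_form (\<lambda>\<mu>. if \<mu> = l then 1 else 0)"
    unfolding linear_form_sum by (simp add: mult.commute[of "B' _ _"] mult_inverse)
  also have "\<dots> = gen l"
    by (simp add: linear_form_def if_distrib[of "single _"] cong: if_cong)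
  finally show ?thesis ..
qed

end

section \<open>Module maps and free modules\<close>

context left_module
begin

lemma smult_zero_left [simp]: "x \<in> carrier M \<Longrightarrow> \<zero> \<odot>\<^bsub>M\<^esub> x = \<zero>\<^bsub>M\<^esub>"
proof -
  assume x: "x \<in> carrier M"
  have "\<zero> \<odot>\<^bsub>M\<^esub> x \<oplus>\<^bsub>M\<^esub> \<zero> \<odot>\<^bsub>M\<^esub> x = (\<zero> \<oplus> \<zero>) \<odot>\<^bsub>M\<^esub> x"
    using x by (simp only: smult_l_distr A.zero_closed)
  also have "\<dots> = \<zero> \<odot>\<^bsub>M\<^esub> x" by simp
  finally show ?thesis
    using M.add.r_cancel_one'[of "\<zero> \<odot>\<^bsub>M\<^esub> x" "\<zero> \<odot>\<^bsub>M\<^esub> x"] x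
    by (simp add: smult_closed eq_commute)
qed

lemma smult_zero_right [simp]: "a \<in> carrier A \<Longrightarrow> a \<odot>\<^bsub>M\<^esub> \<zero>\<^bsub>M\<^esub> = \<zero>\<^bsub>M\<^esub>"
proof -
  assume a: "a \<in> carrier A"
  have "a \<odot>\<^bsub>M\<^esub> \<zero>\<^bsub>M\<^esub> \<oplus>\<^bsub>M\<^esub> a \<odot>\<^bsub>M\<^esub> \<zero>\<^bsub>M\<^esub> = a \<odot>\<^bsub>M\<^esub> (\<zero>\<^bsub>M\<^esub> \<oplus>\<^bsub>M\<^esub> \<zero>\<^bsub>M\<^esub>)"
    using a by (simp only: smult_r_distr M.zero_closed)
  also have "\<dots> = a \<odot>\<^bsub>M\<^esub> \<zero>\<^bsub>M\<^esub>" by simp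
  finally show ?thesis
    using M.add.r_cancel_one'[of "a \<odot>\<^bsub>M\<^esub> \<zero>\<^bsub>M\<^esub>" "a \<odot>\<^bsub>M\<^esub> \<zero>\<^bsub>M\<^esub>"] a
    by (simp add: smult_closed eq_commute)
qed

lemma smult_minus_right: "a \<in> carrier A \<Longrightarrow> x \<in> carrier M \<Longrightarrow> a \<odot>\<^bsub>M\<^esub> (\<ominus>\<^bsub>M\<^esub> x) = \<ominus>\<^bsub>M\<^esub> (a \<odot>\<^bsub>M\<^esub> x)"
  by (rule M.minus_equality[symmetric])
     (simp_all add: smult_closed M.l_neg flip: smult_r_distr)

lemma smult_finsum:
  assumes "a \<in> carrier A" "f \<in> S \<rightarrow> carrier M"
  shows "a \<odot>\<^bsub>M\<^esub> finsum M f S = finsum M (\<lambda>x. a \<odot>\<^bsub>M\<^esub> f x) S"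
  using assms
proof (induction S rule: infinite_finite_induct)
  case (insert x S)
  then show ?case
    by (subst M.finsum_insert M.finsum_insert; (simp add: smult_closed Pi_iff)?)+
       (simp add: smult_r_distr Pi_iff M.finsum_closed)
qed auto

end

text \<open>Like \<open>module_homs\<close> but without extensionality, so that maps can be composed
  and subtracted as plain functions; \<open>restrict\<close> is applied only where an element of a
  Hom set must be exhibited.\<close>

definition module_map ::
    "('c, 'z) ring_scheme \<Rightarrow> ('c, 'm) module \<Rightarrow> ('c, 'n) module \<Rightarrow> ('m \<Rightarrow> 'n) \<Rightarrow> bool" where
  "module_map A M N h \<longleftrightarrow> (\<forall>x\<in>carrier M. h x \<in> carrier N) \<and>
     (\<forall>x\<in>carrier M. \<forall>y\<in>carrier M. h (x \<oplus>\<^bsub>M\<^esub> y) = h x \<oplus>\<^bsub>N\<^esub> h y) \<and>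
     (\<forall>a\<in>carrier A. \<forall>x\<in>carrier M. h (a \<odot>\<^bsub>M\<^esub> x) = a \<odot>\<^bsub>N\<^esub> h x)"

lemma module_homs_iff: "h \<in> module_homs A M N \<longleftrightarrow> h \<in> extensional (carrier M) \<and> module_map A M N h"
  by (auto simp: module_homs_def module_map_def PiE_def)

lemma module_mapI:
  assumes "\<And>x. x \<in> carrier M \<Longrightarrow> h x \<in> carrier N"
    "\<And>x y. x \<in> carrier M \<Longrightarrow> y \<in> carrier M \<Longrightarrow> h (x \<oplus>\<^bsub>M\<^esub> y) = h x \<oplus>\<^bsub>N\<^esub> h y"
    "\<And>a x. a \<in> carrier A \<Longrightarrow> x \<in> carrier M \<Longrightarrow> h (a \<odot>\<^bsub>M\<^esub> x) = a \<odot>\<^bsub>N\<^esub> h x"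
  shows "module_map A M N h"
  using assms by (auto simp: module_map_def)

lemma module_map_closed: "module_map A M N h \<Longrightarrow> x \<in> carrier M \<Longrightarrow> h x \<in> carrier N"
  by (auto simp: module_map_def)

lemma module_map_add:
  "module_map A M N h \<Longrightarrow> x \<in> carrier M \<Longrightarrow> y \<in> carrier M \<Longrightarrow> h (x \<oplus>\<^bsub>M\<^esub> y) = h x \<oplus>\<^bsub>N\<^esub> h y"
  by (auto simp: module_map_def)

lemma module_map_smult:
  "module_map A M N h \<Longrightarrow> a \<in> carrier A \<Longrightarrow> x \<in> carrier M \<Longrightarrow> h (a \<odot>\<^bsub>M\<^esub> x) = a \<odot>\<^bsub>N\<^esub> h x"
  by (auto simp: module_map_def)

lemma module_map_cong:
  assumes "module_map A M N h" "left_module A M" "\<And>x. x \<in> carrier M \<Longrightarrow> h' x = h x"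
  shows "module_map A M N h'"
proof -
  interpret left_module A M by fact
  show ?thesis using assms(1,3) by (auto simp: module_map_def smult_closed)
qed

lemma restrict_module_homs:
  assumes "module_map A M N h" "left_module A M"
  shows "restrict h (carrier M) \<in> module_homs A M N"
  unfolding module_homs_iff using module_map_cong[OF assms] by auto

lemma module_map_comp:
  assumes "module_map A M N h" "module_map A N L k"
  shows "module_map A M L (\<lambda>x. k (h x))"
  using assms by (auto simp: module_map_def)

lemma module_map_zero:
  assumes "module_map A M N h" "left_module A M" "left_module A N"
  shows "h \<zero>\<^bsub>M\<^esub> = \<zero>\<^bsub>N\<^esub>"
proof -
  interpret M: left_module A M by fact
  interpret N: left_module A N by fact
  have "h (\<zero>\<^bsub>A\<^esub> \<odot>\<^bsub>M\<^esub> \<zero>\<^bsub>M\<^esub>) = \<zero>\<^bsub>A\<^esub> \<odot>\<^bsub>N\<^esub> h \<zero>\<^bsub>M\<^esub>"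
    by (rule module_map_smult[OF assms(1)]) auto
  then show ?thesis using module_map_closed[OF assms(1)] by simp
qed

lemma module_map_uminus:
  assumes h: "module_map A M N h" "left_module A M" "left_module A N" and x: "x \<in> carrier M"
  shows "h (\<ominus>\<^bsub>M\<^esub> x) = \<ominus>\<^bsub>N\<^esub> h x"
proof -
  interpret M: left_module A M by fact
  interpret N: left_module A N by fact
  have "h (\<ominus>\<^bsub>M\<^esub> x) \<oplus>\<^bsub>N\<^esub> h x = h (\<ominus>\<^bsub>M\<^esub> x \<oplus>\<^bsub>M\<^esub> x)"
    using x by (simp add: module_map_add[OF h(1)])
  also have "\<dots> = \<zero>\<^bsub>N\<^esub>"
    using x by (simp add: M.M.l_neg module_map_zero[OF h])
  finally show ?thesis
    using x module_map_closed[OF h(1)] by (intro N.M.minus_equality[symmetric]) auto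
qed

lemma module_map_minus:
  assumes h: "module_map A M N h" "left_module A M" "left_module A N"
    and x: "x \<in> carrier M" "y \<in> carrier M"
  shows "h (x \<ominus>\<^bsub>M\<^esub> y) = h x \<ominus>\<^bsub>N\<^esub> h y"
proof -
  interpret M: left_module A M by fact
  show ?thesis
    using x by (simp add: a_minus_def module_map_add[OF h(1)] module_map_uminus[OF h])
qed

lemma module_map_plus_map:
  assumes h: "module_map A M N h" and k: "module_map A M N k" and N: "left_module A N"
  shows "module_map A M N (\<lambda>x. h x \<oplus>\<^bsub>N\<^esub> k x)"
proof -
  interpret N: left_module A N by fact
  show ?thesis
    using h k unfolding module_map_def
    by (auto simp: N.smult_r_distr N.M.a_ac)
qed

lemma module_map_uminus_map:
  assumes h: "module_map A M N h" and N: "left_module A N"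
  shows "module_map A M N (\<lambda>x. \<ominus>\<^bsub>N\<^esub> h x)"
proof -
  interpret N: left_module A N by fact
  show ?thesis
    using h unfolding module_map_def
    by (auto simp: N.smult_minus_right N.M.minus_add)
qed

lemma module_map_minus_map:
  assumes h: "module_map A M N h" and k: "module_map A M N k" and N: "left_module A N"
  shows "module_map A M N (\<lambda>x. h x \<ominus>\<^bsub>N\<^esub> k x)"
  unfolding a_minus_def
  by (intro module_map_plus_map module_map_uminus_map h k N)

lemma module_map_id: "module_map A M M (\<lambda>x. x)"
  by (auto simp: module_map_def)

lemma a_kernel_iff: "x \<in> a_kernel M N h \<longleftrightarrow> x \<in> carrier M \<and> h x = \<zero>\<^bsub>N\<^esub>"
  by (auto simp: a_kernel_def')

lemma left_module_regular: "ring A \<Longrightarrow> left_module A (regular_module A)"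
proof -
  assume "ring A"
  then interpret ring A .
  interpret R: abelian_group "regular_module A"
    by (rule abelian_groupI) (auto simp: regular_module_def a_ac intro: add.l_inv_ex)
  show ?thesis
    by unfold_locales (auto simp: regular_module_def l_distr r_distr m_assoc)
qed

lemma regular_module_simps [simp]:
  "carrier (regular_module A) = carrier A" "zero (regular_module A) = zero A"
  "add (regular_module A) = add A" "smult (regular_module A) = mult A"
  by (simp_all add: regular_module_def)

lemma regular_a_inv: "a_inv (regular_module A) = a_inv A"
  by (simp add: fun_eq_iff a_inv_def m_inv_def regular_module_def)

section \<open>Free modules, their universal property and lifting along projectives\<close>

definition unit_vector :: "('c, 'z) ring_scheme \<Rightarrow> 'i \<Rightarrow> 'i \<Rightarrow> 'c" where
  "unit_vector A x = (\<lambda>y. if y = x then \<one>\<^bsub>A\<^esub> else \<zero>\<^bsub>A\<^esub>)"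

lemma free_module_simps [simp]:
  "zero (free_module A X) = (\<lambda>_. \<zero>\<^bsub>A\<^esub>)"
  "add (free_module A X) = (\<lambda>f g x. f x \<oplus>\<^bsub>A\<^esub> g x)"
  "smult (free_module A X) = (\<lambda>a f x. a \<otimes>\<^bsub>A\<^esub> f x)"
  by (simp_all add: free_module_def)

lemma carrier_free_module:
  "f \<in> carrier (free_module A X) \<longleftrightarrow>
     (\<forall>x. f x \<in> carrier A) \<and> (\<forall>x. x \<notin> X \<longrightarrow> f x = \<zero>\<^bsub>A\<^esub>) \<and> finite {x. f x \<noteq> \<zero>\<^bsub>A\<^esub>}"
  by (simp add: free_module_def)

lemma free_module_finite:
  "finite X \<Longrightarrow> f \<in> carrier (free_module A X) \<longleftrightarrow>
     (\<forall>x. f x \<in> carrier A) \<and> (\<forall>x. x \<notin> X \<longrightarrow> f x = \<zero>\<^bsub>A\<^esub>)"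
  unfolding carrier_free_module using finite_subset[of "{x. f x \<noteq> \<zero>\<^bsub>A\<^esub>}" X] by auto

context ring
begin

lemma left_module_free: "left_module R (free_module R X)"
proof -
  interpret F: abelian_group "free_module R X"
  proof (rule abelian_groupI)
    fix f g assume fg: "f \<in> carrier (free_module R X)" "g \<in> carrier (free_module R X)"
    have "{x. f x \<oplus> g x \<noteq> \<zero>} \<subseteq> {x. f x \<noteq> \<zero>} \<union> {x. g x \<noteq> \<zero>}" by auto
    then have "finite {x. f x \<oplus> g x \<noteq> \<zero>}"
      by (rule finite_subset) (use fg in \<open>auto simp: carrier_free_module\<close>)
    then show "f \<oplus>\<^bsub>free_module R X\<^esub> g \<in> carrier (free_module R X)"
      using fg by (auto simp: carrier_free_module)
    show "f \<oplus>\<^bsub>free_module R X\<^esub> g = g \<oplus>\<^bsub>free_module R X\<^esub> f"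
      using fg by (auto simp: carrier_free_module a_comm)
  next
    fix f assume f: "f \<in> carrier (free_module R X)"
    have "{x. \<ominus> f x \<noteq> \<zero>} = {x. f x \<noteq> \<zero>}"
      using f by (simp add: carrier_free_module add.inv_eq_1_iff)
    then show "\<exists>g\<in>carrier (free_module R X). g \<oplus>\<^bsub>free_module R X\<^esub> f = \<zero>\<^bsub>free_module R X\<^esub>"
      using f by (intro bexI[of _ "\<lambda>x. \<ominus> f x"]) (auto simp: carrier_free_module l_neg)
  qed (auto simp: carrier_free_module a_assoc)
  show ?thesis
  proof unfold_locales
    fix a f assume af: "a \<in> carrier R" "f \<in> carrier (free_module R X)"
    have "{x. a \<otimes> f x \<noteq> \<zero>} \<subseteq> {x. f x \<noteq> \<zero>}" using af by auto
    then have "finite {x. a \<otimes> f x \<noteq> \<zero>}"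
      by (rule finite_subset) (use af in \<open>auto simp: carrier_free_module\<close>)
    then show "a \<odot>\<^bsub>free_module R X\<^esub> f \<in> carrier (free_module R X)"
      using af by (auto simp: carrier_free_module)
  qed (auto simp: carrier_free_module l_distr r_distr m_assoc)
qed

lemma unit_vector_closed: "x \<in> X \<Longrightarrow> unit_vector R x \<in> carrier (free_module R X)"
  by (auto simp: unit_vector_def carrier_free_module)

text \<open>\<open>X\<close> may be infinite, but every element has finite support, and one
  coordinate at a time can be split off.\<close>

lemma free_module_maps_eq:
  assumes h: "module_map R (free_module R X) N h" and k: "module_map R (free_module R X) N k"
    and N: "left_module R N"
    and eq: "\<And>x. x \<in> X \<Longrightarrow> h (unit_vector R x) = k (unit_vector R x)"
    and f: "f \<in> carrier (free_module R X)"
  shows "h f = k f"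
proof -
  interpret N: left_module R N by fact
  interpret F: left_module R "free_module R X" by (rule left_module_free)
  have "\<forall>f \<in> carrier (free_module R X). {x. f x \<noteq> \<zero>} \<subseteq> S \<longrightarrow> h f = k f" if "finite S" for S
    using that
  proof induction
    case empty
    have "f = \<zero>\<^bsub>free_module R X\<^esub>" if "{x. f x \<noteq> \<zero>} \<subseteq> {}" for f using that by auto
    then show ?case
      using module_map_zero[OF h F.left_module_axioms N] module_map_zero[OF k F.left_module_axioms N] by metis
  next
    case (insert y S)
    show ?case
    proof (intro ballI impI)
      fix f assume f: "f \<in> carrier (free_module R X)" and S: "{x. f x \<noteq> \<zero>} \<subseteq> insert y S"
      show "h f = k f"
      proof (cases "y \<in> X")
        case True
        let ?g = "f(y := \<zero>)"
        have g: "?g \<in> carrier (free_module R X)"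
          using f by (auto simp: carrier_free_module intro: finite_subset[of _ "{x. f x \<noteq> \<zero>}"])
        have fy: "f y \<in> carrier R" using f by (auto simp: carrier_free_module)
        note u = unit_vector_closed[OF True]
        have dec: "f = ?g \<oplus>\<^bsub>free_module R X\<^esub> (f y \<odot>\<^bsub>free_module R X\<^esub> unit_vector R y)"
          using f by (auto simp: carrier_free_module unit_vector_def fun_eq_iff)
        have "{x. ?g x \<noteq> \<zero>} \<subseteq> S" using S by auto
        then have "h ?g = k ?g" using insert.IH g by blast
        then show ?thesis
          by (subst (1 2) dec)
             (simp only: module_map_add[OF h g F.smult_closed[OF fy u]] module_map_smult[OF h fy u]
               module_map_add[OF k g F.smult_closed[OF fy u]] module_map_smult[OF k fy u] eq[OF True])
      next
        case False
        then have "f y = \<zero>" using f by (auto simp: carrier_free_module)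
        then have "{x. f x \<noteq> \<zero>} \<subseteq> S" using S by auto
        then show ?thesis using insert.IH f by blast
      qed
    qed
  qed
  then show ?thesis using f by (auto simp: carrier_free_module)
qed

definition free_ext :: "('a, 'm) module \<Rightarrow> ('i \<Rightarrow> 'm) \<Rightarrow> ('i \<Rightarrow> 'a) \<Rightarrow> 'm" where
  "free_ext N g f = finsum N (\<lambda>x. f x \<odot>\<^bsub>N\<^esub> g x) {x. f x \<noteq> \<zero>}"

lemma free_ext_superset:
  assumes N: "left_module R N" and g: "\<And>x. x \<in> X \<Longrightarrow> g x \<in> carrier N"
    and f: "f \<in> carrier (free_module R X)" and S: "finite S" "{x. f x \<noteq> \<zero>} \<subseteq> S" "S \<subseteq> X"
  shows "free_ext N g f = finsum N (\<lambda>x. f x \<odot>\<^bsub>N\<^esub> g x) S"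
proof -
  interpret N: left_module R N by fact
  have fc: "f x \<in> carrier R" for x using f by (auto simp: carrier_free_module)
  show ?thesis
    unfolding free_ext_def
    by (rule N.M.add.finprod_mono_neutral_cong_left[OF S(1,2)])
       (use S g fc N.smult_zero_left in \<open>auto intro!: N.smult_closed\<close>)
qed

lemma free_ext_module_map:
  assumes N: "left_module R N" and g: "\<And>x. x \<in> X \<Longrightarrow> g x \<in> carrier N"
  shows "module_map R (free_module R X) N (free_ext N g)"
proof -
  interpret N: left_module R N by fact
  interpret F: left_module R "free_module R X" by (rule left_module_free)
  have supp: "finite {x. f x \<noteq> \<zero>}" "{x. f x \<noteq> \<zero>} \<subseteq> X" "\<And>x. f x \<in> carrier R"
    if "f \<in> carrier (free_module R X)" for f
    using that by (auto simp: carrier_free_module)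
  show ?thesis
  proof (rule module_mapI)
    fix f assume f: "f \<in> carrier (free_module R X)"
    show "free_ext N g f \<in> carrier N"
      unfolding free_ext_def using supp[OF f] g by (intro N.M.finsum_closed) (auto intro!: N.smult_closed)
    fix a assume a: "a \<in> carrier R"
    have "free_ext N g (a \<odot>\<^bsub>free_module R X\<^esub> f) = finsum N (\<lambda>x. a \<odot>\<^bsub>N\<^esub> (f x \<odot>\<^bsub>N\<^esub> g x)) {x. f x \<noteq> \<zero>}"
      using supp[OF f] a g
      by (subst free_ext_superset[OF N g F.smult_closed[OF a f], where S = "{x. f x \<noteq> \<zero>}"])
         (auto intro!: N.M.finsum_cong' N.smult_closed simp: subset_iff N.smult_assoc)
    then show "free_ext N g (a \<odot>\<^bsub>free_module R X\<^esub> f) = a \<odot>\<^bsub>N\<^esub> free_ext N g f"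
      using supp[OF f] a g unfolding free_ext_def
      by (subst N.smult_finsum) (auto intro!: N.smult_closed)
  next
    fix f h assume f: "f \<in> carrier (free_module R X)" and h: "h \<in> carrier (free_module R X)"
    let ?S = "{x. f x \<noteq> \<zero>} \<union> {x. h x \<noteq> \<zero>}"
    have S: "finite ?S" "?S \<subseteq> X" using supp f h by auto
    have "free_ext N g (f \<oplus>\<^bsub>free_module R X\<^esub> h) = finsum N (\<lambda>x. (f x \<odot>\<^bsub>N\<^esub> g x) \<oplus>\<^bsub>N\<^esub> (h x \<odot>\<^bsub>N\<^esub> g x)) ?S"
      using supp(3)[OF f] supp(3)[OF h] S g
      by (subst free_ext_superset[OF N g F.M.a_closed[OF f h] S(1) _ S(2)])
         (auto intro!: N.M.finsum_cong' N.smult_closed simp: N.smult_l_distr subset_iff)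
    also have "\<dots> = free_ext N g f \<oplus>\<^bsub>N\<^esub> free_ext N g h"
      using supp(3)[OF f] supp(3)[OF h] S g
      by (subst (1 2) free_ext_superset[OF N g _ S(1) _ S(2)])
         (auto intro!: N.smult_closed N.M.finsum_addf simp: f h subset_iff)
    finally show "free_ext N g (f \<oplus>\<^bsub>free_module R X\<^esub> h) = free_ext N g f \<oplus>\<^bsub>N\<^esub> free_ext N g h" .
  qed
qed

lemma free_ext_unit_vector:
  assumes N: "left_module R N" and g: "\<And>x. x \<in> X \<Longrightarrow> g x \<in> carrier N" and x: "x \<in> X"
  shows "free_ext N g (unit_vector R x) = g x"
proof -
  interpret N: left_module R N by fact
  have "free_ext N g (unit_vector R x) = finsum N (\<lambda>y. unit_vector R x y \<odot>\<^bsub>N\<^esub> g y) {x}"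
    using x by (intro free_ext_superset[OF N g] unit_vector_closed) (auto simp: unit_vector_def)
  also have "\<dots> = g x"
    using g[OF x] by (simp add: unit_vector_def N.smult_one)
  finally show ?thesis .
qed

lemma free_module_lift:
  assumes f: "module_map R (free_module R X) N f" and q: "module_map R M N q"
    and M: "left_module R M" and N: "left_module R N"
    and im: "\<And>x. x \<in> X \<Longrightarrow> f (unit_vector R x) \<in> q ` carrier M"
  shows "\<exists>g. module_map R (free_module R X) M g \<and> (\<forall>p\<in>carrier (free_module R X). q (g p) = f p)"
proof -
  obtain m where m: "\<And>x. x \<in> X \<Longrightarrow> m x \<in> carrier M" "\<And>x. x \<in> X \<Longrightarrow> q (m x) = f (unit_vector R x)"
    using im unfolding image_iff by metis
  have g: "module_map R (free_module R X) M (free_ext M m)"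
    by (rule free_ext_module_map[OF M]) (rule m(1))
  have gu: "free_ext M m (unit_vector R x) = m x" if "x \<in> X" for x
    by (rule free_ext_unit_vector[OF M _ that]) (rule m(1))
  have "q (free_ext M m p) = f p" if "p \<in> carrier (free_module R X)" for p
    by (rule free_module_maps_eq[OF module_map_comp[OF g q] f N _ that])
       (simp add: gu m(2))
  then show ?thesis using g by blast
qed

text \<open>On the free module of which \<open>P\<close> is a summand, lift \<open>f\<close>
  composed with the retraction, then restrict to \<open>P\<close>. The condition on images, in place
  of surjectivity of \<open>q\<close>, is the form in which exactness is available.\<close>

lemma projective_lift:
  fixes P :: "('a, 'p) module"
  assumes P: "projective_module R P" and f: "module_map R P N f" and q: "module_map R M N q"
    and M: "left_module R M" and N: "left_module R N"
    and im: "f ` carrier P \<subseteq> q ` carrier M"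
  shows "\<exists>g. module_map R P M g \<and> (\<forall>p\<in>carrier P. q (g p) = f p)"
proof -
  obtain X :: "'p set" and i p where "i \<in> module_homs R P (free_module R X)" "p \<in> module_homs R (free_module R X) P"
    and pi: "\<forall>x\<in>carrier P. p (i x) = x"
    using P unfolding projective_module_def by blast
  then have i: "module_map R P (free_module R X) i" and p: "module_map R (free_module R X) P p"
    by (simp_all add: module_homs_iff)
  have "\<exists>g. module_map R (free_module R X) M g \<and> (\<forall>y\<in>carrier (free_module R X). q (g y) = f (p y))"
    by (rule free_module_lift[OF module_map_comp[OF p f] q M N])
       (use im module_map_closed[OF p unit_vector_closed] in blast)
  then obtain g where g: "module_map R (free_module R X) M g"
    "\<And>y. y \<in> carrier (free_module R X) \<Longrightarrow> q (g y) = f (p y)" by blast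
  show ?thesis
    by (rule exI[of _ "\<lambda>x. g (i x)"])
       (use module_map_comp[OF i g(1)] g(2) module_map_closed[OF i] pi in auto)
qed

end

lemma projective_left_module: "projective_module A P \<Longrightarrow> left_module A P"
  by (simp add: projective_module_def)

section \<open>Transport of modules along injections\<close>

text \<open>All terms of a resolution must have their elements in 'm, while the natural ones are
  function spaces; the structure is transported along an injection.\<close>

definition encode_module :: "('x \<Rightarrow> 'm) \<Rightarrow> ('c, 'x) module \<Rightarrow> ('c, 'm) module" where
  "encode_module \<Phi> M =
     \<lparr>carrier = \<Phi> ` carrier M, mult = undefined, one = undefined, zero = \<Phi> \<zero>\<^bsub>M\<^esub>,
      add = (\<lambda>u v. \<Phi> (inv_into (carrier M) \<Phi> u \<oplus>\<^bsub>M\<^esub> inv_into (carrier M) \<Phi> v)),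
      smult = (\<lambda>a u. \<Phi> (a \<odot>\<^bsub>M\<^esub> inv_into (carrier M) \<Phi> u))\<rparr>"

context
  fixes A :: "('c, 'z) ring_scheme" and M :: "('c, 'x) module" and \<Phi> :: "'x \<Rightarrow> 'm"
  assumes M: "left_module A M" and inj: "inj_on \<Phi> (carrier M)"
begin

interpretation left_module A M by (rule M)

lemma carrier_encode: "carrier (encode_module \<Phi> M) = \<Phi> ` carrier M"
  by (simp add: encode_module_def)

lemma left_module_encode: "left_module A (encode_module \<Phi> M)"
proof -
  interpret E: abelian_group "encode_module \<Phi> M"
  proof (rule abelian_groupI)
    fix u assume "u \<in> carrier (encode_module \<Phi> M)"
    then obtain x where x: "x \<in> carrier M" "u = \<Phi> x" by (auto simp: encode_module_def)
    then show "\<exists>v\<in>carrier (encode_module \<Phi> M). v \<oplus>\<^bsub>encode_module \<Phi> M\<^esub> u = \<zero>\<^bsub>encode_module \<Phi> M\<^esub>"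
      by (intro bexI[of _ "\<Phi> (\<ominus>\<^bsub>M\<^esub> x)"]) (auto simp: encode_module_def inv_into_f_f[OF inj] M.l_neg)
  qed (auto simp: encode_module_def inv_into_f_f[OF inj] M.a_ac)
  show ?thesis
    by unfold_locales
       (auto simp: encode_module_def inv_into_f_f[OF inj] smult_closed smult_l_distr smult_r_distr
         smult_assoc smult_one)
qed

lemma module_map_encode: "module_map A M (encode_module \<Phi> M) \<Phi>"
  by (rule module_mapI) (auto simp: encode_module_def inv_into_f_f[OF inj])

lemma module_map_decode: "module_map A (encode_module \<Phi> M) M (inv_into (carrier M) \<Phi>)"
  by (rule module_mapI) (auto simp: encode_module_def inv_into_f_f[OF inj] smult_closed)

end

text \<open>\<open>projective_module\<close> asks for a free module with basis in the element type
  itself, so besides the coding of elements a renaming \<open>g\<close> of the basis is called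
  for.\<close>

lemma projective_encode_free:
  fixes A :: "('c, 'z) ring_scheme" and \<Phi> :: "('y \<Rightarrow> 'c) \<Rightarrow> 'm" and g :: "'y \<Rightarrow> 'm"
  assumes "ring A" and inj: "inj_on \<Phi> (carrier (free_module A Y))" and g: "inj_on g Y"
  shows "projective_module A (encode_module \<Phi> (free_module A Y))"
proof -
  interpret ring A by fact
  let ?F = "free_module A Y" and ?G = "free_module A (g ` Y)"
  let ?E = "encode_module \<Phi> ?F"
  note F = left_module_free[of Y]
  define i where "i f = (\<lambda>m. if m \<in> g ` Y then f (inv_into Y g m) else \<zero>\<^bsub>A\<^esub>)" for f :: "'y \<Rightarrow> 'c"
  define p where "p f = (\<lambda>y. if y \<in> Y then f (g y) else \<zero>\<^bsub>A\<^esub>)" for f :: "'m \<Rightarrow> 'c"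
  have i: "module_map A ?F ?G i"
  proof (rule module_mapI)
    fix f assume f: "f \<in> carrier ?F"
    have "{m. i f m \<noteq> \<zero>\<^bsub>A\<^esub>} \<subseteq> g ` {y. f y \<noteq> \<zero>\<^bsub>A\<^esub>}"
      unfolding i_def by (auto simp: inv_into_f_f[OF g])
    then have "finite {m. i f m \<noteq> \<zero>\<^bsub>A\<^esub>}"
      by (rule finite_subset) (use f in \<open>auto simp: carrier_free_module\<close>)
    then show "i f \<in> carrier ?G"
      using f by (auto simp: carrier_free_module i_def)
  qed (auto simp: i_def fun_eq_iff)
  have p: "module_map A ?G ?F p"
  proof (rule module_mapI)
    fix f assume f: "f \<in> carrier ?G"
    have "inj_on g {y. p f y \<noteq> \<zero>\<^bsub>A\<^esub>}"
      by (rule inj_on_subset[OF g]) (auto simp: p_def)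
    moreover have "g ` {y. p f y \<noteq> \<zero>\<^bsub>A\<^esub>} \<subseteq> {x. f x \<noteq> \<zero>\<^bsub>A\<^esub>}"
      by (auto simp: p_def split: if_splits)
    moreover have "finite {x. f x \<noteq> \<zero>\<^bsub>A\<^esub>}"
      using f by (simp add: carrier_free_module)
    ultimately have "finite {y. p f y \<noteq> \<zero>\<^bsub>A\<^esub>}"
      using finite_imageD finite_subset by blast
    then show "p f \<in> carrier ?F"
      using f by (auto simp: carrier_free_module p_def)
  qed (auto simp: p_def fun_eq_iff)
  have pi: "p (i f) = f" if "f \<in> carrier ?F" for f
    using that by (auto simp: p_def i_def fun_eq_iff inv_into_f_f[OF g] carrier_free_module)
  note E = left_module_encode[OF F inj]
  have 1: "module_map A ?E ?G (\<lambda>u. i (inv_into (carrier ?F) \<Phi> u))"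
    by (rule module_map_comp[OF module_map_decode[OF F inj] i])
  have 2: "module_map A ?G ?E (\<lambda>f. \<Phi> (p f))"
    by (rule module_map_comp[OF p module_map_encode[OF F inj]])
  show ?thesis
    unfolding projective_module_def
  proof (intro conjI exI[of _ "g ` Y"] bexI ballI)
    fix u assume "u \<in> carrier ?E"
    then obtain f where f: "f \<in> carrier ?F" "u = \<Phi> f" by (auto simp: carrier_encode[OF F inj])
    show "restrict (\<lambda>f. \<Phi> (p f)) (carrier ?G) (restrict (\<lambda>u. i (inv_into (carrier ?F) \<Phi> u)) (carrier ?E) u) = u"
      using f \<open>u \<in> carrier ?E\<close> module_map_closed[OF i f(1)] by (simp add: inv_into_f_f[OF inj] pi)
  qed (rule E restrict_module_homs[OF 1 E] restrict_module_homs[OF 2 left_module_free])+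
qed

text \<open>The only element is a parameter: in \<open>enc_module\<close> it is the code of the zero
  of the last nonzero term, so that the zero differentials are the same constant function in all
  higher degrees.\<close>

definition zero_module :: "'m \<Rightarrow> ('c, 'm) module" where
  "zero_module u = \<lparr>carrier = {u}, mult = undefined, one = undefined, zero = u,
     add = (\<lambda>_ _. u), smult = (\<lambda>_ _. u)\<rparr>"

lemma left_module_zero_module: "ring A \<Longrightarrow> left_module A (zero_module u)"
proof -
  assume "ring A"
  then interpret ring A .
  interpret abelian_group "zero_module u"
    by (rule abelian_groupI) (auto simp: zero_module_def)
  show ?thesis by unfold_locales (auto simp: zero_module_def)
qed

lemma projective_zero_module:
  fixes A :: "('c, 'z) ring_scheme" and u :: 'm
  assumes "ring A"
  shows "projective_module A (zero_module u)"
proof -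
  interpret ring A by fact
  let ?F = "free_module A ({} :: 'm set)"
  have 1: "module_map A (zero_module u) ?F (\<lambda>_. \<zero>\<^bsub>?F\<^esub>)"
    by (rule module_mapI) (auto simp: carrier_free_module)
  have 2: "module_map A ?F (zero_module u) (\<lambda>_. u)"
    by (rule module_mapI) (auto simp: zero_module_def)
  note Z = left_module_zero_module[OF assms, of u]
  show ?thesis
    unfolding projective_module_def
  proof (intro conjI exI[of _ "{} :: 'm set"] bexI ballI)
    fix x assume "x \<in> carrier (zero_module u)"
    then show "restrict (\<lambda>_. u) (carrier ?F) (restrict (\<lambda>_. \<zero>\<^bsub>?F\<^esub>) (carrier (zero_module u)) x) = x"
      by (simp add: zero_module_def carrier_free_module)
  qed (rule Z restrict_module_homs[OF 1 Z] restrict_module_homs[OF 2 left_module_free])+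
qed

lemma (in abelian_group) a_inv_zero: "\<ominus> \<zero> = \<zero>"
  by (simp add: a_inv_def)

section \<open>Comparison of a projective resolution with a presentation of a cyclic module\<close>

context ring
begin

text \<open>The map R^n -> R that sends the unit vectors to the \<open>x l\<close>; coefficients
  stand on the left because modules are left modules.\<close>

definition row_sum :: "('n::finite \<Rightarrow> 'a) \<Rightarrow> ('n \<Rightarrow> 'a) \<Rightarrow> 'a" where
  "row_sum x c = (\<Oplus>l\<in>UNIV. c l \<otimes> x l)"

lemma row_sum_module_map:
  fixes x :: "'n::finite \<Rightarrow> 'a"
  assumes x: "\<And>l. x l \<in> carrier R"
  shows "module_map R (free_module R UNIV) (regular_module R) (row_sum x)"
proof (rule module_map_cong[OF free_ext_module_map left_module_free])
  show "left_module R (regular_module R)"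
    by (rule left_module_regular) (rule ring_axioms)
  fix c :: "'n \<Rightarrow> 'a" assume "c \<in> carrier (free_module R UNIV)"
  then show "row_sum x c = free_ext (regular_module R) x c"
    by (subst free_ext_superset[where X = UNIV and S = UNIV])
       (auto simp: x row_sum_def finsum_def finprod_def regular_module_def
         intro: left_module_regular[OF ring_axioms, unfolded regular_module_def])
qed (use x in simp)

lemma row_sum_unit_vector:
  fixes x :: "'n::finite \<Rightarrow> 'a"
  assumes x: "\<And>l. x l \<in> carrier R"
  shows "row_sum x (unit_vector R l) = x l"
proof -
  have "row_sum x (unit_vector R l) = (\<Oplus>m\<in>UNIV. if l = m then x m else \<zero>)"
    unfolding row_sum_def by (intro finsum_cong') (auto simp: unit_vector_def x)
  then show ?thesis
    using add.finprod_singleton[of l UNIV x] x by simp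
qed

text \<open>
  Lifting the identity of \<open>N\<close> gives chain maps in both directions between the resolution and
  \<open>R\<^sup>n \<rightarrow> R \<rightarrow> N\<close>; in degree \<open>1\<close> the two composites differ from the identity by the homotopies
  \<open>h1\<close> and \<open>k1\<close>, up to terms that vanish on cycles.
\<close>

lemma resolution_comparison:
  fixes x :: "'n::finite \<Rightarrow> 'a"
  assumes P0: "projective_module R P0" and P1: "projective_module R P1" and P2: "left_module R P2"
    and N: "left_module R N"
    and d0: "module_map R P1 P0 d0" and d1: "module_map R P2 P1 d1" and e: "module_map R P0 N e"
    and e_surj: "e ` carrier P0 = carrier N"
    and exact0: "d0 ` carrier P1 = a_kernel P0 N e" and exact1: "d1 ` carrier P2 = a_kernel P1 P0 d0"
    and x: "\<And>l. x l \<in> carrier R"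
    and u: "u \<in> carrier N" and cyclic: "\<And>y. y \<in> carrier N \<Longrightarrow> \<exists>a\<in>carrier R. y = a \<odot>\<^bsub>N\<^esub> u"
    and ann: "\<And>a. a \<in> carrier R \<Longrightarrow> a \<odot>\<^bsub>N\<^esub> u = \<zero>\<^bsub>N\<^esub> \<longleftrightarrow> (\<exists>c\<in>carrier (free_module R UNIV). a = row_sum x c)"
  obtains \<phi>1 \<psi>1 h1 k1 where
    "module_map R (free_module R (UNIV :: 'n set)) P1 \<phi>1"
    "module_map R P1 (free_module R UNIV) \<psi>1"
    "module_map R (free_module R UNIV) (free_module R UNIV) h1"
    "module_map R P1 P2 k1"
    "\<And>c. c \<in> carrier (free_module R UNIV) \<Longrightarrow> row_sum x c = \<zero> \<Longrightarrow> d0 (\<phi>1 c) = \<zero>\<^bsub>P0\<^esub>"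
    "\<And>q. q \<in> carrier P1 \<Longrightarrow> d0 q = \<zero>\<^bsub>P0\<^esub> \<Longrightarrow> row_sum x (\<psi>1 q) = \<zero>"
    "\<And>c. c \<in> carrier (free_module R UNIV) \<Longrightarrow> row_sum x (h1 c) = \<zero>"
    "\<And>c. c \<in> carrier (free_module R UNIV) \<Longrightarrow> row_sum x c = \<zero> \<Longrightarrow>
       \<psi>1 (\<phi>1 c) = c \<oplus>\<^bsub>free_module R UNIV\<^esub> h1 c"
    "\<And>q. q \<in> carrier P1 \<Longrightarrow> d0 q = \<zero>\<^bsub>P0\<^esub> \<Longrightarrow> \<phi>1 (\<psi>1 q) = q \<oplus>\<^bsub>P1\<^esub> d1 (k1 q)"
proof -
  let ?F = "free_module R (UNIV :: 'n set)" and ?A = "regular_module R"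
  note lm = projective_left_module[OF P0] projective_left_module[OF P1] P2 N
  interpret P0: left_module R P0 by (rule lm)
  interpret P1: left_module R P1 by (rule lm)
  interpret P2: left_module R P2 by (rule lm)
  interpret N: left_module R N by (rule lm)
  interpret F: left_module R ?F by (rule left_module_free)
  have A: "left_module R ?A" by (rule left_module_regular) (rule ring_axioms)
  interpret A: left_module R ?A by (rule A)
  note rs = row_sum_module_map[OF x]
  have rs_closed: "row_sum x c \<in> carrier R" if "c \<in> carrier ?F" for c
    using module_map_closed[OF rs that] by simp
  \<comment> \<open>In degree 0 the chain map from R to the resolution is a \<mapsto> a p0.\<close>
  obtain p0 where p0: "p0 \<in> carrier P0" "e p0 = u"
    using e_surj u by (metis (no_types, lifting) imageE)
  have ed0: "e (d0 q) = \<zero>\<^bsub>N\<^esub>" if "q \<in> carrier P1" for q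
    using exact0 that by (auto simp: set_eq_iff a_kernel_iff image_iff)
  have orbit: "module_map R ?A M (\<lambda>a. a \<odot>\<^bsub>M\<^esub> m)" if "left_module R M" "m \<in> carrier M" for M :: "('a, 'q) module" and m
  proof -
    interpret M: left_module R M by fact
    show ?thesis using that by (intro module_mapI) (auto simp: M.smult_closed M.smult_l_distr M.smult_assoc)
  qed
  note au = orbit[OF N u]
  have "\<exists>q\<in>carrier P1. d0 q = x l \<odot>\<^bsub>P0\<^esub> p0" for l
  proof -
    have "e (x l \<odot>\<^bsub>P0\<^esub> p0) = x l \<odot>\<^bsub>N\<^esub> u"
      by (simp add: module_map_smult[OF e] x p0)
    also have "\<dots> = \<zero>\<^bsub>N\<^esub>"
      using ann[OF x, of l] row_sum_unit_vector[where x = x, OF x, of l] unit_vector_closed[of l UNIV]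
      by (metis UNIV_I)
    finally have "x l \<odot>\<^bsub>P0\<^esub> p0 \<in> a_kernel P0 N e"
      by (simp add: a_kernel_iff P0.smult_closed x p0)
    then show ?thesis unfolding exact0[symmetric] by (metis imageE)
  qed
  then obtain q where q: "\<And>l. q l \<in> carrier P1" "\<And>l. d0 (q l) = x l \<odot>\<^bsub>P0\<^esub> p0" by metis
  define \<phi>1 where "\<phi>1 = free_ext P1 q"
  have \<phi>1: "module_map R ?F P1 \<phi>1"
    unfolding \<phi>1_def by (rule free_ext_module_map) (use lm q in auto)
  note po = orbit[OF lm(1) p0(1)]
  have d0\<phi>1: "d0 (\<phi>1 c) = row_sum x c \<odot>\<^bsub>P0\<^esub> p0" if "c \<in> carrier ?F" for c
  proof (rule free_module_maps_eq[OF module_map_comp[OF \<phi>1 d0] module_map_comp[OF rs po] lm(1) _ that])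
    fix l :: 'n
    have "free_ext P1 q (unit_vector R l) = q l"
      by (rule free_ext_unit_vector) (use lm q in auto)
    then show "d0 (\<phi>1 (unit_vector R l)) = row_sum x (unit_vector R l) \<odot>\<^bsub>P0\<^esub> p0"
      by (simp add: \<phi>1_def q row_sum_unit_vector[where x = x, OF x])
  qed
  have "e ` carrier P0 \<subseteq> (\<lambda>a. a \<odot>\<^bsub>N\<^esub> u) ` carrier ?A"
    unfolding image_def using cyclic[OF module_map_closed[OF e]] by auto
  from projective_lift[OF P0 e au A N this]
  obtain \<psi>0 where \<psi>0: "module_map R P0 ?A \<psi>0" "\<And>p. p \<in> carrier P0 \<Longrightarrow> \<psi>0 p \<odot>\<^bsub>N\<^esub> u = e p"
    by blast
  have \<psi>0_closed: "\<psi>0 p \<in> carrier R" if "p \<in> carrier P0" for p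
    using module_map_closed[OF \<psi>0(1) that] by simp
  have "\<psi>0 (d0 q) \<in> row_sum x ` carrier ?F" if "q \<in> carrier P1" for q
      using ann[of "\<psi>0 (d0 q)"] \<psi>0(2)[of "d0 q"] \<psi>0_closed[of "d0 q"] module_map_closed[OF d0 that]
        ed0[OF that] by auto
  then have "(\<lambda>q. \<psi>0 (d0 q)) ` carrier P1 \<subseteq> row_sum x ` carrier ?F" by blast
  from projective_lift[OF P1 module_map_comp[OF d0 \<psi>0(1)] rs F.left_module_axioms A this]
  obtain \<psi>1 where \<psi>1: "module_map R P1 ?F \<psi>1" "\<And>q. q \<in> carrier P1 \<Longrightarrow> row_sum x (\<psi>1 q) = \<psi>0 (d0 q)"
    by blast
  \<comment> \<open>The composite R -> P0 -> R is multiplication by \<open>\<psi>0 p0\<close>, which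
    acts on \<open>u\<close> like 1. Their difference is therefore a row sum, and a \<mapsto> a t is
    the homotopy in degree 0.\<close>
  obtain t where t: "t \<in> carrier ?F" "row_sum x t = \<psi>0 p0 \<ominus> \<one>"
  proof -
    have "(\<psi>0 p0 \<ominus> \<one>) \<odot>\<^bsub>N\<^esub> u = \<psi>0 p0 \<odot>\<^bsub>N\<^esub> u \<ominus>\<^bsub>N\<^esub> \<one> \<odot>\<^bsub>N\<^esub> u"
      using module_map_minus[OF au A N, of "\<psi>0 p0" \<one>] \<psi>0_closed[OF p0(1)]
      by (simp add: a_minus_def regular_a_inv)
    also have "\<dots> = \<zero>\<^bsub>N\<^esub>"
      using \<psi>0(2)[OF p0(1)] p0 u by (simp add: N.smult_one a_minus_def N.M.r_neg)
    finally show thesis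
      using ann[of "\<psi>0 p0 \<ominus> \<one>"] \<psi>0_closed[OF p0(1)] that by auto
  qed
  \<comment> \<open>The composite in degree 1, minus the identity, minus the homotopy of degree 0
    after the differential. Its values are syzygies, and on a syzygy the last term vanishes.\<close>
  define h1 where "h1 c = (\<psi>1 (\<phi>1 c) \<ominus>\<^bsub>?F\<^esub> c) \<ominus>\<^bsub>?F\<^esub> (row_sum x c \<odot>\<^bsub>?F\<^esub> t)" for c
  have h1: "module_map R ?F ?F h1"
    unfolding h1_def
    by (intro module_map_minus_map module_map_comp[OF \<phi>1 \<psi>1(1)] module_map_id F.left_module_axioms
        module_map_comp[OF rs orbit] t)
  have rs_h1: "row_sum x (h1 c) = \<zero>" if c: "c \<in> carrier ?F" for c
  proof -
    note cl = module_map_closed[OF \<phi>1 c] module_map_closed[OF \<psi>1(1) module_map_closed[OF \<phi>1 c]]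
      rs_closed[OF c] \<psi>0_closed[OF p0(1)]
    have ct: "row_sum x c \<odot>\<^bsub>?F\<^esub> t \<in> carrier ?F" using cl t F.smult_closed by blast
    have "row_sum x (\<psi>1 (\<phi>1 c)) = row_sum x c \<otimes> \<psi>0 p0"
      using module_map_smult[OF \<psi>0(1) cl(3) p0(1)] by (simp add: \<psi>1(2)[OF cl(1)] d0\<phi>1[OF c])
    moreover have "row_sum x (row_sum x c \<odot>\<^bsub>?F\<^esub> t) = row_sum x c \<otimes> \<psi>0 p0 \<ominus> row_sum x c"
      using module_map_smult[OF rs cl(3) t(1)] cl by (simp add: t a_minus_def r_distr r_minus)
    ultimately have "row_sum x (h1 c) = (row_sum x c \<otimes> \<psi>0 p0 \<ominus> row_sum x c) \<ominus> (row_sum x c \<otimes> \<psi>0 p0 \<ominus> row_sum x c)"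
      unfolding h1_def
      using module_map_minus[OF rs F.left_module_axioms A F.M.minus_closed[OF cl(2) c] ct]
        module_map_minus[OF rs F.left_module_axioms A cl(2) c]
      by (simp add: a_minus_def regular_a_inv)
    also have "\<dots> = \<zero>" using cl by (simp add: r_neg a_minus_def)
    finally show ?thesis .
  qed
  have \<psi>\<phi>: "\<psi>1 (\<phi>1 c) = c \<oplus>\<^bsub>?F\<^esub> h1 c" if c: "c \<in> carrier ?F" and "row_sum x c = \<zero>" for c
  proof -
    note cl = module_map_closed[OF \<psi>1(1) module_map_closed[OF \<phi>1 c]]
    have "h1 c = \<psi>1 (\<phi>1 c) \<ominus>\<^bsub>?F\<^esub> c"
      unfolding h1_def that(2) F.smult_zero_left[OF t(1)]
      using cl c by (simp only: a_minus_def F.M.a_inv_zero F.M.r_zero F.M.a_closed F.M.a_inv_closed)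
    then show ?thesis
      using cl c by (simp only: a_minus_def F.M.a_comm[of "\<psi>1 (\<phi>1 c)"] F.M.a_inv_closed F.M.r_neg1
          F.M.r_neg2)
  qed
  \<comment> \<open>The homotopy on the side of the resolution: round trip through R minus the
    identity has values in the kernel of \<open>e\<close>, hence lifts along
    \<open>d0\<close>.\<close>
  obtain k0 where k0: "module_map R P0 P1 k0"
    "\<And>p. p \<in> carrier P0 \<Longrightarrow> d0 (k0 p) = \<psi>0 p \<odot>\<^bsub>P0\<^esub> p0 \<ominus>\<^bsub>P0\<^esub> p"
  proof -
    have map: "module_map R P0 P0 (\<lambda>p. \<psi>0 p \<odot>\<^bsub>P0\<^esub> p0 \<ominus>\<^bsub>P0\<^esub> p)"
      by (intro module_map_minus_map module_map_comp[OF \<psi>0(1) po] module_map_id lm)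
    have "\<psi>0 p \<odot>\<^bsub>P0\<^esub> p0 \<ominus>\<^bsub>P0\<^esub> p \<in> d0 ` carrier P1" if p: "p \<in> carrier P0" for p
    proof -
      have cl: "\<psi>0 p \<odot>\<^bsub>P0\<^esub> p0 \<in> carrier P0" using P0.smult_closed \<psi>0_closed p p0 by blast
      have "e (\<psi>0 p \<odot>\<^bsub>P0\<^esub> p0 \<ominus>\<^bsub>P0\<^esub> p) = e p \<ominus>\<^bsub>N\<^esub> e p"
        using module_map_minus[OF e lm(1) N cl p] module_map_smult[OF e \<psi>0_closed[OF p] p0(1)] \<psi>0(2)[OF p]
        by (simp add: p0)
      also have "\<dots> = \<zero>\<^bsub>N\<^esub>"
        using module_map_closed[OF e p] by (simp add: a_minus_def N.M.r_neg)
      finally show ?thesis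
        using cl p by (simp add: exact0 a_kernel_iff)
    qed
    then have "(\<lambda>p. \<psi>0 p \<odot>\<^bsub>P0\<^esub> p0 \<ominus>\<^bsub>P0\<^esub> p) ` carrier P0 \<subseteq> d0 ` carrier P1" by blast
    from projective_lift[OF P0 map d0 lm(2) lm(1) this] show thesis using that by blast
  qed
  \<comment> \<open>Subtracting \<open>k0\<close> after \<open>d0\<close> makes the expression a
    cycle, so it lifts along \<open>d1\<close> by exactness.\<close>
  obtain k1 where k1: "module_map R P1 P2 k1"
    "\<And>q. q \<in> carrier P1 \<Longrightarrow> d1 (k1 q) = (\<phi>1 (\<psi>1 q) \<ominus>\<^bsub>P1\<^esub> q) \<ominus>\<^bsub>P1\<^esub> k0 (d0 q)"
  proof -
    have map: "module_map R P1 P1 (\<lambda>q. (\<phi>1 (\<psi>1 q) \<ominus>\<^bsub>P1\<^esub> q) \<ominus>\<^bsub>P1\<^esub> k0 (d0 q))"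
      by (intro module_map_minus_map module_map_comp[OF \<psi>1(1) \<phi>1] module_map_comp[OF d0 k0(1)] module_map_id lm)
    have "(\<phi>1 (\<psi>1 q) \<ominus>\<^bsub>P1\<^esub> q) \<ominus>\<^bsub>P1\<^esub> k0 (d0 q) \<in> d1 ` carrier P2" if q: "q \<in> carrier P1" for q
    proof -
      note c1 = module_map_closed[OF \<psi>1(1) q]
      note c2 = module_map_closed[OF \<phi>1 c1] and c3 = module_map_closed[OF d0 q]
      note c4 = module_map_closed[OF k0(1) c3]
      let ?y = "\<psi>0 (d0 q) \<odot>\<^bsub>P0\<^esub> p0 \<ominus>\<^bsub>P0\<^esub> d0 q"
      have y: "?y \<in> carrier P0" using P0.smult_closed \<psi>0_closed c3 p0 by blast
      have "d0 ((\<phi>1 (\<psi>1 q) \<ominus>\<^bsub>P1\<^esub> q) \<ominus>\<^bsub>P1\<^esub> k0 (d0 q)) = ?y \<ominus>\<^bsub>P0\<^esub> ?y"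
        using module_map_minus[OF d0 lm(2) lm(1) P1.M.minus_closed[OF c2 q] c4]
          module_map_minus[OF d0 lm(2) lm(1) c2 q]
        by (simp only: k0(2)[OF c3] d0\<phi>1[OF c1] \<psi>1(2)[OF q])
      also have "\<dots> = \<zero>\<^bsub>P0\<^esub>" using y by (simp add: a_minus_def[of P0 ?y] P0.M.r_neg)
      finally show ?thesis
        using c2 c4 q by (simp add: exact1 a_kernel_iff)
    qed
    then have "(\<lambda>q. (\<phi>1 (\<psi>1 q) \<ominus>\<^bsub>P1\<^esub> q) \<ominus>\<^bsub>P1\<^esub> k0 (d0 q)) ` carrier P1 \<subseteq> d1 ` carrier P2" by blast
    from projective_lift[OF P1 map d1 lm(3) lm(2) this] show thesis using that by blast
  qed
  have \<phi>\<psi>: "\<phi>1 (\<psi>1 q) = q \<oplus>\<^bsub>P1\<^esub> d1 (k1 q)" if q: "q \<in> carrier P1" and "d0 q = \<zero>\<^bsub>P0\<^esub>" for q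
  proof -
    note c2 = module_map_closed[OF \<phi>1 module_map_closed[OF \<psi>1(1) q]]
    have "d1 (k1 q) = \<phi>1 (\<psi>1 q) \<ominus>\<^bsub>P1\<^esub> q"
      unfolding k1(2)[OF q] that(2) module_map_zero[OF k0(1) lm(1) lm(2)]
      using c2 q by (simp add: a_minus_def)
    then show ?thesis
      using c2 q by (simp add: a_minus_def P1.M.a_comm[of "\<phi>1 (\<psi>1 q)"] P1.M.r_neg1 P1.M.r_neg2)
  qed
  show thesis
    by (rule that[OF \<phi>1 \<psi>1(1) h1 k1(1) _ _ rs_h1 \<psi>\<phi> \<phi>\<psi>])
       (simp_all add: d0\<phi>1 p0 \<psi>1(2) module_map_zero[OF \<psi>0(1) lm(1) A])
qed

end

section \<open>Quotient modules and Ext\<close>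

context
  fixes M :: "('c, 'm) module" and N :: "'m set"
  assumes M: "abelian_group M" and N: "additive_subgroup N M"
begin

interpretation abelian_group M by (rule M)
interpretation N: additive_subgroup N M by (rule N)
interpretation NA: abelian_subgroup N M
  by (rule abelian_subgroupI3) (rule N M)+

lemma carrier_quotient: "carrier (quotient_module M N) = (\<lambda>x. N +>\<^bsub>M\<^esub> x) ` carrier M"
  by (auto simp: quotient_module_def A_RCOSETS_def')

lemma coset_eq_iff:
  assumes x: "x \<in> carrier M" and y: "y \<in> carrier M"
  shows "N +>\<^bsub>M\<^esub> x = N +>\<^bsub>M\<^esub> y \<longleftrightarrow> x \<ominus>\<^bsub>M\<^esub> y \<in> N"
proof
  assume "N +>\<^bsub>M\<^esub> x = N +>\<^bsub>M\<^esub> y"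
  then have "x \<in> N +>\<^bsub>M\<^esub> y" using NA.a_rcos_self[OF x] by simp
  then obtain n where "n \<in> N" "x = n \<oplus>\<^bsub>M\<^esub> y" by (auto simp: a_r_coset_def')
  then show "x \<ominus>\<^bsub>M\<^esub> y \<in> N"
    using y N.a_subset by (auto simp: a_minus_def a_assoc r_neg subset_iff)
next
  assume "x \<ominus>\<^bsub>M\<^esub> y \<in> N"
  moreover have "x = (x \<ominus>\<^bsub>M\<^esub> y) \<oplus>\<^bsub>M\<^esub> y" using x y by (simp add: a_minus_def a_assoc l_neg)
  ultimately have "x \<in> N +>\<^bsub>M\<^esub> y" by (auto simp: a_r_coset_def')
  then show "N +>\<^bsub>M\<^esub> x = N +>\<^bsub>M\<^esub> y"
    using a_repr_independence[OF _ y N.a_subgroup] by simp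
qed

lemma coset_eq_zero_iff:
  assumes x: "x \<in> carrier M"
  shows "N +>\<^bsub>M\<^esub> x = N \<longleftrightarrow> x \<in> N"
  using coset_eq_iff[OF x zero_closed] x N.a_subset by (simp add: a_minus_def a_inv_zero)

lemma quotient_zero: "zero (quotient_module M N) = N"
  by (simp add: quotient_module_def)

lemma quotient_add:
  "x \<in> carrier M \<Longrightarrow> y \<in> carrier M \<Longrightarrow>
    (N +>\<^bsub>M\<^esub> x) \<oplus>\<^bsub>quotient_module M N\<^esub> (N +>\<^bsub>M\<^esub> y) = N +>\<^bsub>M\<^esub> (x \<oplus>\<^bsub>M\<^esub> y)"
  by (simp add: quotient_module_def NA.a_rcos_sum)

lemma quotient_smult:
  assumes closed: "\<And>x. x \<in> carrier M \<Longrightarrow> a \<odot>\<^bsub>M\<^esub> x \<in> carrier M"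
    and add: "\<And>x y. x \<in> carrier M \<Longrightarrow> y \<in> carrier M \<Longrightarrow> a \<odot>\<^bsub>M\<^esub> (x \<oplus>\<^bsub>M\<^esub> y) = a \<odot>\<^bsub>M\<^esub> x \<oplus>\<^bsub>M\<^esub> a \<odot>\<^bsub>M\<^esub> y"
    and N_closed: "\<And>x. x \<in> N \<Longrightarrow> a \<odot>\<^bsub>M\<^esub> x \<in> N" and x: "x \<in> carrier M"
  shows "a \<odot>\<^bsub>quotient_module M N\<^esub> (N +>\<^bsub>M\<^esub> x) = N +>\<^bsub>M\<^esub> (a \<odot>\<^bsub>M\<^esub> x)"
proof -
  \<comment> \<open>All members of the union that defines the scalar multiplication are the same
    coset.\<close>
  have "N +>\<^bsub>M\<^esub> (a \<odot>\<^bsub>M\<^esub> y) = N +>\<^bsub>M\<^esub> (a \<odot>\<^bsub>M\<^esub> x)" if y: "y \<in> N +>\<^bsub>M\<^esub> x" for y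
  proof -
    obtain n where n: "n \<in> N" "y = n \<oplus>\<^bsub>M\<^esub> x" using y by (auto simp: a_r_coset_def')
    then have nc: "n \<in> carrier M" using N.a_subset by auto
    have "a \<odot>\<^bsub>M\<^esub> y \<ominus>\<^bsub>M\<^esub> a \<odot>\<^bsub>M\<^esub> x = a \<odot>\<^bsub>M\<^esub> n"
      using n nc x closed by (simp add: add a_minus_def a_assoc r_neg)
    then show ?thesis
      using n nc x closed N_closed coset_eq_iff[of "a \<odot>\<^bsub>M\<^esub> y" "a \<odot>\<^bsub>M\<^esub> x"] by simp
  qed
  then have "(\<Union>y\<in>N +>\<^bsub>M\<^esub> x. N +>\<^bsub>M\<^esub> (a \<odot>\<^bsub>M\<^esub> y)) = (\<Union>y\<in>N +>\<^bsub>M\<^esub> x. N +>\<^bsub>M\<^esub> (a \<odot>\<^bsub>M\<^esub> x))"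
    by (intro SUP_cong refl)
  also have "\<dots> = N +>\<^bsub>M\<^esub> (a \<odot>\<^bsub>M\<^esub> x)"
    using NA.a_rcos_self[OF x] by (subst UN_constant) auto
  finally show ?thesis by (simp add: quotient_module_def)
qed

end

section \<open>Ext modules of a complex, computed on cocycles\<close>

locale module_complex = ring A
  for A :: "('c, 'z) ring_scheme" (structure) +
  fixes P :: "nat \<Rightarrow> ('c, 'm) module" and d :: "nat \<Rightarrow> 'm \<Rightarrow> 'm"
  assumes P: "left_module A (P i)"
    and d: "module_map A (P (Suc i)) (P i) (d i)"
    and d_d: "p \<in> carrier (P (Suc (Suc i))) \<Longrightarrow> d i (d (Suc i) p) = \<zero>\<^bsub>P i\<^esub>"
begin

abbreviation cocycle_module :: "nat \<Rightarrow> ('c, 'm \<Rightarrow> 'c) module" where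
  "cocycle_module i \<equiv> dual_module A (P i)\<lparr>carrier := ext_cocycles A P d i\<rparr>"

lemma dual_simps [simp]:
  "zero (dual_module A M) = (\<lambda>p\<in>carrier M. \<zero>)"
  "add (dual_module A M) = (\<lambda>f g. \<lambda>p\<in>carrier M. f p \<oplus> g p)"
  "smult (dual_module A M) = (\<lambda>a f. \<lambda>p\<in>carrier M. f p \<otimes> a)"
  by (simp_all add: dual_module_def)

lemma carrier_dual:
  "f \<in> carrier (dual_module A M) \<longleftrightarrow> f \<in> extensional (carrier M) \<and> module_map A M (regular_module A) f"
  by (simp add: dual_module_def module_homs_iff)

lemma cocycles_iff:
  "f \<in> ext_cocycles A P d i \<longleftrightarrow> f \<in> extensional (carrier (P i)) \<and>
     module_map A (P i) (regular_module A) f \<and> (\<forall>p\<in>carrier (P (Suc i)). f (d i p) = \<zero>)"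
  by (auto simp: ext_cocycles_def carrier_dual)

lemma regular: "left_module A (regular_module A)"
  by (rule left_module_regular) (rule ring_axioms)

lemma d_closed: "p \<in> carrier (P (Suc i)) \<Longrightarrow> d i p \<in> carrier (P i)"
  using module_map_closed[OF d] .

lemma dual_closed: "f \<in> carrier (dual_module A M) \<Longrightarrow> p \<in> carrier M \<Longrightarrow> f p \<in> carrier A"
  unfolding carrier_dual using module_map_closed[of A M "regular_module A" f p] by auto

lemma cocycle_closed: "f \<in> ext_cocycles A P d i \<Longrightarrow> p \<in> carrier (P i) \<Longrightarrow> f p \<in> carrier A"
  using dual_closed unfolding ext_cocycles_def by auto

lemma dual_add:
  assumes "left_module A M" "f \<in> carrier (dual_module A M)" "g \<in> carrier (dual_module A M)"
  shows "(\<lambda>p\<in>carrier M. f p \<oplus> g p) \<in> carrier (dual_module A M)"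
  using module_map_plus_map[of A M "regular_module A" f g] assms regular
  by (auto simp: carrier_dual intro: module_map_cong)

lemma dual_uminus:
  assumes "left_module A M" "f \<in> carrier (dual_module A M)"
  shows "(\<lambda>p\<in>carrier M. \<ominus> f p) \<in> carrier (dual_module A M)"
  using module_map_uminus_map[of A M "regular_module A" f] assms regular
  by (auto simp: carrier_dual regular_a_inv intro: module_map_cong)

lemma right_mult_map:
  assumes f: "module_map A M (regular_module A) f" and a: "a \<in> carrier A"
  shows "module_map A M (regular_module A) (\<lambda>p. f p \<otimes> a)"
  using f a unfolding module_map_def by (auto simp: l_distr m_assoc)

lemma dual_smult:
  assumes "left_module A M" "f \<in> carrier (dual_module A M)" "a \<in> carrier A"
  shows "(\<lambda>p\<in>carrier M. f p \<otimes> a) \<in> carrier (dual_module A M)"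
  using right_mult_map[of M f a] assms
  by (auto simp: carrier_dual intro: module_map_cong)

lemma dual_zero:
  assumes "left_module A M"
  shows "(\<lambda>p\<in>carrier M. \<zero>) \<in> carrier (dual_module A M)"
proof -
  have "module_map A M (regular_module A) (\<lambda>_. \<zero>)" by (rule module_mapI) auto
  then show ?thesis using assms by (auto simp: carrier_dual intro: module_map_cong)
qed

lemma cocycle_add:
  "f \<in> ext_cocycles A P d i \<Longrightarrow> g \<in> ext_cocycles A P d i \<Longrightarrow>
    (\<lambda>p\<in>carrier (P i). f p \<oplus> g p) \<in> ext_cocycles A P d i"
  using dual_add[OF P] d_closed by (auto simp: ext_cocycles_def)

lemma cocycle_uminus:
  "f \<in> ext_cocycles A P d i \<Longrightarrow> (\<lambda>p\<in>carrier (P i). \<ominus> f p) \<in> ext_cocycles A P d i"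
  using dual_uminus[OF P] d_closed by (auto simp: ext_cocycles_def a_inv_zero)

lemma cocycle_smult:
  "f \<in> ext_cocycles A P d i \<Longrightarrow> a \<in> carrier A \<Longrightarrow> (\<lambda>p\<in>carrier (P i). f p \<otimes> a) \<in> ext_cocycles A P d i"
  using dual_smult[OF P] d_closed by (auto simp: ext_cocycles_def)

lemma cocycle_zero: "(\<lambda>p\<in>carrier (P i). \<zero>) \<in> ext_cocycles A P d i"
  using dual_zero[OF P] d_closed by (auto simp: ext_cocycles_def)

lemma abelian_group_cocycles: "abelian_group (cocycle_module i)"
proof (rule abelian_groupI)
  fix f assume f: "f \<in> carrier (cocycle_module i)"
  then have ext: "f \<in> extensional (carrier (P i))" by (simp add: cocycles_iff)
  show "\<exists>g\<in>carrier (cocycle_module i). g \<oplus>\<^bsub>cocycle_module i\<^esub> f = \<zero>\<^bsub>cocycle_module i\<^esub>"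
    by (rule bexI[of _ "\<lambda>p\<in>carrier (P i). \<ominus> f p"])
       (use f cocycle_uminus in \<open>auto simp: fun_eq_iff l_neg cocycle_closed\<close>)
  show "\<zero>\<^bsub>cocycle_module i\<^esub> \<oplus>\<^bsub>cocycle_module i\<^esub> f = f"
    using f ext by (auto simp: fun_eq_iff cocycle_closed extensional_def)
qed (auto simp: cocycle_add cocycle_zero cocycle_closed fun_eq_iff a_ac)

lemma cocycle_a_inv:
  assumes f: "f \<in> ext_cocycles A P d i"
  shows "\<ominus>\<^bsub>cocycle_module i\<^esub> f = (\<lambda>p\<in>carrier (P i). \<ominus> f p)"
proof -
  interpret Z: abelian_group "cocycle_module i" by (rule abelian_group_cocycles)
  show ?thesis
    by (rule Z.minus_equality) (use f cocycle_uminus in \<open>auto simp: fun_eq_iff l_neg cocycle_closed\<close>)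
qed

lemma coboundaries_Suc:
  "f \<in> ext_coboundaries A P d (Suc j) \<longleftrightarrow>
     (\<exists>g\<in>carrier (dual_module A (P j)). f = (\<lambda>p\<in>carrier (P (Suc j)). g (d j p)))"
  by (auto simp: ext_coboundaries_def)

lemma
  shows coboundary_cocycle: "f \<in> ext_coboundaries A P d i \<Longrightarrow> f \<in> ext_cocycles A P d i"
    and coboundary_zero: "(\<lambda>p\<in>carrier (P i). \<zero>) \<in> ext_coboundaries A P d i"
    and coboundary_add: "f \<in> ext_coboundaries A P d i \<Longrightarrow> g \<in> ext_coboundaries A P d i \<Longrightarrow>
      (\<lambda>p\<in>carrier (P i). f p \<oplus> g p) \<in> ext_coboundaries A P d i"
    and coboundary_uminus: "f \<in> ext_coboundaries A P d i \<Longrightarrow>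
      (\<lambda>p\<in>carrier (P i). \<ominus> f p) \<in> ext_coboundaries A P d i"
    and coboundary_smult: "f \<in> ext_coboundaries A P d i \<Longrightarrow> a \<in> carrier A \<Longrightarrow>
      (\<lambda>p\<in>carrier (P i). f p \<otimes> a) \<in> ext_coboundaries A P d i"
proof -
  show "f \<in> ext_coboundaries A P d i \<Longrightarrow> f \<in> ext_cocycles A P d i"
  proof (cases i)
    case (Suc j)
    assume "f \<in> ext_coboundaries A P d i"
    then obtain g where g: "g \<in> carrier (dual_module A (P j))" "f = (\<lambda>p\<in>carrier (P (Suc j)). g (d j p))"
      by (auto simp: Suc coboundaries_Suc)
    have gm: "module_map A (P j) (regular_module A) g" using g by (simp add: carrier_dual)
    have "module_map A (P (Suc j)) (regular_module A) f"
      using module_map_cong[OF module_map_comp[OF d gm] P] g by auto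
    moreover have "g \<zero>\<^bsub>P j\<^esub> = \<zero>" using module_map_zero[OF gm P regular] by simp
    ultimately show ?thesis using g d_closed by (auto simp: Suc cocycles_iff d_d)
  qed (auto simp: ext_coboundaries_def cocycle_zero)
  show "(\<lambda>p\<in>carrier (P i). \<zero>) \<in> ext_coboundaries A P d i"
  proof (cases i)
    case (Suc j)
    show ?thesis unfolding Suc coboundaries_Suc
      by (rule bexI[OF _ dual_zero[OF P]]) (auto simp: fun_eq_iff d_closed)
  qed (auto simp: ext_coboundaries_def)
  show "f \<in> ext_coboundaries A P d i \<Longrightarrow> g \<in> ext_coboundaries A P d i \<Longrightarrow>
      (\<lambda>p\<in>carrier (P i). f p \<oplus> g p) \<in> ext_coboundaries A P d i"
  proof (cases i)
    case (Suc j)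
    assume "f \<in> ext_coboundaries A P d i" "g \<in> ext_coboundaries A P d i"
    then obtain f' g' where fg: "f' \<in> carrier (dual_module A (P j))" "f = (\<lambda>p\<in>carrier (P (Suc j)). f' (d j p))"
      "g' \<in> carrier (dual_module A (P j))" "g = (\<lambda>p\<in>carrier (P (Suc j)). g' (d j p))"
      by (auto simp: Suc coboundaries_Suc)
    show ?thesis unfolding Suc coboundaries_Suc
      by (rule bexI[OF _ dual_add[OF P fg(1,3)]]) (auto simp: fun_eq_iff d_closed fg(2,4))
  qed (auto simp: ext_coboundaries_def fun_eq_iff)
  show "f \<in> ext_coboundaries A P d i \<Longrightarrow> (\<lambda>p\<in>carrier (P i). \<ominus> f p) \<in> ext_coboundaries A P d i"
  proof (cases i)
    case (Suc j)
    assume "f \<in> ext_coboundaries A P d i"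
    then obtain g where g: "g \<in> carrier (dual_module A (P j))" "f = (\<lambda>p\<in>carrier (P (Suc j)). g (d j p))"
      by (auto simp: Suc coboundaries_Suc)
    show ?thesis unfolding Suc coboundaries_Suc
      by (rule bexI[OF _ dual_uminus[OF P g(1)]]) (auto simp: fun_eq_iff d_closed g)
  qed (auto simp: ext_coboundaries_def fun_eq_iff a_inv_zero)
  show "f \<in> ext_coboundaries A P d i \<Longrightarrow> a \<in> carrier A \<Longrightarrow>
      (\<lambda>p\<in>carrier (P i). f p \<otimes> a) \<in> ext_coboundaries A P d i"
  proof (cases i)
    case (Suc j)
    assume a: "a \<in> carrier A" and "f \<in> ext_coboundaries A P d i"
    then obtain g where g: "g \<in> carrier (dual_module A (P j))" "f = (\<lambda>p\<in>carrier (P (Suc j)). g (d j p))"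
      by (auto simp: Suc coboundaries_Suc)
    show ?thesis unfolding Suc coboundaries_Suc
      by (rule bexI[OF _ dual_smult[OF P g(1) a]]) (auto simp: fun_eq_iff d_closed g)
  qed (auto simp: ext_coboundaries_def fun_eq_iff)
qed

lemma coboundaries_subgroup: "additive_subgroup (ext_coboundaries A P d i) (cocycle_module i)"
proof -
  interpret Z: abelian_group "cocycle_module i" by (rule abelian_group_cocycles)
  have "subgroup (ext_coboundaries A P d i) (add_monoid (cocycle_module i))"
  proof (rule group.subgroupI[OF Z.a_group])
    show "ext_coboundaries A P d i \<subseteq> carrier (add_monoid (cocycle_module i))"
      using coboundary_cocycle by auto
    show "ext_coboundaries A P d i \<noteq> {}"
      using coboundary_zero[of i] by blast
    show "inv\<^bsub>add_monoid (cocycle_module i)\<^esub> f \<in> ext_coboundaries A P d i"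
      if "f \<in> ext_coboundaries A P d i" for f
      unfolding cocycle_a_inv[OF coboundary_cocycle[OF that], unfolded a_inv_def[of "cocycle_module i"]]
      by (rule coboundary_uminus) fact
  qed (use coboundary_add in auto)
  then show ?thesis by (rule additive_subgroupI)
qed

abbreviation ext_class :: "nat \<Rightarrow> ('m \<Rightarrow> 'c) \<Rightarrow> ('m \<Rightarrow> 'c) set" where
  "ext_class i z \<equiv> ext_coboundaries A P d i +>\<^bsub>cocycle_module i\<^esub> z"

lemma carrier_ext: "carrier (ext_module A P d i) = ext_class i ` ext_cocycles A P d i"
  unfolding ext_module_def carrier_quotient[OF abelian_group_cocycles coboundaries_subgroup] by simp

lemma ext_zero: "zero (ext_module A P d i) = ext_coboundaries A P d i"
  by (simp add: ext_module_def quotient_module_def)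

lemma ext_class_zero_iff:
  "z \<in> ext_cocycles A P d i \<Longrightarrow> ext_class i z = ext_coboundaries A P d i \<longleftrightarrow> z \<in> ext_coboundaries A P d i"
  using coset_eq_zero_iff[OF abelian_group_cocycles coboundaries_subgroup] by simp

lemma ext_class_eq_iff:
  assumes "z \<in> ext_cocycles A P d i" "y \<in> ext_cocycles A P d i"
  shows "ext_class i z = ext_class i y \<longleftrightarrow>
    (\<lambda>p\<in>carrier (P i). z p \<ominus> y p) \<in> ext_coboundaries A P d i"
proof -
  have "z \<ominus>\<^bsub>cocycle_module i\<^esub> y = (\<lambda>p\<in>carrier (P i). z p \<ominus> y p)"
    unfolding a_minus_def cocycle_a_inv[OF assms(2)] by (simp add: fun_eq_iff)
  then show ?thesis
    using coset_eq_iff[OF abelian_group_cocycles coboundaries_subgroup, of z i y] assms by simp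
qed

lemma ext_class_add:
  assumes "z \<in> ext_cocycles A P d i" "y \<in> ext_cocycles A P d i"
  shows "ext_class i z \<oplus>\<^bsub>ext_module A P d i\<^esub> ext_class i y = ext_class i (\<lambda>p\<in>carrier (P i). z p \<oplus> y p)"
  unfolding ext_module_def
  using quotient_add[OF abelian_group_cocycles coboundaries_subgroup, of z i y] assms by simp

lemma ext_class_smult:
  assumes "z \<in> ext_cocycles A P d i" "a \<in> carrier A"
  shows "a \<odot>\<^bsub>ext_module A P d i\<^esub> ext_class i z = ext_class i (\<lambda>p\<in>carrier (P i). z p \<otimes> a)"
proof -
  have "a \<odot>\<^bsub>quotient_module (cocycle_module i) (ext_coboundaries A P d i)\<^esub> ext_class i z =
    ext_class i (a \<odot>\<^bsub>cocycle_module i\<^esub> z)"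
    by (rule quotient_smult[OF abelian_group_cocycles coboundaries_subgroup])
       (use assms cocycle_smult coboundary_smult in \<open>auto simp: fun_eq_iff l_distr cocycle_closed\<close>)
  then show ?thesis by (simp add: ext_module_def)
qed

lemma ext_vanishes:
  assumes "\<And>z. z \<in> ext_cocycles A P d i \<Longrightarrow> z \<in> ext_coboundaries A P d i"
  shows "carrier (ext_module A P d i) = {\<zero>\<^bsub>ext_module A P d i\<^esub>}"
proof -
  have "ext_class i z = ext_coboundaries A P d i" if "z \<in> ext_cocycles A P d i" for z
    using that assms ext_class_zero_iff by blast
  then show ?thesis unfolding carrier_ext ext_zero using cocycle_zero[of i] by blast
qed

end

section \<open>Algebras presented by homogeneous relations\<close>

lemma ring_of_surjection:
  fixes A :: "('c, 'z) ring_scheme" and \<pi> :: "'a::ring_1 \<Rightarrow> 'c"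
  assumes surj: "carrier A = range \<pi>" and add: "\<And>p q. \<pi> (p + q) = \<pi> p \<oplus>\<^bsub>A\<^esub> \<pi> q"
    and mult: "\<And>p q. \<pi> (p * q) = \<pi> p \<otimes>\<^bsub>A\<^esub> \<pi> q" and one: "\<pi> 1 = \<one>\<^bsub>A\<^esub>" and zero: "\<pi> 0 = \<zero>\<^bsub>A\<^esub>"
  shows "ring A"
proof (rule ringI)
  show "abelian_group A"
  proof (rule abelian_groupI)
    fix x assume "x \<in> carrier A"
    then obtain p where p: "x = \<pi> p" by (auto simp: surj)
    have "\<pi> (- p) \<oplus>\<^bsub>A\<^esub> \<pi> p = \<zero>\<^bsub>A\<^esub>" by (simp add: zero flip: add)
    then show "\<exists>y\<in>carrier A. y \<oplus>\<^bsub>A\<^esub> x = \<zero>\<^bsub>A\<^esub>" by (auto simp: surj p)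
  qed (auto simp: surj algebra_simps simp flip: add zero)
  show "monoid A"
    by (rule monoidI) (auto simp: surj algebra_simps simp flip: mult one)
qed (auto simp: surj algebra_simps simp flip: add mult)

lemma (in abelian_group) minus_eq_zero_iff:
  assumes "x \<in> carrier G" "y \<in> carrier G"
  shows "x \<ominus> y = \<zero> \<longleftrightarrow> x = y"
proof
  have "x = (x \<ominus> y) \<oplus> y" using assms by (simp add: a_minus_def a_assoc l_neg)
  also assume "x \<ominus> y = \<zero>"
  finally show "x = y" using assms by simp
qed (use assms in \<open>simp add: a_minus_def r_neg\<close>)

text \<open>An algebra T/I given by a surjection rather than as a ring of cosets: both
  \<open>presented_algebra\<close> and an algebra isomorphic to one are instances. The last two
  assumptions say that \<open>I\<close> is homogeneous and begins in degree 2.\<close>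

locale presentation =
  fixes A :: "('k::field, 'c) module" (structure) and \<pi> :: "('n::finite list \<Rightarrow>\<^sub>0 'k) \<Rightarrow> 'c"
    and I :: "('n list \<Rightarrow>\<^sub>0 'k) set"
  assumes \<pi>_surj: "carrier A = range \<pi>"
    and \<pi>_add: "\<pi> (p + q) = \<pi> p \<oplus> \<pi> q"
    and \<pi>_mult: "\<pi> (p * q) = \<pi> p \<otimes> \<pi> q"
    and \<pi>_one: "\<pi> 1 = \<one>"
    and \<pi>_smult: "c \<odot> \<pi> p = \<pi> (scalar c * p)"
    and \<pi>_zero_iff: "\<pi> p = \<zero> \<longleftrightarrow> p \<in> I"
    and zero_in_I: "0 \<in> I"
    and component_I: "p \<in> I \<Longrightarrow> component n p \<in> I"
    and component_I_low: "p \<in> I \<Longrightarrow> n < 2 \<Longrightarrow> component n p = 0"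
begin

lemma \<pi>_0: "\<pi> 0 = \<zero>"
  using \<pi>_zero_iff zero_in_I by blast

sublocale ring A
  by (rule ring_of_surjection[OF \<pi>_surj \<pi>_add \<pi>_mult \<pi>_one \<pi>_0])

lemma \<pi>_closed [simp]: "\<pi> p \<in> carrier A"
  by (simp add: \<pi>_surj)

lemma carrier_cases:
  assumes "a \<in> carrier A"
  obtains p where "a = \<pi> p"
  using assms \<pi>_surj by auto

lemma \<pi>_uminus: "\<pi> (- p) = \<ominus> \<pi> p"
proof -
  have "\<pi> (- p) \<oplus> \<pi> p = \<zero>" by (simp add: \<pi>_0 flip: \<pi>_add)
  then show ?thesis using minus_equality by fastforce
qed

lemma \<pi>_diff: "\<pi> (p - q) = \<pi> p \<ominus> \<pi> q"
  using \<pi>_add[of p "- q"] by (simp add: a_minus_def \<pi>_uminus)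

lemma \<pi>_eq_iff: "\<pi> p = \<pi> q \<longleftrightarrow> p - q \<in> I"
proof -
  have "\<pi> p = \<pi> q \<longleftrightarrow> \<pi> p \<ominus> \<pi> q = \<zero>" by (rule minus_eq_zero_iff[symmetric]) simp_all
  then show ?thesis by (simp add: \<pi>_zero_iff flip: \<pi>_diff)
qed

lemma \<pi>_sum: "\<pi> (sum f S) = (\<Oplus>x\<in>S. \<pi> (f x))"
  by (induction S rule: infinite_finite_induct) (auto simp: \<pi>_0 \<pi>_add)

lemma ideal_I: "tensor_ideal I"
proof (rule tensor_idealI)
  fix p q
  show "p \<in> I \<Longrightarrow> q \<in> I \<Longrightarrow> p + q \<in> I" "p \<in> I \<Longrightarrow> q * p \<in> I" "p \<in> I \<Longrightarrow> p * q \<in> I"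
    unfolding \<pi>_zero_iff[symmetric] \<pi>_add \<pi>_mult by simp_all
qed (rule zero_in_I)

lemma scalar_in_I_iff: "scalar c \<in> I \<longleftrightarrow> c = 0"
proof
  assume "scalar c \<in> I"
  then have "component 0 (scalar c) = (0 :: 'n list \<Rightarrow>\<^sub>0 'k)" by (rule component_I_low) simp
  then show "c = 0" by (metis component_0_eq lookup_single_eq lookup_zero)
qed (simp add: zero_in_I)

lemma eq_on_low_components:
  assumes "\<pi> p = \<pi> q" "n < 2"
  shows "component n p = component n q"
  using component_I_low[of "p - q" n] assms by (simp add: \<pi>_eq_iff component_diff)

lemma lookup_Nil_cong: "\<pi> p = \<pi> q \<Longrightarrow> lookup p [] = lookup q []"
  using eq_on_low_components[of p q 0] by (simp add: component_0_eq inj_eq[OF inj_single])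

text \<open>The constant term of any representative; it is well defined because \<open>I\<close> has
  no component in degree 0. It computes \<open>augmentation\<close> without recourse to homogeneous
  decompositions.\<close>

definition eps :: "'c \<Rightarrow> 'k" where
  "eps a = lookup (SOME p. \<pi> p = a) []"

lemma eps_\<pi> [simp]: "eps (\<pi> p) = lookup p []"
  unfolding eps_def by (rule lookup_Nil_cong) (rule someI, rule refl)

lemma eps_add: "a \<in> carrier A \<Longrightarrow> b \<in> carrier A \<Longrightarrow> eps (a \<oplus> b) = eps a + eps b"
  by (auto elim!: carrier_cases simp: lookup_add simp flip: \<pi>_add)

lemma eps_mult: "a \<in> carrier A \<Longrightarrow> b \<in> carrier A \<Longrightarrow> eps (a \<otimes> b) = eps a * eps b"
  by (auto elim!: carrier_cases simp: lookup_Nil_mult simp flip: \<pi>_mult)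

lemma eps_one [simp]: "eps \<one> = 1"
  by (simp add: one_tensor flip: \<pi>_one)

lemma eps_zero [simp]: "eps \<zero> = 0"
  by (simp flip: \<pi>_0)

text \<open>Since \<open>I\<close> is homogeneous, two representatives of the same element have
  congruent components. This gives existence and uniqueness of the decomposition at once.\<close>

lemma homogeneous_components_iff:
  assumes gr: "\<And>n. gr n = \<pi> ` homogeneous n"
  shows "homogeneous_components A gr (\<pi> p) f \<longleftrightarrow> f = (\<lambda>n. \<pi> (component n p))"
proof
  assume f: "homogeneous_components A gr (\<pi> p) f"
  then have "\<forall>n. \<exists>q. q \<in> homogeneous n \<and> f n = \<pi> q"
    unfolding homogeneous_components_def gr by blast
  then obtain q where q: "\<And>n. q n \<in> homogeneous n" "\<And>n. f n = \<pi> (q n)" by metis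
  let ?S = "{n. f n \<noteq> \<zero>}"
  have fin: "finite ?S" and sum: "\<pi> p = (\<Oplus>n\<in>?S. f n)"
    using f by (auto simp: homogeneous_components_def)
  have "\<pi> p = \<pi> (\<Sum>n\<in>?S. q n)" unfolding sum \<pi>_sum q ..
  then have "component m (p - (\<Sum>n\<in>?S. q n)) \<in> I" for m
    by (intro component_I) (simp add: \<pi>_eq_iff)
  then have 1: "\<pi> (component m p) = \<pi> (component m (\<Sum>n\<in>?S. q n))" for m
    by (simp add: \<pi>_eq_iff component_diff)
  have 2: "component m (\<Sum>n\<in>?S. q n) = (if m \<in> ?S then q m else 0)" for m
  proof -
    have "component m (\<Sum>n\<in>?S. q n) = (\<Sum>n\<in>?S. if n = m then q n else 0)"
      unfolding component_sum by (intro sum.cong refl) (auto simp: component_of_homogeneous[OF q(1)])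
    then show ?thesis using fin by simp
  qed
  have "\<pi> (component m p) = f m" for m
    unfolding 1 2 by (cases "m \<in> ?S") (auto simp: q \<pi>_0)
  then show "f = (\<lambda>n. \<pi> (component n p))" by auto
next
  assume f: "f = (\<lambda>n. \<pi> (component n p))"
  let ?S = "{n. f n \<noteq> \<zero>}" and ?N = "max_degree p"
  have sub: "?S \<subseteq> {..?N}"
    by (rule subsetI, rule ccontr) (simp add: f \<pi>_0 component_above_max_degree)
  have "\<pi> p = (\<Oplus>n\<in>{..?N}. f n)"
    unfolding f \<pi>_sum[symmetric] using sum_components[of p ?N] by simp
  also have "\<dots> = (\<Oplus>n\<in>?S. f n)"
    by (rule add.finprod_mono_neutral_cong_left[symmetric]) (use sub in \<open>auto simp: f\<close>)
  finally show "homogeneous_components A gr (\<pi> p) f"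
    unfolding homogeneous_components_def gr
    using finite_subset[OF sub] component_homogeneous by (auto simp: f)
qed

lemma augmentation_eq:
  assumes gr: "\<And>n. gr n = \<pi> ` homogeneous n" and a: "a \<in> carrier A"
  shows "augmentation A gr a = eps a"
proof -
  obtain p where p: "a = \<pi> p" using a by (rule carrier_cases)
  have "\<pi> (component 0 p) = c \<odot> \<one> \<longleftrightarrow> c = lookup p []" for c
  proof -
    have "\<pi> (component 0 p) = c \<odot> \<one> \<longleftrightarrow> scalar (lookup p [] - c) \<in> I"
      unfolding \<pi>_one[symmetric] \<pi>_smult \<pi>_eq_iff by (simp add: component_0_eq single_diff)
    also have "\<dots> \<longleftrightarrow> lookup p [] - c = 0"
      using scalar_in_I_iff .
    finally show ?thesis by auto
  qed
  then show ?thesis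
    unfolding augmentation_def p homogeneous_components_iff[OF gr] by simp
qed

lemma connected_graded:
  assumes gr: "\<And>n. gr n = \<pi> ` homogeneous n"
  shows "connected_graded_algebra A gr"
proof unfold_locales
  fix m n x y
  assume "x \<in> gr m" "y \<in> gr n"
  then show "x \<otimes> y \<in> gr (m + n)"
    by (auto simp: gr simp flip: \<pi>_mult intro!: imageI homogeneous_mult)
next
  fix a assume "a \<in> carrier A"
  then obtain p where "a = \<pi> p" by (rule carrier_cases)
  then show "\<exists>!f. homogeneous_components A gr a f"
    using homogeneous_components_iff[OF gr] by auto
next
  show "gr 0 = range (\<lambda>c. c \<odot> \<one>)"
    unfolding gr \<pi>_one[symmetric] \<pi>_smult
    by (auto simp: homogeneous_single) (metis homogeneous_0_eq_scalar rangeI)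
  have "1 \<notin> I" by (simp add: one_tensor scalar_in_I_iff)
  then show "\<one> \<noteq> \<zero>" using \<pi>_one \<pi>_zero_iff by metis
next
  fix x y n and c d :: 'k
  show "x \<in> gr n \<Longrightarrow> y \<in> gr n \<Longrightarrow> x \<oplus> y \<in> gr n"
    by (auto simp: gr simp flip: \<pi>_add intro!: imageI homogeneous_add)
  show "x \<in> gr n \<Longrightarrow> c \<odot> x \<in> gr n"
    by (auto simp: gr \<pi>_smult intro!: imageI homogeneous_scalar_mult)
  show "\<zero> \<in> gr n" unfolding gr \<pi>_0[symmetric] by (rule imageI) simp
  show "gr n \<subseteq> carrier A" by (auto simp: gr)
  assume "x \<in> carrier A"
  then obtain p where p: "x = \<pi> p" by (rule carrier_cases)
  show "c \<odot> x \<in> carrier A" by (simp add: p \<pi>_smult)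
  show "1 \<odot> x = x" by (simp add: p \<pi>_smult)
  show "(c * d) \<odot> x = c \<odot> (d \<odot> x)"
    unfolding p \<pi>_smult by (simp add: mult.commute[of c] flip: mult.assoc)
  show "(c + d) \<odot> x = c \<odot> x \<oplus> d \<odot> x"
    unfolding p \<pi>_smult \<pi>_add[symmetric] by (simp add: single_add distrib_right)
  assume "y \<in> carrier A"
  then obtain q where q: "y = \<pi> q" by (rule carrier_cases)
  show "c \<odot> (x \<oplus> y) = c \<odot> x \<oplus> c \<odot> y"
    unfolding p q \<pi>_smult \<pi>_add[symmetric] by (simp add: distrib_left)
  show "(c \<odot> x) \<otimes> y = c \<odot> (x \<otimes> y)"
    unfolding p q \<pi>_smult \<pi>_mult[symmetric] by (simp add: mult.assoc)
  show "x \<otimes> (c \<odot> y) = c \<odot> (x \<otimes> y)"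
    unfolding p q \<pi>_smult \<pi>_mult[symmetric] by (simp add: scalar_left_commute)
qed

abbreviation gens :: "'n \<Rightarrow> 'c" where
  "gens l \<equiv> \<pi> (gen l)"

abbreviation row_module :: "('c, 'n \<Rightarrow> 'c) module" where
  "row_module \<equiv> free_module A UNIV"

lemma row_module_cases:
  assumes "c \<in> carrier row_module"
  obtains q where "c = (\<lambda>l. \<pi> (q l))"
proof -
  have "\<forall>l. \<exists>p. c l = \<pi> p" using assms \<pi>_surj by (auto simp: carrier_free_module)
  then show thesis using that by metis
qed

lemma \<pi>_row_module: "(\<lambda>l. \<pi> (q l)) \<in> carrier row_module"
  by (simp add: free_module_finite)

lemma row_sum_gens: "row_sum gens (\<lambda>l. \<pi> (q l)) = \<pi> (\<Sum>l\<in>UNIV. q l * gen l)"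
  unfolding row_sum_def \<pi>_sum \<pi>_mult ..

text \<open>Exactness of A^(s+1) -> A -> K: without a constant term, every word has a last letter to
  split off.\<close>

lemma eps_eq_0_iff:
  assumes "a \<in> carrier A"
  shows "eps a = 0 \<longleftrightarrow> (\<exists>c\<in>carrier row_module. a = row_sum gens c)"
proof
  obtain p where p: "a = \<pi> p" using assms by (rule carrier_cases)
  assume "eps a = 0"
  then have "a = \<pi> (\<Sum>l\<in>UNIV. rquot l p * gen l)"
    unfolding p using split_last[of p] by simp
  then show "\<exists>c\<in>carrier row_module. a = row_sum gens c"
    using row_sum_gens \<pi>_row_module by metis
next
  assume "\<exists>c\<in>carrier row_module. a = row_sum gens c"
  then obtain c where "c \<in> carrier row_module" "a = row_sum gens c" by blast
  then show "eps a = 0"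
    by (auto elim!: row_module_cases simp: row_sum_gens lookup_sum lookup_mult_gen_Nil)
qed

lemma trivial_module_simps:
  "carrier (trivial_module A gr) = UNIV" "zero (trivial_module A gr) = 0"
  "add (trivial_module A gr) = (+)" "smult (trivial_module A gr) = (\<lambda>a c. augmentation A gr a * c)"
  by (simp_all add: trivial_module_def)

lemma left_module_trivial:
  assumes gr: "\<And>n. gr n = \<pi> ` homogeneous n"
  shows "left_module A (trivial_module A gr)"
proof -
  interpret abelian_group "trivial_module A gr"
    by (rule abelian_groupI) (auto simp: trivial_module_simps algebra_simps intro: exI[of _ "- x" for x] add.right_inverse)
  show ?thesis
    by unfold_locales
       (auto simp: trivial_module_simps augmentation_eq[OF gr] eps_add eps_mult algebra_simps)
qed

end

lemma presentation_residue_class: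
  fixes S :: "('n::finite list \<Rightarrow>\<^sub>0 'k::field) set"
  assumes S: "\<And>s. s \<in> S \<Longrightarrow> \<exists>n\<ge>2. s \<in> homogeneous n"
  shows "presentation (presented_algebra S) (residue_class S) (Idl\<^bsub>tensor_algebra\<^esub> S)"
proof -
  let ?I = "Idl\<^bsub>tensor_algebra\<^esub> S"
  note id = tensor_ideal_Idl[of S]
  interpret T: ring tensor_algebra by (rule ring_tensor_algebra)
  interpret I: ideal ?I tensor_algebra by (rule id)
  note grp = T.abelian_group_axioms I.additive_subgroup_axioms
  show ?thesis
  proof
    fix p q :: "'n list \<Rightarrow>\<^sub>0 'k" and c n
    show "carrier (presented_algebra S) = range (residue_class S)"
      by (simp add: presented_algebra_def carrier_quotient[OF grp] residue_class_def[abs_def])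
    show "residue_class S (p + q) = residue_class S p \<oplus>\<^bsub>presented_algebra S\<^esub> residue_class S q"
      using quotient_add[OF grp, of p q] by (simp add: presented_algebra_def residue_class_def)
    show "residue_class S (p * q) = residue_class S p \<otimes>\<^bsub>presented_algebra S\<^esub> residue_class S q"
      using I.rcoset_mult_add[of p q] by (simp add: presented_algebra_def residue_class_def quotient_module_def)
    show "residue_class S 1 = \<one>\<^bsub>presented_algebra S\<^esub>"
      by (simp add: presented_algebra_def residue_class_def quotient_module_def)
    show "c \<odot>\<^bsub>presented_algebra S\<^esub> residue_class S p = residue_class S (scalar c * p)"
      unfolding presented_algebra_def residue_class_def
      using tensor_ideal_left[OF id] by (subst quotient_smult[OF grp]) (auto simp: algebra_simps)
    show "residue_class S p = \<zero>\<^bsub>presented_algebra S\<^esub> \<longleftrightarrow> p \<in> ?I"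
      using coset_eq_zero_iff[OF grp, of p]
      by (simp add: presented_algebra_def residue_class_def quotient_zero[OF grp])
    show "0 \<in> ?I" by (rule tensor_ideal_0[OF id])
    show "component n p \<in> ?I" if "p \<in> ?I"
      using component_Idl[OF _ that] S by blast
    show "component n p = 0" if "p \<in> ?I" "n < 2"
      using component_Idl_low[OF S that] .
  qed
qed

section \<open>Minimal relations\<close>

lemma component_mult_homogeneous_left:
  assumes "p \<in> homogeneous d"
  shows "component n (p * q) = (if d \<le> n then p * component (n - d) q else 0)"
proof -
  have "component n (p * q) = (\<Sum>i\<le>n. if i = d then p * component (n - d) q else 0)"
    unfolding component_mult
    by (intro sum.cong) (auto simp: component_of_homogeneous[OF assms])
  then show ?thesis by simp
qed

context presentation
begin

text \<open>The right quotients of the elements of \<open>R\<close> generate the syzygies of the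
  generators of A. Minimality of a set of relations is measured here instead of on the ideal,
  because this is the statement that minimal resolutions are about.\<close>

definition generates_syzygies :: "('n list \<Rightarrow>\<^sub>0 'k) set \<Rightarrow> bool" where
  "generates_syzygies R \<longleftrightarrow>
     (\<forall>q. (\<Sum>l\<in>UNIV. q l * gen l) \<in> I \<longrightarrow> (\<exists>t. \<forall>l. q l - (\<Sum>s\<in>R. t s * rquot l s) \<in> I))"

lemma generates_syzygiesD:
  assumes "generates_syzygies R" "(\<Sum>l\<in>UNIV. q l * gen l) \<in> I"
  obtains t where "\<And>l. q l - (\<Sum>s\<in>R. t s * rquot l s) \<in> I"
  using assms unfolding generates_syzygies_def by blast

lemma minimal_syzygies_coefficients:
  assumes gen: "generates_syzygies R" and min: "\<And>s. s \<in> R \<Longrightarrow> \<not> generates_syzygies (R - {s})"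
    and "finite R" and hom: "\<And>s. s \<in> R \<Longrightarrow> \<exists>n\<ge>2. s \<in> homogeneous n"
    and t: "\<And>l. (\<Sum>s\<in>R. t s * rquot l s) \<in> I" and r: "r \<in> R"
  shows "lookup (t r) [] = 0"
proof (rule ccontr)
  assume c: "lookup (t r) [] \<noteq> 0"
  define c where "c = lookup (t r) []"
  have "\<forall>s. \<exists>n. s \<in> R \<longrightarrow> n \<ge> 2 \<and> s \<in> homogeneous n" using hom by blast
  then obtain n where n: "\<And>s. s \<in> R \<Longrightarrow> n s \<ge> 2" "\<And>s. s \<in> R \<Longrightarrow> s \<in> homogeneous (n s)" by metis
  \<comment> \<open>The part of \<open>t s\<close> that contributes to the total degree
    \<open>n r - 1\<close>. The guard is for relations of degree above that of \<open>r\<close>,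
    which contribute nothing.\<close>
  define t' where "t' s = (if n s \<le> n r then component (n r - n s) (t s) else 0)" for s
  have t'r: "t' r = scalar c" by (simp add: t'_def c_def component_0_eq)
  have t': "(\<Sum>s\<in>R. t' s * rquot l s) \<in> I" for l
  proof -
    have "component (n r - 1) (t s * rquot l s) = t' s * rquot l s" if s: "s \<in> R" for s
    proof -
      have "n s - 1 \<le> n r - 1 \<longleftrightarrow> n s \<le> n r" "n r - 1 - (n s - 1) = n r - n s"
        using n(1)[OF s] n(1)[OF r] by linarith+
      then show ?thesis
        by (simp add: component_mult_homogeneous_right[OF rquot_homogeneous[OF n(2)[OF s]]] t'_def)
    qed
    then have "component (n r - 1) (\<Sum>s\<in>R. t s * rquot l s) = (\<Sum>s\<in>R. t' s * rquot l s)"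
      by (simp add: component_sum)
    then show ?thesis using component_I[OF t] by metis
  qed
  have sum_split: "(\<Sum>s\<in>R. f s) = f r + (\<Sum>s\<in>R - {r}. f s)" for f :: "('n list \<Rightarrow>\<^sub>0 'k) \<Rightarrow> 'n list \<Rightarrow>\<^sub>0 'k"
    using \<open>finite R\<close> r by (rule sum.remove)
  have "generates_syzygies (R - {r})"
    unfolding generates_syzygies_def
  proof (intro allI impI)
    fix q assume "(\<Sum>l\<in>UNIV. q l * gen l) \<in> I"
    then obtain u where u: "\<And>l. q l - (\<Sum>s\<in>R. u s * rquot l s) \<in> I"
      using generates_syzygiesD[OF gen] by blast
    \<comment> \<open>Subtracting \<open>?w\<close> times the homogeneous relation cancels the
      coefficient of \<open>r\<close>, since there the relation has the scalar
      \<open>c\<close>.\<close>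
    let ?w = "u r * scalar (inverse c)"
    let ?u = "\<lambda>s. u s - ?w * t' s"
    have 1: "q l - (\<Sum>s\<in>R - {r}. ?u s * rquot l s) \<in> I" for l
    proof -
      have "?w * scalar c = u r"
        using c unfolding mult.assoc by (simp add: c_def)
      then have "?w * (\<Sum>s\<in>R. t' s * rquot l s) = u r * rquot l r + (\<Sum>s\<in>R - {r}. ?w * t' s * rquot l s)"
        by (simp only: sum_split t'r distrib_left sum_distrib_left mult.assoc[symmetric])
      then have "q l - (\<Sum>s\<in>R - {r}. ?u s * rquot l s) =
        (q l - (\<Sum>s\<in>R. u s * rquot l s)) + ?w * (\<Sum>s\<in>R. t' s * rquot l s)"
        by (simp add: sum_split left_diff_distrib sum_subtractf)
      then show ?thesis
        using tensor_ideal_add[OF ideal_I u[of l] tensor_ideal_left[OF ideal_I t'[of l], of ?w]] by (simp only:)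
    qed
    show "\<exists>t. \<forall>l. q l - (\<Sum>s\<in>R - {r}. t s * rquot l s) \<in> I"
      by (rule exI[of _ ?u], rule allI, rule 1)
  qed
  then show False using min[OF r] by blast
qed

text \<open>A cyclic module whose generator is annihilated exactly by the augmentation ideal, that
  is, the trivial module with elements in an arbitrary type. It covers \<open>trivial_module\<close>
  as well as its copy in 'm.\<close>

definition trivial_like :: "('c, 'u) module \<Rightarrow> 'u \<Rightarrow> bool" where
  "trivial_like N u \<longleftrightarrow> left_module A N \<and> u \<in> carrier N \<and>
     (\<forall>y\<in>carrier N. \<exists>a\<in>carrier A. y = a \<odot>\<^bsub>N\<^esub> u) \<and>
     (\<forall>a\<in>carrier A. a \<odot>\<^bsub>N\<^esub> u = \<zero>\<^bsub>N\<^esub> \<longleftrightarrow> eps a = 0)"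

lemma trivial_like_trivial:
  assumes gr: "\<And>n. gr n = \<pi> ` homogeneous n"
  shows "trivial_like (trivial_module A gr) 1"
proof -
  have "\<exists>a\<in>carrier A. c = a \<odot>\<^bsub>trivial_module A gr\<^esub> 1" for c
    by (rule bexI[of _ "\<pi> (scalar c)"]) (simp_all add: trivial_module_simps augmentation_eq[OF gr])
  then show ?thesis
    unfolding trivial_like_def
    by (simp add: left_module_trivial[OF gr] trivial_module_simps augmentation_eq[OF gr])
qed

lemma resolution_complex:
  assumes res: "projective_resolution A N P d e" and N: "left_module A N"
  shows "module_complex A P d"
proof (intro module_complex.intro module_complex_axioms.intro)
  show "ring A" by (rule ring_axioms)
  fix i p
  have proj: "projective_module A (P i)" and d: "module_map A (P (Suc i)) (P i) (d i)" for i
    using res by (simp_all add: projective_resolution_def module_homs_iff)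
  show "left_module A (P i)" using proj projective_left_module by blast
  show "module_map A (P (Suc i)) (P i) (d i)" by (rule d)
  assume p: "p \<in> carrier (P (Suc (Suc i)))"
  have "d (Suc i) ` carrier (P (Suc (Suc i))) = a_kernel (P (Suc i)) (P i) (d i)"
    using res by (simp add: projective_resolution_def)
  then have "d (Suc i) p \<in> a_kernel (P (Suc i)) (P i) (d i)" using p by blast
  then show "d i (d (Suc i) p) = \<zero>\<^bsub>P i\<^esub>" by (simp add: a_kernel_iff)
qed

lemma trivial_comparison:
  assumes res: "projective_resolution A N P d e" and N: "trivial_like N u"
  obtains \<phi>1 \<psi>1 h1 k1 where
    "module_map A row_module (P 1) \<phi>1" "module_map A (P 1) row_module \<psi>1"
    "module_map A row_module row_module h1" "module_map A (P 1) (P 2) k1"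
    "\<And>c. c \<in> carrier row_module \<Longrightarrow> row_sum gens c = \<zero> \<Longrightarrow> d 0 (\<phi>1 c) = \<zero>\<^bsub>P 0\<^esub>"
    "\<And>q. q \<in> carrier (P 1) \<Longrightarrow> d 0 q = \<zero>\<^bsub>P 0\<^esub> \<Longrightarrow> row_sum gens (\<psi>1 q) = \<zero>"
    "\<And>c. c \<in> carrier row_module \<Longrightarrow> row_sum gens (h1 c) = \<zero>"
    "\<And>c. c \<in> carrier row_module \<Longrightarrow> row_sum gens c = \<zero> \<Longrightarrow> \<psi>1 (\<phi>1 c) = c \<oplus>\<^bsub>row_module\<^esub> h1 c"
    "\<And>q. q \<in> carrier (P 1) \<Longrightarrow> d 0 q = \<zero>\<^bsub>P 0\<^esub> \<Longrightarrow> \<phi>1 (\<psi>1 q) = q \<oplus>\<^bsub>P 1\<^esub> d 1 (k1 q)"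
proof (rule resolution_comparison[of "P 0" "P 1" "P 2" N "d 0" "d 1" e gens u])
  have proj: "projective_module A (P i)" and d: "module_map A (P (Suc i)) (P i) (d i)" for i
    using res by (simp_all add: projective_resolution_def module_homs_iff)
  show "projective_module A (P 0)" "projective_module A (P 1)" by (rule proj)+
  show "left_module A (P 2)" using proj projective_left_module by blast
  show "module_map A (P 1) (P 0) (d 0)" "module_map A (P 2) (P 1) (d 1)"
    using d[of 0] d[of 1] by (simp_all add: numeral_2_eq_2)
  show "left_module A N" "u \<in> carrier N" "\<And>y. y \<in> carrier N \<Longrightarrow> \<exists>a\<in>carrier A. y = a \<odot>\<^bsub>N\<^esub> u"
    using N by (auto simp: trivial_like_def)
  show "module_map A (P 0) N e" "e ` carrier (P 0) = carrier N" "d 0 ` carrier (P 1) = a_kernel (P 0) N e"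
    using res by (simp_all add: projective_resolution_def module_homs_iff)
  have "d (Suc 0) ` carrier (P (Suc (Suc 0))) = a_kernel (P (Suc 0)) (P 0) (d 0)"
    using res unfolding projective_resolution_def by blast
  then show "d 1 ` carrier (P 2) = a_kernel (P 1) (P 0) (d 0)" by (simp add: numeral_2_eq_2)
  show "a \<odot>\<^bsub>N\<^esub> u = \<zero>\<^bsub>N\<^esub> \<longleftrightarrow> (\<exists>c\<in>carrier row_module. a = row_sum gens c)" if "a \<in> carrier A" for a
    using N eps_eq_0_iff[OF that] that by (simp add: trivial_like_def)
qed (use that in simp_all)

text \<open>The elements without terms of degree below \<open>n\<close>; as A is generated in degree
  1, this is the n-th power of the augmentation ideal. Its intersection is 0, which replaces
  Nakayama's lemma for maps that respect no grading.\<close>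

definition filtration :: "nat \<Rightarrow> 'c set" where
  "filtration n = \<pi> ` {p. \<forall>i<n. component i p = 0}"

lemma filtration_0: "a \<in> carrier A \<Longrightarrow> a \<in> filtration 0"
  by (auto simp: filtration_def \<pi>_surj)

lemma filtration_mult_1:
  assumes a: "a \<in> filtration n" and b: "b \<in> carrier A" "eps b = 0"
  shows "a \<otimes> b \<in> filtration (Suc n)"
proof -
  obtain p where p: "a = \<pi> p" "\<forall>i<n. component i p = 0" using a by (auto simp: filtration_def)
  obtain q where q: "b = \<pi> q" using b by (elim carrier_cases)
  have "component 0 q = 0" using b q by (simp add: component_0_eq)
  then have "component i (p * q) = 0" if "i < Suc n" for i
    unfolding component_mult using p that by (intro sum.neutral) (metis atMost_iff diff_is_0_eq
        le_neq_implies_less less_Suc_eq_le mult_zero_left mult_zero_right order_less_le_trans)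
  then show ?thesis by (auto simp: filtration_def p q simp flip: \<pi>_mult)
qed

lemma filtration_add:
  assumes "a \<in> filtration n" "b \<in> filtration n"
  shows "a \<oplus> b \<in> filtration n"
proof -
  obtain p q where "a = \<pi> p" "\<forall>i<n. component i p = 0" "b = \<pi> q" "\<forall>i<n. component i q = 0"
    using assms by (auto simp: filtration_def)
  then show ?thesis
    by (auto simp: filtration_def component_add simp flip: \<pi>_add intro!: imageI)
qed

lemma filtration_zero: "\<zero> \<in> filtration n"
  unfolding \<pi>_0[symmetric] filtration_def by (rule imageI) simp

lemma filtration_finsum:
  "(\<And>x. x \<in> X \<Longrightarrow> f x \<in> filtration n) \<Longrightarrow> finsum A f X \<in> filtration n"
proof (induction X rule: infinite_finite_induct)
  case (insert x X)
  have "f y \<in> carrier A" if "y \<in> insert x X" for y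
    using insert.prems[OF that] by (auto simp: filtration_def)
  then show ?case
    using insert by (subst finsum_insert) (auto intro!: filtration_add)
qed (auto simp: filtration_zero)

text \<open>Compared with a representative of order above \<open>n\<close>, the component of degree
  \<open>n\<close> lies in \<open>I\<close>; and \<open>I\<close> contains what it contains
  componentwise.\<close>

lemma filtration_inter:
  assumes "a \<in> carrier A" "\<And>n. a \<in> filtration n"
  shows "a = \<zero>"
proof -
  obtain p where p: "a = \<pi> p" using assms by (elim carrier_cases)
  have "component n p \<in> I" for n
  proof -
    obtain q where q: "a = \<pi> q" "\<forall>i<Suc n. component i q = 0"
      using assms(2)[of "Suc n"] by (auto simp: filtration_def)
    then show ?thesis
      using component_I[of "p - q" n] p by (simp add: \<pi>_eq_iff component_diff)
  qed
  then show ?thesis unfolding p \<pi>_zero_iff by (rule tensor_ideal_components[OF ideal_I])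
qed

end

locale minimal_presentation = presentation A \<pi> I
  for A :: "('k::field, 'c) module" (structure) and \<pi> :: "('n::finite list \<Rightarrow>\<^sub>0 'k) \<Rightarrow> 'c"
    and I :: "('n list \<Rightarrow>\<^sub>0 'k) set" +
  fixes R :: "('n list \<Rightarrow>\<^sub>0 'k) set"
  assumes finite_R: "finite R" and R_I: "R \<subseteq> I"
    and hom: "s \<in> R \<Longrightarrow> \<exists>n\<ge>2. s \<in> homogeneous n"
    and gen: "generates_syzygies R"
    and min: "s \<in> R \<Longrightarrow> \<not> generates_syzygies (R - {s})"
begin

abbreviation rel_module :: "('c, ('n list \<Rightarrow>\<^sub>0 'k) \<Rightarrow> 'c) module" where
  "rel_module \<equiv> free_module A R"

text \<open>The differential A^m -> A^(s+1) of the complex of generators and relations; its matrix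
  consists of the right quotients of the relations.\<close>

definition rel_map :: "(('n list \<Rightarrow>\<^sub>0 'k) \<Rightarrow> 'c) \<Rightarrow> 'n \<Rightarrow> 'c" where
  "rel_map F = (\<lambda>l. \<Oplus>s\<in>R. F s \<otimes> \<pi> (rquot l s))"

lemma rel_module_cases:
  assumes "F \<in> carrier rel_module"
  obtains t where "F = (\<lambda>s. \<pi> (t s))" "\<And>s. s \<notin> R \<Longrightarrow> t s = 0"
proof -
  have "\<forall>s. \<exists>p. F s = \<pi> p \<and> (s \<notin> R \<longrightarrow> p = 0)"
    using assms \<pi>_surj \<pi>_0 unfolding free_module_finite[OF finite_R] by (metis rangeE)
  then show thesis using that by metis
qed

lemma rel_map_\<pi>: "rel_map (\<lambda>s. \<pi> (t s)) = (\<lambda>l. \<pi> (\<Sum>s\<in>R. t s * rquot l s))"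
  by (simp add: rel_map_def \<pi>_sum \<pi>_mult)

lemma rel_map_module_map: "module_map A rel_module row_module rel_map"
proof (rule module_mapI)
  fix F assume "F \<in> carrier rel_module"
  then obtain t where t: "F = (\<lambda>s. \<pi> (t s))" by (rule rel_module_cases)
  show "rel_map F \<in> carrier row_module" unfolding t rel_map_\<pi> by (rule \<pi>_row_module)
  { fix G assume "G \<in> carrier rel_module"
    then obtain u where u: "G = (\<lambda>s. \<pi> (u s))" by (rule rel_module_cases)
    show "rel_map (F \<oplus>\<^bsub>rel_module\<^esub> G) = rel_map F \<oplus>\<^bsub>row_module\<^esub> rel_map G"
      unfolding t u free_module_simps \<pi>_add[symmetric] rel_map_\<pi>
      by (simp add: distrib_right sum.distrib) }
  fix a assume "a \<in> carrier A"
  then obtain p where p: "a = \<pi> p" by (rule carrier_cases)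
  show "rel_map (a \<odot>\<^bsub>rel_module\<^esub> F) = a \<odot>\<^bsub>row_module\<^esub> rel_map F"
    unfolding t p free_module_simps \<pi>_mult[symmetric] rel_map_\<pi>
    by (simp add: sum_distrib_left mult.assoc)
qed

lemma rel_map_unit_vector: "s \<in> R \<Longrightarrow> rel_map (unit_vector A s) = (\<lambda>l. \<pi> (rquot l s))"
proof -
  assume s: "s \<in> R"
  have "unit_vector A s = (\<lambda>r. \<pi> (if r = s then 1 else 0))"
    by (auto simp: unit_vector_def \<pi>_one \<pi>_0)
  then show ?thesis
    using s finite_R by (simp add: rel_map_\<pi> if_distrib[of "\<lambda>x. x * _"] cong: if_cong)
qed

lemma relation_split: "s \<in> R \<Longrightarrow> (\<Sum>l\<in>UNIV. rquot l s * gen l) = s"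
proof -
  assume "s \<in> R"
  then obtain n where "n \<ge> 2" "s \<in> homogeneous n" using hom by blast
  then have "lookup s [] = 0" using lookup_homogeneous[of s n "[]"] by auto
  then show ?thesis using split_last[of s] by simp
qed

lemma row_sum_rel_map:
  assumes "F \<in> carrier rel_module"
  shows "row_sum gens (rel_map F) = \<zero>"
proof -
  obtain t where t: "F = (\<lambda>s. \<pi> (t s))" using assms by (rule rel_module_cases)
  have "(\<Sum>l\<in>UNIV. (\<Sum>s\<in>R. t s * rquot l s) * gen l) = (\<Sum>s\<in>R. t s * (\<Sum>l\<in>UNIV. rquot l s * gen l))"
    by (simp add: sum_distrib_left sum_distrib_right mult.assoc sum.swap[of _ R])
  also have "\<dots> = (\<Sum>s\<in>R. t s * s)" by (simp add: relation_split)
  also have "\<dots> \<in> I" using R_I by (intro tensor_ideal_sum[OF ideal_I] tensor_ideal_left[OF ideal_I]) auto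
  finally show ?thesis unfolding t rel_map_\<pi> row_sum_gens \<pi>_zero_iff .
qed

lemma rel_map_surj:
  assumes c: "c \<in> carrier row_module" and "row_sum gens c = \<zero>"
  shows "c \<in> rel_map ` carrier rel_module"
proof -
  obtain q where q: "c = (\<lambda>l. \<pi> (q l))" using c by (rule row_module_cases)
  have "(\<Sum>l\<in>UNIV. q l * gen l) \<in> I"
    using assms(2) unfolding q row_sum_gens \<pi>_zero_iff .
  then obtain t where t: "\<And>l. q l - (\<Sum>s\<in>R. t s * rquot l s) \<in> I"
    using generates_syzygiesD[OF gen] by blast
  let ?F = "\<lambda>s. \<pi> (if s \<in> R then t s else 0)"
  have "rel_map ?F = c"
    unfolding rel_map_\<pi> q by (simp add: \<pi>_eq_iff fun_eq_iff tensor_ideal_diff_sym[OF ideal_I t])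
  moreover have "?F \<in> carrier rel_module" by (simp add: free_module_finite[OF finite_R] \<pi>_0)
  ultimately show ?thesis by blast
qed

text \<open>Minimality of \<open>R\<close> read as a condition on the kernel: all coordinates lie in
  the augmentation ideal.\<close>

lemma rel_map_kernel_eps:
  assumes "F \<in> carrier rel_module" "rel_map F = \<zero>\<^bsub>row_module\<^esub>"
  shows "eps (F s) = 0"
proof -
  obtain t where t: "F = (\<lambda>s. \<pi> (t s))" "\<And>s. s \<notin> R \<Longrightarrow> t s = 0"
    using assms(1) by (rule rel_module_cases) blast
  have "(\<Sum>s\<in>R. t s * rquot l s) \<in> I" for l
    using assms(2) unfolding t rel_map_\<pi> by (simp add: fun_eq_iff \<pi>_zero_iff)
  then have "s \<in> R \<Longrightarrow> lookup (t s) [] = 0"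
    using minimal_syzygies_coefficients[of R t s] gen min finite_R hom by blast
  then show ?thesis using t by (cases "s \<in> R") auto
qed

text \<open>
  If the trivial module has a projective resolution of length \<open>2\<close>, then the module of syzygies is
  projective, so \<open>rel_map\<close> splits and its kernel \<open>L\<close> is a direct summand. Minimality gives
  \<open>L \<subseteq> A\<^sub>+\<^sup>m\<close>; applying the projection onto \<open>L\<close> yields \<open>L = A\<^sub>+ L\<close>, hence \<open>L = 0\<close>.
\<close>

lemma rel_map_injective:
  assumes res: "projective_resolution A N P d e" and N: "trivial_like N u"
    and P3: "carrier (P 3) = {\<zero>\<^bsub>P 3\<^esub>}"
    and F: "F \<in> carrier rel_module" "rel_map F = \<zero>\<^bsub>row_module\<^esub>"
  shows "F = \<zero>\<^bsub>rel_module\<^esub>"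
proof -
  note FM = left_module_free[of R] and RM = left_module_free[of "UNIV :: 'n set"]
  interpret FM: left_module A rel_module by (rule FM)
  interpret RM: left_module A row_module by (rule RM)
  interpret C: module_complex A P d
    by (rule resolution_complex[OF res]) (use N in \<open>simp add: trivial_like_def\<close>)
  obtain \<phi>1 \<psi>1 h1 k1 where
    \<phi>1: "module_map A row_module (P 1) \<phi>1" and \<psi>1: "module_map A (P 1) row_module \<psi>1" and
    h1: "module_map A row_module row_module h1" and
    \<phi>1_ker: "\<And>c. c \<in> carrier row_module \<Longrightarrow> row_sum gens c = \<zero> \<Longrightarrow> d 0 (\<phi>1 c) = \<zero>\<^bsub>P 0\<^esub>" and
    \<psi>1_ker: "\<And>q. q \<in> carrier (P 1) \<Longrightarrow> d 0 q = \<zero>\<^bsub>P 0\<^esub> \<Longrightarrow> row_sum gens (\<psi>1 q) = \<zero>" and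
    h1_ker: "\<And>c. c \<in> carrier row_module \<Longrightarrow> row_sum gens (h1 c) = \<zero>" and
    \<psi>\<phi>: "\<And>c. c \<in> carrier row_module \<Longrightarrow> row_sum gens c = \<zero> \<Longrightarrow> \<psi>1 (\<phi>1 c) = c \<oplus>\<^bsub>row_module\<^esub> h1 c"
    by (rule trivial_comparison[OF res N]) blast
  have d1: "module_map A (P 2) (P 1) (d 1)" using C.d[of 1] by (simp add: numeral_2_eq_2)
  have d01: "d 0 (d 1 p) = \<zero>\<^bsub>P 0\<^esub>" if "p \<in> carrier (P 2)" for p
    using C.d_d[of p 0] that by (simp add: numeral_2_eq_2)
  have ex: "d (Suc i) ` carrier (P (Suc (Suc i))) = a_kernel (P (Suc i)) (P i) (d i)" for i
    using res by (simp add: projective_resolution_def)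
  have ex1: "d 1 ` carrier (P 2) = a_kernel (P 1) (P 0) (d 0)"
    using ex[of 0] by (simp add: numeral_2_eq_2)
  \<comment> \<open>The term in degree 3 is zero, so by exactness \<open>d 1\<close> is injective.
    The bound on the projective dimension is used here only.\<close>
  have d1_inj: "p = \<zero>\<^bsub>P 2\<^esub>" if "p \<in> carrier (P 2)" "d 1 p = \<zero>\<^bsub>P 1\<^esub>" for p
  proof -
    have "p \<in> d 2 ` carrier (P 3)"
      using ex[of 1] that by (simp add: a_kernel_iff numeral_2_eq_2 numeral_3_eq_3)
    moreover have "module_map A (P 3) (P 2) (d 2)"
      using C.d[of 2] by (simp add: numeral_2_eq_2 numeral_3_eq_3)
    ultimately show ?thesis
      using module_map_zero[OF _ C.P C.P] by (auto simp: P3)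
  qed
  have "d 0 (\<phi>1 (rel_map (unit_vector A s))) = \<zero>\<^bsub>P 0\<^esub>" if "s \<in> R" for s
    by (intro \<phi>1_ker module_map_closed[OF rel_map_module_map] row_sum_rel_map unit_vector_closed that)
  then have im: "\<phi>1 (rel_map (unit_vector A s)) \<in> d 1 ` carrier (P 2)" if "s \<in> R" for s
    unfolding ex1 a_kernel_iff using that
      module_map_closed[OF \<phi>1 module_map_closed[OF rel_map_module_map unit_vector_closed[OF that]]] by simp
  obtain \<theta> where \<theta>: "module_map A rel_module (P 2) \<theta>"
    "\<And>F. F \<in> carrier rel_module \<Longrightarrow> d 1 (\<theta> F) = \<phi>1 (rel_map F)"
    using free_module_lift[OF module_map_comp[OF rel_map_module_map \<phi>1] d1 C.P C.P] im by blast
  have "(\<lambda>p. \<psi>1 (d 1 p)) ` carrier (P 2) \<subseteq> rel_map ` carrier rel_module"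
    using rel_map_surj module_map_closed[OF \<psi>1] module_map_closed[OF d1] \<psi>1_ker d01 by blast
  moreover have "projective_module A (P 2)" using res by (simp add: projective_resolution_def)
  ultimately obtain \<psi>2 where \<psi>2: "module_map A (P 2) rel_module \<psi>2"
    "\<And>p. p \<in> carrier (P 2) \<Longrightarrow> rel_map (\<psi>2 p) = \<psi>1 (d 1 p)"
    using projective_lift[OF _ module_map_comp[OF d1 \<psi>1] rel_map_module_map FM RM] by blast
  have "h1 (unit_vector A l) \<in> rel_map ` carrier rel_module" for l
    by (intro rel_map_surj module_map_closed[OF h1] h1_ker unit_vector_closed) auto
  then obtain h1' where h1': "module_map A row_module rel_module h1'"
    "\<And>c. c \<in> carrier row_module \<Longrightarrow> rel_map (h1' c) = h1 c"
    using free_module_lift[OF h1 rel_map_module_map FM RM] by blast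
  \<comment> \<open>The round trip A^m -> P2 -> A^m corrected by the lifted homotopy: it leaves
    \<open>rel_map\<close> unchanged, and it kills the kernel of \<open>rel_map\<close> because
    injectivity of \<open>d 1\<close> forces \<open>\<theta> F\<close> to be zero there.\<close>
  define \<tau> where "\<tau> F = \<psi>2 (\<theta> F) \<ominus>\<^bsub>rel_module\<^esub> h1' (rel_map F)" for F
  have \<tau>: "module_map A rel_module rel_module \<tau>"
    unfolding \<tau>_def
    by (intro module_map_minus_map module_map_comp[OF \<theta>(1) \<psi>2(1)] module_map_comp[OF rel_map_module_map h1'(1)] FM)
  have rel_\<tau>: "rel_map (\<tau> F) = rel_map F" if F: "F \<in> carrier rel_module" for F
  proof -
    note K = module_map_closed[OF rel_map_module_map F]
    note T = module_map_closed[OF \<theta>(1) F]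
    have "rel_map (\<tau> F) = \<psi>1 (d 1 (\<theta> F)) \<ominus>\<^bsub>row_module\<^esub> h1 (rel_map F)"
      unfolding \<tau>_def
      by (subst module_map_minus[OF rel_map_module_map FM RM])
         (simp_all only: module_map_closed[OF \<psi>2(1) T] module_map_closed[OF h1'(1) K] \<psi>2(2)[OF T] h1'(2)[OF K])
    also have "\<dots> = (rel_map F \<oplus>\<^bsub>row_module\<^esub> h1 (rel_map F)) \<ominus>\<^bsub>row_module\<^esub> h1 (rel_map F)"
      by (simp only: \<theta>(2)[OF F] \<psi>\<phi>[OF K row_sum_rel_map[OF F]])
    also have "\<dots> = rel_map F"
      using K module_map_closed[OF h1 K] by (simp only: a_minus_def RM.M.a_assoc RM.M.r_neg RM.M.r_zero RM.M.a_inv_closed)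
    finally show ?thesis .
  qed
  have \<tau>_ker: "\<tau> F = \<zero>\<^bsub>rel_module\<^esub>" if F: "F \<in> carrier rel_module" "rel_map F = \<zero>\<^bsub>row_module\<^esub>" for F
  proof -
    have "d 1 (\<theta> F) = \<zero>\<^bsub>P 1\<^esub>"
      by (simp only: \<theta>(2)[OF F(1)] F(2) module_map_zero[OF \<phi>1 RM C.P])
    then have "\<theta> F = \<zero>\<^bsub>P 2\<^esub>" using d1_inj module_map_closed[OF \<theta>(1) F(1)] by blast
    then show ?thesis
      unfolding \<tau>_def F(2)
      by (simp only: module_map_zero[OF \<psi>2(1) C.P FM] module_map_zero[OF h1'(1) RM FM] a_minus_def
          FM.M.a_inv_zero FM.M.r_zero FM.M.zero_closed)
  qed
  \<comment> \<open>The identity minus \<open>\<tau>\<close> is a projection onto the kernel of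
    \<open>rel_map\<close>.\<close>
  define \<rho> where "\<rho> F = F \<ominus>\<^bsub>rel_module\<^esub> \<tau> F" for F
  have \<rho>: "module_map A rel_module rel_module \<rho>"
    unfolding \<rho>_def by (intro module_map_minus_map module_map_id \<tau> FM)
  have rel_\<rho>: "rel_map (\<rho> F) = \<zero>\<^bsub>row_module\<^esub>" if F: "F \<in> carrier rel_module" for F
  proof -
    have "rel_map (\<rho> F) = rel_map F \<ominus>\<^bsub>row_module\<^esub> rel_map F"
      unfolding \<rho>_def
      by (subst module_map_minus[OF rel_map_module_map FM RM F module_map_closed[OF \<tau> F]]) (simp only: rel_\<tau>[OF F])
    then show ?thesis
      using RM.M.minus_eq_zero_iff module_map_closed[OF rel_map_module_map F] by metis
  qed
  have \<rho>_id: "\<rho> F = F" if F: "F \<in> carrier rel_module" "rel_map F = \<zero>\<^bsub>row_module\<^esub>" for F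
    unfolding \<rho>_def \<tau>_ker[OF F] a_minus_def using F by (simp only: FM.M.a_inv_zero FM.M.r_zero)
  \<comment> \<open>By linearity an element of the kernel, being fixed by \<open>\<rho>\<close>, is
    a combination of the images of the unit vectors, whose coordinates have constant term 0.\<close>
  have expand: "\<rho> F r = (\<Oplus>s\<in>R. F s \<otimes> \<rho> (unit_vector A s) r)" if F: "F \<in> carrier rel_module" for F r
  proof -
    have reg: "left_module A (regular_module A)" by (rule C.regular)
    have cl: "\<rho> F r \<in> carrier A" if "F \<in> carrier rel_module" for F
      using module_map_closed[OF \<rho> that] by (simp add: carrier_free_module)
    have g: "\<And>s. s \<in> R \<Longrightarrow> \<rho> (unit_vector A s) r \<in> carrier (regular_module A)"
      using cl[OF unit_vector_closed] by (simp only: regular_module_simps)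
    have ev: "module_map A rel_module (regular_module A) (\<lambda>F. F r)"
      by (rule module_mapI) (auto simp: carrier_free_module)
    have "\<rho> F r = free_ext (regular_module A) (\<lambda>s. \<rho> (unit_vector A s) r) F"
    proof (rule free_module_maps_eq[OF module_map_comp[OF \<rho> ev] free_ext_module_map[OF reg] reg _ F])
      fix s assume s: "s \<in> R"
      show "\<rho> (unit_vector A s) r \<in> carrier (regular_module A)" by (rule g[OF s])
      show "\<rho> (unit_vector A s) r = free_ext (regular_module A) (\<lambda>s. \<rho> (unit_vector A s) r) (unit_vector A s)"
        by (rule free_ext_unit_vector[OF reg _ s, symmetric]) (rule g)
    qed
    also have "\<dots> = finsum (regular_module A) (\<lambda>s. F s \<odot>\<^bsub>regular_module A\<^esub> \<rho> (unit_vector A s) r) R"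
      by (rule free_ext_superset[OF reg _ F finite_R]) (use g F in \<open>auto simp: carrier_free_module\<close>)
    also have "\<dots> = (\<Oplus>s\<in>R. F s \<otimes> \<rho> (unit_vector A s) r)"
      by (simp add: finsum_def finprod_def regular_module_def)
    finally show ?thesis .
  qed
  \<comment> \<open>Each use of this expansion multiplies by elements of the augmentation ideal and
    so raises the order of all coordinates by one.\<close>
  have fil: "\<forall>F. F \<in> carrier rel_module \<longrightarrow> rel_map F = \<zero>\<^bsub>row_module\<^esub> \<longrightarrow> (\<forall>r. F r \<in> filtration n)" for n
  proof (induction n)
    case 0
    show ?case using filtration_0 by (simp add: carrier_free_module)
  next
    case (Suc n)
    show ?case
    proof (intro allI impI)
      fix F r assume F: "F \<in> carrier rel_module" "rel_map F = \<zero>\<^bsub>row_module\<^esub>"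
      have "F r = (\<Oplus>s\<in>R. F s \<otimes> \<rho> (unit_vector A s) r)"
        using expand[OF F(1), of r] \<rho>_id[OF F] by simp
      also have "\<dots> \<in> filtration (Suc n)"
      proof (rule filtration_finsum)
        fix s assume s: "s \<in> R"
        note us = unit_vector_closed[OF s]
        have "F s \<in> filtration n" using Suc F by blast
        moreover have "\<rho> (unit_vector A s) r \<in> carrier A"
          using module_map_closed[OF \<rho> us] by (simp add: carrier_free_module)
        moreover have "eps (\<rho> (unit_vector A s) r) = 0"
          by (rule rel_map_kernel_eps[OF module_map_closed[OF \<rho> us] rel_\<rho>[OF us]])
        ultimately show "F s \<otimes> \<rho> (unit_vector A s) r \<in> filtration (Suc n)" by (rule filtration_mult_1)
      qed
      finally show "F r \<in> filtration (Suc n)" .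
    qed
  qed
  have "F r = \<zero>" for r
  proof (rule filtration_inter)
    show "F r \<in> carrier A" using F(1) by (simp add: carrier_free_module)
    show "F r \<in> filtration n" for n using fil[of n] F by blast
  qed
  then show ?thesis by auto
qed

end

section \<open>Consequences of the Gorenstein property\<close>

lemma (in abelian_group) diff_add_cancel_right:
  assumes "x \<in> carrier G" "y \<in> carrier G"
  shows "(x \<oplus> y) \<ominus> y = x"
  using assms by (simp add: a_minus_def a_assoc r_neg)

context minimal_presentation
begin

text \<open>One half of the independence of Ext^2 from the resolution. Functionals on A^m pull back
  along the comparison map \<open>\<omega>\<close> to cocycles; if the pullback of \<open>g\<close>
  is a coboundary, then \<open>g\<close> factors through \<open>rel_map\<close>, and its values on
  the basis have the form in the conclusion.\<close>

lemma ext2_detection: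
  assumes inj: "\<forall>F\<in>carrier rel_module. rel_map F = \<zero>\<^bsub>row_module\<^esub> \<longrightarrow> F = \<zero>\<^bsub>rel_module\<^esub>"
    and res: "projective_resolution A N P d e" and N: "trivial_like N u"
  obtains \<omega> where "module_map A (P 2) rel_module \<omega>"
    "\<And>p. p \<in> carrier (P 3) \<Longrightarrow> \<omega> (d 2 p) = \<zero>\<^bsub>rel_module\<^esub>"
    "\<forall>g g'. module_map A rel_module (regular_module A) g \<longrightarrow> module_map A (P 1) (regular_module A) g' \<longrightarrow>
      (\<forall>p\<in>carrier (P 2). g (\<omega> p) = g' (d 1 p)) \<longrightarrow>
      (\<exists>v. \<forall>s\<in>R. g (unit_vector A s) = \<pi> (\<Sum>l\<in>UNIV. rquot l s * v l))"
proof -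
  note FM = left_module_free[of R] and RM = left_module_free[of "UNIV :: 'n set"]
  interpret FM: left_module A rel_module by (rule FM)
  interpret RM: left_module A row_module by (rule RM)
  interpret C: module_complex A P d
    by (rule resolution_complex[OF res]) (use N in \<open>simp add: trivial_like_def\<close>)
  note reg = C.regular
  interpret reg: left_module A "regular_module A" by (rule reg)
  obtain \<phi>1 \<psi>1 h1 k1 where
    \<phi>1: "module_map A row_module (P 1) \<phi>1" and \<psi>1: "module_map A (P 1) row_module \<psi>1" and
    h1: "module_map A row_module row_module h1" and
    \<phi>1_ker: "\<And>c. c \<in> carrier row_module \<Longrightarrow> row_sum gens c = \<zero> \<Longrightarrow> d 0 (\<phi>1 c) = \<zero>\<^bsub>P 0\<^esub>" and
    \<psi>1_ker: "\<And>q. q \<in> carrier (P 1) \<Longrightarrow> d 0 q = \<zero>\<^bsub>P 0\<^esub> \<Longrightarrow> row_sum gens (\<psi>1 q) = \<zero>" and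
    h1_ker: "\<And>c. c \<in> carrier row_module \<Longrightarrow> row_sum gens (h1 c) = \<zero>" and
    \<psi>\<phi>: "\<And>c. c \<in> carrier row_module \<Longrightarrow> row_sum gens c = \<zero> \<Longrightarrow> \<psi>1 (\<phi>1 c) = c \<oplus>\<^bsub>row_module\<^esub> h1 c"
    by (rule trivial_comparison[OF res N]) blast
  have d1: "module_map A (P 2) (P 1) (d 1)" using C.d[of 1] by (simp add: numeral_2_eq_2)
  have d2: "module_map A (P 3) (P 2) (d 2)" using C.d[of 2] by (simp add: numeral_2_eq_2 numeral_3_eq_3)
  have d01: "d 0 (d 1 p) = \<zero>\<^bsub>P 0\<^esub>" if "p \<in> carrier (P 2)" for p
    using C.d_d[of p 0] that by (simp add: numeral_2_eq_2)
  have d12: "d 1 (d 2 p) = \<zero>\<^bsub>P 1\<^esub>" if "p \<in> carrier (P 3)" for p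
    using C.d_d[of p 1] that by (simp add: numeral_2_eq_2 numeral_3_eq_3)
  have "d (Suc 0) ` carrier (P (Suc (Suc 0))) = a_kernel (P (Suc 0)) (P 0) (d 0)"
    using res unfolding projective_resolution_def by blast
  then have ex1: "d 1 ` carrier (P 2) = a_kernel (P 1) (P 0) (d 0)"
    by (simp add: numeral_2_eq_2)
  have "(\<lambda>p. \<psi>1 (d 1 p)) ` carrier (P 2) \<subseteq> rel_map ` carrier rel_module"
    using rel_map_surj module_map_closed[OF \<psi>1] module_map_closed[OF d1] \<psi>1_ker d01 by blast
  moreover have "projective_module A (P 2)" using res by (simp add: projective_resolution_def)
  ultimately obtain \<omega> where \<omega>: "module_map A (P 2) rel_module \<omega>"
    "\<And>p. p \<in> carrier (P 2) \<Longrightarrow> rel_map (\<omega> p) = \<psi>1 (d 1 p)"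
    using projective_lift[OF _ module_map_comp[OF d1 \<psi>1] rel_map_module_map FM RM] by blast
  have "h1 (unit_vector A l) \<in> rel_map ` carrier rel_module" for l
    by (intro rel_map_surj module_map_closed[OF h1] h1_ker unit_vector_closed) auto
  then obtain h1' where h1': "module_map A row_module rel_module h1'"
    "\<And>c. c \<in> carrier row_module \<Longrightarrow> rel_map (h1' c) = h1 c"
    using free_module_lift[OF h1 rel_map_module_map FM RM] by blast
  have inj': "F = G" if "F \<in> carrier rel_module" "G \<in> carrier rel_module" "rel_map F = rel_map G" for F G
  proof -
    have "rel_map (F \<ominus>\<^bsub>rel_module\<^esub> G) = rel_map F \<ominus>\<^bsub>row_module\<^esub> rel_map G"
      by (rule module_map_minus[OF rel_map_module_map FM RM that(1,2)])
    also have "\<dots> = \<zero>\<^bsub>row_module\<^esub>"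
      using RM.M.minus_eq_zero_iff module_map_closed[OF rel_map_module_map] that by metis
    finally have "F \<ominus>\<^bsub>rel_module\<^esub> G = \<zero>\<^bsub>rel_module\<^esub>"
      by (rule inj[rule_format, OF FM.M.minus_closed[OF that(1,2)]])
    then show ?thesis using FM.M.minus_eq_zero_iff that by blast
  qed
  show thesis
  proof (rule that[OF \<omega>(1)])
    fix p assume p: "p \<in> carrier (P 3)"
    note p2 = module_map_closed[OF d2 p]
    have "rel_map (\<omega> (d 2 p)) = \<zero>\<^bsub>row_module\<^esub>"
      by (simp only: \<omega>(2)[OF p2] d12[OF p] module_map_zero[OF \<psi>1 C.P RM])
    then show "\<omega> (d 2 p) = \<zero>\<^bsub>rel_module\<^esub>"
      by (rule inj[rule_format, OF module_map_closed[OF \<omega>(1) p2]])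
  next
    show "\<forall>g g'. module_map A rel_module (regular_module A) g \<longrightarrow> module_map A (P 1) (regular_module A) g' \<longrightarrow>
      (\<forall>p\<in>carrier (P 2). g (\<omega> p) = g' (d 1 p)) \<longrightarrow>
      (\<exists>v. \<forall>s\<in>R. g (unit_vector A s) = \<pi> (\<Sum>l\<in>UNIV. rquot l s * v l))"
    proof (intro allI impI)
    fix g g'
    assume g: "module_map A rel_module (regular_module A) g" and g': "module_map A (P 1) (regular_module A) g'"
      and eq: "\<forall>p\<in>carrier (P 2). g (\<omega> p) = g' (d 1 p)"
    \<comment> \<open>The primitive \<open>g'\<close> transported to A^(s+1), minus the error caused
      by the homotopy \<open>h1\<close>.\<close>
    define G where "G c = g' (\<phi>1 c) \<ominus>\<^bsub>regular_module A\<^esub> g (h1' c)" for c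
    have G: "module_map A row_module (regular_module A) G"
      unfolding G_def by (intro module_map_minus_map module_map_comp[OF \<phi>1 g'] module_map_comp[OF h1'(1) g] reg)
    have gG: "g F = G (rel_map F)" if F: "F \<in> carrier rel_module" for F
    proof -
      note K = module_map_closed[OF rel_map_module_map F] row_sum_rel_map[OF F]
      have "\<phi>1 (rel_map F) \<in> d 1 ` carrier (P 2)"
        unfolding ex1 a_kernel_iff using module_map_closed[OF \<phi>1 K(1)] \<phi>1_ker[OF K] by simp
      \<comment> \<open>A preimage under \<open>d 1\<close> makes the hypothesis on \<open>g\<close>
        and \<open>g'\<close> applicable; injectivity of \<open>rel_map\<close> then identifies
        \<open>\<omega> p\<close> as \<open>F\<close> plus the homotopy term.\<close>
      then obtain p where p: "p \<in> carrier (P 2)" "d 1 p = \<phi>1 (rel_map F)" by (metis imageE)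
      have "rel_map (\<omega> p) = rel_map F \<oplus>\<^bsub>row_module\<^esub> rel_map (h1' (rel_map F))"
        by (simp only: \<omega>(2)[OF p(1)] p(2) \<psi>\<phi>[OF K] h1'(2)[OF K(1)])
      also have "\<dots> = rel_map (F \<oplus>\<^bsub>rel_module\<^esub> h1' (rel_map F))"
        by (rule module_map_add[OF rel_map_module_map F module_map_closed[OF h1'(1) K(1)], symmetric])
      finally have "\<omega> p = F \<oplus>\<^bsub>rel_module\<^esub> h1' (rel_map F)"
        by (rule inj'[OF module_map_closed[OF \<omega>(1) p(1)] FM.M.a_closed[OF F module_map_closed[OF h1'(1) K(1)]]])
      then have "g' (\<phi>1 (rel_map F)) = g F \<oplus>\<^bsub>regular_module A\<^esub> g (h1' (rel_map F))"
        using eq[rule_format, OF p(1)] module_map_add[OF g F module_map_closed[OF h1'(1) K(1)]] p(2) by simp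
      then show ?thesis
        unfolding G_def
        using reg.M.diff_add_cancel_right[OF module_map_closed[OF g F] module_map_closed[OF g module_map_closed[OF h1'(1) K(1)]]]
        by simp
    qed
    have "\<forall>l. \<exists>p. G (unit_vector A l) = \<pi> p"
      using module_map_closed[OF G unit_vector_closed] \<pi>_surj by auto
    then obtain v where v: "\<And>l. G (unit_vector A l) = \<pi> (v l)" by metis
    have vc: "\<And>l. \<pi> (v l) \<in> carrier A" by simp
    have "g (unit_vector A s) = \<pi> (\<Sum>l\<in>UNIV. rquot l s * v l)" if s: "s \<in> R" for s
    proof -
      have "g (unit_vector A s) = G (\<lambda>l. \<pi> (rquot l s))"
        using gG[OF unit_vector_closed[OF s]] by (simp add: rel_map_unit_vector[OF s])
      also have "\<dots> = row_sum (\<lambda>l. \<pi> (v l)) (\<lambda>l. \<pi> (rquot l s))"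
        by (rule free_module_maps_eq[OF G row_sum_module_map[OF vc] reg _ \<pi>_row_module])
           (simp add: v row_sum_unit_vector[OF vc])
      also have "\<dots> = \<pi> (\<Sum>l\<in>UNIV. rquot l s * v l)"
        unfolding row_sum_def \<pi>_sum \<pi>_mult ..
      finally show ?thesis .
    qed
    then show "\<exists>v. \<forall>s\<in>R. g (unit_vector A s) = \<pi> (\<Sum>l\<in>UNIV. rquot l s * v l)" by blast
    qed
  qed
qed

text \<open>Without relations there are no syzygies, so \<open>\<psi>1\<close> vanishes on cycles
  and \<open>k1\<close> contracts the resolution in degree 2: p + k1 (d 1 p) is a boundary, on which
  a cocycle is zero.\<close>

lemma ext2_zero_without_relations:
  assumes R: "R = {}" and res: "projective_resolution A N P d e" and N: "trivial_like N u"
    and z: "z \<in> ext_cocycles A P d 2"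
  shows "z \<in> ext_coboundaries A P d 2"
proof -
  interpret C: module_complex A P d
    by (rule resolution_complex[OF res]) (use N in \<open>simp add: trivial_like_def\<close>)
  note reg = C.regular
  interpret P2: left_module A "P 2" by (rule C.P)
  interpret P1: left_module A "P 1" by (rule C.P)
  interpret reg: left_module A "regular_module A" by (rule reg)
  obtain \<phi>1 \<psi>1 h1 k1 where
    \<phi>1: "module_map A row_module (P 1) \<phi>1" and \<psi>1: "module_map A (P 1) row_module \<psi>1" and
    k1: "module_map A (P 1) (P 2) k1" and
    \<psi>1_ker: "\<And>q. q \<in> carrier (P 1) \<Longrightarrow> d 0 q = \<zero>\<^bsub>P 0\<^esub> \<Longrightarrow> row_sum gens (\<psi>1 q) = \<zero>" and
    \<phi>\<psi>: "\<And>q. q \<in> carrier (P 1) \<Longrightarrow> d 0 q = \<zero>\<^bsub>P 0\<^esub> \<Longrightarrow> \<phi>1 (\<psi>1 q) = q \<oplus>\<^bsub>P 1\<^esub> d 1 (k1 q)"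
    by (rule trivial_comparison[OF res N]) blast
  have d1: "module_map A (P 2) (P 1) (d 1)" using C.d[of 1] by (simp add: numeral_2_eq_2)
  have d01: "d 0 (d 1 p) = \<zero>\<^bsub>P 0\<^esub>" if "p \<in> carrier (P 2)" for p
    using C.d_d[of p 0] that by (simp add: numeral_2_eq_2)
  have "d (Suc 1) ` carrier (P (Suc (Suc 1))) = a_kernel (P (Suc 1)) (P 1) (d 1)"
    using res unfolding projective_resolution_def by blast
  then have ex2: "d 2 ` carrier (P 3) = a_kernel (P 2) (P 1) (d 1)"
    by (simp add: numeral_2_eq_2 numeral_3_eq_3)
  have zm: "module_map A (P 2) (regular_module A) z" and zext: "z \<in> extensional (carrier (P 2))"
    and zd: "\<And>p. p \<in> carrier (P 3) \<Longrightarrow> z (d 2 p) = \<zero>"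
    using z unfolding C.cocycles_iff by (auto simp: numeral_2_eq_2 numeral_3_eq_3)
  have \<psi>1_0: "\<psi>1 q = \<zero>\<^bsub>row_module\<^esub>" if q: "q \<in> carrier (P 1)" "d 0 q = \<zero>\<^bsub>P 0\<^esub>" for q
  proof -
    obtain F where F: "F \<in> carrier rel_module" "\<psi>1 q = rel_map F"
      using rel_map_surj[OF module_map_closed[OF \<psi>1 q(1)] \<psi>1_ker[OF q]] by blast
    then have "F = \<zero>\<^bsub>rel_module\<^esub>" by (auto simp: carrier_free_module R)
    then show ?thesis
      using F module_map_zero[OF rel_map_module_map left_module_free left_module_free] by simp
  qed
  \<comment> \<open>The contraction makes minus \<open>z\<close> after \<open>k1\<close> a primitive
    of \<open>z\<close>.\<close>
  define g where "g q = \<ominus>\<^bsub>regular_module A\<^esub> z (k1 q)" for q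
  have g: "module_map A (P 1) (regular_module A) g"
    unfolding g_def by (intro module_map_uminus_map module_map_comp[OF k1 zm] reg)
  have "z p = g (d 1 p)" if p: "p \<in> carrier (P 2)" for p
  proof -
    note q = module_map_closed[OF d1 p] d01[OF p]
    note k = module_map_closed[OF k1 q(1)]
    have "d 1 (p \<oplus>\<^bsub>P 2\<^esub> k1 (d 1 p)) = \<phi>1 (\<psi>1 (d 1 p))"
      by (simp only: module_map_add[OF d1 p k] \<phi>\<psi>[OF q])
    also have "\<dots> = \<zero>\<^bsub>P 1\<^esub>"
      by (simp only: \<psi>1_0[OF q] module_map_zero[OF \<phi>1 left_module_free C.P])
    finally have "p \<oplus>\<^bsub>P 2\<^esub> k1 (d 1 p) \<in> d 2 ` carrier (P 3)"
      unfolding ex2 a_kernel_iff using p k by simp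
    then have "z (p \<oplus>\<^bsub>P 2\<^esub> k1 (d 1 p)) = \<zero>" using zd by auto
    then have "z p \<oplus>\<^bsub>regular_module A\<^esub> z (k1 (d 1 p)) = \<zero>\<^bsub>regular_module A\<^esub>"
      using module_map_add[OF zm p k] by simp
    then show ?thesis
      unfolding g_def
      using reg.M.minus_equality[of "z p" "z (k1 (d 1 p))"] module_map_closed[OF zm p] module_map_closed[OF zm k]
      by simp
  qed
  then have "z = (\<lambda>p\<in>carrier (P (Suc 1)). restrict g (carrier (P 1)) (d 1 p))"
    using zext module_map_closed[OF d1] by (auto simp: fun_eq_iff extensional_def numeral_2_eq_2)
  moreover have "restrict g (carrier (P 1)) \<in> carrier (dual_module A (P 1))"
    using restrict_module_homs[OF g C.P] by (simp add: dual_module_def)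
  ultimately have "z \<in> ext_coboundaries A P d (Suc 1)"
    unfolding C.coboundaries_Suc by blast
  then show ?thesis by (simp add: numeral_2_eq_2)
qed

text \<open>The isomorphism of Ext with K becomes a functional on cocycles that vanishes on
  coboundaries only, so that cosets can be left behind.\<close>

lemma ext_functional:
  assumes gr: "\<And>n. gr n = \<pi> ` homogeneous n"
    and res: "projective_resolution A (trivial_module A gr) P d e"
    and h: "h \<in> module_homs A (ext_module A P d i) (trivial_module A gr)"
    and bij: "bij_betw h (carrier (ext_module A P d i)) (carrier (trivial_module A gr))"
  obtains H :: "('m \<Rightarrow> 'c) \<Rightarrow> 'k" where
    "\<And>z y. z \<in> ext_cocycles A P d i \<Longrightarrow> y \<in> ext_cocycles A P d i \<Longrightarrow>
       H (\<lambda>p\<in>carrier (P i). z p \<oplus> y p) = H z + H y"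
    "\<And>z a. z \<in> ext_cocycles A P d i \<Longrightarrow> a \<in> carrier A \<Longrightarrow> H (\<lambda>p\<in>carrier (P i). z p \<otimes> a) = eps a * H z"
    "\<And>z. z \<in> ext_cocycles A P d i \<Longrightarrow> H z = 0 \<Longrightarrow> z \<in> ext_coboundaries A P d i"
    "\<exists>z\<in>ext_cocycles A P d i. z \<notin> ext_coboundaries A P d i"
proof -
  interpret C: module_complex A P d
    by (rule resolution_complex[OF res left_module_trivial[OF gr]])
  define H where "H z = h (C.ext_class i z)" for z
  have hm: "module_map A (ext_module A P d i) (trivial_module A gr) h"
    using h by (simp add: module_homs_iff)
  have cl: "C.ext_class i z \<in> carrier (ext_module A P d i)" if "z \<in> ext_cocycles A P d i" for z
    using that by (auto simp: C.carrier_ext)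
  have add: "H (\<lambda>p\<in>carrier (P i). z p \<oplus> y p) = H z + H y"
    if "z \<in> ext_cocycles A P d i" "y \<in> ext_cocycles A P d i" for z y
    unfolding H_def C.ext_class_add[OF that, symmetric]
    using module_map_add[OF hm cl[OF that(1)] cl[OF that(2)]] by (simp add: trivial_module_simps)
  have smult: "H (\<lambda>p\<in>carrier (P i). z p \<otimes> a) = eps a * H z"
    if "z \<in> ext_cocycles A P d i" "a \<in> carrier A" for z a
    unfolding H_def C.ext_class_smult[OF that, symmetric]
    using module_map_smult[OF hm that(2) cl[OF that(1)]] that(2)
    by (simp add: trivial_module_simps augmentation_eq[OF gr])
  let ?z = "\<lambda>p\<in>carrier (P i). \<zero>"
  have z0: "?z \<in> ext_cocycles A P d i" by (rule C.cocycle_zero)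
  have zz: "(\<lambda>p\<in>carrier (P i). ?z p \<oplus> ?z p) = ?z" by auto
  have H0: "H ?z = 0"
    by (rule add_cancel_right_right[THEN iffD1, of "H ?z"]) (rule add[OF z0 z0, unfolded zz])
  have zero: "z \<in> ext_coboundaries A P d i" if z: "z \<in> ext_cocycles A P d i" "H z = 0" for z
  proof -
    have "C.ext_class i z = C.ext_class i ?z"
      using bij_betw_imp_inj_on[OF bij] cl[OF z(1)] cl[OF z0] z(2) H0 unfolding H_def by (metis inj_onD)
    then show ?thesis
      using C.ext_class_zero_iff[OF z(1)] C.ext_class_zero_iff[OF z0] C.coboundary_zero by blast
  qed
  have "1 \<in> h ` carrier (ext_module A P d i)"
    using bij_betw_imp_surj_on[OF bij] by (simp add: trivial_module_simps)
  then obtain z where z: "z \<in> ext_cocycles A P d i" "H z = 1" by (auto simp: C.carrier_ext H_def)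
  have "z \<notin> ext_coboundaries A P d i"
  proof
    assume "z \<in> ext_coboundaries A P d i"
    then have "C.ext_class i z = C.ext_class i ?z"
      using C.ext_class_zero_iff[OF z(1)] C.ext_class_zero_iff[OF z0] C.coboundary_zero by blast
    then show False using z H0 by (simp add: H_def)
  qed
  then show thesis using that add smult zero z(1) by blast
qed

text \<open>Relations have degree at least 2, so their right quotients have no constant term, and
  neither do the values on the basis of a functional on A^m whose class is zero. Two coordinates
  would have proportional classes in the one-dimensional Ext^2, and a nontrivial combination of
  class zero would have a nonzero constant value. The generators enter because they act as 0 on
  Ext^2.\<close>

lemma single_relation:
  assumes inj: "\<forall>F\<in>carrier rel_module. rel_map F = \<zero>\<^bsub>row_module\<^esub> \<longrightarrow> F = \<zero>\<^bsub>rel_module\<^esub>"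
    and gr: "\<And>n. gr n = \<pi> ` homogeneous n"
    and res: "projective_resolution A (trivial_module A gr) P d e"
    and h: "h \<in> module_homs A (ext_module A P d 2) (trivial_module A gr)"
    and bij: "bij_betw h (carrier (ext_module A P d 2)) (carrier (trivial_module A gr))"
  obtains s v where "R = {s}" "\<And>m. gen m - (\<Sum>l\<in>UNIV. rquot l s * v m l) \<in> I"
proof -
  note N = trivial_like_trivial[OF gr]
  interpret C: module_complex A P d
    by (rule resolution_complex[OF res left_module_trivial[OF gr]])
  obtain H :: "('a \<Rightarrow> 'c) \<Rightarrow> 'k" where
    H_add: "\<And>z y. z \<in> ext_cocycles A P d 2 \<Longrightarrow> y \<in> ext_cocycles A P d 2 \<Longrightarrow>
       H (\<lambda>p\<in>carrier (P 2). z p \<oplus> y p) = H z + H y" and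
    H_smult: "\<And>z a. z \<in> ext_cocycles A P d 2 \<Longrightarrow> a \<in> carrier A \<Longrightarrow> H (\<lambda>p\<in>carrier (P 2). z p \<otimes> a) = eps a * H z" and
    H_zero: "\<And>z. z \<in> ext_cocycles A P d 2 \<Longrightarrow> H z = 0 \<Longrightarrow> z \<in> ext_coboundaries A P d 2" and
    H_nonzero: "\<exists>z\<in>ext_cocycles A P d 2. z \<notin> ext_coboundaries A P d 2"
    by (rule ext_functional[OF gr res h bij]) blast
  obtain \<omega> where \<omega>: "module_map A (P 2) rel_module \<omega>"
    "\<And>p. p \<in> carrier (P 3) \<Longrightarrow> \<omega> (d 2 p) = \<zero>\<^bsub>rel_module\<^esub>"
    "\<forall>g g'. module_map A rel_module (regular_module A) g \<longrightarrow> module_map A (P 1) (regular_module A) g' \<longrightarrow>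
      (\<forall>p\<in>carrier (P 2). g (\<omega> p) = g' (d 1 p)) \<longrightarrow>
      (\<exists>v. \<forall>s\<in>R. g (unit_vector A s) = \<pi> (\<Sum>l\<in>UNIV. rquot l s * v l))"
    by (rule ext2_detection[OF inj res N]) blast
  define z where "z g = (\<lambda>p\<in>carrier (P 2). g (\<omega> p))" for g :: "(('n list \<Rightarrow>\<^sub>0 'k) \<Rightarrow> 'c) \<Rightarrow> 'c"
  have z: "z g \<in> ext_cocycles A P d 2" if g: "module_map A rel_module (regular_module A) g" for g
  proof -
    have "module_map A (P 2) (regular_module A) (z g)"
      by (rule module_map_cong[OF module_map_comp[OF \<omega>(1) g] C.P]) (simp add: z_def)
    moreover have "z g (d 2 p) = \<zero>" if "p \<in> carrier (P (Suc 2))" for p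
    proof -
      have p: "p \<in> carrier (P 3)" using that by (simp add: numeral_3_eq_3 numeral_2_eq_2)
      have "z g (d 2 p) = g (\<omega> (d 2 p))" using C.d_closed[OF that] by (simp add: z_def)
      also have "\<dots> = \<zero>" unfolding \<omega>(2)[OF p]
        using module_map_zero[OF g left_module_free C.regular] by simp
      finally show ?thesis .
    qed
    ultimately show ?thesis by (simp add: C.cocycles_iff z_def)
  qed
  \<comment> \<open>\<open>H\<close> detects coboundaries, and a coboundary is what
    \<open>ext2_detection\<close> asks for.\<close>
  have bound: "\<exists>v. \<forall>s\<in>R. g (unit_vector A s) = \<pi> (\<Sum>l\<in>UNIV. rquot l s * v l)"
    if g: "module_map A rel_module (regular_module A) g" and "H (z g) = 0" for g
  proof -
    have "z g \<in> ext_coboundaries A P d (Suc 1)"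
      using H_zero[OF z[OF g] that(2)] by (simp add: numeral_2_eq_2)
    then obtain g' where g': "g' \<in> carrier (dual_module A (P 1))"
      "z g = (\<lambda>p\<in>carrier (P (Suc 1)). g' (d 1 p))"
      unfolding C.coboundaries_Suc by blast
    show ?thesis
    proof (intro \<omega>(3)[rule_format, OF g] ballI)
      show "module_map A (P 1) (regular_module A) g'" using g'(1) by (simp add: C.carrier_dual)
      fix p assume "p \<in> carrier (P 2)"
      then show "g (\<omega> p) = g' (d 1 p)"
        using fun_cong[OF g'(2), of p] by (simp add: z_def numeral_2_eq_2)
    qed
  qed
  \<comment> \<open>A coordinate followed by right multiplication by \<open>a\<close>, the operation
    that gives Ext its right module structure.\<close>
  define coord where "coord s a F = F s \<otimes> a" for s a and F :: "('n list \<Rightarrow>\<^sub>0 'k) \<Rightarrow> 'c"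
  have coord: "module_map A rel_module (regular_module A) (coord s a)" if "a \<in> carrier A" for s a
    unfolding coord_def by (rule module_mapI) (use that in \<open>auto simp: carrier_free_module l_distr m_assoc\<close>)
  have H_coord: "H (z (coord s a)) = eps a * H (z (coord s \<one>))" if "a \<in> carrier A" for s a
  proof -
    have "\<omega> p s \<in> carrier A" if "p \<in> carrier (P 2)" for p
      using module_map_closed[OF \<omega>(1) that] by (simp add: carrier_free_module)
    then have "z (coord s a) = (\<lambda>p\<in>carrier (P 2). z (coord s \<one>) p \<otimes> a)"
      by (auto simp: z_def coord_def)
    then show ?thesis using H_smult[OF z[OF coord[of \<one> s]] that] by simp
  qed
  have "R \<noteq> {}" using ext2_zero_without_relations[OF _ res N] H_nonzero by blast
  then obtain s where s: "s \<in> R" by blast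
  have low: "lookup (\<Sum>l\<in>UNIV. rquot l r * v l) [] = 0" if "r \<in> R" for r v
  proof -
    obtain n where n: "n \<ge> 2" "r \<in> homogeneous n" using hom \<open>r \<in> R\<close> by blast
    then have "lookup (rquot l r) [] = 0" for l
      using lookup_homogeneous[OF rquot_homogeneous[OF n(2)], of "[]" l] by simp
    then show ?thesis by (simp add: lookup_sum lookup_Nil_mult)
  qed
  have "R = {s}"
  proof (rule ccontr)
    assume "R \<noteq> {s}"
    then obtain r where r: "r \<in> R" "r \<noteq> s" using s by blast
    \<comment> \<open>The scalars of a linear dependence between two elements of a one-dimensional
      space.\<close>
    obtain a b where ab: "a * H (z (coord s \<one>)) + b * H (z (coord r \<one>)) = 0" "a \<noteq> 0 \<or> b \<noteq> 0"
    proof (cases "H (z (coord s \<one>)) = 0 \<and> H (z (coord r \<one>)) = 0")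
      case True
      then show ?thesis using that[of 1 0] by simp
    next
      case False
      then show ?thesis
        using that[of "H (z (coord r \<one>))" "- H (z (coord s \<one>))"] by (simp add: mult.commute) blast
    qed
    define g where "g F = coord s (\<pi> (scalar a)) F \<oplus>\<^bsub>regular_module A\<^esub> coord r (\<pi> (scalar b)) F" for F
    have g: "module_map A rel_module (regular_module A) g"
      unfolding g_def by (intro module_map_plus_map coord C.regular \<pi>_closed)
    have "z g = (\<lambda>p\<in>carrier (P 2). z (coord s (\<pi> (scalar a))) p \<oplus> z (coord r (\<pi> (scalar b))) p)"
      by (auto simp: z_def g_def)
    then have "H (z g) = H (z (coord s (\<pi> (scalar a)))) + H (z (coord r (\<pi> (scalar b))))"
      using H_add[OF z[OF coord] z[OF coord]] by simp
    also have "\<dots> = 0" using ab(1) H_coord[of "\<pi> (scalar a)" s] H_coord[of "\<pi> (scalar b)" r] by simp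
    finally obtain v where v: "\<And>t. t \<in> R \<Longrightarrow> g (unit_vector A t) = \<pi> (\<Sum>l\<in>UNIV. rquot l t * v l)"
      using bound[OF g] by blast
    have "g (unit_vector A s) = \<pi> (scalar a)" "g (unit_vector A r) = \<pi> (scalar b)"
      using r by (auto simp: g_def coord_def unit_vector_def)
    then have "eps (\<pi> (scalar a)) = 0" "eps (\<pi> (scalar b)) = 0"
      using v[OF s] v[OF r(1)] low[OF s] low[OF r(1)] by (metis eps_\<pi>)+
    then show False using ab(2) by simp
  qed
  \<comment> \<open>A generator has constant term 0, so the coordinate multiplied by it has class
    zero and is governed by \<open>bound\<close>.\<close>
  moreover have "\<exists>v. gen m - (\<Sum>l\<in>UNIV. rquot l s * v l) \<in> I" for m
  proof -
    have "H (z (coord s (gens m))) = 0" using H_coord[of "gens m" s] by (simp add: lookup_single)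
    then obtain v where "\<forall>t\<in>R. coord s (gens m) (unit_vector A t) = \<pi> (\<Sum>l\<in>UNIV. rquot l t * v l)"
      using bound[OF coord[of "gens m"]] by auto
    then have "coord s (gens m) (unit_vector A s) = \<pi> (\<Sum>l\<in>UNIV. rquot l s * v l)" using s by blast
    then have "gens m = \<pi> (\<Sum>l\<in>UNIV. rquot l s * v l)" by (simp add: coord_def unit_vector_def)
    then show ?thesis unfolding \<pi>_eq_iff by blast
  qed
  ultimately show thesis using that by metis
qed

end

text \<open>Everything is read off in degree 1, where the ideal is zero. A right quotient of degree
  above 1 could not contribute there, so \<open>n\<close> is 2; then only the constant terms of the
  \<open>v m l\<close> matter, and they form a right inverse of the coefficient matrix.\<close>

lemma scalar_matrix_of_relation:
  fixes s :: "'n::finite list \<Rightarrow>\<^sub>0 'k::field"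
  assumes low: "\<And>p n. p \<in> I \<Longrightarrow> n < 2 \<Longrightarrow> component n p = 0"
    and s: "s \<in> homogeneous n" "n \<ge> 2"
    and v: "\<And>m. gen m - (\<Sum>l\<in>UNIV. rquot l s * v m l) \<in> I"
  shows "n = 2" "(\<Sum>l\<in>UNIV. lookup s [\<mu>, l] * lookup (v m l) []) = (if \<mu> = m then 1 else 0)"
proof -
  have r: "rquot l s \<in> homogeneous (n - 1)" for l by (rule rquot_homogeneous[OF s(1)])
  have eq: "gen m = (\<Sum>l\<in>UNIV. component 1 (rquot l s * v m l))" for m
    using low[OF v[of m], of 1] by (simp add: component_diff component_sum component_single)
  show n: "n = 2"
  proof (rule ccontr)
    assume "n \<noteq> 2"
    then have "\<not> n - 1 \<le> 1" using s(2) by simp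
    then have "gen m = (0 :: 'n list \<Rightarrow>\<^sub>0 'k)" for m :: 'n
      unfolding eq[of m] by (simp add: component_mult_homogeneous_left[OF r])
    then show False by (metis lookup_single_eq lookup_zero zero_neq_one)
  qed
  have "gen m = (\<Sum>l\<in>UNIV. scalar (lookup (v m l) []) * rquot l s)"
    unfolding eq[of m] using s n
    by (simp add: component_mult_homogeneous_left[OF r] component_0_eq scalar_commute)
  then have "lookup (gen m :: 'n list \<Rightarrow>\<^sub>0 'k) [\<mu>] = (\<Sum>l\<in>UNIV. lookup (v m l) [] * lookup s [\<mu>, l])"
    by (simp add: lookup_sum lookup_scalar_mult lookup_rquot)
  then show "(\<Sum>l\<in>UNIV. lookup s [\<mu>, l] * lookup (v m l) []) = (if \<mu> = m then 1 else 0)"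
    by (simp add: lookup_single when_def mult.commute eq_commute)
qed

text \<open>\<open>R\<close> is known to generate syzygies, not the ideal. Induction on the degree:
  the right quotients of \<open>p\<close> differ from multiples of those of \<open>s\<close> by
  elements of \<open>I\<close> of smaller degree.\<close>

lemma (in minimal_presentation) ideal_of_single_relation:
  assumes R: "R = {s}" and s2: "s \<in> homogeneous 2"
  shows "I = Idl\<^bsub>tensor_algebra\<^esub> {s}"
proof
  let ?J = "Idl\<^bsub>tensor_algebra\<^esub> {s}"
  note id = tensor_ideal_Idl[of "{s}"]
  show "?J \<subseteq> I" using R_I R by (intro Idl_subset ideal_I) auto
  have "p \<in> ?J" if "p \<in> I" "p \<in> homogeneous n" for p n
    using that
  proof (induction n arbitrary: p)
    case 0
    then have "p = 0" using component_I_low[of p 0] by (simp add: homogeneous_iff)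
    then show ?case by (simp add: tensor_ideal_0[OF id])
  next
    case (Suc n)
    have "lookup p [] = 0" using lookup_homogeneous[OF Suc.prems(2), of "[]"] by simp
    then have split: "p = (\<Sum>l\<in>UNIV. rquot l p * gen l)" using split_last[of p] by simp
    then obtain t where t: "\<And>l. rquot l p - t s * rquot l s \<in> I"
      using generates_syzygiesD[OF gen, of "\<lambda>l. rquot l p"] Suc.prems(1) by (auto simp: R)
    have r1: "rquot l s \<in> homogeneous 1" for l using rquot_homogeneous[OF s2, of l] by simp
    have rp: "rquot l p \<in> homogeneous n" for l using rquot_homogeneous[OF Suc.prems(2), of l] by simp
    \<comment> \<open>The part of \<open>t s\<close> that meets degree \<open>n\<close> after
      multiplication by a linear form; for \<open>n\<close> = 0 there is none.\<close>
    define u where "u = (if 1 \<le> n then component (n - 1) (t s) else 0)"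
    have "component n (rquot l p - t s * rquot l s) = rquot l p - u * rquot l s" for l
      using rp[of l] by (simp add: u_def component_diff component_mult_homogeneous_right[OF r1] homogeneous_iff)
    then have i: "rquot l p - u * rquot l s \<in> I" for l
      using component_I[OF t[of l], of n] by simp
    moreover have "rquot l p - u * rquot l s \<in> homogeneous n" for l
      using rp[of l] component_homogeneous[of n "rquot l p - t s * rquot l s"]
        \<open>component n (rquot l p - t s * rquot l s) = rquot l p - u * rquot l s\<close> by simp
    ultimately have "rquot l p - u * rquot l s \<in> ?J" for l using Suc.IH by blast
    then have "(\<Sum>l\<in>UNIV. (rquot l p - u * rquot l s) * gen l) + u * s \<in> ?J"
      by (intro tensor_ideal_add[OF id] tensor_ideal_sum[OF id] tensor_ideal_right[OF id] tensor_ideal_left[OF id])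
         (auto intro: Idl_self)
    also have "(\<Sum>l\<in>UNIV. (rquot l p - u * rquot l s) * gen l) = p - u * s"
      using relation_split[of s] split
      by (simp add: R left_diff_distrib sum_subtractf mult.assoc flip: sum_distrib_left)
    finally show ?case by simp
  qed
  then have "component n p \<in> ?J" if "p \<in> I" for p n
    using component_I[OF that] component_homogeneous by blast
  then show "I \<subseteq> ?J" using tensor_ideal_components[OF id] by blast
qed

section \<open>Cardinality of free modules\<close>

lemma Times_lepoll_infinite:
  assumes U: "infinite (UNIV :: 'm set)" and "X \<lesssim> (UNIV :: 'm set)" "Y \<lesssim> (UNIV :: 'm set)"
  shows "X \<times> Y \<lesssim> (UNIV :: 'm set)"
proof -
  have "ordLeq3 (card_of ((UNIV :: 'm set) \<times> (UNIV :: 'm set))) (card_of (UNIV :: 'm set))"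
    using card_of_Times_same_infinite[OF U] by (rule ordIso_imp_ordLeq)
  then have "(UNIV :: 'm set) \<times> (UNIV :: 'm set) \<lesssim> (UNIV :: 'm set)"
    unfolding card_of_ordLeq[symmetric] lepoll_def .
  then show ?thesis by (rule lepoll_trans[OF times_lepoll_mono[OF assms(2,3)]])
qed

text \<open>A finite set is listed, the list is folded with a pairing function on the infinite type,
  and its length is recorded.\<close>

lemma Fpow_lepoll_infinite:
  assumes U: "infinite (UNIV :: 'm set)" and X: "X \<lesssim> (UNIV :: 'm set)"
  shows "Fpow X \<lesssim> (UNIV :: 'm set)"
proof -
  obtain f :: "'a \<Rightarrow> 'm" where f: "inj_on f X" using X by (auto simp: lepoll_def)
  have nat: "(UNIV :: nat set) \<lesssim> (UNIV :: 'm set)" using U by (simp add: infinite_le_lepoll)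
  have self: "(UNIV :: 'm set) \<lesssim> (UNIV :: 'm set)" by (rule subset_imp_lepoll) simp
  have "(UNIV :: 'm set) \<times> (UNIV :: 'm set) \<lesssim> (UNIV :: 'm set)"
    "(UNIV :: nat set) \<times> (UNIV :: 'm set) \<lesssim> (UNIV :: 'm set)"
    by (rule Times_lepoll_infinite[OF U self self], rule Times_lepoll_infinite[OF U nat self])
  then obtain pair :: "'m \<times> 'm \<Rightarrow> 'm" and tag :: "nat \<times> 'm \<Rightarrow> 'm" where
    pair: "inj pair" and tag: "inj tag" by (auto simp: lepoll_def)
  \<comment> \<open>The fold starts from an arbitrary element, which may coincide with a pair, so
    codes separate lists of equal length only; the tag with the length takes care of the
    rest.\<close>
  define code where "code xs = foldr (\<lambda>x c. pair (f x, c)) xs undefined" for xs :: "'a list"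
  have code: "xs = ys" if "length xs = length ys" "set xs \<subseteq> X" "set ys \<subseteq> X" "code xs = code ys" for xs ys
    using that
  proof (induction xs ys rule: list_induct2)
    case (Cons x xs y ys)
    then show ?case using injD[OF pair, of "(f x, code xs)" "(f y, code ys)"] inj_onD[OF f, of x y]
      by (auto simp: code_def)
  qed simp
  define g where "g S = (SOME xs. set xs = S)" for S :: "'a set"
  have g: "set (g S) = S" if "finite S" for S
    unfolding g_def using finite_list[OF that] by (rule someI_ex)
  have "inj_on (\<lambda>S. tag (length (g S), code (g S))) (Fpow X)"
  proof (rule inj_onI)
    fix S T assume S: "S \<in> Fpow X" "T \<in> Fpow X"
      and eq: "tag (length (g S), code (g S)) = tag (length (g T), code (g T))"
    have "(length (g S), code (g S)) = (length (g T), code (g T))" by (rule injD[OF tag eq])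
    then have "g S = g T" using S g by (intro code) (auto simp: Fpow_def)
    then show "S = T" using S g by (metis (no_types, lifting) Fpow_def mem_Collect_eq)
  qed
  then show ?thesis by (auto simp: lepoll_def)
qed

text \<open>A finitely supported function is determined by the finite part of its graph over the
  support.\<close>

lemma free_module_lepoll:
  assumes U: "infinite (UNIV :: 'm set)" and "Y \<lesssim> (UNIV :: 'm set)" "carrier A \<lesssim> (UNIV :: 'm set)"
  shows "carrier (free_module A Y) \<lesssim> (UNIV :: 'm set)"
proof -
  have "carrier (free_module A Y) \<lesssim>
    {f. f ` Y \<subseteq> carrier A \<and> {x. f x \<noteq> \<zero>\<^bsub>A\<^esub>} \<subseteq> Y \<and> finite {x. f x \<noteq> \<zero>\<^bsub>A\<^esub>}}"
    by (rule subset_imp_lepoll) (auto simp: carrier_free_module)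
  also have "\<dots> \<lesssim> Fpow (Y \<times> carrier A)" by (rule lepoll_restricted_funspace)
  also have "\<dots> \<lesssim> (UNIV :: 'm set)"
    by (intro Fpow_lepoll_infinite Times_lepoll_infinite assms)
  finally show ?thesis .
qed

lemma tensor_algebra_lepoll:
  assumes U: "infinite (UNIV :: 'm set)" and k: "(UNIV :: 'k::field set) \<lesssim> (UNIV :: 'm set)"
  shows "(UNIV :: ('n::finite list \<Rightarrow>\<^sub>0 'k) set) \<lesssim> (UNIV :: 'm set)"
proof -
  have "(UNIV :: ('n list \<Rightarrow>\<^sub>0 'k) set) \<lesssim> {f :: 'n list \<Rightarrow> 'k. f ` UNIV \<subseteq> UNIV \<and> {x. f x \<noteq> 0} \<subseteq> UNIV \<and> finite {x. f x \<noteq> 0}}"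
    unfolding lepoll_def by (rule exI[of _ lookup]) (simp add: inj_on_def lookup_inject image_subset_iff)
  also have "\<dots> \<lesssim> Fpow ((UNIV :: 'n list set) \<times> (UNIV :: 'k set))" by (rule lepoll_restricted_funspace)
  also have "\<dots> \<lesssim> (UNIV :: 'm set)"
  proof (intro Fpow_lepoll_infinite Times_lepoll_infinite U k)
    have "(UNIV :: 'n list set) \<lesssim> (UNIV :: nat set)"
      unfolding lepoll_def by (rule exI[of _ to_nat]) auto
    also have "(UNIV :: nat set) \<lesssim> (UNIV :: 'm set)" using U by (simp add: infinite_le_lepoll)
    finally show "(UNIV :: 'n list set) \<lesssim> (UNIV :: 'm set)" .
  qed
  finally show ?thesis .
qed

lemma (in presentation) free_module_inj:
  fixes Y :: "'y set"
  assumes U: "infinite (UNIV :: 'm set)" and k: "(UNIV :: 'k set) \<lesssim> (UNIV :: 'm set)" and Y: "Y \<lesssim> (UNIV :: 'm set)"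
  obtains \<Phi> :: "('y \<Rightarrow> 'c) \<Rightarrow> 'm" where "inj_on \<Phi> (carrier (free_module A Y))"
    "projective_module A (encode_module \<Phi> (free_module A Y))"
proof -
  have "carrier A \<lesssim> (UNIV :: 'm set)"
    unfolding \<pi>_surj by (rule lepoll_trans[OF image_lepoll tensor_algebra_lepoll[OF U k]])
  then obtain \<Phi> :: "('y \<Rightarrow> 'c) \<Rightarrow> 'm" where \<Phi>: "inj_on \<Phi> (carrier (free_module A Y))"
    using free_module_lepoll[OF U Y, of A] by (auto simp: lepoll_def)
  obtain g :: "'y \<Rightarrow> 'm" where "inj_on g Y" using Y by (auto simp: lepoll_def)
  then show thesis using that \<Phi> projective_encode_free[OF ring_axioms \<Phi>] by blast
qed

section \<open>Resolutions of length two and projective dimension\<close>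

text \<open>The three terms may live in different types, each with its own coding into 'm. The
  locale is interpreted for an arbitrary module, to bound the global dimension, and for the trivial
  module, to compute Ext.\<close>

locale encoded_resolution = ring A
  for A :: "('c, 'z) ring_scheme" (structure) +
  fixes N :: "('c, 'u) module" and F0 :: "('c, 'x) module" and F1 :: "('c, 'y) module" and F2 :: "('c, 'w) module"
    and D0 :: "'y \<Rightarrow> 'x" and D1 :: "'w \<Rightarrow> 'y" and E :: "'x \<Rightarrow> 'u"
    and \<Phi>0 :: "'x \<Rightarrow> 'm" and \<Phi>1 :: "'y \<Rightarrow> 'm" and \<Phi>2 :: "'w \<Rightarrow> 'm"
  assumes N: "left_module A N" and F0: "left_module A F0" and F1: "left_module A F1" and F2: "left_module A F2"
    and inj0: "inj_on \<Phi>0 (carrier F0)" and inj1: "inj_on \<Phi>1 (carrier F1)" and inj2: "inj_on \<Phi>2 (carrier F2)"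
    and proj0: "projective_module A (encode_module \<Phi>0 F0)"
    and proj1: "projective_module A (encode_module \<Phi>1 F1)"
    and proj2: "projective_module A (encode_module \<Phi>2 F2)"
    and E: "module_map A F0 N E" and D0: "module_map A F1 F0 D0" and D1: "module_map A F2 F1 D1"
    and surj: "E ` carrier F0 = carrier N"
    and exact0: "D0 ` carrier F1 = {x \<in> carrier F0. E x = \<zero>\<^bsub>N\<^esub>}"
    and exact1: "D1 ` carrier F2 = {y \<in> carrier F1. D0 y = \<zero>\<^bsub>F0\<^esub>}"
    and exact2: "w \<in> carrier F2 \<Longrightarrow> D1 w = \<zero>\<^bsub>F1\<^esub> \<Longrightarrow> w = \<zero>\<^bsub>F2\<^esub>"
begin

definition enc_module :: "nat \<Rightarrow> ('c, 'm) module" where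
  "enc_module i = (if i = 0 then encode_module \<Phi>0 F0 else if i = Suc 0 then encode_module \<Phi>1 F1
     else if i = Suc (Suc 0) then encode_module \<Phi>2 F2 else zero_module (\<Phi>2 \<zero>\<^bsub>F2\<^esub>))"

definition enc_diff :: "nat \<Rightarrow> 'm \<Rightarrow> 'm" where
  "enc_diff i = (\<lambda>p\<in>carrier (enc_module (Suc i)).
     if i = 0 then \<Phi>0 (D0 (inv_into (carrier F1) \<Phi>1 p))
     else if i = Suc 0 then \<Phi>1 (D1 (inv_into (carrier F2) \<Phi>2 p)) else \<Phi>2 \<zero>\<^bsub>F2\<^esub>)"

definition enc_aug :: "'m \<Rightarrow> 'u" where
  "enc_aug = (\<lambda>p\<in>carrier (enc_module 0). E (inv_into (carrier F0) \<Phi>0 p))"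

lemma enc_module_simps [simp]:
  "enc_module 0 = encode_module \<Phi>0 F0" "enc_module (Suc 0) = encode_module \<Phi>1 F1"
  "enc_module (Suc (Suc 0)) = encode_module \<Phi>2 F2" "enc_module (Suc (Suc (Suc i))) = zero_module (\<Phi>2 \<zero>\<^bsub>F2\<^esub>)"
  by (simp_all add: enc_module_def)

lemma carriers:
  "carrier (encode_module \<Phi>0 F0) = \<Phi>0 ` carrier F0" "carrier (encode_module \<Phi>1 F1) = \<Phi>1 ` carrier F1"
  "carrier (encode_module \<Phi>2 F2) = \<Phi>2 ` carrier F2" "carrier (zero_module u) = {u}"
  by (simp_all add: encode_module_def zero_module_def)

lemma zeros: "zero (encode_module \<Phi> M) = \<Phi> \<zero>\<^bsub>M\<^esub>" "zero (zero_module u) = u"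
  by (simp_all add: encode_module_def zero_module_def)

lemma enc_aug_\<Phi>: "x \<in> carrier F0 \<Longrightarrow> enc_aug (\<Phi>0 x) = E x"
  by (simp add: enc_aug_def carriers inv_into_f_f[OF inj0])

lemma enc_diff_0: "y \<in> carrier F1 \<Longrightarrow> enc_diff 0 (\<Phi>1 y) = \<Phi>0 (D0 y)"
  by (simp add: enc_diff_def carriers inv_into_f_f[OF inj1])

lemma enc_diff_1: "w \<in> carrier F2 \<Longrightarrow> enc_diff (Suc 0) (\<Phi>2 w) = \<Phi>1 (D1 w)"
  by (simp add: enc_diff_def carriers inv_into_f_f[OF inj2])

lemma enc_module_above: "i > 2 \<Longrightarrow> carrier (enc_module i) = {\<zero>\<^bsub>enc_module i\<^esub>}"
  by (simp add: enc_module_def carriers zeros)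

lemma enc_left_module: "left_module A (enc_module i)"
  by (auto simp: enc_module_def intro: left_module_encode F0 F1 F2 inj0 inj1 inj2
      left_module_zero_module ring_axioms)

lemma enc_projective: "projective_module A (enc_module i)"
  by (auto simp: enc_module_def proj0 proj1 proj2 intro: projective_zero_module ring_axioms)

lemma enc_diff_homs: "enc_diff i \<in> module_homs A (enc_module (Suc i)) (enc_module i)"
proof -
  have "module_map A (enc_module (Suc i)) (enc_module i)
    (\<lambda>p. if i = 0 then \<Phi>0 (D0 (inv_into (carrier F1) \<Phi>1 p))
     else if i = Suc 0 then \<Phi>1 (D1 (inv_into (carrier F2) \<Phi>2 p)) else \<Phi>2 \<zero>\<^bsub>F2\<^esub>)"
  proof -
    consider "i = 0" | "i = Suc 0" | j where "i = Suc (Suc j)" by (metis old.nat.exhaust)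
    then show ?thesis
    proof cases
      case 1
      then show ?thesis
        using module_map_comp[OF module_map_comp[OF module_map_decode[OF F1 inj1] D0] module_map_encode[OF F0 inj0]]
        by simp
    next
      case 2
      then show ?thesis
        using module_map_comp[OF module_map_comp[OF module_map_decode[OF F2 inj2] D1] module_map_encode[OF F1 inj1]]
        by simp
    next
      case 3
      interpret M: left_module A "enc_module (Suc (Suc j))" by (rule enc_left_module)
      \<comment> \<open>The target is the encoded \<open>F2\<close> when \<open>j\<close> is 0 and a
        zero module otherwise; both have the same zero by the choice made in
        \<open>enc_module\<close>.\<close>
      have z: "\<Phi>2 \<zero>\<^bsub>F2\<^esub> = \<zero>\<^bsub>enc_module (Suc (Suc j))\<^esub>" by (cases j) (simp_all add: zeros)
      show ?thesis using 3 M.M.r_zero[OF M.M.zero_closed] by (intro module_mapI) (simp_all add: z)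
    qed
  qed
  then show ?thesis unfolding enc_diff_def by (rule restrict_module_homs[OF _ enc_left_module])
qed

lemma enc_resolution: "projective_resolution A N enc_module enc_diff enc_aug"
proof -
  interpret F0: left_module A F0 by (rule F0)
  interpret F1: left_module A F1 by (rule F1)
  interpret F2: left_module A F2 by (rule F2)
  have "enc_aug \<in> module_homs A (enc_module 0) N"
    unfolding enc_aug_def enc_module_simps
    by (rule restrict_module_homs[OF module_map_comp[OF module_map_decode[OF F0 inj0] E] left_module_encode[OF F0 inj0]])
  moreover have "enc_aug ` carrier (enc_module 0) = carrier N"
    using enc_aug_\<Phi> by (simp add: carriers image_image surj)
  moreover have "enc_diff 0 ` carrier (enc_module 1) = a_kernel (enc_module 0) N enc_aug"
  proof -
    have "enc_diff 0 ` carrier (enc_module 1) = \<Phi>0 ` D0 ` carrier F1"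
      using enc_diff_0 by (simp add: carriers image_image)
    also have "\<dots> = a_kernel (enc_module 0) N enc_aug"
      unfolding exact0 using enc_aug_\<Phi> by (auto simp: a_kernel_iff carriers)
    finally show ?thesis .
  qed
  moreover have "enc_diff (Suc i) ` carrier (enc_module (Suc (Suc i))) =
    a_kernel (enc_module (Suc i)) (enc_module i) (enc_diff i)" for i
  proof -
    consider "i = 0" | "i = Suc 0" | j where "i = Suc (Suc j)" by (metis old.nat.exhaust)
    then show ?thesis
    proof cases
      case 1
      have "enc_diff (Suc 0) ` carrier (enc_module (Suc (Suc 0))) = \<Phi>1 ` D1 ` carrier F2"
        using enc_diff_1 by (simp add: carriers image_image)
      also have "\<dots> = a_kernel (enc_module (Suc 0)) (enc_module 0) (enc_diff 0)"
        unfolding exact1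
        using enc_diff_0 inj_on_eq_iff[OF inj0 module_map_closed[OF D0] F0.M.zero_closed]
        by (auto simp: a_kernel_iff carriers zeros)
      finally show ?thesis using 1 by simp
    next
      case 2
      have "\<Phi>2 w \<in> a_kernel (enc_module (Suc (Suc 0))) (enc_module (Suc 0)) (enc_diff (Suc 0)) \<longleftrightarrow> w = \<zero>\<^bsub>F2\<^esub>"
        if "w \<in> carrier F2" for w
        using that enc_diff_1[OF that] inj_on_eq_iff[OF inj1 module_map_closed[OF D1 that] F1.M.zero_closed]
          exact2[OF that] module_map_zero[OF D1 F2 F1]
        by (auto simp: a_kernel_iff carriers zeros)
      then have "a_kernel (enc_module (Suc (Suc 0))) (enc_module (Suc 0)) (enc_diff (Suc 0)) = {\<Phi>2 \<zero>\<^bsub>F2\<^esub>}"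
        using F2.M.zero_closed by (auto simp: a_kernel_iff carriers)
      moreover have "enc_diff (Suc (Suc 0)) ` carrier (enc_module (Suc (Suc (Suc 0)))) = {\<Phi>2 \<zero>\<^bsub>F2\<^esub>}"
        by (simp add: enc_diff_def carriers)
      ultimately show ?thesis using 2 by simp
    next
      case 3
      have "\<zero>\<^bsub>enc_module (Suc (Suc j))\<^esub> = \<Phi>2 \<zero>\<^bsub>F2\<^esub>" by (cases j) (simp_all add: zeros)
      then show ?thesis using 3 by (auto simp: enc_diff_def carriers a_kernel_iff)
    qed
  qed
  ultimately show ?thesis
    unfolding projective_resolution_def using enc_projective enc_diff_homs by blast
qed

end

lemma proj_dim_le:
  fixes M :: "('c, 'm) module" and P :: "nat \<Rightarrow> ('c, 'm) module"
  assumes "projective_resolution A M P d e" "\<forall>i>n. carrier (P i) = {\<zero>\<^bsub>P i\<^esub>}"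
  shows "proj_dim A M \<le> enat n"
  unfolding proj_dim_def using assms by (intro INF_lower) blast

text \<open>An infimum of natural numbers below a finite bound is attained, and a resolution that
  ends earlier also ends at \<open>n\<close>.\<close>

lemma proj_dim_leD:
  fixes M :: "('c, 'm) module"
  assumes "proj_dim A M \<le> enat n"
  obtains P d e where "projective_resolution A M P d e" "\<forall>i>n. carrier (P i) = {\<zero>\<^bsub>P i :: ('c, 'm) module\<^esub>}"
proof -
  let ?S = "{n. \<exists>(P :: nat \<Rightarrow> ('c, 'm) module) d e.
     projective_resolution A M P d e \<and> (\<forall>i>n. carrier (P i) = {\<zero>\<^bsub>P i\<^esub>})}"
  have "\<exists>m\<in>?S. m \<le> n"
  proof (rule ccontr)
    assume "\<not> (\<exists>m\<in>?S. m \<le> n)"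
    then have "enat (Suc n) \<le> enat m" if "m \<in> ?S" for m using that by (simp add: not_le Suc_le_eq) blast
    then have "enat (Suc n) \<le> proj_dim A M" unfolding proj_dim_def by (rule INF_greatest)
    then show False using assms by (metis enat_ord_simps(1) not_less_eq_eq order_refl order_trans)
  qed
  then obtain m P d e where "m \<le> n" "projective_resolution A M P d e"
    "\<forall>i>m. carrier (P i) = {\<zero>\<^bsub>P i :: ('c, 'm) module\<^esub>}" by blast
  then show thesis using that by (meson le_less_trans)
qed

lemma proj_dim_le_global_dim:
  fixes M :: "('c, 'm) module"
  shows "left_module A M \<Longrightarrow> proj_dim A M \<le> global_dim TYPE('m) A"
  unfolding global_dim_def by (intro SUP_upper) simp

text \<open>\<open>global_dim\<close> ranges over modules with elements in 'm,
  \<open>trivial_module\<close> has its elements in 'k. The bound on projective dimension is applied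
  to this copy.\<close>

lemma (in presentation) trivial_like_encode:
  assumes gr: "\<And>n. gr n = \<pi> ` homogeneous n" and emb: "inj (emb :: 'k \<Rightarrow> 'm)"
  shows "trivial_like (encode_module emb (trivial_module A gr)) (emb 1)"
proof -
  note T = left_module_trivial[OF gr]
  have inj: "inj_on emb (carrier (trivial_module A gr))" using emb by (simp add: trivial_module_simps)
  note map = module_map_encode[OF T inj]
  have one: "1 \<in> carrier (trivial_module A gr)" by (simp add: trivial_module_simps)
  have act: "a \<odot>\<^bsub>encode_module emb (trivial_module A gr)\<^esub> emb 1 = emb (eps a)" if "a \<in> carrier A" for a
    using module_map_smult[OF map that one] that by (simp add: trivial_module_simps augmentation_eq[OF gr])
  have "\<exists>a\<in>carrier A. emb c = a \<odot>\<^bsub>encode_module emb (trivial_module A gr)\<^esub> emb 1" for c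
    by (rule bexI[of _ "\<pi> (scalar c)"]) (simp_all add: act)
  then show ?thesis
    unfolding trivial_like_def using left_module_encode[OF T inj] act injD[OF emb]
    by (auto simp: encode_module_def trivial_module_simps)
qed

section \<open>The resolution of an arbitrary module\<close>

locale form_presentation = presentation A \<pi> I + nondegenerate_matrix B B'
  for A :: "('k::field, 'c) module" (structure) and \<pi> :: "('n::finite list \<Rightarrow>\<^sub>0 'k) \<Rightarrow> 'c"
    and I :: "('n list \<Rightarrow>\<^sub>0 'k) set" and B B' :: "'n \<Rightarrow> 'n \<Rightarrow> 'k" +
  assumes I_eq: "I = relation_ideal B"
begin

abbreviation column :: "'n \<Rightarrow> 'n list \<Rightarrow>\<^sub>0 'k" where
  "column \<nu> \<equiv> linear_form (\<lambda>\<mu>. B \<mu> \<nu>)"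

end

text \<open>
  Elements of \<open>T \<otimes> V\<close>, for \<open>V\<close> the space with basis \<open>'m\<close>, are finitely supported functions
  from \<open>'m\<close> to \<open>T\<close>.
\<close>

definition tensor_with :: "('m \<Rightarrow>\<^sub>0 'k) \<Rightarrow> ('n list \<Rightarrow>\<^sub>0 'k::field) \<Rightarrow> 'm \<Rightarrow>\<^sub>0 ('n list \<Rightarrow>\<^sub>0 'k)" where
  "tensor_with v p = Poly_Mapping.map (\<lambda>c. scalar c * p) v"

definition scale_vec :: "'k \<Rightarrow> ('m \<Rightarrow>\<^sub>0 'k) \<Rightarrow> 'm \<Rightarrow>\<^sub>0 'k::field" where
  "scale_vec c v = Poly_Mapping.map (\<lambda>a. c * a) v"

definition right_mult :: "('m \<Rightarrow>\<^sub>0 ('n list \<Rightarrow>\<^sub>0 'k)) \<Rightarrow> ('n list \<Rightarrow>\<^sub>0 'k) \<Rightarrow> 'm \<Rightarrow>\<^sub>0 ('n list \<Rightarrow>\<^sub>0 'k::field)" where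
  "right_mult F q = Poly_Mapping.map (\<lambda>p. p * q) F"

definition left_mult :: "('n list \<Rightarrow>\<^sub>0 'k) \<Rightarrow> ('m \<Rightarrow>\<^sub>0 ('n list \<Rightarrow>\<^sub>0 'k)) \<Rightarrow> 'm \<Rightarrow>\<^sub>0 ('n list \<Rightarrow>\<^sub>0 'k::field)" where
  "left_mult q F = Poly_Mapping.map (\<lambda>p. q * p) F"

definition degree_part :: "nat \<Rightarrow> ('m \<Rightarrow>\<^sub>0 ('n list \<Rightarrow>\<^sub>0 'k)) \<Rightarrow> 'm \<Rightarrow>\<^sub>0 ('n list \<Rightarrow>\<^sub>0 'k::field)" where
  "degree_part n F = Poly_Mapping.map (component n) F"

lemma lookup_map_zero: "f 0 = 0 \<Longrightarrow> lookup (Poly_Mapping.map f v) x = f (lookup v x)"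
  by (simp add: map.rep_eq when_def)

lemma lookup_tensor_with: "lookup (tensor_with v p) x = scalar (lookup v x) * p"
  unfolding tensor_with_def by (rule lookup_map_zero) simp

lemma lookup_scale_vec: "lookup (scale_vec c v) x = c * lookup v x"
  unfolding scale_vec_def by (rule lookup_map_zero) simp

lemma lookup_right_mult: "lookup (right_mult F q) x = lookup F x * q"
  unfolding right_mult_def by (rule lookup_map_zero) simp

lemma lookup_left_mult: "lookup (left_mult q F) x = q * lookup F x"
  unfolding left_mult_def by (rule lookup_map_zero) simp

lemma lookup_degree_part: "lookup (degree_part n F) x = component n (lookup F x)"
  unfolding degree_part_def by (rule lookup_map_zero) simp

lemmas lookup_ops = lookup_tensor_with lookup_scale_vec lookup_right_mult lookup_left_mult
  lookup_degree_part lookup_add lookup_minus lookup_sum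

lemma tensor_with_add_left: "tensor_with (u + v) p = tensor_with u p + tensor_with v p"
  by (rule poly_mapping_eqI) (simp add: lookup_ops single_add distrib_right)

lemma tensor_with_add_right: "tensor_with v (p + q) = tensor_with v p + tensor_with v q"
  by (rule poly_mapping_eqI) (simp add: lookup_ops distrib_left)

lemma tensor_with_0 [simp]: "tensor_with 0 p = 0" "tensor_with v 0 = 0"
  by (rule poly_mapping_eqI, simp add: lookup_ops)+

lemma tensor_with_sum_left: "tensor_with (\<Sum>a\<in>S. f a) p = (\<Sum>a\<in>S. tensor_with (f a) p)"
  by (induction S rule: infinite_finite_induct) (simp_all add: tensor_with_add_left)

lemma tensor_with_sum_right: "tensor_with v (\<Sum>a\<in>S. f a) = (\<Sum>a\<in>S. tensor_with v (f a))"
  by (induction S rule: infinite_finite_induct) (simp_all add: tensor_with_add_right)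

lemma tensor_with_scale: "tensor_with (scale_vec c v) p = tensor_with v (scalar c * p)"
  by (rule poly_mapping_eqI) (simp add: lookup_ops mult.commute[of c] flip: mult.assoc)

lemma single_eq_tensor_with: "single x p = tensor_with (single x 1) p"
  by (rule poly_mapping_eqI) (auto simp: lookup_ops lookup_single when_def)

lemma single_eq_scale: "single x c = scale_vec c (single x (1 :: 'k::field))"
  by (rule poly_mapping_eqI) (auto simp: lookup_ops lookup_single when_def)

lemma right_mult_add: "right_mult (F + G) q = right_mult F q + right_mult G q"
  by (rule poly_mapping_eqI) (simp add: lookup_ops distrib_right)

lemma right_mult_tensor_with: "right_mult (tensor_with v p) q = tensor_with v (p * q)"
  by (rule poly_mapping_eqI) (simp add: lookup_ops mult.assoc)

lemma left_mult_tensor_with: "left_mult q (tensor_with v p) = tensor_with v (q * p)"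
  by (rule poly_mapping_eqI) (simp add: lookup_ops scalar_left_commute)

lemma left_mult_add: "left_mult q (F + G) = left_mult q F + left_mult q G"
  by (rule poly_mapping_eqI) (simp add: lookup_ops distrib_left)

lemma left_mult_right_mult: "left_mult p (right_mult F q) = right_mult (left_mult p F) q"
  by (rule poly_mapping_eqI) (simp add: lookup_ops mult.assoc)

lemma right_mult_0 [simp]: "right_mult 0 q = 0"
  by (rule poly_mapping_eqI) (simp add: lookup_ops)

lemma left_mult_0 [simp]: "left_mult q 0 = 0"
  by (rule poly_mapping_eqI) (simp add: lookup_ops)

lemma right_mult_sum: "right_mult (\<Sum>a\<in>S. f a) q = (\<Sum>a\<in>S. right_mult (f a) q)"
  by (rule poly_mapping_eqI) (simp add: lookup_ops sum_distrib_right)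

lemma left_mult_sum: "left_mult q (\<Sum>a\<in>S. f a) = (\<Sum>a\<in>S. left_mult q (f a))"
  by (rule poly_mapping_eqI) (simp add: lookup_ops sum_distrib_left)

lemma left_mult_diff: "left_mult q (F - G) = left_mult q F - left_mult q G"
  by (rule poly_mapping_eqI) (simp add: lookup_ops right_diff_distrib)

lemma left_mult_scalar_commute: "left_mult (scalar b) (left_mult q G) = left_mult q (left_mult (scalar b) G)"
  by (rule poly_mapping_eqI) (simp add: lookup_ops scalar_left_commute)

lemma eq_0_of_degree_parts:
  assumes "\<forall>n. degree_part n w = 0"
  shows "w = 0"
proof (rule poly_mapping_eqI)
  fix x
  have "component n (lookup w x) = 0" for n
    using assms by (simp flip: lookup_degree_part)
  then show "lookup w x = lookup 0 x" by (simp add: eq_0_of_components)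
qed

lemma degree_part_add: "degree_part n (F + G) = degree_part n F + degree_part n G"
  by (rule poly_mapping_eqI) (simp add: lookup_ops component_add)

lemma degree_part_0 [simp]: "degree_part n 0 = 0"
  by (rule poly_mapping_eqI) (simp add: lookup_ops)

lemma keys_degree_part: "keys (degree_part n F) \<subseteq> keys F"
  by (rule subsetI, rule ccontr) (simp add: in_keys_iff lookup_ops)

text \<open>The map id \<otimes> h on T \<otimes> V, for the linear map that sends the basis vector
  \<open>x\<close> to \<open>h x\<close>.\<close>

definition extend :: "('m \<Rightarrow> 'm \<Rightarrow>\<^sub>0 'k) \<Rightarrow> ('m \<Rightarrow>\<^sub>0 ('n list \<Rightarrow>\<^sub>0 'k)) \<Rightarrow> 'm \<Rightarrow>\<^sub>0 ('n list \<Rightarrow>\<^sub>0 'k::field)" where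
  "extend h F = (\<Sum>x\<in>keys F. tensor_with (h x) (lookup F x))"

lemma extend_add: "extend h (F + G) = extend h F + extend h G"
  unfolding extend_def
  by (rule setsum_keys_plus_distrib) (simp_all add: tensor_with_add_right)

lemma extend_single: "extend h (single x p) = tensor_with (h x) p"
  by (cases "p = 0") (simp_all add: extend_def)

lemma extend_0 [simp]: "extend h 0 = 0"
  by (simp add: extend_def)

lemma extend_left_mult: "extend h (left_mult q F) = left_mult q (extend h F)"
proof (induction F rule: poly_mapping_additive_induct)
  case (single x p)
  have "left_mult q (single x p) = single x (q * p)"
    unfolding single_eq_tensor_with by (simp add: left_mult_tensor_with)
  then show ?case by (simp add: extend_single left_mult_tensor_with)
qed (auto simp: left_mult_add extend_add intro: poly_mapping_eqI simp: lookup_ops)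

lemma extend_degree_part: "extend h (degree_part n F) = degree_part n (extend h F)"
proof (induction F rule: poly_mapping_additive_induct)
  case (single x p)
  have "degree_part n (single x p) = single x (component n p)"
    by (rule poly_mapping_eqI) (auto simp: lookup_ops lookup_single when_def)
  moreover have "degree_part n (tensor_with (h x) p) = tensor_with (h x) (component n p)"
  proof (rule poly_mapping_eqI)
    fix y
    show "lookup (degree_part n (tensor_with (h x) p)) y = lookup (tensor_with (h x) (component n p)) y"
      using component_mult_homogeneous_left[OF homogeneous_single[of "[]" 0], of n "lookup (h x) y" p]
      by (simp add: lookup_ops)
  qed
  ultimately show ?case by (simp add: extend_single)
next
  case (add F G)
  then show ?case by (simp add: extend_add degree_part_add)
qed (auto intro: poly_mapping_eqI simp: lookup_ops)

lemma lookup_extend: "lookup (extend h F) y = (\<Sum>x\<in>keys F. scalar (lookup (h x) y) * lookup F x)"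
  by (simp add: extend_def lookup_ops)

text \<open>A module over A in coordinates with respect to a K-basis \<open>X\<close>:
  \<open>act p v\<close> stands for the coordinates of p v. Vectors supported outside
  \<open>X\<close> are tolerated but are first rewritten in terms of the basis, so scalars act as
  scalars only on vectors supported in \<open>X\<close>.\<close>

locale coordinate_module = form_presentation A \<pi> I B B'
  for A :: "('k::field, 'c) module" (structure) and \<pi> :: "('n::finite list \<Rightarrow>\<^sub>0 'k) \<Rightarrow> 'c"
    and I :: "('n list \<Rightarrow>\<^sub>0 'k) set" and B B' :: "'n \<Rightarrow> 'n \<Rightarrow> 'k" +
  fixes X :: "'m set" and act :: "('n list \<Rightarrow>\<^sub>0 'k) \<Rightarrow> ('m \<Rightarrow>\<^sub>0 'k) \<Rightarrow> 'm \<Rightarrow>\<^sub>0 'k"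
  assumes act_add_left: "act (p + q) v = act p v + act q v"
    and act_add_right: "act p (u + v) = act p u + act p v"
    and act_mult: "act (p * q) v = act p (act q v)"
    and act_scale: "act p (scale_vec c v) = scale_vec c (act p v)"
    and act_I: "p \<in> I \<Longrightarrow> act p v = 0"
    and act_scalar: "keys v \<subseteq> X \<Longrightarrow> act (scalar c) v = scale_vec c v"
    and keys_act: "keys (act p v) \<subseteq> X"
begin

definition op :: "'n \<Rightarrow> ('m \<Rightarrow>\<^sub>0 ('n list \<Rightarrow>\<^sub>0 'k)) \<Rightarrow> 'm \<Rightarrow>\<^sub>0 ('n list \<Rightarrow>\<^sub>0 'k)" where
  "op \<nu> = extend (\<lambda>x. act (gen \<nu>) (single x 1))"

text \<open>The map T \<otimes> E \<otimes> M -> T \<otimes> M that sends a \<otimes> x \<otimes> m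
  to a x \<otimes> m - a \<otimes> x m. The first part raises the degree in T, the second preserves
  it.\<close>

definition diff1 :: "('n \<Rightarrow> 'm \<Rightarrow>\<^sub>0 ('n list \<Rightarrow>\<^sub>0 'k)) \<Rightarrow> 'm \<Rightarrow>\<^sub>0 ('n list \<Rightarrow>\<^sub>0 'k)" where
  "diff1 c = (\<Sum>\<nu>\<in>UNIV. right_mult (c \<nu>) (gen \<nu>) - op \<nu> (c \<nu>))"

text \<open>On a \<otimes> f \<otimes> m, each monomial of f has one letter absorbed into a, giving
  the columns of \<open>B\<close>, or one letter applied to m, giving its rows; the other letter
  stays in E.\<close>

definition diff2 :: "('m \<Rightarrow>\<^sub>0 ('n list \<Rightarrow>\<^sub>0 'k)) \<Rightarrow> 'n \<Rightarrow> 'm \<Rightarrow>\<^sub>0 ('n list \<Rightarrow>\<^sub>0 'k)" where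
  "diff2 w \<nu> = right_mult w (column \<nu>) + (\<Sum>\<mu>\<in>UNIV. left_mult (scalar (B \<nu> \<mu>)) (op \<mu> w))"

definition value_at :: "('m \<Rightarrow>\<^sub>0 ('n list \<Rightarrow>\<^sub>0 'k)) \<Rightarrow> 'm \<Rightarrow>\<^sub>0 'k" where
  "value_at F = (\<Sum>x\<in>keys F. act (lookup F x) (single x 1))"

text \<open>The kernel of T \<otimes> M -> A \<otimes> M. Exactness over A is exactness over T
  modulo this subspace.\<close>

definition vanishing :: "('m \<Rightarrow>\<^sub>0 ('n list \<Rightarrow>\<^sub>0 'k)) set" where
  "vanishing = {F. \<forall>x. lookup F x \<in> I}"

section \<open>Linearity, supports and composition of the differentials\<close>

lemma act_0 [simp]: "act 0 v = 0" "act p 0 = 0"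
  using act_add_left[of 0 0 v] act_add_right[of p 0 0] by simp_all

lemma act_sum_left: "act (\<Sum>a\<in>S. f a) v = (\<Sum>a\<in>S. act (f a) v)"
  by (induction S rule: infinite_finite_induct) (simp_all add: act_add_left)

lemma op_add: "op \<nu> (F + G) = op \<nu> F + op \<nu> G"
  by (simp add: op_def extend_add)

lemma op_0 [simp]: "op \<nu> 0 = 0"
  by (simp add: op_def)

lemma op_tensor_with: "op \<nu> (tensor_with v p) = tensor_with (act (gen \<nu>) v) p"
proof (induction v rule: poly_mapping_additive_induct)
  case (single x c)
  have "op \<nu> (tensor_with (single x c) p) = op \<nu> (single x (scalar c * p))"
    by (simp add: single_eq_scale[of x c] tensor_with_scale flip: single_eq_tensor_with)
  then show ?case
    by (simp add: op_def extend_single single_eq_scale[of x c] act_scale tensor_with_scale)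
qed (simp_all add: tensor_with_add_left op_add act_add_right)

lemma keys_op: "keys (op \<nu> F) \<subseteq> X"
proof -
  have "lookup (op \<nu> F) y = 0" if "y \<notin> X" for y
  proof -
    have "lookup (act (gen \<nu>) v) y = 0" for v
      using keys_act[of "gen \<nu>" v] that by (auto simp: in_keys_iff)
    then show ?thesis by (simp add: op_def lookup_extend)
  qed
  then show ?thesis by (auto simp: in_keys_iff)
qed

lemma diff2_add: "diff2 (F + G) \<nu> = diff2 F \<nu> + diff2 G \<nu>"
  by (simp add: diff2_def right_mult_add op_add left_mult_add sum.distrib)

lemma diff1_add: "diff1 (\<lambda>\<nu>. c \<nu> + c' \<nu>) = diff1 c + diff1 c'"
  by (simp add: diff1_def right_mult_add op_add sum.distrib sum_subtractf)

lemma diff1_0 [simp]: "diff1 (\<lambda>\<nu>. 0) = 0"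
  using diff1_add[of "\<lambda>_. 0" "\<lambda>_. 0"] by simp

lemma diff1_diff: "diff1 (\<lambda>\<nu>. c \<nu> - c' \<nu>) = diff1 c - diff1 c'"
  using diff1_add[of "\<lambda>\<nu>. c \<nu> - c' \<nu>" c'] by (simp add: algebra_simps)

lemma diff2_0 [simp]: "diff2 0 \<nu> = 0"
  using diff2_add[of 0 0 \<nu>] by simp

lemma diff2_diff: "diff2 (F - G) \<nu> = diff2 F \<nu> - diff2 G \<nu>"
  using diff2_add[of "F - G" G \<nu>] by (simp add: algebra_simps)

lemma diff1_left_mult: "diff1 (\<lambda>\<nu>. left_mult q (c \<nu>)) = left_mult q (diff1 c)"
  by (simp add: diff1_def op_def extend_left_mult left_mult_right_mult left_mult_sum left_mult_diff)

lemma diff2_left_mult: "diff2 (left_mult q F) \<nu> = left_mult q (diff2 F \<nu>)"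
  by (simp add: diff2_def op_def extend_left_mult left_mult_right_mult left_mult_add left_mult_sum
      left_mult_scalar_commute[of _ q])

lemma keys_tensor_with: "keys (tensor_with v p) \<subseteq> keys v"
  by (auto simp: in_keys_iff lookup_ops)

lemma keys_diff1: "(\<And>\<nu>. keys (c \<nu>) \<subseteq> X) \<Longrightarrow> keys (diff1 c) \<subseteq> X"
proof -
  assume c: "\<And>\<nu>. keys (c \<nu>) \<subseteq> X"
  have "lookup (diff1 c) y = 0" if "y \<notin> X" for y
  proof -
    have "lookup (op \<nu> F) y = 0" "lookup (c \<nu>) y = 0" for \<nu> F
      using that c[of \<nu>] keys_op[of \<nu> F] by (auto simp: in_keys_iff)
    then show ?thesis by (simp add: diff1_def lookup_ops)
  qed
  then show ?thesis by (auto simp: in_keys_iff)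
qed

lemma keys_diff2: "keys w \<subseteq> X \<Longrightarrow> keys (diff2 w \<nu>) \<subseteq> X"
proof -
  assume w: "keys w \<subseteq> X"
  have "lookup (diff2 w \<nu>) y = 0" if "y \<notin> X" for y
  proof -
    have "lookup (op \<nu> F) y = 0" "lookup w y = 0" for \<nu> F
      using that w keys_op[of \<nu> F] by (auto simp: in_keys_iff)
    then show ?thesis by (simp add: diff2_def lookup_ops)
  qed
  then show ?thesis by (auto simp: in_keys_iff)
qed

text \<open>The terms with one letter in T and one on M cancel, and those with both letters on M
  contain the action of f, which is 0. What remains over T is right multiplication by f.\<close>

lemma diff1_diff2: "diff1 (diff2 w) = right_mult w (bilinear_relation B)"
proof (induction w rule: poly_mapping_additive_induct)
  case zero
  have "diff2 0 = (\<lambda>\<nu>. 0)" by auto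
  then show ?case by (auto intro: poly_mapping_eqI simp: lookup_ops)
next
  case (add F G)
  have "diff2 (F + G) = (\<lambda>\<nu>. diff2 F \<nu> + diff2 G \<nu>)" by (auto simp: diff2_add)
  then show ?case by (simp add: diff1_add add right_mult_add)
next
  case (single x p)
  define v :: "'m \<Rightarrow>\<^sub>0 'k" where "v = single x 1"
  have sp: "single x p = tensor_with v p" by (simp add: v_def single_eq_tensor_with)
  have d2: "diff2 (tensor_with v p) \<nu> =
    tensor_with v (p * column \<nu>) + (\<Sum>\<mu>\<in>UNIV. tensor_with (act (gen \<mu>) v) (scalar (B \<nu> \<mu>) * p))" for \<nu>
    by (simp add: diff2_def right_mult_tensor_with op_tensor_with left_mult_tensor_with)

  have osum: "op \<nu> (\<Sum>a\<in>S. f a) = (\<Sum>a\<in>S. op \<nu> (f a))" for f \<nu> and S :: "'n set"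
    by (induction S rule: infinite_finite_induct) (simp_all add: op_add)
  have "diff1 (diff2 (tensor_with v p)) =
    (\<Sum>\<nu>\<in>UNIV. tensor_with v (p * column \<nu> * gen \<nu>))
    + (\<Sum>\<nu>\<in>UNIV. \<Sum>\<mu>\<in>UNIV. tensor_with (act (gen \<mu>) v) (scalar (B \<nu> \<mu>) * p * gen \<nu>))
    - (\<Sum>\<nu>\<in>UNIV. tensor_with (act (gen \<nu>) v) (p * column \<nu>))
    - (\<Sum>\<nu>\<in>UNIV. \<Sum>\<mu>\<in>UNIV. tensor_with (act (gen \<nu>) (act (gen \<mu>) v)) (scalar (B \<nu> \<mu>) * p))"
    unfolding diff1_def d2
    by (simp add: right_mult_add right_mult_sum osum op_add right_mult_tensor_with op_tensor_with
        sum.distrib sum_subtractf)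
  also have "(\<Sum>\<nu>\<in>UNIV. tensor_with v (p * column \<nu> * gen \<nu>)) = tensor_with v (p * bilinear_relation B)"
    by (simp add: bilinear_relation_eq_right sum_distrib_left mult.assoc flip: tensor_with_sum_right)
  \<comment> \<open>Exchanging the summations shows that this mixed term equals the one subtracted
    in the next line of the formula.\<close>
  also have "(\<Sum>\<nu>\<in>UNIV. \<Sum>\<mu>\<in>UNIV. tensor_with (act (gen \<mu>) v) (scalar (B \<nu> \<mu>) * p * gen \<nu>)) =
    (\<Sum>\<nu>\<in>UNIV. tensor_with (act (gen \<nu>) v) (p * column \<nu>))"
  proof (subst sum.swap, intro sum.cong refl)
    fix \<nu>
    have "p * column \<nu> = (\<Sum>\<mu>\<in>UNIV. scalar (B \<mu> \<nu>) * p * gen \<mu>)"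
      by (simp add: mult_linear_form)
    then show "(\<Sum>\<mu>\<in>UNIV. tensor_with (act (gen \<nu>) v) (scalar (B \<mu> \<nu>) * p * gen \<mu>)) =
      tensor_with (act (gen \<nu>) v) (p * column \<nu>)"
      by (simp add: tensor_with_sum_right)
  qed
  also have "(\<Sum>\<nu>\<in>UNIV. \<Sum>\<mu>\<in>UNIV. tensor_with (act (gen \<nu>) (act (gen \<mu>) v)) (scalar (B \<nu> \<mu>) * p)) =
    tensor_with (act (bilinear_relation B) v) p"
  proof -
    have "(single [\<nu>, \<mu>] b :: 'n list \<Rightarrow>\<^sub>0 'k) = gen \<nu> * (gen \<mu> * scalar b)" for \<nu> \<mu> b
      by (simp add: single_mult_single)
    moreover have "act (gen \<mu> * scalar b) v = scale_vec b (act (gen \<mu>) v)" for \<mu> b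
    proof -
      have "act (gen \<mu> * scalar b) v = act (scalar b) (act (gen \<mu>) v)"
        unfolding scalar_commute[of b "gen \<mu>", symmetric] by (rule act_mult)
      then show ?thesis by (simp add: act_scalar keys_act)
    qed
    ultimately have "act (single [\<nu>, \<mu>] b) v = scale_vec b (act (gen \<nu>) (act (gen \<mu>) v))" for \<nu> \<mu> b
      by (simp only: act_mult[of "gen \<nu>"] act_scale)
    then show ?thesis
      by (simp add: bilinear_relation_def act_sum_left tensor_with_sum_left tensor_with_scale)
  qed
  also have "act (bilinear_relation B) v = 0"
    by (rule act_I) (simp add: I_eq bilinear_relation_in_ideal)
  finally show ?case by (simp add: sp right_mult_tensor_with)
qed

lemma value_at_add: "value_at (F + G) = value_at F + value_at G"
  unfolding value_at_def
  by (rule setsum_keys_plus_distrib) (simp_all add: act_add_left)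

lemma value_at_single: "value_at (single x p) = act p (single x 1)"
  by (cases "p = 0") (simp_all add: value_at_def)

lemma value_at_0 [simp]: "value_at 0 = 0"
  by (simp add: value_at_def)

lemma value_at_diff: "value_at (F - G) = value_at F - value_at G"
  using value_at_add[of "F - G" G] by (simp add: algebra_simps)

lemma value_at_sum: "value_at (\<Sum>a\<in>S. f a) = (\<Sum>a\<in>S. value_at (f a))"
  by (induction S rule: infinite_finite_induct) (simp_all add: value_at_add)

lemma value_at_tensor_with: "value_at (tensor_with v p) = act p v"
proof (induction v rule: poly_mapping_additive_induct)
  case (single x c)
  have "value_at (tensor_with (single x c) p) = act (p * scalar c) (single x 1)"
    by (simp add: single_eq_scale[of x c] tensor_with_scale value_at_single scalar_commute
        flip: single_eq_tensor_with)
  also have "\<dots> = act p (single x c)"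
  proof -
    have "act (p * scalar c) (single x 1) = act (scalar c) (act p (single x 1))"
      unfolding scalar_commute[of c p, symmetric] by (rule act_mult)
    then show ?thesis
      by (simp add: act_scalar keys_act single_eq_scale[of x c] act_scale)
  qed
  finally show ?case .
qed (simp_all add: tensor_with_add_left value_at_add act_add_right)

lemma value_at_diff1: "value_at (diff1 c) = 0"
proof -
  have "value_at (right_mult F (gen \<nu>)) = value_at (op \<nu> F)" for F \<nu>
  proof (induction F rule: poly_mapping_additive_induct)
    case (single x p)
    show ?case
      unfolding single_eq_tensor_with[of x p] right_mult_tensor_with op_tensor_with value_at_tensor_with
      by (rule act_mult)
  qed (auto simp: right_mult_add op_add value_at_add)
  then show ?thesis by (simp add: diff1_def value_at_sum value_at_diff)
qed

lemma keys_value_at: "keys (value_at F) \<subseteq> X"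
  unfolding value_at_def using keys_sum keys_act by fastforce

text \<open>The letters of \<open>p\<close> are moved across the tensor sign one by one, starting
  with the last; each move changes the element by an image of \<open>diff1\<close>.\<close>

lemma tensor_with_mod_diff1:
  assumes "keys v \<subseteq> X"
  shows "\<exists>c. (\<forall>\<nu>. keys (c \<nu>) \<subseteq> X) \<and> tensor_with v p - tensor_with (act p v) 1 = diff1 c"
proof (induction p rule: poly_mapping_additive_induct)
  case zero
  show ?case by (rule exI[of _ "\<lambda>_. 0"]) simp
next
  case (add p q)
  then obtain c c' where "\<And>\<nu>. keys (c \<nu>) \<subseteq> X" "tensor_with v p - tensor_with (act p v) 1 = diff1 c"
    "\<And>\<nu>. keys (c' \<nu>) \<subseteq> X" "tensor_with v q - tensor_with (act q v) 1 = diff1 c'" by blast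
  moreover have "keys (c \<nu> + c' \<nu>) \<subseteq> X" if "\<And>\<nu>. keys (c \<nu>) \<subseteq> X" "\<And>\<nu>. keys (c' \<nu>) \<subseteq> X" for \<nu>
    using keys_add[of "c \<nu>" "c' \<nu>"] that by blast
  ultimately show ?case
    by (intro exI[of _ "\<lambda>\<nu>. c \<nu> + c' \<nu>"])
       (simp add: diff1_add tensor_with_add_right tensor_with_add_left act_add_left algebra_simps)
next
  case (single w a)
  show ?case using assms
  proof (induction w arbitrary: v rule: rev_induct)
    case Nil
    have "tensor_with v (scalar a) = tensor_with (act (scalar a) v) 1"
      by (simp add: act_scalar[OF Nil] tensor_with_scale)
    then show ?case by (intro exI[of _ "\<lambda>_. 0"]) simp
  next
    case (snoc \<nu> w)
    let ?s = "single w a" and ?v = "act (gen \<nu>) v"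
    obtain c where c: "\<And>\<mu>. keys (c \<mu>) \<subseteq> X" "tensor_with ?v ?s - tensor_with (act ?s ?v) 1 = diff1 c"
      using snoc.IH[of ?v] keys_act by blast
    \<comment> \<open>The chain whose boundary moves the single letter \<open>\<nu>\<close>;
      induction moves the remaining word.\<close>
    let ?e = "\<lambda>\<mu>. if \<mu> = \<nu> then tensor_with v ?s else 0"
    have "diff1 ?e = (\<Sum>\<mu>\<in>UNIV. if \<mu> = \<nu> then tensor_with v (?s * gen \<nu>) - tensor_with ?v ?s else 0)"
      unfolding diff1_def
      by (intro sum.cong refl) (auto simp: right_mult_tensor_with op_tensor_with simp del: single_mult_single)
    then have e: "diff1 ?e = tensor_with v (?s * gen \<nu>) - tensor_with ?v ?s" by simp
    have s: "single (w @ [\<nu>]) a = ?s * gen \<nu>" by (simp add: single_mult_single)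
    have "tensor_with v (single (w @ [\<nu>]) a) - tensor_with (act (single (w @ [\<nu>]) a) v) 1 = diff1 (\<lambda>\<mu>. ?e \<mu> + c \<mu>)"
      unfolding diff1_add e c(2)[symmetric] s act_mult by simp
    moreover have "keys (?e \<mu> + c \<mu>) \<subseteq> X" for \<mu>
      using keys_add[of "?e \<mu>" "c \<mu>"] c(1)[of \<mu>] keys_tensor_with[of v ?s] snoc.prems by (auto split: if_splits)
    ultimately show ?case by (intro exI[of _ "\<lambda>\<mu>. ?e \<mu> + c \<mu>"]) simp
  qed
qed

lemma exact_at_0:
  assumes F: "keys F \<subseteq> X"
  shows "\<exists>c. (\<forall>\<nu>. keys (c \<nu>) \<subseteq> X) \<and> F - tensor_with (value_at F) 1 = diff1 c"
proof -
  have sum: "\<exists>c. (\<forall>\<nu>. keys (c \<nu>) \<subseteq> X) \<and> G - tensor_with (value_at G) 1 = diff1 c"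
    if "finite S" "S \<subseteq> X" "G = (\<Sum>x\<in>S. single x (g x))" for S G g
    using that
  proof (induction S arbitrary: G)
    case empty
    then show ?case by (intro exI[of _ "\<lambda>_. 0"]) simp
  next
    case (insert x S)
    let ?G = "\<Sum>y\<in>S. single y (g y)"
    obtain c where c: "\<And>\<nu>. keys (c \<nu>) \<subseteq> X" "?G - tensor_with (value_at ?G) 1 = diff1 c"
      using insert.IH[of ?G] insert.prems by blast
    obtain c' where c': "\<And>\<nu>. keys (c' \<nu>) \<subseteq> X"
      "tensor_with (single x 1) (g x) - tensor_with (act (g x) (single x 1)) 1 = diff1 c'"
      using tensor_with_mod_diff1[of "single x 1" "g x"] insert.prems by auto
    have "keys (c' \<nu> + c \<nu>) \<subseteq> X" for \<nu> using keys_add[of "c' \<nu>" "c \<nu>"] c c' by blast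
    moreover have "G - tensor_with (value_at G) 1 = diff1 (\<lambda>\<nu>. c' \<nu> + c \<nu>)"
      unfolding diff1_add c(2)[symmetric] c'(2)[symmetric] insert.prems(2)
      using insert.hyps
      by (simp add: value_at_add value_at_single tensor_with_add_left single_eq_tensor_with[of x "g x"]
        value_at_tensor_with)
    ultimately show ?case by (intro exI[of _ "\<lambda>\<nu>. c' \<nu> + c \<nu>"]) simp
  qed
  have "F = (\<Sum>x\<in>keys F. single x (lookup F x))"
    by (rule poly_mapping_eqI) (auto simp: lookup_sum lookup_single when_def in_keys_iff)
  then show ?thesis using sum[of "keys F" F "lookup F"] F by simp
qed

section \<open>Exactness over A, by induction on the degree in T\<close>

lemma vanishing_diff: "F \<in> vanishing \<Longrightarrow> G \<in> vanishing \<Longrightarrow> F - G \<in> vanishing"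
  by (simp add: vanishing_def lookup_ops tensor_ideal_diff[OF ideal_I])

lemma vanishing_add: "F \<in> vanishing \<Longrightarrow> G \<in> vanishing \<Longrightarrow> F + G \<in> vanishing"
  by (simp add: vanishing_def lookup_ops tensor_ideal_add[OF ideal_I])

lemma vanishing_0: "0 \<in> vanishing"
  by (simp add: vanishing_def zero_in_I)

lemma vanishing_right_mult: "F \<in> vanishing \<Longrightarrow> right_mult F q \<in> vanishing"
  by (simp add: vanishing_def lookup_ops tensor_ideal_right[OF ideal_I])

lemma vanishing_left_mult: "F \<in> vanishing \<Longrightarrow> left_mult q F \<in> vanishing"
  by (simp add: vanishing_def lookup_ops tensor_ideal_left[OF ideal_I])

lemma vanishing_sum: "(\<And>a. a \<in> S \<Longrightarrow> f a \<in> vanishing) \<Longrightarrow> sum f S \<in> vanishing"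
  by (simp add: vanishing_def lookup_ops tensor_ideal_sum[OF ideal_I])

lemma vanishing_op: "F \<in> vanishing \<Longrightarrow> op \<nu> F \<in> vanishing"
  by (simp add: vanishing_def op_def lookup_extend tensor_ideal_sum[OF ideal_I] tensor_ideal_left[OF ideal_I])

lemma vanishing_degree_part: "F \<in> vanishing \<Longrightarrow> degree_part n F \<in> vanishing"
  by (simp add: vanishing_def lookup_ops component_I)

lemma vanishing_diff1: "(\<And>\<nu>. c \<nu> \<in> vanishing) \<Longrightarrow> diff1 c \<in> vanishing"
  unfolding diff1_def by (intro vanishing_sum vanishing_diff vanishing_right_mult vanishing_op)

lemma vanishing_diff2: "w \<in> vanishing \<Longrightarrow> diff2 w \<nu> \<in> vanishing"
  unfolding diff2_def
  by (intro vanishing_add vanishing_sum vanishing_left_mult vanishing_right_mult vanishing_op)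

lemma degree_bound: "\<exists>d. \<forall>n\<ge>d. degree_part n F = 0"
proof -
  define d where "d = Suc (Max (insert 0 ((\<lambda>x. max_degree (lookup F x)) ` keys F)))"
  have "component n (lookup F x) = 0" if "n \<ge> d" for n x
  proof (cases "x \<in> keys F")
    case True
    then have "max_degree (lookup F x) < d" by (auto simp: d_def less_Suc_eq_le intro: Max_ge)
    then show ?thesis using that by (intro component_above_max_degree) simp
  qed (simp add: in_keys_iff)
  then have "degree_part n F = 0" if "n \<ge> d" for n
    using that by (auto intro: poly_mapping_eqI simp: lookup_ops)
  then show ?thesis by blast
qed

lemma degree_part_diff: "degree_part n (F - G) = degree_part n F - degree_part n G"
  by (rule poly_mapping_eqI) (simp add: lookup_ops component_diff)

lemma degree_part_sum: "degree_part n (sum f S) = (\<Sum>a\<in>S. degree_part n (f a))"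
  by (rule poly_mapping_eqI) (simp add: lookup_ops component_sum)

lemma degree_part_degree_part: "degree_part m (degree_part n F) = (if m = n then degree_part n F else 0)"
  by (rule poly_mapping_eqI) (simp add: lookup_ops component_component)

lemma degree_part_op: "degree_part n (op \<nu> F) = op \<nu> (degree_part n F)"
  by (simp add: op_def extend_degree_part)

lemma degree_part_right_mult:
  assumes "q \<in> homogeneous 1"
  shows "degree_part (Suc n) (right_mult F q) = right_mult (degree_part n F) q"
  by (rule poly_mapping_eqI) (simp add: lookup_ops component_mult_homogeneous_right[OF assms])

lemma degree_part_left_mult_scalar: "degree_part n (left_mult (scalar c) F) = left_mult (scalar c) (degree_part n F)"
  by (rule poly_mapping_eqI)
     (simp add: lookup_ops component_mult_homogeneous_left[OF homogeneous_single[of "[]" 0]])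

lemma degree_part_diff2:
  "degree_part (Suc n) (diff2 w \<nu>) = right_mult (degree_part n w) (column \<nu>)
     + (\<Sum>\<mu>\<in>UNIV. left_mult (scalar (B \<nu> \<mu>)) (op \<mu> (degree_part (Suc n) w)))"
  by (simp add: diff2_def degree_part_add degree_part_right_mult[OF linear_form_homogeneous]
      degree_part_sum degree_part_left_mult_scalar degree_part_op)

text \<open>Only the part of the differentials that raises the degree matters for the leading terms, and
  for it exactness is \<open>mult_column_cancel\<close> and \<open>right_syzygy_homogeneous\<close>.\<close>

lemma exact_at_2:
  assumes "\<And>\<nu>. diff2 w \<nu> \<in> vanishing"
  shows "w \<in> vanishing"
proof -
  have "\<forall>w. (\<forall>n\<ge>d. degree_part n w = 0) \<longrightarrow> (\<forall>\<nu>. diff2 w \<nu> \<in> vanishing) \<longrightarrow> w \<in> vanishing" for d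
  proof (induction d)
    case 0
    show ?case using vanishing_0 eq_0_of_degree_parts by blast
  next
    case (Suc d)
    show ?case
    proof (intro allI impI)
      fix w assume top: "\<forall>n\<ge>Suc d. degree_part n w = 0" and w: "\<forall>\<nu>. diff2 w \<nu> \<in> vanishing"
      have "right_mult (degree_part d w) (column \<nu>) \<in> vanishing" for \<nu>
        using vanishing_degree_part[OF w[rule_format, of \<nu>], of "Suc d"] top
        by (simp add: degree_part_diff2)
      then have t: "degree_part d w \<in> vanishing"
        using mult_column_cancel[folded I_eq] by (auto simp: vanishing_def lookup_ops)
      have "w - degree_part d w \<in> vanishing"
      proof (rule Suc.IH[rule_format])
        show "degree_part n (w - degree_part d w) = 0" if "n \<ge> d" for n
          using that top by (cases "n = d") (auto simp: degree_part_diff degree_part_degree_part)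
        show "diff2 (w - degree_part d w) \<nu> \<in> vanishing" for \<nu>
          unfolding diff2_diff using w vanishing_diff2[OF t] by (intro vanishing_diff) auto
      qed
      then show "w \<in> vanishing" using vanishing_add[OF _ t] by fastforce
    qed
  qed
  then show ?thesis using degree_bound assms by blast
qed

text \<open>The syzygy lemma is applied separately at every basis vector of M. Choosing 0 wherever
  all \<open>c \<nu>\<close> vanish keeps the support of the lift finite.\<close>

lemma leading_term_lift:
  assumes c: "\<And>\<nu>. keys (c \<nu>) \<subseteq> X" and hom: "\<And>\<nu> x. lookup (c \<nu>) x \<in> homogeneous (Suc e)"
    and rel: "(\<Sum>\<nu>\<in>UNIV. right_mult (c \<nu>) (gen \<nu>)) \<in> vanishing"
  obtains w where "keys w \<subseteq> X" "\<And>x. lookup w x \<in> homogeneous e"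
    "\<And>\<nu>. c \<nu> - right_mult w (column \<nu>) \<in> vanishing"
proof -
  have "\<forall>x. \<exists>t. t \<in> homogeneous e \<and> (\<forall>\<nu>. lookup (c \<nu>) x - t * column \<nu> \<in> I) \<and>
      ((\<forall>\<nu>. lookup (c \<nu>) x = 0) \<longrightarrow> t = 0)"
  proof
    fix x
    show "\<exists>t. t \<in> homogeneous e \<and> (\<forall>\<nu>. lookup (c \<nu>) x - t * column \<nu> \<in> I) \<and>
      ((\<forall>\<nu>. lookup (c \<nu>) x = 0) \<longrightarrow> t = 0)"
    proof (cases "\<forall>\<nu>. lookup (c \<nu>) x = 0")
      case True
      then show ?thesis by (intro exI[of _ 0]) (simp add: zero_in_I)
    next
      case False
      have "(\<Sum>\<nu>\<in>UNIV. lookup (c \<nu>) x * gen \<nu>) \<in> relation_ideal B"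
        using rel by (simp add: vanishing_def lookup_ops flip: I_eq)
      then obtain t where "t \<in> homogeneous e" "\<And>\<nu>. lookup (c \<nu>) x - t * column \<nu> \<in> relation_ideal B"
        by (rule right_syzygy_homogeneous[OF _ hom]) blast
      then show ?thesis using False by (auto simp: I_eq)
    qed
  qed
  then obtain t where t: "\<And>x. t x \<in> homogeneous e" "\<And>x \<nu>. lookup (c \<nu>) x - t x * column \<nu> \<in> I"
    "\<And>x. (\<forall>\<nu>. lookup (c \<nu>) x = 0) \<Longrightarrow> t x = 0" by metis
  have sub: "{x. t x \<noteq> 0} \<subseteq> (\<Union>\<nu>. keys (c \<nu>))"
    by (rule subsetI, rule ccontr) (simp add: in_keys_iff t(3))
  then have "finite {x. t x \<noteq> 0}" by (rule finite_subset) auto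
  then have look: "lookup (Abs_poly_mapping t) = t" by simp
  show thesis
  proof (rule that[of "Abs_poly_mapping t"])
    show "keys (Abs_poly_mapping t) \<subseteq> X"
      using sub c by (auto simp: in_keys_iff look subset_iff)
  qed (simp_all add: look t vanishing_def lookup_ops)
qed

text \<open>The leading term of a cycle is a syzygy over A, hence lifts; subtracting
  \<open>diff2\<close> of the lift lowers the degree. As \<open>diff2\<close> composes with
  \<open>diff1\<close> to a multiple of f, the remainder is again a cycle modulo
  \<open>vanishing\<close>.\<close>

lemma exact_at_1:
  assumes "\<And>\<nu>. keys (c \<nu>) \<subseteq> X" "diff1 c \<in> vanishing"
  shows "\<exists>w. keys w \<subseteq> X \<and> (\<forall>\<nu>. c \<nu> - diff2 w \<nu> \<in> vanishing)"
proof -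
  have "\<forall>c. (\<forall>\<nu>. keys (c \<nu>) \<subseteq> X) \<longrightarrow> (\<forall>\<nu>. \<forall>n\<ge>d. degree_part n (c \<nu>) = 0) \<longrightarrow> diff1 c \<in> vanishing \<longrightarrow>
    (\<exists>w. keys w \<subseteq> X \<and> (\<forall>\<nu>. c \<nu> - diff2 w \<nu> \<in> vanishing))" for d
  proof (induction d)
    case 0
    show ?case
    proof (intro allI impI exI[of _ 0] conjI)
      fix c :: "'n \<Rightarrow> 'm \<Rightarrow>\<^sub>0 ('n list \<Rightarrow>\<^sub>0 'k)" and \<nu>
      assume "\<forall>\<nu>. \<forall>n\<ge>0. degree_part n (c \<nu>) = 0"
      then have "c \<nu> = 0" by (intro eq_0_of_degree_parts) simp
      then show "c \<nu> - diff2 0 \<nu> \<in> vanishing" by (simp add: vanishing_0)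
    qed simp
  next
    case (Suc d)
    show ?case
    proof (intro allI impI)
      fix c assume X: "\<forall>\<nu>. keys (c \<nu>) \<subseteq> X" and top: "\<forall>\<nu>. \<forall>n\<ge>Suc d. degree_part n (c \<nu>) = 0"
        and c: "diff1 c \<in> vanishing"
      let ?t = "\<lambda>\<nu>. degree_part d (c \<nu>)"
      have tX: "keys (?t \<nu>) \<subseteq> X" for \<nu>
        using X keys_degree_part[of d "c \<nu>"] by blast
      have "degree_part (Suc d) (diff1 c) = (\<Sum>\<nu>\<in>UNIV. right_mult (?t \<nu>) (gen \<nu>))"
        using top by (simp add: diff1_def degree_part_sum degree_part_diff degree_part_op
            degree_part_right_mult homogeneous_single)
      then have rel: "(\<Sum>\<nu>\<in>UNIV. right_mult (?t \<nu>) (gen \<nu>)) \<in> vanishing"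
        using vanishing_degree_part[OF c, of "Suc d"] by simp
      obtain w0 where w0: "keys w0 \<subseteq> X" "\<And>n. n \<ge> d \<Longrightarrow> degree_part n w0 = 0"
        "\<And>\<nu>. ?t \<nu> - right_mult w0 (column \<nu>) \<in> vanishing"
        "\<And>\<nu> n. n \<ge> Suc d \<Longrightarrow> degree_part n (right_mult w0 (column \<nu>)) = 0"
        "\<And>\<nu>. degree_part d (right_mult w0 (column \<nu>)) = right_mult w0 (column \<nu>)"
      proof (cases d)
        \<comment> \<open>In degree 0 there is nothing to lift: constants multiplied by generators
          give degree 1, where \<open>I\<close> is zero, so the leading term itself
          vanishes.\<close>
        case 0
        have "?t \<nu> \<in> vanishing" for \<nu>
          unfolding vanishing_def
        proof (intro CollectI allI)
          fix x
          define q where "q = (\<lambda>\<nu>. lookup (?t \<nu>) x)"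
          have q: "q \<nu> \<in> homogeneous 0" for \<nu> by (simp add: q_def 0 lookup_ops component_homogeneous)
          have "(\<Sum>\<nu>\<in>UNIV. q \<nu> * gen \<nu>) \<in> I"
            using rel by (simp add: vanishing_def lookup_ops q_def)
          then have "component 1 (\<Sum>\<nu>\<in>UNIV. q \<nu> * gen \<nu>) = 0" by (rule component_I_low) simp
          moreover have "component 1 (q \<nu> * gen \<nu>) = q \<nu> * gen \<nu>" for \<nu>
            using homogeneous_mult[OF q homogeneous_single[of "[\<nu>]" 1 1]] by (simp add: homogeneous_iff)
          ultimately have "(\<Sum>\<nu>\<in>UNIV. q \<nu> * gen \<nu>) = 0"
            by (simp add: component_sum)
          then have "q \<nu> = 0" for \<nu> using rquot_sum_gen[of \<nu> q] by simp
          then show "lookup (?t \<nu>) x \<in> I" by (simp add: q_def zero_in_I)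
        qed
        then show ?thesis using that[of 0] by simp
      next
        case (Suc e)
        obtain w where w: "keys w \<subseteq> X" "\<And>x. lookup w x \<in> homogeneous e"
          "\<And>\<nu>. ?t \<nu> - right_mult w (column \<nu>) \<in> vanishing"
          by (rule leading_term_lift[OF tX _ rel, of e]) (auto simp: lookup_ops Suc component_homogeneous)
        have w': "degree_part n w = (if n = e then w else 0)" for n
          by (rule poly_mapping_eqI) (simp add: lookup_ops component_of_homogeneous[OF w(2)])
        have "degree_part (Suc n) (right_mult w (column \<nu>)) = (if n = e then right_mult w (column \<nu>) else 0)" for n \<nu>
          by (simp add: degree_part_right_mult[OF linear_form_homogeneous] w')
        then have rm: "degree_part n (right_mult w (column \<nu>)) = (if n = d then right_mult w (column \<nu>) else 0)"
          if "n \<ge> d" for n \<nu>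
          using that Suc by (cases n) simp_all
        show ?thesis
        proof (rule that[OF w(1) _ w(3)])
          show "degree_part n w = 0" if "n \<ge> d" for n using that Suc by (simp add: w')
        qed (simp_all add: rm)
      qed
      define c' where "c' = (\<lambda>\<nu>. c \<nu> - diff2 w0 \<nu>)"
      \<comment> \<open>The leading part of \<open>c'\<close> is zero only modulo \<open>I\<close>,
        while the induction hypothesis asks for representatives that are really zero in degree
        \<open>d\<close>; so this part is removed.\<close>
      define c'' where "c'' = (\<lambda>\<nu>. c' \<nu> - degree_part d (c' \<nu>))"
      have "degree_part n (op \<mu> w0) = 0" if "n \<ge> d" for n \<mu>
        by (simp add: degree_part_op w0(2)[OF that])
      then have d2: "degree_part n (diff2 w0 \<nu>) = degree_part n (right_mult w0 (column \<nu>))" if "n \<ge> d" for n \<nu>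
        using that by (simp add: diff2_def degree_part_add degree_part_sum degree_part_left_mult_scalar)
      have t': "degree_part d (c' \<nu>) \<in> vanishing" for \<nu>
        using w0(3)[of \<nu>] by (simp add: c'_def degree_part_diff d2 w0(5))
      have c'X: "keys (c' \<nu>) \<subseteq> X" for \<nu>
        unfolding c'_def using X keys_diff2[OF w0(1), of \<nu>] keys_diff[of "c \<nu>" "diff2 w0 \<nu>"] by blast
      have "\<exists>w. keys w \<subseteq> X \<and> (\<forall>\<nu>. c'' \<nu> - diff2 w \<nu> \<in> vanishing)"
      proof (rule Suc.IH[rule_format])
        show "keys (c'' \<nu>) \<subseteq> X" for \<nu>
          using c'X[of \<nu>] keys_diff[of "c' \<nu>" "degree_part d (c' \<nu>)"] keys_degree_part[of d "c' \<nu>"]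
          unfolding c''_def by blast
        show "degree_part n (c'' \<nu>) = 0" if "n \<ge> d" for n \<nu>
          using that top d2 w0(4)
          by (cases "n = d") (auto simp: c''_def c'_def degree_part_diff degree_part_degree_part)
        have "diff1 c' = diff1 c - right_mult w0 (bilinear_relation B)"
          unfolding c'_def diff1_diff diff1_diff2 ..
        moreover have "right_mult w0 (bilinear_relation B) \<in> vanishing"
          using bilinear_relation_in_ideal[of B, folded I_eq]
          by (simp add: vanishing_def lookup_ops tensor_ideal_left[OF ideal_I])
        ultimately have "diff1 c' \<in> vanishing" using c vanishing_diff by simp
        then show "diff1 c'' \<in> vanishing"
          unfolding c''_def diff1_diff using vanishing_diff1[of "\<lambda>\<nu>. degree_part d (c' \<nu>)", OF t']
          by (rule vanishing_diff)
      qed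
      then obtain w where w: "keys w \<subseteq> X" "\<And>\<nu>. c'' \<nu> - diff2 w \<nu> \<in> vanishing" by blast
      have "c \<nu> - diff2 (w0 + w) \<nu> = (c'' \<nu> - diff2 w \<nu>) + degree_part d (c' \<nu>)" for \<nu>
        by (simp add: c''_def c'_def diff2_add)
      then have "c \<nu> - diff2 (w0 + w) \<nu> \<in> vanishing" for \<nu>
        using vanishing_add[OF w(2) t'] by simp
      moreover have "keys (w0 + w) \<subseteq> X" using keys_add[of w0 w] w0(1) w(1) by blast
      ultimately show "\<exists>w. keys w \<subseteq> X \<and> (\<forall>\<nu>. c \<nu> - diff2 w \<nu> \<in> vanishing)" by blast
    qed
  qed
  moreover obtain d where "\<forall>\<nu>. \<forall>n\<ge>d. degree_part n (c \<nu>) = 0"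
  proof -
    have "\<forall>\<nu>. \<exists>d. \<forall>n\<ge>d. degree_part n (c \<nu>) = 0" by (rule allI) (rule degree_bound)
    from choice[OF this] obtain f where f: "\<forall>\<nu>. \<forall>n\<ge>f \<nu>. degree_part n (c \<nu>) = 0" ..
    have "f \<nu> \<le> n" if "n \<ge> Max (range f)" for \<nu> n
      by (rule order_trans[OF _ that]) simp
    then show thesis
      by (intro that[of "Max (range f)"] allI impI f[rule_format])
  qed
  ultimately show ?thesis using assms by simp
qed

end

subsection \<open>Coordinates of a module\<close>

lemma vector_space_scale_vec: "vector_space (scale_vec :: 'k::field \<Rightarrow> ('m \<Rightarrow>\<^sub>0 'k) \<Rightarrow> 'm \<Rightarrow>\<^sub>0 'k)"
  by unfold_locales (rule poly_mapping_eqI, simp add: lookup_ops algebra_simps)+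

lemma (in abelian_monoid) finsum_superset:
  assumes "finite S" "T \<subseteq> S" "\<And>x. x \<in> S \<Longrightarrow> f x \<in> carrier G" "\<And>x. x \<in> S - T \<Longrightarrow> f x = \<zero>"
  shows "finsum G f T = finsum G f S"
  by (rule add.finprod_mono_neutral_cong_left) (use assms in auto)

text \<open>M is the quotient of the space of formal combinations of its elements by the kernel of
  evaluation. A basis of this kernel is completed by formal elements; these form a K-basis
  \<open>X\<close> of M. \<open>\<kappa>\<close> takes coordinates and \<open>\<rho>\<close>
  evaluates.\<close>

lemma (in presentation) module_coordinates:
  fixes M :: "('c, 'm) module"
  assumes M: "left_module A M"
  obtains X \<kappa> and \<rho> :: "('m \<Rightarrow>\<^sub>0 'k) \<Rightarrow> 'm" where "X \<subseteq> carrier M"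
    "\<And>v. \<rho> v \<in> carrier M" "\<And>u v. \<rho> (u + v) = \<rho> u \<oplus>\<^bsub>M\<^esub> \<rho> v"
    "\<And>c v. \<rho> (scale_vec c v) = \<pi> (scalar c) \<odot>\<^bsub>M\<^esub> \<rho> v" "\<And>x. x \<in> carrier M \<Longrightarrow> \<rho> (single x 1) = x"
    "\<And>m m'. m \<in> carrier M \<Longrightarrow> m' \<in> carrier M \<Longrightarrow> \<kappa> (m \<oplus>\<^bsub>M\<^esub> m') = \<kappa> m + \<kappa> m'"
    "\<And>c m. m \<in> carrier M \<Longrightarrow> \<kappa> (\<pi> (scalar c) \<odot>\<^bsub>M\<^esub> m) = scale_vec c (\<kappa> m)"
    "\<And>m. m \<in> carrier M \<Longrightarrow> keys (\<kappa> m) \<subseteq> X" "\<And>m. m \<in> carrier M \<Longrightarrow> \<rho> (\<kappa> m) = m"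
    "\<And>v. keys v \<subseteq> X \<Longrightarrow> \<kappa> (\<rho> v) = v"
proof -
  interpret M: left_module A M by (rule M)
  let ?s = "scale_vec :: 'k \<Rightarrow> ('m \<Rightarrow>\<^sub>0 'k) \<Rightarrow> 'm \<Rightarrow>\<^sub>0 'k"
  interpret V: vector_space_pair ?s ?s
    by (intro vector_space_pair.intro vector_space_scale_vec)
  let ?C = "carrier M"
  \<comment> \<open>Formal terms outside the carrier are ignored, which makes evaluation linear on
    the whole type.\<close>
  define \<rho> where "\<rho> v = finsum M (\<lambda>x. \<pi> (scalar (lookup v x)) \<odot>\<^bsub>M\<^esub> x) (keys v \<inter> ?C)" for v :: "'m \<Rightarrow>\<^sub>0 'k"
  have \<rho>_superset: "\<rho> v = finsum M (\<lambda>x. \<pi> (scalar (lookup v x)) \<odot>\<^bsub>M\<^esub> x) S"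
    if "finite S" "keys v \<inter> ?C \<subseteq> S" "S \<subseteq> ?C" for v S
    unfolding \<rho>_def
    by (rule M.M.finsum_superset) (use that in \<open>auto simp: M.smult_closed in_keys_iff \<pi>_0\<close>)
  have \<rho>_closed: "\<rho> v \<in> ?C" for v
    unfolding \<rho>_def by (rule M.M.finsum_closed) (auto simp: M.smult_closed)
  have \<rho>_add: "\<rho> (u + v) = \<rho> u \<oplus>\<^bsub>M\<^esub> \<rho> v" for u v
  proof -
    let ?S = "(keys u \<union> keys v) \<inter> ?C"
    have S: "finite ?S" "?S \<subseteq> ?C" "keys u \<inter> ?C \<subseteq> ?S" "keys v \<inter> ?C \<subseteq> ?S" "keys (u + v) \<inter> ?C \<subseteq> ?S"
      using keys_add[of u v] by auto
    have "\<rho> (u + v) = finsum M (\<lambda>x. \<pi> (scalar (lookup u x)) \<odot>\<^bsub>M\<^esub> x \<oplus>\<^bsub>M\<^esub> \<pi> (scalar (lookup v x)) \<odot>\<^bsub>M\<^esub> x) ?S"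
      unfolding \<rho>_superset[OF S(1,5,2)]
      by (rule M.M.finsum_cong') (auto simp: lookup_add single_add \<pi>_add M.smult_l_distr M.smult_closed)
    also have "\<dots> = \<rho> u \<oplus>\<^bsub>M\<^esub> \<rho> v"
      unfolding \<rho>_superset[OF S(1,3,2)] \<rho>_superset[OF S(1,4,2)]
      by (rule M.M.finsum_addf) (auto simp: M.smult_closed)
    finally show ?thesis .
  qed
  have \<rho>_scale: "\<rho> (?s c v) = \<pi> (scalar c) \<odot>\<^bsub>M\<^esub> \<rho> v" for c v
  proof -
    have sub: "keys (?s c v) \<inter> ?C \<subseteq> keys v \<inter> ?C" by (auto simp: in_keys_iff lookup_ops)
    have "\<rho> (?s c v) = finsum M (\<lambda>x. \<pi> (scalar c) \<odot>\<^bsub>M\<^esub> (\<pi> (scalar (lookup v x)) \<odot>\<^bsub>M\<^esub> x)) (keys v \<inter> ?C)"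
      unfolding \<rho>_superset[OF finite_Int[OF disjI1[OF finite_keys]] sub Int_lower2]
      by (rule M.M.finsum_cong') (auto simp: lookup_ops M.smult_closed \<pi>_mult[symmetric] mult.commute[of c] simp flip: M.smult_assoc)
    then show ?thesis
      unfolding \<rho>_def by (subst M.smult_finsum) (auto simp: M.smult_closed)
  qed
  have \<rho>_single: "\<rho> (single x 1) = x" if "x \<in> ?C" for x
    using \<rho>_superset[of "{x}" "single x 1"] that by (simp add: one_tensor[symmetric] \<pi>_one M.smult_one)
  have \<rho>_0: "\<rho> 0 = \<zero>\<^bsub>M\<^esub>" by (simp add: \<rho>_def)
  define U where "U = {v. keys v \<subseteq> ?C \<and> \<rho> v = \<zero>\<^bsub>M\<^esub>}"
  define D where "D = (\<lambda>x. single x (1 :: 'k)) ` ?C"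
  obtain BU where BU: "BU \<subseteq> U" "V.vs1.independent BU" "U \<subseteq> V.vs1.span BU"
    using V.vs1.maximal_independent_subset by blast
  obtain Bs where Bs: "BU \<subseteq> Bs" "Bs \<subseteq> BU \<union> D" "V.vs1.independent Bs" "BU \<union> D \<subseteq> V.vs1.span Bs"
    using V.vs1.maximal_independent_subset_extend[of BU "BU \<union> D"] BU by blast
  define X where "X = {x \<in> ?C. single x 1 \<in> Bs - BU}"
  \<comment> \<open>The projection onto the span of \<open>X\<close> along the kernel of evaluation:
    two formal combinations in the carrier with the same value have the same image.\<close>
  obtain g where g: "Vector_Spaces.linear ?s ?s g" "\<forall>b\<in>Bs. g b = (if b \<in> BU then 0 else b)"
    using V.linear_independent_extend[OF Bs(3), of "\<lambda>b. if b \<in> BU then 0 else b"] by blast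
  interpret g: Vector_Spaces.linear ?s ?s g by (rule g(1))
  define \<kappa> where "\<kappa> m = g (single m 1)" for m
  have X_C: "X \<subseteq> ?C" by (auto simp: X_def)
  have g_U: "g v = 0" if "v \<in> U" for v
  proof -
    have "v \<in> V.vs1.span BU" using that BU by blast
    then show ?thesis
    proof (induction rule: V.vs1.span_induct_alt)
      case base
      show ?case by (rule g.zero)
    next
      case (step c x y)
      then show ?case using g(2) Bs(1) by (auto simp: g.add g.scale intro: poly_mapping_eqI simp: lookup_ops)
    qed
  qed
  have g_keys_\<rho>: "keys (g v) \<subseteq> X \<and> \<rho> (g v) = \<rho> v" if "v \<in> V.vs1.span Bs" for v
    using that
  proof (induction rule: V.vs1.span_induct_alt)
    case base
    show ?case by (simp add: g.zero)
  next
    case (step c b v)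
    have "keys (g b) \<subseteq> X \<and> \<rho> (g b) = \<rho> b"
    proof (cases "b \<in> BU")
      case True
      then have "g b = 0" "\<rho> b = \<zero>\<^bsub>M\<^esub>" using g(2) Bs(1) BU(1) by (auto simp: U_def)
      then show ?thesis by (simp add: \<rho>_0)
    next
      case False
      then obtain x where "x \<in> ?C" "b = single x 1" using Bs(2) step by (auto simp: D_def)
      then show ?thesis using g(2) step False by (auto simp: X_def)
    qed
    moreover have "keys (?s c (g b)) \<subseteq> keys (g b)" by (auto simp: in_keys_iff lookup_ops)
    ultimately show ?case
      using step keys_add[of "?s c (g b)" "g v"] by (auto simp: g.add g.scale \<rho>_add \<rho>_scale)
  qed
  have g_single: "g (single x 1) = single x 1" if "x \<in> X" for x
    using g(2) that by (auto simp: X_def)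
  have g_id: "g v = v" if "keys v \<subseteq> X" for v
  proof -
    have "g (\<Sum>x\<in>S. single x (lookup v x)) = (\<Sum>x\<in>S. single x (lookup v x))" if "finite S" "S \<subseteq> X" for S
      using that by (induction S rule: finite_induct)
        (auto simp: g.zero g.add g_single g.scale single_eq_scale[of _ "lookup v _"])
    moreover have "(\<Sum>x\<in>keys v. single x (lookup v x)) = v"
      by (rule poly_mapping_eqI) (auto simp: lookup_sum lookup_single when_def in_keys_iff)
    ultimately show ?thesis using that by (metis finite_keys)
  qed
  have span: "single m 1 \<in> V.vs1.span Bs" if "m \<in> ?C" for m
    using that Bs(4) by (auto simp: D_def)
  have U_diff: "g u = g v" if "keys u \<subseteq> ?C" "keys v \<subseteq> ?C" "\<rho> u = \<rho> v" for u v
  proof -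
    have "\<rho> (u - v) \<oplus>\<^bsub>M\<^esub> \<rho> v = \<rho> v"
      using \<rho>_add[of "u - v" v] that(3) by simp
    then have "\<rho> (u - v) = \<zero>\<^bsub>M\<^esub>" using \<rho>_closed by (simp add: M.M.add.r_cancel_one)
    then have "u - v \<in> U" using that keys_diff[of u v] by (auto simp: U_def)
    then show ?thesis using g_U g.diff by fastforce
  qed
  have k1: "keys (single m (1 :: 'k)) \<subseteq> ?C" if "m \<in> ?C" for m using that by simp
  show thesis
  proof (rule that[of X \<rho> \<kappa>])
    show "\<kappa> (m \<oplus>\<^bsub>M\<^esub> m') = \<kappa> m + \<kappa> m'" if m: "m \<in> ?C" "m' \<in> ?C" for m m'
    proof -
      have "keys (single m 1 + single m' (1::'k)) \<subseteq> ?C" using keys_add[of "single m 1" "single m' (1::'k)"] m by auto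
      then show ?thesis
        unfolding \<kappa>_def g.add[symmetric] using m by (intro U_diff k1) (simp_all add: \<rho>_single \<rho>_add)
    qed
    show "\<kappa> (\<pi> (scalar c) \<odot>\<^bsub>M\<^esub> m) = ?s c (\<kappa> m)" if m: "m \<in> ?C" for c m
    proof -
      have "keys (?s c (single m 1)) \<subseteq> ?C" using m by (auto simp: in_keys_iff lookup_ops lookup_single when_def split: if_splits)
      then show ?thesis
        unfolding \<kappa>_def g.scale[symmetric] using m
        by (intro U_diff k1) (simp_all add: \<rho>_single \<rho>_scale M.smult_closed)
    qed
    show "keys (\<kappa> m) \<subseteq> X" "\<rho> (\<kappa> m) = m" if "m \<in> ?C" for m
      using g_keys_\<rho>[OF span[OF that]] \<rho>_single[OF that] by (simp_all add: \<kappa>_def)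
    show "\<kappa> (\<rho> v) = v" if v: "keys v \<subseteq> X" for v
    proof -
      have "g (single (\<rho> v) 1) = g v"
        using v X_C \<rho>_closed[of v] by (intro U_diff k1) (auto simp: \<rho>_single)
      then show ?thesis using g_id[OF v] by (simp add: \<kappa>_def)
    qed
  qed (use X_C \<rho>_closed \<rho>_add \<rho>_scale \<rho>_single in auto)
qed

context coordinate_module
begin

section \<open>Descent of the complex from T to free modules over A\<close>

definition to_free :: "('m \<Rightarrow>\<^sub>0 ('n list \<Rightarrow>\<^sub>0 'k)) \<Rightarrow> 'm \<Rightarrow> 'c" where
  "to_free F = (\<lambda>x. \<pi> (lookup F x))"

definition to_free1 :: "('n \<Rightarrow> 'm \<Rightarrow>\<^sub>0 ('n list \<Rightarrow>\<^sub>0 'k)) \<Rightarrow> 'n \<times> 'm \<Rightarrow> 'c" where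
  "to_free1 c = (\<lambda>y. \<pi> (lookup (c (fst y)) (snd y)))"

lemma to_free_closed: "keys F \<subseteq> X \<Longrightarrow> to_free F \<in> carrier (free_module A X)"
proof -
  assume "keys F \<subseteq> X"
  moreover have "{x. to_free F x \<noteq> \<zero>} \<subseteq> keys F"
    by (rule subsetI, rule ccontr) (simp add: to_free_def in_keys_iff \<pi>_0)
  ultimately show ?thesis
    using finite_subset[OF _ finite_keys] by (auto simp: carrier_free_module) (auto simp: to_free_def)
qed

lemma to_free_cases:
  assumes "G \<in> carrier (free_module A X)"
  obtains F where "keys F \<subseteq> X" "G = to_free F"
proof -
  have "\<forall>x. \<exists>p. G x = \<pi> p \<and> (G x = \<zero> \<longrightarrow> p = 0)"
    using assms \<pi>_surj \<pi>_0 unfolding carrier_free_module by (metis rangeE)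
  then obtain p where p: "\<And>x. G x = \<pi> (p x)" "\<And>x. G x = \<zero> \<Longrightarrow> p x = 0" by metis
  have "{x. p x \<noteq> 0} \<subseteq> {x. G x \<noteq> \<zero>}" using p(2) by auto
  then have "finite {x. p x \<noteq> 0}" using assms finite_subset by (auto simp: carrier_free_module)
  then have look: "lookup (Abs_poly_mapping p) = p" by simp
  have "keys (Abs_poly_mapping p) \<subseteq> X"
    using p(2) assms by (auto simp: in_keys_iff look carrier_free_module)
  then show thesis using that[of "Abs_poly_mapping p"] p(1) by (auto simp: to_free_def look)
qed

lemma to_free1_closed:
  assumes c: "\<And>\<nu>. keys (c \<nu>) \<subseteq> X"
  shows "to_free1 c \<in> carrier (free_module A ((UNIV :: 'n set) \<times> X))"
proof -
  have sub: "{y. to_free1 c y \<noteq> \<zero>} \<subseteq> (SIGMA \<nu>:UNIV. keys (c \<nu>))"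
  proof (rule subsetI, rule ccontr)
    fix y assume "y \<in> {y. to_free1 c y \<noteq> \<zero>}" "y \<notin> (SIGMA \<nu>:UNIV. keys (c \<nu>))"
    then show False by (cases y) (simp add: to_free1_def in_keys_iff \<pi>_0)
  qed
  have "finite {y. to_free1 c y \<noteq> \<zero>}" by (rule finite_subset[OF sub]) auto
  moreover have "to_free1 c y = \<zero>" if "y \<notin> UNIV \<times> X" for y
  proof -
    have "snd y \<notin> keys (c (fst y))" using that c by (cases y) auto
    then show ?thesis by (simp add: to_free1_def in_keys_iff \<pi>_0)
  qed
  ultimately show ?thesis by (simp add: carrier_free_module) (simp add: to_free1_def)
qed

lemma to_free1_cases:
  assumes G: "G \<in> carrier (free_module A ((UNIV :: 'n set) \<times> X))"
  obtains c where "\<And>\<nu>. keys (c \<nu>) \<subseteq> X" "G = to_free1 c"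
proof -
  have "(\<lambda>x. G (\<nu>, x)) \<in> carrier (free_module A X)" for \<nu>
  proof -
    have "{x. G (\<nu>, x) \<noteq> \<zero>} \<subseteq> snd ` {y. G y \<noteq> \<zero>}" by force
    then have "finite {x. G (\<nu>, x) \<noteq> \<zero>}" by (rule finite_subset) (use G in \<open>simp add: carrier_free_module\<close>)
    then show ?thesis using G by (simp add: carrier_free_module)
  qed
  then have "\<forall>\<nu>. \<exists>F. keys F \<subseteq> X \<and> (\<lambda>x. G (\<nu>, x)) = to_free F" by (metis to_free_cases)
  then obtain c where "\<And>\<nu>. keys (c \<nu>) \<subseteq> X" "\<And>\<nu>. (\<lambda>x. G (\<nu>, x)) = to_free (c \<nu>)" by metis
  then show thesis using that[of c] by (auto simp: to_free1_def to_free_def fun_eq_iff)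
qed

lemma to_free_eq_iff: "to_free F = to_free G \<longleftrightarrow> F - G \<in> vanishing"
  by (auto simp: to_free_def fun_eq_iff \<pi>_eq_iff vanishing_def lookup_minus)

lemma to_free1_eq_iff: "to_free1 c = to_free1 c' \<longleftrightarrow> (\<forall>\<nu>. c \<nu> - c' \<nu> \<in> vanishing)"
  by (auto simp: to_free1_def fun_eq_iff \<pi>_eq_iff vanishing_def lookup_minus)

lemma to_free_ops:
  "to_free F \<oplus>\<^bsub>free_module A X\<^esub> to_free G = to_free (F + G)"
  "\<pi> p \<odot>\<^bsub>free_module A X\<^esub> to_free F = to_free (left_mult p F)"
  "\<zero>\<^bsub>free_module A X\<^esub> = to_free 0"
  by (auto simp: to_free_def lookup_ops \<pi>_add \<pi>_mult \<pi>_0)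

lemma to_free1_ops:
  "to_free1 c \<oplus>\<^bsub>free_module A Y\<^esub> to_free1 c' = to_free1 (\<lambda>\<nu>. c \<nu> + c' \<nu>)"
  "\<pi> p \<odot>\<^bsub>free_module A Y\<^esub> to_free1 c = to_free1 (\<lambda>\<nu>. left_mult p (c \<nu>))"
  "\<zero>\<^bsub>free_module A Y\<^esub> = to_free1 (\<lambda>_. 0)"
  by (auto simp: to_free1_def lookup_ops \<pi>_add \<pi>_mult \<pi>_0)

lemma keys_left_mult: "keys (left_mult p F) \<subseteq> keys F"
  by (auto simp: in_keys_iff lookup_ops)

text \<open>An element of the free module has many representatives over T. One is chosen, and since
  \<open>diff1\<close> maps \<open>vanishing\<close> into itself the result does not depend on it;
  the same argument serves \<open>free_diff2\<close>.\<close>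

lemma free_diff1:
  obtains D where "module_map A (free_module A ((UNIV :: 'n set) \<times> X)) (free_module A X) D"
    "\<And>c. (\<And>\<nu>. keys (c \<nu>) \<subseteq> X) \<Longrightarrow> D (to_free1 c) = to_free (diff1 c)"
proof -
  define D where "D G = to_free (diff1 (SOME c. (\<forall>\<nu>. keys (c \<nu>) \<subseteq> X) \<and> G = to_free1 c))" for G
  have D: "D (to_free1 c) = to_free (diff1 c)" if c: "\<And>\<nu>. keys (c \<nu>) \<subseteq> X" for c
  proof -
    let ?c = "SOME c'. (\<forall>\<nu>. keys (c' \<nu>) \<subseteq> X) \<and> to_free1 c = to_free1 c'"
    have "(\<forall>\<nu>. keys (?c \<nu>) \<subseteq> X) \<and> to_free1 c = to_free1 ?c"
      by (rule someI[of _ c]) (use c in auto)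
    then have "diff1 (\<lambda>\<nu>. ?c \<nu> - c \<nu>) \<in> vanishing"
      using to_free1_eq_iff[of ?c c] by (intro vanishing_diff1) auto
    then show ?thesis unfolding D_def to_free_eq_iff diff1_diff .
  qed
  have "module_map A (free_module A ((UNIV :: 'n set) \<times> X)) (free_module A X) D"
  proof (rule module_mapI)
    fix G assume "G \<in> carrier (free_module A ((UNIV :: 'n set) \<times> X))"
    then obtain c where c: "\<And>\<nu>. keys (c \<nu>) \<subseteq> X" "G = to_free1 c" using to_free1_cases by metis
    show "D G \<in> carrier (free_module A X)"
      unfolding c(2) D[OF c(1)] by (rule to_free_closed[OF keys_diff1[OF c(1)]])
    { fix H assume "H \<in> carrier (free_module A ((UNIV :: 'n set) \<times> X))"
      then obtain c' where c': "\<And>\<nu>. keys (c' \<nu>) \<subseteq> X" "H = to_free1 c'" using to_free1_cases by metis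
      have "keys (c \<nu> + c' \<nu>) \<subseteq> X" for \<nu> using keys_add[of "c \<nu>" "c' \<nu>"] c(1) c'(1) by blast
      then show "D (G \<oplus>\<^bsub>free_module A ((UNIV :: 'n set) \<times> X)\<^esub> H) = D G \<oplus>\<^bsub>free_module A X\<^esub> D H"
        unfolding c(2) c'(2) to_free1_ops by (simp only: D c(1) c'(1) to_free_ops diff1_add) }
    fix a assume "a \<in> carrier A"
    then obtain p where p: "a = \<pi> p" by (rule carrier_cases)
    have "keys (left_mult p (c \<nu>)) \<subseteq> X" for \<nu> using keys_left_mult[of p "c \<nu>"] c(1) by blast
    then show "D (a \<odot>\<^bsub>free_module A ((UNIV :: 'n set) \<times> X)\<^esub> G) = a \<odot>\<^bsub>free_module A X\<^esub> D G"
      unfolding c(2) p to_free1_ops by (simp only: D c(1) to_free_ops diff1_left_mult)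
  qed
  then show thesis using that D by blast
qed

lemma free_diff2:
  obtains D where "module_map A (free_module A X) (free_module A ((UNIV :: 'n set) \<times> X)) D"
    "\<And>F. keys F \<subseteq> X \<Longrightarrow> D (to_free F) = to_free1 (diff2 F)"
proof -
  define D where "D G = to_free1 (diff2 (SOME F. keys F \<subseteq> X \<and> G = to_free F))" for G
  have D: "D (to_free F) = to_free1 (diff2 F)" if F: "keys F \<subseteq> X" for F
  proof -
    let ?F = "SOME F'. keys F' \<subseteq> X \<and> to_free F = to_free F'"
    have "keys ?F \<subseteq> X \<and> to_free F = to_free ?F"
      by (rule someI[of _ F]) (use F in auto)
    then have "?F - F \<in> vanishing" using to_free_eq_iff[of ?F F] by simp
    then have "diff2 (?F - F) \<nu> \<in> vanishing" for \<nu> by (rule vanishing_diff2)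
    then show ?thesis unfolding D_def to_free1_eq_iff diff2_diff by blast
  qed
  have "module_map A (free_module A X) (free_module A ((UNIV :: 'n set) \<times> X)) D"
  proof (rule module_mapI)
    fix G assume "G \<in> carrier (free_module A X)"
    then obtain F where F: "keys F \<subseteq> X" "G = to_free F" by (rule to_free_cases)
    show "D G \<in> carrier (free_module A ((UNIV :: 'n set) \<times> X))"
      unfolding F(2) D[OF F(1)] by (rule to_free1_closed[OF keys_diff2[OF F(1)]])
    { fix H assume "H \<in> carrier (free_module A X)"
      then obtain F' where F': "keys F' \<subseteq> X" "H = to_free F'" by (rule to_free_cases)
      have "keys (F + F') \<subseteq> X" using keys_add[of F F'] F F' by blast
      moreover have "diff2 (F + F') = (\<lambda>\<nu>. diff2 F \<nu> + diff2 F' \<nu>)" by (auto simp: diff2_add)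
      ultimately show "D (G \<oplus>\<^bsub>free_module A X\<^esub> H) = D G \<oplus>\<^bsub>free_module A ((UNIV :: 'n set) \<times> X)\<^esub> D H"
        unfolding F(2) F'(2) to_free_ops by (simp only: D F(1) F'(1) to_free1_ops) }
    fix a assume "a \<in> carrier A"
    then obtain p where p: "a = \<pi> p" by (rule carrier_cases)
    have "keys (left_mult p F) \<subseteq> X" using keys_left_mult[of p F] F by blast
    moreover have "diff2 (left_mult p F) = (\<lambda>\<nu>. left_mult p (diff2 F \<nu>))" by (auto simp: diff2_left_mult)
    ultimately show "D (a \<odot>\<^bsub>free_module A X\<^esub> G) = a \<odot>\<^bsub>free_module A ((UNIV :: 'n set) \<times> X)\<^esub> D G"
      unfolding F(2) p to_free_ops by (simp only: D F(1) to_free1_ops)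
  qed
  then show thesis using that D by blast
qed

end

context form_presentation
begin

text \<open>The terms A \<otimes> M, A \<otimes> E \<otimes> M, A \<otimes> M are free on
  \<open>X\<close>, on pairs, and on \<open>X\<close>, because M is replaced by its underlying
  vector space. Its action survives in the differentials only.\<close>

lemma proj_dim_le_2:
  fixes M :: "('c, 'm) module"
  assumes U: "infinite (UNIV :: 'm set)" and k: "(UNIV :: 'k set) \<lesssim> (UNIV :: 'm set)" and M: "left_module A M"
  shows "proj_dim A M \<le> 2"
proof -
  interpret M: left_module A M by (rule M)
  obtain X \<kappa> and \<rho> :: "('m \<Rightarrow>\<^sub>0 'k) \<Rightarrow> 'm" where X: "X \<subseteq> carrier M"
    and \<rho>: "\<And>v. \<rho> v \<in> carrier M" "\<And>u v. \<rho> (u + v) = \<rho> u \<oplus>\<^bsub>M\<^esub> \<rho> v"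
    "\<And>c v. \<rho> (scale_vec c v) = \<pi> (scalar c) \<odot>\<^bsub>M\<^esub> \<rho> v" "\<And>x. x \<in> carrier M \<Longrightarrow> \<rho> (single x 1) = x"
    and \<kappa>: "\<And>m m'. m \<in> carrier M \<Longrightarrow> m' \<in> carrier M \<Longrightarrow> \<kappa> (m \<oplus>\<^bsub>M\<^esub> m') = \<kappa> m + \<kappa> m'"
    "\<And>c m. m \<in> carrier M \<Longrightarrow> \<kappa> (\<pi> (scalar c) \<odot>\<^bsub>M\<^esub> m) = scale_vec c (\<kappa> m)"
    "\<And>m. m \<in> carrier M \<Longrightarrow> keys (\<kappa> m) \<subseteq> X" "\<And>m. m \<in> carrier M \<Longrightarrow> \<rho> (\<kappa> m) = m"
    "\<And>v. keys v \<subseteq> X \<Longrightarrow> \<kappa> (\<rho> v) = v"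
    by (rule module_coordinates[OF M]) blast
  have "scale_vec 0 0 = (0 :: 'm \<Rightarrow>\<^sub>0 'k)" by (rule poly_mapping_eqI) (simp add: lookup_ops)
  then have \<rho>0: "\<rho> 0 = \<zero>\<^bsub>M\<^esub>" using \<rho>(3)[of 0 0] \<rho>(1) by (simp add: \<pi>_0)
  define act where "act p v = \<kappa> (\<pi> p \<odot>\<^bsub>M\<^esub> \<rho> v)" for p v
  have cl: "\<pi> p \<odot>\<^bsub>M\<^esub> \<rho> v \<in> carrier M" for p v by (simp add: M.smult_closed \<rho>)
  have \<kappa>0: "\<kappa> \<zero>\<^bsub>M\<^esub> = 0"
    using \<kappa>(1)[of "\<zero>\<^bsub>M\<^esub>" "\<zero>\<^bsub>M\<^esub>"] by simp
  interpret C: coordinate_module A \<pi> I B B' X act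
  proof unfold_locales
    fix p q :: "'n list \<Rightarrow>\<^sub>0 'k" and u v :: "'m \<Rightarrow>\<^sub>0 'k" and c :: 'k
    show "act (p + q) v = act p v + act q v"
      by (simp add: act_def \<pi>_add M.smult_l_distr \<rho> \<kappa> cl)
    show "act p (u + v) = act p u + act p v"
      by (simp add: act_def M.smult_r_distr \<rho> \<kappa> cl)
    show "act (p * q) v = act p (act q v)"
      by (simp add: act_def \<pi>_mult M.smult_assoc \<rho> \<kappa> cl)
    show "act p (scale_vec c v) = scale_vec c (act p v)"
    proof -
      have "\<pi> p \<odot>\<^bsub>M\<^esub> (\<pi> (scalar c) \<odot>\<^bsub>M\<^esub> \<rho> v) = \<pi> (scalar c) \<odot>\<^bsub>M\<^esub> (\<pi> p \<odot>\<^bsub>M\<^esub> \<rho> v)"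
        using scalar_commute[of c p] by (simp add: \<rho> flip: M.smult_assoc \<pi>_mult)
      then show ?thesis by (simp add: act_def \<rho> \<kappa> cl)
    qed
    show "act p v = 0" if "p \<in> I"
    proof -
      have "\<pi> p = \<zero>" using that by (simp add: \<pi>_zero_iff)
      then show ?thesis by (simp add: act_def \<rho> \<kappa>0)
    qed
    show "act (scalar c) v = scale_vec c v" if "keys v \<subseteq> X" using that by (simp add: act_def \<kappa> \<rho>)
    show "keys (act p v) \<subseteq> X" by (simp add: act_def \<kappa> cl)
  qed
  let ?F0 = "free_module A X" and ?F1 = "free_module A ((UNIV :: 'n set) \<times> X)"
  obtain D0 where D0: "module_map A ?F1 ?F0 D0"
    "\<And>c. (\<And>\<nu>. keys (c \<nu>) \<subseteq> X) \<Longrightarrow> D0 (C.to_free1 c) = C.to_free (C.diff1 c)"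
    by (rule C.free_diff1) blast
  obtain D1 where D1: "module_map A ?F0 ?F1 D1" "\<And>F. keys F \<subseteq> X \<Longrightarrow> D1 (C.to_free F) = C.to_free1 (C.diff2 F)"
    by (rule C.free_diff2) blast
  define E where "E = free_ext M (\<lambda>x. x)"
  have Xc: "\<And>x. x \<in> X \<Longrightarrow> x \<in> carrier M" using X by blast
  have E: "module_map A ?F0 M E" unfolding E_def by (rule free_ext_module_map[OF M Xc])
  have E_eq: "E (C.to_free F) = \<rho> (C.value_at F)" if F: "keys F \<subseteq> X" for F
  proof -
    have "\<rho> (\<Sum>x\<in>S. f x) = finsum M (\<lambda>x. \<rho> (f x)) S" if "finite S" for f and S :: "'m set"
      using that
    proof (induction S rule: finite_induct)
      case empty
      show ?case by (simp add: \<rho>0)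
    next
      case (insert x S)
      then show ?case using \<rho>(1) by (simp add: \<rho>(2))
    qed
    then have "\<rho> (C.value_at F) = finsum M (\<lambda>x. \<rho> (act (lookup F x) (single x 1))) (keys F)"
      by (simp add: C.value_at_def)
    also have "\<dots> = finsum M (\<lambda>x. C.to_free F x \<odot>\<^bsub>M\<^esub> x) (keys F)"
      by (rule M.M.finsum_cong') (use F X in \<open>auto simp: act_def \<kappa> cl \<rho> C.to_free_def M.smult_closed subset_iff\<close>)
    also have "\<dots> = E (C.to_free F)"
      unfolding E_def
    proof (rule free_ext_superset[OF M Xc C.to_free_closed[OF F], symmetric])
      show "{x. C.to_free F x \<noteq> \<zero>} \<subseteq> keys F"
        by (rule subsetI, rule ccontr) (simp add: C.to_free_def in_keys_iff \<pi>_0)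
    qed (use F in auto)
    finally show ?thesis ..
  qed
  have "infinite (UNIV :: 'm set)" by (rule U)
  then have nat: "(UNIV :: nat set) \<lesssim> (UNIV :: 'm set)" by (simp add: infinite_le_lepoll)
  have X_le: "X \<lesssim> (UNIV :: 'm set)" by (rule subset_imp_lepoll) simp
  have n_le: "(UNIV :: 'n set) \<lesssim> (UNIV :: 'm set)" by (rule finite_lepoll_infinite[OF U]) simp
  obtain \<Phi>0 :: "('m \<Rightarrow> 'c) \<Rightarrow> 'm" where \<Phi>0: "inj_on \<Phi>0 (carrier ?F0)" "projective_module A (encode_module \<Phi>0 ?F0)"
    by (rule free_module_inj[OF U k X_le])
  obtain \<Phi>1 :: "('n \<times> 'm \<Rightarrow> 'c) \<Rightarrow> 'm" where \<Phi>1: "inj_on \<Phi>1 (carrier ?F1)" "projective_module A (encode_module \<Phi>1 ?F1)"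
    by (rule free_module_inj[OF U k Times_lepoll_infinite[OF U n_le X_le]])
  interpret R: encoded_resolution A M ?F0 ?F1 ?F0 D0 D1 E \<Phi>0 \<Phi>1 \<Phi>0
  proof (intro encoded_resolution.intro encoded_resolution_axioms.intro ring_axioms M left_module_free \<Phi>0 \<Phi>1 E D0(1) D1(1))
    have "m \<in> E ` carrier ?F0" if m: "m \<in> carrier M" for m
    proof -
      have keys: "keys (tensor_with (\<kappa> m) (1 :: 'n list \<Rightarrow>\<^sub>0 'k)) \<subseteq> X"
        using C.keys_tensor_with[of "\<kappa> m" "1 :: 'n list \<Rightarrow>\<^sub>0 'k"] \<kappa>(3)[OF m] by blast
      have "E (C.to_free (tensor_with (\<kappa> m) 1)) = m"
        unfolding E_eq[OF keys] C.value_at_tensor_with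
        using m by (simp add: act_def \<kappa> \<pi>_one M.smult_one)
      then show ?thesis using C.to_free_closed[OF keys] by force
    qed
    then show "E ` carrier ?F0 = carrier M" using module_map_closed[OF E] by blast
    show "D0 ` carrier ?F1 = {x \<in> carrier ?F0. E x = \<zero>\<^bsub>M\<^esub>}"
    proof (intro equalityI subsetI)
      fix y assume "y \<in> D0 ` carrier ?F1"
      then obtain G where G: "G \<in> carrier ?F1" "y = D0 G" by blast
      obtain c where c: "\<And>\<nu>. keys (c \<nu>) \<subseteq> X" "G = C.to_free1 c" using C.to_free1_cases[OF G(1)] by metis
      have "E y = \<rho> 0"
        unfolding G c(2) D0(2)[OF c(1)] E_eq[OF C.keys_diff1[OF c(1)]] C.value_at_diff1 ..
      also have "\<rho> 0 = \<zero>\<^bsub>M\<^esub>" by (rule \<rho>0)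
      finally show "y \<in> {x \<in> carrier ?F0. E x = \<zero>\<^bsub>M\<^esub>}" using module_map_closed[OF D0(1) G(1)] G(2) by simp
    next
      fix y assume "y \<in> {x \<in> carrier ?F0. E x = \<zero>\<^bsub>M\<^esub>}"
      then have y: "y \<in> carrier ?F0" "E y = \<zero>\<^bsub>M\<^esub>" by auto
      obtain F where F: "keys F \<subseteq> X" "y = C.to_free F" using C.to_free_cases[OF y(1)] by metis
      have "\<rho> (C.value_at F) = \<zero>\<^bsub>M\<^esub>" using y(2) F E_eq by simp
      then have "C.value_at F = 0" using \<kappa>(5)[OF C.keys_value_at[of F]] \<kappa>0 by simp
      then obtain c where c: "\<And>\<nu>. keys (c \<nu>) \<subseteq> X" "F = C.diff1 c" using C.exact_at_0[OF F(1)] by auto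
      then have "y = D0 (C.to_free1 c)" using F D0(2) by simp
      then show "y \<in> D0 ` carrier ?F1" using C.to_free1_closed[of c, OF c(1)] by blast
    qed
    show "D1 ` carrier ?F0 = {y \<in> carrier ?F1. D0 y = \<zero>\<^bsub>?F0\<^esub>}"
    proof (intro equalityI subsetI)
      fix y assume "y \<in> D1 ` carrier ?F0"
      then obtain G where G: "G \<in> carrier ?F0" "y = D1 G" by blast
      obtain F where F: "keys F \<subseteq> X" "G = C.to_free F" using C.to_free_cases[OF G(1)] by metis
      have "right_mult F (bilinear_relation B) \<in> C.vanishing"
        using bilinear_relation_in_ideal[of B, folded I_eq]
        by (simp add: C.vanishing_def lookup_ops tensor_ideal_left[OF ideal_I])
      then have "D0 y = \<zero>\<^bsub>?F0\<^esub>"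
        unfolding G F(2) D1(2)[OF F(1)] C.to_free_ops D0(2)[of "C.diff2 F", OF C.keys_diff2[OF F(1)]] C.to_free_eq_iff
        by (simp add: C.diff1_diff2)
      then show "y \<in> {y \<in> carrier ?F1. D0 y = \<zero>\<^bsub>?F0\<^esub>}" using module_map_closed[OF D1(1) G(1)] G(2) by simp
    next
      fix y assume "y \<in> {y \<in> carrier ?F1. D0 y = \<zero>\<^bsub>?F0\<^esub>}"
      then have y: "y \<in> carrier ?F1" "D0 y = C.to_free 0" by (auto simp: C.to_free_def \<pi>_0)
      obtain c where c: "\<And>\<nu>. keys (c \<nu>) \<subseteq> X" "y = C.to_free1 c" using C.to_free1_cases[OF y(1)] by metis
      have "C.diff1 c \<in> C.vanishing" using y(2) unfolding c(2) D0(2)[OF c(1)] C.to_free_eq_iff by simp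
      then obtain w where w: "keys w \<subseteq> X" "\<forall>\<nu>. c \<nu> - C.diff2 w \<nu> \<in> C.vanishing"
        using C.exact_at_1[of c, OF c(1)] by blast
      have "y = D1 (C.to_free w)" unfolding D1(2)[OF w(1)] c(2) C.to_free1_eq_iff by (rule w(2))
      then show "y \<in> D1 ` carrier ?F0" using C.to_free_closed[OF w(1)] by blast
    qed
    fix w assume w: "w \<in> carrier ?F0" "D1 w = \<zero>\<^bsub>?F1\<^esub>"
    obtain F where F: "keys F \<subseteq> X" "w = C.to_free F" using C.to_free_cases[OF w(1)] by metis
    have "C.to_free1 (C.diff2 F) = C.to_free1 (\<lambda>_. 0)"
      using w(2) by (simp only: F(2) D1(2)[OF F(1)] C.to_free1_ops(3))
    then have "C.diff2 F \<nu> \<in> C.vanishing" for \<nu>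
      using C.to_free1_eq_iff[THEN iffD1, rule_format, of "C.diff2 F" "\<lambda>_. 0" \<nu>] by simp
    then have "F \<in> C.vanishing" by (rule C.exact_at_2)
    then have "C.to_free F = C.to_free 0" using C.to_free_eq_iff[of F 0] by simp
    then show "w = \<zero>\<^bsub>?F0\<^esub>" by (simp only: F(2) C.to_free_ops(3))
  qed
  have "proj_dim A M \<le> enat 2"
    by (rule proj_dim_le[OF R.enc_resolution]) (use R.enc_module_above in blast)
  then show ?thesis by (simp add: numeral_eq_enat)
qed

text \<open>The columns of \<open>B\<close> form a syzygy. If P2 were zero, the comparison would
  express it as minus its image under \<open>h1\<close>, whose values are multiples of that syzygy.
  So each column would equal an expression of order at least 2, contradicting its degree 1.\<close>

lemma no_short_resolution:
  assumes res: "projective_resolution A N P d e" and N: "trivial_like N u"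
    and P2: "carrier (P 2) = {\<zero>\<^bsub>P 2\<^esub>}"
  shows False
proof -
  note RM = left_module_free[of "UNIV :: 'n set"]
  interpret C: module_complex A P d
    by (rule resolution_complex[OF res]) (use N in \<open>simp add: trivial_like_def\<close>)
  obtain \<phi>1 \<psi>1 h1 k1 where
    \<phi>1: "module_map A row_module (P 1) \<phi>1" and \<psi>1: "module_map A (P 1) row_module \<psi>1" and
    h1: "module_map A row_module row_module h1" and
    \<phi>1_ker: "\<And>c. c \<in> carrier row_module \<Longrightarrow> row_sum gens c = \<zero> \<Longrightarrow> d 0 (\<phi>1 c) = \<zero>\<^bsub>P 0\<^esub>" and
    h1_ker: "\<And>c. c \<in> carrier row_module \<Longrightarrow> row_sum gens (h1 c) = \<zero>" and
    \<psi>\<phi>: "\<And>c. c \<in> carrier row_module \<Longrightarrow> row_sum gens c = \<zero> \<Longrightarrow> \<psi>1 (\<phi>1 c) = c \<oplus>\<^bsub>row_module\<^esub> h1 c"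
    by (rule trivial_comparison[OF res N]) blast
  let ?c = "\<lambda>l. \<pi> (column l)"
  have c: "?c \<in> carrier row_module" by (rule \<pi>_row_module)
  have ck: "row_sum gens ?c = \<zero>"
    unfolding row_sum_gens \<pi>_zero_iff using bilinear_relation_in_ideal[of B] by (simp add: bilinear_relation_eq_right I_eq)
  have "d (Suc 0) ` carrier (P (Suc (Suc 0))) = a_kernel (P (Suc 0)) (P 0) (d 0)"
    using res unfolding projective_resolution_def by blast
  then have "\<phi>1 ?c \<in> d 1 ` carrier (P 2)"
    using \<phi>1_ker[OF c ck] module_map_closed[OF \<phi>1 c] by (simp add: a_kernel_iff numeral_2_eq_2)
  moreover have "module_map A (P 2) (P 1) (d 1)" using C.d[of 1] by (simp add: numeral_2_eq_2)
  ultimately have "\<phi>1 ?c = \<zero>\<^bsub>P 1\<^esub>"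
    using module_map_zero[OF _ C.P C.P] by (auto simp: P2)
  then have zero: "?c \<oplus>\<^bsub>row_module\<^esub> h1 ?c = \<zero>\<^bsub>row_module\<^esub>"
    using \<psi>\<phi>[OF c ck] module_map_zero[OF \<psi>1 C.P RM] by simp
  have "\<exists>t. \<forall>\<mu>. h1 (unit_vector A l) \<mu> = \<pi> (t * column \<mu>)" for l
  proof -
    have u: "unit_vector A l \<in> carrier row_module" by (rule unit_vector_closed) simp
    obtain q where q: "h1 (unit_vector A l) = (\<lambda>\<mu>. \<pi> (q \<mu>))"
      using row_module_cases[OF module_map_closed[OF h1 u]] by metis
    have "(\<Sum>\<mu>\<in>UNIV. q \<mu> * gen \<mu>) \<in> relation_ideal B"
      using h1_ker[OF u] unfolding q row_sum_gens \<pi>_zero_iff I_eq .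
    then obtain t where "\<And>\<mu>. q \<mu> - t * column \<mu> \<in> relation_ideal B" by (rule right_syzygy) blast
    then show ?thesis unfolding q by (auto simp: \<pi>_eq_iff I_eq)
  qed
  then obtain t where t: "\<And>l \<mu>. h1 (unit_vector A l) \<mu> = \<pi> (t l * column \<mu>)" by metis
  fix \<mu> :: 'n
  have tc: "\<And>l. \<pi> (t l * column \<mu>) \<in> carrier A" by simp
  have ev: "module_map A row_module (regular_module A) (\<lambda>F. F \<mu>)"
    by (rule module_mapI) (auto simp: carrier_free_module)
  have "h1 ?c \<mu> = row_sum (\<lambda>l. \<pi> (t l * column \<mu>)) ?c"
    by (rule free_module_maps_eq[OF module_map_comp[OF h1 ev] row_sum_module_map[OF tc] C.regular _ c])
       (simp add: t row_sum_unit_vector[OF tc])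
  also have "\<dots> = \<pi> (\<Sum>l\<in>UNIV. column l * (t l * column \<mu>))"
    unfolding row_sum_def \<pi>_sum \<pi>_mult ..
  finally have "\<pi> (column \<mu> + (\<Sum>l\<in>UNIV. column l * (t l * column \<mu>))) = \<zero>"
    using fun_cong[OF zero, of \<mu>] by (simp add: \<pi>_add)
  then have "component 1 (column \<mu> + (\<Sum>l\<in>UNIV. column l * (t l * column \<mu>))) = 0"
    unfolding \<pi>_zero_iff by (rule component_I_low) simp
  moreover have "component 1 (column l * (t l * column \<mu>)) = 0" for l
    by (simp add: component_mult_homogeneous_left[OF linear_form_homogeneous] component_0_eq lookup_Nil_mult)
  moreover have "component 1 (column \<mu>) = column \<mu>"
    using linear_form_homogeneous by (simp add: homogeneous_iff)
  ultimately have "column \<mu> = 0" by (simp add: component_add component_sum)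
  then have "B \<nu> \<mu> = 0" for \<nu> using lookup_linear_form[of "\<lambda>\<nu>. B \<nu> \<mu>" \<nu>] by simp
  then show False using column_nonzero[of \<mu>] by auto
qed

text \<open>Every module obeys the upper bound, and the copy of K in 'm attains it, as
  \<open>no_short_resolution\<close> excludes length one.\<close>

lemma global_dim_eq_2:
  fixes emb :: "'k \<Rightarrow> 'm"
  assumes gr: "\<And>n. gr n = \<pi> ` homogeneous n" and U: "infinite (UNIV :: 'm set)" and emb: "inj emb"
  shows "global_dim TYPE('m) A = 2"
proof (rule antisym)
  have k: "(UNIV :: 'k set) \<lesssim> (UNIV :: 'm set)" using emb by (auto simp: lepoll_def)
  show "global_dim TYPE('m) A \<le> 2"
    unfolding global_dim_def using proj_dim_le_2[OF U k] by (intro SUP_least) simp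
  let ?N = "encode_module emb (trivial_module A gr)"
  have N: "trivial_like ?N (emb 1)" by (rule trivial_like_encode[OF gr emb])
  have "\<not> proj_dim A ?N \<le> enat 1"
  proof
    assume "proj_dim A ?N \<le> enat 1"
    then obtain P d e where "projective_resolution A ?N P d e" "\<forall>i>1. carrier (P i) = {\<zero>\<^bsub>P i :: ('c, 'm) module\<^esub>}"
      by (rule proj_dim_leD)
    then have "projective_resolution A ?N P d e" "carrier (P 2) = {\<zero>\<^bsub>P 2\<^esub>}" by simp_all
    then show False by (rule no_short_resolution[OF _ N])
  qed
  then have "2 \<le> proj_dim A ?N" by (cases "proj_dim A ?N") (auto simp: numeral_eq_enat)
  also have "\<dots> \<le> global_dim TYPE('m) A" using N by (intro proj_dim_le_global_dim) (simp add: trivial_like_def)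
  finally show "2 \<le> global_dim TYPE('m) A" .
qed

end

section \<open>The Gorenstein property\<close>

context presentation
begin

text \<open>The counterpart of \<open>ext_functional\<close>: a surjective functional on cocycles
  whose kernel consists of the coboundaries descends to cosets.\<close>

lemma ext_isomorphism:
  fixes P :: "nat \<Rightarrow> ('c, 'm) module"
  assumes gr: "\<And>n. gr n = \<pi> ` homogeneous n" and C: "module_complex A P d"
    and add: "\<And>z y. z \<in> ext_cocycles A P d i \<Longrightarrow> y \<in> ext_cocycles A P d i \<Longrightarrow>
       H (\<lambda>p\<in>carrier (P i). z p \<oplus> y p) = H z + H y"
    and smult: "\<And>z a. z \<in> ext_cocycles A P d i \<Longrightarrow> a \<in> carrier A \<Longrightarrow>
       H (\<lambda>p\<in>carrier (P i). z p \<otimes> a) = eps a * H z"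
    and zero: "\<And>z. z \<in> ext_cocycles A P d i \<Longrightarrow> H z = (0 :: 'k) \<longleftrightarrow> z \<in> ext_coboundaries A P d i"
    and surj: "\<And>c. \<exists>z\<in>ext_cocycles A P d i. H z = c"
  shows "\<exists>h \<in> module_homs A (ext_module A P d i) (trivial_module A gr).
     bij_betw h (carrier (ext_module A P d i)) (carrier (trivial_module A gr))"
proof -
  interpret C: module_complex A P d by (rule C)
  let ?Z = "ext_cocycles A P d i"
  have eq: "C.ext_class i z = C.ext_class i y \<longleftrightarrow> H z = H y" if z: "z \<in> ?Z" and y: "y \<in> ?Z" for z y
  proof -
    \<comment> \<open>Negation is right multiplication by the scalar -1, so the assumptions on sums
      and on the action determine \<open>H\<close> on differences.\<close>
    let ?m = "\<pi> (scalar (- 1))"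
    let ?y = "\<lambda>p\<in>carrier (P i). y p \<otimes> ?m"
    have y': "?y \<in> ?Z" by (rule C.cocycle_smult[OF y]) simp
    have "a \<otimes> ?m = \<ominus> a" if "a \<in> carrier A" for a
      using that by (elim carrier_cases) (simp add: scalar_commute[symmetric] single_uminus flip: \<pi>_mult \<pi>_uminus)
    then have "(\<lambda>p\<in>carrier (P i). z p \<ominus> y p) = (\<lambda>p\<in>carrier (P i). z p \<oplus> ?y p)"
      by (auto simp: a_minus_def C.cocycle_closed[OF y])
    then have "H (\<lambda>p\<in>carrier (P i). z p \<ominus> y p) = H z - H y"
      using add[OF z y'] smult[OF y, of ?m] by simp
    moreover have dZ: "(\<lambda>p\<in>carrier (P i). z p \<ominus> y p) \<in> ?Z"
      using C.cocycle_add[OF z y'] \<open>(\<lambda>p\<in>carrier (P i). z p \<ominus> y p) = _\<close> by simp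
    ultimately show ?thesis using C.ext_class_eq_iff[OF z y] zero[OF dZ] by auto
  qed
  define h where "h x = H (SOME z. z \<in> ?Z \<and> x = C.ext_class i z)" for x
  have h: "h (C.ext_class i z) = H z" if z: "z \<in> ?Z" for z
  proof -
    define y where "y = (SOME y. y \<in> ?Z \<and> C.ext_class i z = C.ext_class i y)"
    have "y \<in> ?Z \<and> C.ext_class i z = C.ext_class i y"
      unfolding y_def by (rule someI[of _ z]) (use z in simp)
    then have "H z = H y" using eq[OF z, of y] by blast
    then show ?thesis by (simp only: h_def flip: y_def)
  qed
  have ext_cases: "\<exists>z\<in>?Z. x = C.ext_class i z" if "x \<in> carrier (ext_module A P d i)" for x
    using that by (auto simp: C.carrier_ext)
  let ?E = "ext_module A P d i"
  have closed: "x \<oplus>\<^bsub>?E\<^esub> y \<in> carrier ?E" if xy: "x \<in> carrier ?E" "y \<in> carrier ?E" for x y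
  proof -
    obtain z z' where z: "z \<in> ?Z" "x = C.ext_class i z" "z' \<in> ?Z" "y = C.ext_class i z'"
      using ext_cases[OF xy(1)] ext_cases[OF xy(2)] by blast
    show ?thesis unfolding z(2,4) C.ext_class_add[OF z(1,3)] C.carrier_ext using C.cocycle_add[OF z(1,3)] by blast
  qed
  have closed': "a \<odot>\<^bsub>?E\<^esub> x \<in> carrier ?E" if a: "a \<in> carrier A" and x: "x \<in> carrier ?E" for a x
  proof -
    obtain z where z: "z \<in> ?Z" "x = C.ext_class i z" using ext_cases[OF x] by blast
    show ?thesis unfolding z(2) C.ext_class_smult[OF z(1) a] C.carrier_ext using C.cocycle_smult[OF z(1) a] by blast
  qed
  have hom: "restrict h (carrier ?E) \<in> module_homs A ?E (trivial_module A gr)"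
    unfolding module_homs_iff
  proof (intro conjI module_mapI)
    fix x assume x: "x \<in> carrier ?E"
    then obtain z where z: "z \<in> ?Z" "x = C.ext_class i z" using ext_cases by blast
    { fix y assume y: "y \<in> carrier ?E"
      then obtain z' where z': "z' \<in> ?Z" "y = C.ext_class i z'" using ext_cases by blast
      have "h (x \<oplus>\<^bsub>?E\<^esub> y) = h x + h y"
        unfolding z(2) z'(2) C.ext_class_add[OF z(1) z'(1)]
        using add[OF z(1) z'(1)] h[OF C.cocycle_add[OF z(1) z'(1)]] h[OF z(1)] h[OF z'(1)] by simp
      then show "restrict h (carrier ?E) (x \<oplus>\<^bsub>?E\<^esub> y) =
          restrict h (carrier ?E) x \<oplus>\<^bsub>trivial_module A gr\<^esub> restrict h (carrier ?E) y"
        using x y closed by (simp add: trivial_module_simps) }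
    fix a assume a: "a \<in> carrier A"
    have "h (a \<odot>\<^bsub>?E\<^esub> x) = eps a * h x"
      unfolding z(2) C.ext_class_smult[OF z(1) a]
      using smult[OF z(1) a] h[OF C.cocycle_smult[OF z(1) a]] h[OF z(1)] by simp
    then show "restrict h (carrier ?E) (a \<odot>\<^bsub>?E\<^esub> x) = a \<odot>\<^bsub>trivial_module A gr\<^esub> restrict h (carrier ?E) x"
      using x a closed' by (simp add: trivial_module_simps augmentation_eq[OF gr])
  qed (auto simp: trivial_module_simps)
  have "inj_on (restrict h (carrier ?E)) (carrier ?E)"
  proof (rule inj_onI)
    fix x y assume x: "x \<in> carrier ?E" and y: "y \<in> carrier ?E"
      and "restrict h (carrier ?E) x = restrict h (carrier ?E) y"
    then have hxy: "h x = h y" by simp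
    obtain z z' where "z \<in> ?Z" "x = C.ext_class i z" "z' \<in> ?Z" "y = C.ext_class i z'"
      using ext_cases[OF x] ext_cases[OF y] by blast
    then show "x = y" using eq h hxy by auto
  qed
  moreover have "c \<in> restrict h (carrier ?E) ` carrier ?E" for c
  proof -
    obtain z where z: "z \<in> ?Z" "H z = c" using surj by blast
    have "C.ext_class i z \<in> carrier ?E" using z by (auto simp: C.carrier_ext)
    then show ?thesis using h[OF z(1)] z(2) by force
  qed
  ultimately have "bij_betw (restrict h (carrier ?E)) (carrier ?E) (carrier (trivial_module A gr))"
    unfolding bij_betw_def by (auto simp: trivial_module_simps)
  then show ?thesis using hom by blast
qed

text \<open>A as a free module of rank one over the one-point index set, so that coding and
  projectivity are those of the other free modules.\<close>

abbreviation unit_module :: "('c, unit \<Rightarrow> 'c) module" where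
  "unit_module \<equiv> free_module A UNIV"

lemma unit_module_iff: "f \<in> carrier unit_module \<longleftrightarrow> f () \<in> carrier A"
  by (simp add: free_module_finite)

lemma unit_map_eval:
  assumes g: "module_map A unit_module (regular_module A) g" and f: "f \<in> carrier unit_module"
  shows "g f = f () \<otimes> g (\<lambda>_. \<one>)"
proof -
  have "f = f () \<odot>\<^bsub>unit_module\<^esub> (\<lambda>_. \<one>)" using f by (auto simp: unit_module_iff)
  then show ?thesis
    using module_map_smult[OF g, of "f ()" "\<lambda>_. \<one>"] f by (simp add: unit_module_iff)
qed

lemma row_map_eval:
  assumes g: "module_map A row_module (regular_module A) g"
  obtains q where "\<And>r. g (\<lambda>l. \<pi> (r l)) = \<pi> (\<Sum>l\<in>UNIV. r l * q l)"
proof -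
  have reg: "left_module A (regular_module A)" by (rule left_module_regular) (rule ring_axioms)
  have "\<forall>l. \<exists>p. g (unit_vector A l) = \<pi> p"
    using module_map_closed[OF g unit_vector_closed] \<pi>_surj by auto
  then obtain q where q: "\<And>l. g (unit_vector A l) = \<pi> (q l)" by metis
  have qc: "\<And>l. \<pi> (q l) \<in> carrier A" by simp
  have "g (\<lambda>l. \<pi> (r l)) = \<pi> (\<Sum>l\<in>UNIV. r l * q l)" for r
  proof -
    have "g (\<lambda>l. \<pi> (r l)) = row_sum (\<lambda>l. \<pi> (q l)) (\<lambda>l. \<pi> (r l))"
      by (rule free_module_maps_eq[OF g row_sum_module_map[OF qc] reg _ \<pi>_row_module])
         (simp add: q row_sum_unit_vector[OF qc])
    then show ?thesis by (simp add: row_sum_def \<pi>_sum \<pi>_mult)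
  qed
  then show thesis by (rule that)
qed

lemma dual_encode:
  assumes "left_module A F" "inj_on \<Phi> (carrier F)"
    and f: "module_map A (encode_module \<Phi> F) (regular_module A) f"
  shows "module_map A F (regular_module A) (\<lambda>x. f (\<Phi> x))"
  by (rule module_map_comp[OF module_map_encode[OF assms(1,2)] f])

end

context form_presentation
begin

text \<open>In the dual complex the image in degree 2 is generated by the columns. As they span all
  linear forms, it is the whole augmentation ideal, and the quotient is K.\<close>

lemma split_first_column:
  assumes "lookup p [] = 0"
  obtains q where "p = (\<Sum>\<nu>\<in>UNIV. column \<nu> * q \<nu>)"
proof -
  have "reverse p = (\<Sum>l\<in>UNIV. rquot l (reverse p) * gen l)"
    using split_last[of "reverse p"] assms by (simp add: lookup_reverse)
  then have "p = reverse (\<Sum>l\<in>UNIV. rquot l (reverse p) * gen l)" by (metis reverse_reverse)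
  also have "\<dots> = (\<Sum>l\<in>UNIV. gen l * reverse (rquot l (reverse p)))"
    by (simp add: reverse_sum reverse_mult)
  also have "\<dots> = (\<Sum>l\<in>UNIV. \<Sum>\<nu>\<in>UNIV. column \<nu> * (scalar (B' \<nu> l) * reverse (rquot l (reverse p))))"
    by (subst gen_eq_column_combination) (simp add: sum_distrib_right mult.assoc)
  also have "\<dots> = (\<Sum>\<nu>\<in>UNIV. column \<nu> * (\<Sum>l\<in>UNIV. scalar (B' \<nu> l) * reverse (rquot l (reverse p))))"
    by (subst sum.swap) (simp add: sum_distrib_left)
  finally show thesis by (rule that)
qed

text \<open>Dualizing the resolution of K gives 0 -> A -> A^(s+1) -> A -> 0 with right module maps.
  Exactness at the three places is \<open>gen_mult_cancel\<close>, \<open>left_syzygy\<close> and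
  \<open>split_first_column\<close>, the last with cokernel K.\<close>

lemma is_gorenstein:
  fixes emb :: "'k \<Rightarrow> 'm"
  assumes gr: "\<And>n. gr n = \<pi> ` homogeneous n" and U: "infinite (UNIV :: 'm set)" and emb: "inj emb"
  shows "gorenstein TYPE('m) A gr"
proof -
  let ?F = "unit_module" and ?R = "row_module" and ?N = "trivial_module A gr"
  have k: "(UNIV :: 'k set) \<lesssim> (UNIV :: 'm set)" using emb by (auto simp: lepoll_def)
  have u_le: "(UNIV :: unit set) \<lesssim> (UNIV :: 'm set)" and n_le: "(UNIV :: 'n set) \<lesssim> (UNIV :: 'm set)"
    by (rule finite_lepoll_infinite[OF U], simp)+
  obtain \<Phi>0 :: "(unit \<Rightarrow> 'c) \<Rightarrow> 'm" where \<Phi>0: "inj_on \<Phi>0 (carrier ?F)" "projective_module A (encode_module \<Phi>0 ?F)"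
    by (rule free_module_inj[OF U k u_le])
  obtain \<Phi>1 :: "('n \<Rightarrow> 'c) \<Rightarrow> 'm" where \<Phi>1: "inj_on \<Phi>1 (carrier ?R)" "projective_module A (encode_module \<Phi>1 ?R)"
    by (rule free_module_inj[OF U k n_le])
  note FM = left_module_free[of "UNIV :: unit set"] and RM = left_module_free[of "UNIV :: 'n set"]
  have genc: "\<And>l. gens l \<in> carrier A" by simp
  note rs = row_sum_module_map[of gens, OF genc]
  define E where "E f = eps (f ())" for f
  define D0 where "D0 c = (\<lambda>_::unit. row_sum gens c)" for c
  define D1 where "D1 f = (\<lambda>l. f () \<otimes> \<pi> (column l))" for f :: "unit \<Rightarrow> 'c"
  have D0\<pi>: "D0 (\<lambda>l. \<pi> (q l)) = (\<lambda>_. \<pi> (\<Sum>l\<in>UNIV. q l * gen l))" for q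
    by (simp add: D0_def row_sum_gens)
  have D1\<pi>: "D1 (\<lambda>_. \<pi> p) = (\<lambda>l. \<pi> (p * column l))" for p
    by (simp add: D1_def \<pi>_mult)
  have unit_cases: "\<exists>p. f = (\<lambda>_. \<pi> p)" if "f \<in> carrier ?F" for f
    using that \<pi>_surj by (auto simp: unit_module_iff fun_eq_iff)
  have row_cases: "\<exists>q. c = (\<lambda>l. \<pi> (q l))" if "c \<in> carrier ?R" for c
    using row_module_cases[OF that] by metis
  have E: "module_map A ?F ?N E"
    by (rule module_mapI)
       (auto simp: E_def trivial_module_simps unit_module_iff eps_add eps_mult augmentation_eq[OF gr])
  have D0: "module_map A ?R ?F D0"
    using rs unfolding module_map_def D0_def by (auto simp: unit_module_iff)
  have D1: "module_map A ?F ?R D1"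
    by (rule module_mapI) (auto simp: D1_def unit_module_iff free_module_finite l_distr m_assoc)
  interpret R: encoded_resolution A ?N ?F ?R ?F D0 D1 E \<Phi>0 \<Phi>1 \<Phi>0
  proof (intro encoded_resolution.intro encoded_resolution_axioms.intro ring_axioms FM RM \<Phi>0 \<Phi>1 E D0 D1
      left_module_trivial[OF gr])
    have "c \<in> E ` carrier ?F" for c
      by (rule image_eqI[of _ _ "\<lambda>_. \<pi> (scalar c)"]) (simp_all add: E_def unit_module_iff)
    then show "E ` carrier ?F = carrier ?N" by (auto simp: trivial_module_simps)
    show "D0 ` carrier ?R = {x \<in> carrier ?F. E x = \<zero>\<^bsub>?N\<^esub>}"
    proof (intro equalityI subsetI)
      fix f assume "f \<in> D0 ` carrier ?R"
      then obtain c where c: "c \<in> carrier ?R" "f = D0 c" by blast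
      then show "f \<in> {x \<in> carrier ?F. E x = \<zero>\<^bsub>?N\<^esub>}"
        using module_map_closed[OF D0 c(1)] eps_eq_0_iff[of "row_sum gens c"] module_map_closed[OF rs c(1)]
        by (auto simp: E_def D0_def trivial_module_simps)
    next
      fix f assume "f \<in> {x \<in> carrier ?F. E x = \<zero>\<^bsub>?N\<^esub>}"
      then have f: "f () \<in> carrier A" "eps (f ()) = 0" by (auto simp: unit_module_iff E_def trivial_module_simps)
      then obtain c where c: "c \<in> carrier ?R" "f () = row_sum gens c" using eps_eq_0_iff by blast
      then have "f = D0 c" by (auto simp: D0_def)
      then show "f \<in> D0 ` carrier ?R" using c by blast
    qed
    show "D1 ` carrier ?F = {y \<in> carrier ?R. D0 y = \<zero>\<^bsub>?F\<^esub>}"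
    proof (intro equalityI subsetI)
      fix c assume "c \<in> D1 ` carrier ?F"
      then obtain f where f: "f \<in> carrier ?F" "c = D1 f" by blast
      then obtain p where p: "f = (\<lambda>_. \<pi> p)" using unit_cases by blast
      have "p * bilinear_relation B \<in> I"
        unfolding I_eq by (intro tensor_ideal_left[OF tensor_ideal_Idl] bilinear_relation_in_ideal)
      then have "(\<Sum>l\<in>UNIV. (p * column l) * gen l) \<in> I"
        by (simp add: bilinear_relation_eq_right sum_distrib_left mult.assoc)
      then have "D0 c = \<zero>\<^bsub>?F\<^esub>" unfolding f(2) p D1\<pi> D0\<pi> by (simp add: \<pi>_zero_iff fun_eq_iff)
      then show "c \<in> {y \<in> carrier ?R. D0 y = \<zero>\<^bsub>?F\<^esub>}" using module_map_closed[OF D1 f(1)] f(2) by simp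
    next
      fix c assume "c \<in> {y \<in> carrier ?R. D0 y = \<zero>\<^bsub>?F\<^esub>}"
      then have c: "c \<in> carrier ?R" "D0 c = (\<lambda>_. \<zero>)" by auto
      then obtain q where q: "c = (\<lambda>l. \<pi> (q l))" using row_cases by blast
      have "(\<Sum>l\<in>UNIV. q l * gen l) \<in> relation_ideal B"
        using c(2) unfolding q D0\<pi> by (simp add: fun_eq_iff \<pi>_zero_iff I_eq)
      then obtain t where t: "\<And>l. q l - t * column l \<in> relation_ideal B" by (rule right_syzygy) blast
      have "c = D1 (\<lambda>_. \<pi> t)" unfolding q D1\<pi> using t by (simp add: \<pi>_eq_iff I_eq fun_eq_iff)
      moreover have "(\<lambda>_. \<pi> t) \<in> carrier ?F" by (simp add: unit_module_iff)
      ultimately show "c \<in> D1 ` carrier ?F" by blast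
    qed
    fix f assume f: "f \<in> carrier ?F" "D1 f = \<zero>\<^bsub>?R\<^esub>"
    obtain p where p: "f = (\<lambda>_. \<pi> p)" using unit_cases[OF f(1)] by blast
    have "p * column l \<in> relation_ideal B" for l
      using f(2) unfolding p D1\<pi> by (simp add: fun_eq_iff \<pi>_zero_iff I_eq)
    then have "p \<in> I" unfolding I_eq by (rule mult_column_cancel)
    then show "f = \<zero>\<^bsub>?F\<^esub>" by (simp add: p \<pi>_zero_iff fun_eq_iff)
  qed
  let ?P = R.enc_module and ?d = R.enc_diff
  note res = R.enc_resolution
  note Ccx = resolution_complex[OF res left_module_trivial[OF gr]]
  interpret C: module_complex A ?P ?d by (rule Ccx)
  have one: "(\<lambda>_. \<one>) \<in> carrier ?F" by (simp add: unit_module_iff)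
  have P: "?P 0 = encode_module \<Phi>0 ?F" "?P (Suc 0) = encode_module \<Phi>1 ?R" "?P (Suc (Suc 0)) = encode_module \<Phi>0 ?F"
    by simp_all
  have zmap: "module_map A (?P i) (regular_module A) z" "z \<in> extensional (carrier (?P i))"
    if "z \<in> ext_cocycles A ?P ?d i" for z i
    using that by (simp_all add: C.cocycles_iff)
  have zd: "z (?d i p) = \<zero>" if "z \<in> ext_cocycles A ?P ?d i" "p \<in> carrier (?P (Suc i))" for z i p
    using that by (simp add: C.cocycles_iff)
  have ext0: "z \<in> ext_coboundaries A ?P ?d 0" if z: "z \<in> ext_cocycles A ?P ?d 0" for z
  proof -
    have g: "module_map A ?F (regular_module A) (\<lambda>x. z (\<Phi>0 x))"
      by (rule dual_encode[OF FM \<Phi>0(1) zmap(1)[OF z, unfolded P]])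
    have "z (\<Phi>0 (\<lambda>_. \<one>)) \<in> carrier A" using module_map_closed[OF g one] by simp
    then obtain p where p: "z (\<Phi>0 (\<lambda>_. \<one>)) = \<pi> p" by (rule carrier_cases)
    \<comment> \<open>A cocycle in degree 0 is right multiplication by its value at 1, and vanishing
      on the image of the differential means that all generators annihilate this value.\<close>
    have "gen l * p \<in> relation_ideal B" for l
    proof -
      have u: "unit_vector A l \<in> carrier ?R" by (rule unit_vector_closed) simp
      have "\<zero> = z (?d 0 (\<Phi>1 (unit_vector A l)))"
        using zd[OF z, of "\<Phi>1 (unit_vector A l)"] u by (simp add: R.carriers)
      also have "\<dots> = z (\<Phi>0 (\<lambda>_. gens l))"
        unfolding R.enc_diff_0[OF u] by (simp add: D0_def row_sum_unit_vector[of gens, OF genc])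
      also have "\<dots> = gens l \<otimes> \<pi> p"
        using unit_map_eval[OF g, of "\<lambda>_. gens l"] by (simp add: unit_module_iff p)
      finally have "\<pi> (gen l * p) = \<zero>" by (simp add: \<pi>_mult)
      then show ?thesis by (simp add: I_eq \<pi>_zero_iff)
    qed
    then have "\<pi> p = \<zero>" unfolding \<pi>_zero_iff I_eq by (rule gen_mult_cancel)
    then have "z (\<Phi>0 f) = \<zero>" if "f \<in> carrier ?F" for f
      using unit_map_eval[OF g that] that by (simp add: p unit_module_iff)
    then have "z = (\<lambda>p\<in>carrier (?P 0). \<zero>)"
      using zmap(2)[OF z] by (auto simp: fun_eq_iff extensional_def R.carriers)
    then show ?thesis using C.coboundary_zero[of 0] by simp
  qed
  have ext1: "z \<in> ext_coboundaries A ?P ?d (Suc 0)" if z: "z \<in> ext_cocycles A ?P ?d (Suc 0)" for z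
  proof -
    have g: "module_map A ?R (regular_module A) (\<lambda>x. z (\<Phi>1 x))"
      by (rule dual_encode[OF RM \<Phi>1(1) zmap(1)[OF z, unfolded P]])
    obtain q where q: "\<And>r. z (\<Phi>1 (\<lambda>l. \<pi> (r l))) = \<pi> (\<Sum>l\<in>UNIV. r l * q l)"
      by (rule row_map_eval[OF g]) blast
    have "\<zero> = z (?d (Suc 0) (\<Phi>0 (\<lambda>_. \<one>)))"
      using zd[OF z, of "\<Phi>0 (\<lambda>_. \<one>)"] one by (simp add: R.carriers)
    also have "\<dots> = z (\<Phi>1 (\<lambda>l. \<pi> (column l)))"
      unfolding R.enc_diff_1[OF one] by (simp add: D1_def)
    also have "\<dots> = \<pi> (\<Sum>l\<in>UNIV. column l * q l)" by (rule q)
    finally have "\<pi> (\<Sum>l\<in>UNIV. column l * q l) = \<zero>" ..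
    then have "(\<Sum>l\<in>UNIV. column l * q l) \<in> relation_ideal B" by (simp add: \<pi>_zero_iff I_eq)
    then obtain t where t: "\<And>\<nu>. q \<nu> - gen \<nu> * t \<in> relation_ideal B" by (rule left_syzygy) blast
    \<comment> \<open>The left syzygy shows that the values of \<open>z\<close> are the generators
      times a common \<open>t\<close>; right multiplication by \<open>t\<close> is therefore a
      primitive.\<close>
    define y where "y = (\<lambda>p\<in>carrier (?P 0). (inv_into (carrier ?F) \<Phi>0 p) () \<otimes> \<pi> t)"
    have ev: "module_map A ?F (regular_module A) (\<lambda>f. f () \<otimes> \<pi> t)"
      by (rule module_mapI) (auto simp: unit_module_iff l_distr m_assoc)
    have y: "y \<in> carrier (dual_module A (?P 0))"
      unfolding C.carrier_dual y_def
      using module_map_cong[OF module_map_comp[OF module_map_decode[OF FM \<Phi>0(1)] ev] left_module_encode[OF FM \<Phi>0(1)]]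
      by (simp add: P)
    have "z (\<Phi>1 c) = y (?d 0 (\<Phi>1 c))" if c: "c \<in> carrier ?R" for c
    proof -
      obtain r where r: "c = (\<lambda>l. \<pi> (r l))" using row_cases[OF c] by blast
      have dc: "D0 c \<in> carrier ?F" by (rule module_map_closed[OF D0 c])
      have "y (?d 0 (\<Phi>1 c)) = D0 c () \<otimes> \<pi> t"
        unfolding R.enc_diff_0[OF c] y_def using dc by (simp add: R.carriers inv_into_f_f[OF \<Phi>0(1) dc])
      also have "\<dots> = \<pi> (\<Sum>l\<in>UNIV. r l * (gen l * t))"
        unfolding r D0\<pi> by (simp add: sum_distrib_right mult.assoc flip: \<pi>_mult)
      also have "\<dots> = \<pi> (\<Sum>l\<in>UNIV. r l * q l)"
      proof -
        have "(\<Sum>l\<in>UNIV. r l * (q l - gen l * t)) \<in> relation_ideal B"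
          by (intro tensor_ideal_sum[OF tensor_ideal_Idl] tensor_ideal_left[OF tensor_ideal_Idl] t)
        then have "\<pi> (\<Sum>l\<in>UNIV. r l * q l) = \<pi> (\<Sum>l\<in>UNIV. r l * (gen l * t))"
          by (simp add: \<pi>_eq_iff I_eq right_diff_distrib sum_subtractf)
        then show ?thesis ..
      qed
      also have "\<dots> = z (\<Phi>1 c)" unfolding r q ..
      finally show ?thesis ..
    qed
    then have "z = (\<lambda>p\<in>carrier (?P (Suc 0)). y (?d 0 p))"
      using zmap(2)[OF z] by (auto simp: fun_eq_iff extensional_def R.carriers)
    then show ?thesis unfolding C.coboundaries_Suc using y by blast
  qed
  have ext_high: "z \<in> ext_coboundaries A ?P ?d i" if z: "z \<in> ext_cocycles A ?P ?d i" and i: "i > 2" for z i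
  proof -
    have "z \<zero>\<^bsub>?P i\<^esub> = \<zero>" using module_map_zero[OF zmap(1)[OF z] C.P C.regular] by simp
    then have "z = (\<lambda>p\<in>carrier (?P i). \<zero>)"
      using zmap(2)[OF z] R.enc_module_above[OF i] by (auto simp: fun_eq_iff extensional_def)
    then show ?thesis using C.coboundary_zero[of i] by simp
  qed
  let ?two = "Suc (Suc 0)"
  have w: "\<Phi>0 (\<lambda>_. \<one>) \<in> carrier (?P ?two)" using one by (simp add: R.carriers)
  \<comment> \<open>The constant term of the value at the free generator identifies Ext^2 with A
    modulo its augmentation ideal.\<close>
  define H where "H z = eps (z (\<Phi>0 (\<lambda>_. \<one>)))" for z
  have "\<exists>h \<in> module_homs A (ext_module A ?P ?d ?two) ?N. bij_betw h (carrier (ext_module A ?P ?d ?two)) (carrier ?N)"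
  proof (rule ext_isomorphism[OF gr Ccx])
    fix z y assume z: "z \<in> ext_cocycles A ?P ?d ?two" and y: "y \<in> ext_cocycles A ?P ?d ?two"
    show "H (\<lambda>p\<in>carrier (?P ?two). z p \<oplus> y p) = H z + H y"
      using w by (simp add: H_def eps_add C.cocycle_closed[OF z] C.cocycle_closed[OF y])
  next
    fix z a assume z: "z \<in> ext_cocycles A ?P ?d ?two" and a: "a \<in> carrier A"
    show "H (\<lambda>p\<in>carrier (?P ?two). z p \<otimes> a) = eps a * H z"
      using w a by (simp add: H_def eps_mult C.cocycle_closed[OF z])
  next
    fix z assume z: "z \<in> ext_cocycles A ?P ?d ?two"
    have g: "module_map A ?F (regular_module A) (\<lambda>x. z (\<Phi>0 x))"
      by (rule dual_encode[OF FM \<Phi>0(1) zmap(1)[OF z, unfolded P]])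
    have "z (\<Phi>0 (\<lambda>_. \<one>)) \<in> carrier A" using module_map_closed[OF g one] by simp
    then obtain p where p: "z (\<Phi>0 (\<lambda>_. \<one>)) = \<pi> p" by (rule carrier_cases)
    show "H z = 0 \<longleftrightarrow> z \<in> ext_coboundaries A ?P ?d ?two"
    proof
      assume "H z = 0"
      then have "lookup p [] = 0" by (simp add: H_def p)
      then obtain q where q: "p = (\<Sum>\<nu>\<in>UNIV. column \<nu> * q \<nu>)" by (rule split_first_column)
      have qc: "\<And>l. \<pi> (q l) \<in> carrier A" by simp
      define y where "y = (\<lambda>p\<in>carrier (?P (Suc 0)). row_sum (\<lambda>l. \<pi> (q l)) (inv_into (carrier ?R) \<Phi>1 p))"
      have y: "y \<in> carrier (dual_module A (?P (Suc 0)))"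
        unfolding C.carrier_dual y_def
        using module_map_cong[OF module_map_comp[OF module_map_decode[OF RM \<Phi>1(1)] row_sum_module_map[OF qc]] left_module_encode[OF RM \<Phi>1(1)]]
        by (simp add: P)
      have "z (\<Phi>0 f) = y (?d (Suc 0) (\<Phi>0 f))" if f: "f \<in> carrier ?F" for f
      proof -
        obtain r where r: "f = (\<lambda>_. \<pi> r)" using unit_cases[OF f] by blast
        have df: "D1 f \<in> carrier ?R" by (rule module_map_closed[OF D1 f])
        have "y (?d (Suc 0) (\<Phi>0 f)) = row_sum (\<lambda>l. \<pi> (q l)) (D1 f)"
          unfolding R.enc_diff_1[OF f] y_def using df by (simp add: R.carriers inv_into_f_f[OF \<Phi>1(1) df])
        also have "\<dots> = \<pi> (\<Sum>l\<in>UNIV. (r * column l) * q l)"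
          unfolding r D1\<pi> row_sum_def \<pi>_sum \<pi>_mult ..
        also have "\<dots> = \<pi> (r * p)" by (simp add: q sum_distrib_left mult.assoc)
        also have "\<dots> = z (\<Phi>0 f)" using unit_map_eval[OF g f] by (simp add: p r \<pi>_mult)
        finally show ?thesis ..
      qed
      then have "z = (\<lambda>p\<in>carrier (?P ?two). y (?d (Suc 0) p))"
        using zmap(2)[OF z] by (auto simp: fun_eq_iff extensional_def R.carriers)
      then show "z \<in> ext_coboundaries A ?P ?d ?two" unfolding C.coboundaries_Suc using y by blast
    next
      assume "z \<in> ext_coboundaries A ?P ?d ?two"
      then obtain y where y: "y \<in> carrier (dual_module A (?P (Suc 0)))"
        "z = (\<lambda>p\<in>carrier (?P ?two). y (?d (Suc 0) p))"
        unfolding C.coboundaries_Suc by blast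
      have "module_map A (?P (Suc 0)) (regular_module A) y" using y(1) by (simp add: C.carrier_dual)
      then have "module_map A ?R (regular_module A) (\<lambda>x. y (\<Phi>1 x))"
        unfolding P by (rule dual_encode[OF RM \<Phi>1(1)])
      then obtain q where q: "\<And>r. y (\<Phi>1 (\<lambda>l. \<pi> (r l))) = \<pi> (\<Sum>l\<in>UNIV. r l * q l)"
        by (rule row_map_eval) blast
      have "z (\<Phi>0 (\<lambda>_. \<one>)) = y (\<Phi>1 (D1 (\<lambda>_. \<one>)))"
        unfolding y(2) using w by (simp only: restrict_apply' R.enc_diff_1[OF one])
      also have "D1 (\<lambda>_. \<one>) = (\<lambda>l. \<pi> (column l))" by (simp add: D1_def)
      finally have "H z = lookup (\<Sum>l\<in>UNIV. column l * q l) []" by (simp add: H_def q)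
      then show "H z = 0" by (simp add: lookup_sum lookup_Nil_mult)
    qed
  next
    fix c
    define z where "z = (\<lambda>p\<in>carrier (?P ?two). (inv_into (carrier ?F) \<Phi>0 p) () \<otimes> \<pi> (scalar c))"
    have ev: "module_map A ?F (regular_module A) (\<lambda>f. f () \<otimes> \<pi> (scalar c))"
      by (rule module_mapI) (auto simp: unit_module_iff l_distr m_assoc)
    have zd: "z \<in> carrier (dual_module A (?P ?two))"
      unfolding C.carrier_dual z_def
      using module_map_cong[OF module_map_comp[OF module_map_decode[OF FM \<Phi>0(1)] ev] left_module_encode[OF FM \<Phi>0(1)]]
      by (simp add: P)
    have zm: "module_map A (?P ?two) (regular_module A) z" using zd by (simp add: C.carrier_dual)
    have "z (?d ?two p) = \<zero>" if p: "p \<in> carrier (?P (Suc ?two))" for p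
    proof -
      have "p = \<zero>\<^bsub>?P (Suc ?two)\<^esub>" using p R.enc_module_above[of "Suc ?two"] by simp
      then have "?d ?two p = \<zero>\<^bsub>?P ?two\<^esub>" using module_map_zero[OF C.d[of ?two] C.P C.P] by (simp only:)
      then show ?thesis using module_map_zero[OF zm C.P C.regular] by simp
    qed
    then have "z \<in> ext_cocycles A ?P ?d ?two" using zd by (simp add: ext_cocycles_def)
    moreover have "H z = c"
      using one by (simp add: H_def z_def R.carriers inv_into_f_f[OF \<Phi>0(1)])
    ultimately show "\<exists>z\<in>ext_cocycles A ?P ?d ?two. H z = c" by blast
  qed
  moreover have "carrier (ext_module A ?P ?d i) = {\<zero>\<^bsub>ext_module A ?P ?d i\<^esub>}" if "i \<noteq> ?two" for i
  proof (rule C.ext_vanishes)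
    fix z assume z: "z \<in> ext_cocycles A ?P ?d i"
    consider "i = 0" | "i = Suc 0" | "i > 2" using \<open>i \<noteq> ?two\<close> by linarith
    then show "z \<in> ext_coboundaries A ?P ?d i"
    proof cases
      case 1
      show ?thesis unfolding 1 by (rule ext0[OF z[unfolded 1]])
    next
      case 2
      show ?thesis unfolding 2 by (rule ext1[OF z[unfolded 2]])
    next
      case 3
      show ?thesis by (rule ext_high[OF z 3])
    qed
  qed
  moreover have "global_dim TYPE('m) A = enat ?two"
    using global_dim_eq_2[OF gr U emb] by (simp add: numeral_eq_enat numeral_2_eq_2)
  ultimately show ?thesis
    unfolding gorenstein_def using connected_graded[OF gr] res by blast
qed

end

section \<open>The Koszul property\<close>

lemma pairing_add: "pairing (f + g) w = pairing f w + pairing g w"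
  by (simp add: pairing_def lookup_add distrib_right sum.distrib)

lemma pairing_diff: "pairing (f - g) w = pairing f w - pairing g w"
  by (simp add: pairing_def lookup_minus left_diff_distrib sum_subtractf)

lemma pairing_0 [simp]: "pairing 0 w = 0"
  by (simp add: pairing_def)

lemma pairing_scalar_mult: "pairing (scalar c * f) w = c * pairing f w"
  by (simp add: pairing_def lookup_scalar_mult sum_distrib_left mult.assoc)

lemma pairing_single: "pairing (single u a) w = a * lookup w u"
proof -
  have "pairing (single u a) w = (\<Sum>v\<in>keys w. if v = u then a * lookup w u else 0)"
    unfolding pairing_def by (intro sum.cong refl) (auto simp: lookup_single when_def)
  then show ?thesis by (simp add: in_keys_iff)
qed

text \<open>The combination of the two dual words with coefficients swapped annihilates
  \<open>f\<close>, so it lies in the orthogonal space. Surrounded by the words \<open>x\<close> and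
  \<open>y\<close> it lies in the ideal, and pairing it with \<open>w\<close> gives the
  proportion.\<close>

lemma koszul_dual_star_proportional:
  assumes w: "w \<in> koszul_dual_star {f} n" and u: "length u = 2" "length v = 2"
    and n: "length x + 2 + length y = n"
  shows "lookup f u * lookup w (x @ v @ y) = lookup f v * lookup w (x @ u @ y)"
proof -
  define e where "e = single v (lookup f u) - single u (lookup f v)"
  have hom: "e \<in> homogeneous 2"
    unfolding e_def by (intro homogeneous_diff homogeneous_single u)
  then have "e \<in> quadratic_perp {f}"
    by (simp add: quadratic_perp_def e_def pairing_diff pairing_single mult.commute)
  then have "single x 1 * e * single y 1 \<in> Idl\<^bsub>tensor_algebra\<^esub> (quadratic_perp {f})"
    by (intro tensor_ideal_right[OF tensor_ideal_Idl] tensor_ideal_left[OF tensor_ideal_Idl] Idl_self)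
  moreover have "single x 1 * e * single y 1 \<in> homogeneous n"
    unfolding n[symmetric] by (intro homogeneous_mult hom homogeneous_single refl)
  ultimately have "pairing (single x 1 * e * single y 1) w = 0"
    using w by (auto simp: koszul_dual_star_def)
  moreover have "single x 1 * e * single y 1 = single (x @ v @ y) (lookup f u) - single (x @ u @ y) (lookup f v)"
    by (simp add: e_def right_diff_distrib left_diff_distrib single_mult_single)
  ultimately show ?thesis by (simp add: pairing_diff pairing_single)
qed

text \<open>In degree 2 an ideal generated in degree 2 consists of scalar combinations of its
  generators. The superset used to see this is closed under multiplication because only constant
  terms of the other factor reach degree 2.\<close>

lemma relation_in_koszul_dual_star:
  fixes f :: "'n list \<Rightarrow>\<^sub>0 'k::field"
  assumes f: "f \<in> homogeneous 2"
  shows "f \<in> koszul_dual_star {f} 2"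
proof -
  let ?I = "Idl\<^bsub>tensor_algebra\<^esub> (quadratic_perp {f})"
  have "?I \<subseteq> {g. (\<forall>n<2. component n g = 0) \<and> pairing (component 2 g) f = 0}"
  proof (intro Idl_subset tensor_idealI)
    show "quadratic_perp {f} \<subseteq> {g. (\<forall>n<2. component n g = 0) \<and> pairing (component 2 g) f = 0}"
      by (auto simp: quadratic_perp_def component_of_homogeneous)
    fix p q assume p: "p \<in> {g. (\<forall>n<2. component n g = 0) \<and> pairing (component 2 g) f = 0}"
    then have "(scalar (lookup p []) :: 'n list \<Rightarrow>\<^sub>0 'k) = 0" "component (Suc 0) p = 0" "component 0 p = 0"
      using component_0_eq[of p] by auto
    then have "component 2 (q * p) = scalar (lookup q []) * component 2 p"
      "component 2 (p * q) = scalar (lookup q []) * component 2 p"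
      by (simp_all add: component_mult numeral_2_eq_2 component_0_eq scalar_commute)
    moreover have "component n (q * p) = 0" "component n (p * q) = 0" if "n < 2" for n
      using p that by (auto simp: component_mult intro!: sum.neutral)
    ultimately show "q * p \<in> {g. (\<forall>n<2. component n g = 0) \<and> pairing (component 2 g) f = 0}"
      "p * q \<in> {g. (\<forall>n<2. component n g = 0) \<and> pairing (component 2 g) f = 0}"
      using p by (simp_all add: pairing_scalar_mult)
  qed (auto simp: component_add pairing_add)
  then show ?thesis
    using f by (auto simp: koszul_dual_star_def component_of_homogeneous dest!: subsetD)
qed

context nondegenerate_matrix
begin

text \<open>With both words empty, \<open>koszul_dual_star_proportional\<close> compares all
  coefficients with one at a nonzero entry of \<open>B\<close>.\<close>

lemma koszul_dual_star_2:
  assumes w: "w \<in> koszul_dual_star {bilinear_relation B} 2"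
  shows "\<exists>c. w = scalar c * bilinear_relation B"
proof -
  obtain \<mu> \<nu> where B: "B \<mu> \<nu> \<noteq> 0" using column_nonzero by fastforce
  define c where "c = lookup w [\<mu>, \<nu>] / B \<mu> \<nu>"
  have hw: "w \<in> homogeneous 2" using w by (simp add: koszul_dual_star_def)
  have "w = scalar c * bilinear_relation B"
  proof (rule poly_mapping_eqI)
    fix v
    show "lookup w v = lookup (scalar c * bilinear_relation B) v"
    proof (cases "length v = 2")
      case True
      have "B \<mu> \<nu> * lookup w v = lookup (bilinear_relation B) v * lookup w [\<mu>, \<nu>]"
        using koszul_dual_star_proportional[OF w _ True, of "[\<mu>, \<nu>]" "[]" "[]"]
        by (simp add: lookup_bilinear_relation)
      then show ?thesis using B by (simp add: c_def lookup_scalar_mult field_simps)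
    next
      case False
      then show ?thesis
        using lookup_homogeneous[OF hw False] lookup_homogeneous[OF bilinear_relation_homogeneous[of B] False]
        by (simp add: lookup_scalar_mult)
    qed
  qed
  then show ?thesis ..
qed

text \<open>For \<open>n \<ge> 3\<close> an element of the dual lies in \<open>\<bbbK>f \<otimes> E\<^bsup>\<otimes>(n-2)\<^esup> \<inter> E \<otimes> \<bbbK>f \<otimes> E\<^bsup>\<otimes>(n-3)\<^esup>\<close>; a nonzero one would
  make \<open>B\<close> a matrix of rank one.\<close>

lemma koszul_dual_star_above:
  assumes w: "w \<in> koszul_dual_star {bilinear_relation B} n" and n: "n \<ge> 3"
  shows "w = 0"
proof (rule poly_mapping_eqI)
  fix z
  have hw: "w \<in> homogeneous n" using w by (simp add: koszul_dual_star_def)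
  show "lookup w z = lookup 0 z"
  proof (cases "length z = n")
    case False
    then show ?thesis using lookup_homogeneous[OF hw False] by simp
  next
    case True
    then obtain a0 z' where z': "z = a0 # z'" "length z' \<ge> 2" using n by (cases z) auto
    then obtain b0 z'' where z'': "z' = b0 # z''" "length z'' \<ge> 1" by (cases z') auto
    then obtain c0 q where "z'' = c0 # q" by (cases z'') auto
    with z' z'' have z: "z = [a0, b0, c0] @ q" by simp
    define W where "W a b c = lookup w ([a, b, c] @ q)" for a b c
    have 1: "B a b * W a' b' c = B a' b' * W a b c" for a b a' b' c
      using koszul_dual_star_proportional[OF w, of "[a, b]" "[a', b']" "[]" "c # q"] True
      by (simp add: W_def z lookup_bilinear_relation)
    have 2: "B b c * W a b' c' = B b' c' * W a b c" for a b c b' c'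
      using koszul_dual_star_proportional[OF w, of "[b, c]" "[b', c']" "[a]" q] True
      by (simp add: W_def z lookup_bilinear_relation)
    show ?thesis
    proof (rule ccontr)
      assume "lookup w z \<noteq> lookup 0 z"
      then have W0: "W a0 b0 c0 \<noteq> 0" by (simp add: W_def z)
      have B0: "B a0 b0 \<noteq> 0"
      proof
        assume "B a0 b0 = 0"
        then have "B a b * W a0 b0 c0 = 0" for a b using 1[of a b a0 b0 c0] by simp
        then have "B a b = 0" for a b using W0 by simp
        then show False using column_nonzero[of b0] by simp
      qed
      \<comment> \<open>All rows of \<open>B\<close> are proportional to the column
        \<open>c0\<close>, so a vector orthogonal to this column lies in the kernel of
        \<open>B\<close>.\<close>
      obtain v where v: "v \<noteq> (\<lambda>_. 0)" "(\<Sum>b\<in>UNIV. v b * B b c0) = 0"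
        by (rule exists_orthogonal_vector[OF card_ge_2, of "\<lambda>b. B b c0"]) blast
      have rank_one: "B a b = B b c0 * (W a a0 b0 / W a0 b0 c0)" for a b
      proof -
        have "B a0 b0 * (B a b * W a0 b0 c0) = B a0 b0 * (B a0 b0 * W a b c0)" using 1[of a b a0 b0 c0] by simp
        also have "\<dots> = B a0 b0 * (B b c0 * W a a0 b0)" using 2[of a0 b0 a b c0] by simp
        finally show ?thesis using B0 W0 by (simp add: field_simps)
      qed
      have "(\<Sum>b\<in>UNIV. B a b * v b) = (\<Sum>b\<in>UNIV. v b * B b c0) * (W a a0 b0 / W a0 b0 c0)" for a
        unfolding sum_distrib_right by (intro sum.cong refl, subst rank_one) (simp only: mult_ac)
      then have "v = (\<lambda>_. 0)" using v(2) by (intro kernel_trivial) simp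
      then show False using v(1) by simp
    qed
  qed
qed

text \<open>The Koszul complex is the resolution A -> A^(s+1) -> A. Degree 1 is
  \<open>right_syzygy\<close>, degree 2 is the cancellation of a column, and above degree 2 the
  terms are zero.\<close>

lemma is_koszul: "koszul {bilinear_relation B}"
proof -
  let ?f = "bilinear_relation B" and ?A = "presented_algebra {bilinear_relation B}"
    and ?\<pi> = "residue_class {bilinear_relation B}"
  interpret presentation ?A ?\<pi> "relation_ideal B"
    by (rule presentation_residue_class) (use bilinear_relation_homogeneous in auto)
  \<comment> \<open>Replaces the coefficients in A by representatives in T, so that terms and
    differentials become statements about the ideal.\<close>
  have term_cases: "\<exists>(m::nat) p w. (\<forall>i<m. w i \<in> koszul_dual_star {?f} n) \<and>
      F = (\<lambda>v. ?\<pi> (\<Sum>i<m. scalar (lookup (w i) v) * p i))" if F: "F \<in> koszul_term {?f} n" for F n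
  proof -
    obtain m :: nat and a w where F': "F = (\<lambda>v. \<Oplus>\<^bsub>?A\<^esub>i\<in>{..<m}. lookup (w i) v \<odot>\<^bsub>?A\<^esub> a i)"
      and "\<forall>i<m. a i \<in> carrier ?A \<and> w i \<in> koszul_dual_star {?f} n"
      using F unfolding koszul_term_def by (elim CollectE exE conjE) (rule that)
    then have a: "\<forall>i. \<exists>p. i < m \<longrightarrow> a i = ?\<pi> p" and w: "\<forall>i<m. w i \<in> koszul_dual_star {?f} n"
      unfolding \<pi>_surj by (auto simp: image_iff)
    obtain p where p: "\<And>i. i < m \<Longrightarrow> a i = ?\<pi> (p i)" using choice[OF a] by blast
    have "F v = ?\<pi> (\<Sum>i<m. scalar (lookup (w i) v) * p i)" for v
      unfolding F' \<pi>_sum by (rule finsum_cong') (simp_all add: p \<pi>_smult)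
    then have "F = (\<lambda>v. ?\<pi> (\<Sum>i<m. scalar (lookup (w i) v) * p i))" by (rule ext)
    then show ?thesis using w by (intro exI[of _ m] exI[of _ p] exI[of _ w] conjI)
  qed
  have diff: "koszul_diff {?f} (\<lambda>v. ?\<pi> (T v)) = (\<lambda>v. ?\<pi> (\<Sum>l\<in>UNIV. T (l # v) * gen l))" for T
    unfolding koszul_diff_def presented_gen_def \<pi>_sum \<pi>_mult ..
  have zero_term: "(\<lambda>_. ?\<pi> 0) \<in> koszul_term {?f} n" for n
    unfolding koszul_term_def
    by (rule CollectI, rule exI[of _ 0], rule exI[of _ undefined], rule exI[of _ undefined]) (simp add: \<pi>_0)
  have term2: "(\<lambda>v. ?\<pi> (scalar (lookup ?f v) * t)) \<in> koszul_term {?f} 2" for t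
    unfolding koszul_term_def
    by (rule CollectI, rule exI[of _ 1], rule exI[of _ "\<lambda>_. ?\<pi> t"], rule exI[of _ "\<lambda>_. ?f"])
       (simp add: \<pi>_smult relation_in_koszul_dual_star[OF bilinear_relation_homogeneous] flip: \<pi>_sum)
  have high: "F = (\<lambda>_. ?\<pi> 0)" if F: "F \<in> koszul_term {?f} n" and n: "n \<ge> 3" for F n
  proof -
    obtain m :: nat and p w where w: "\<forall>i<m. w i \<in> koszul_dual_star {?f} n"
      and F': "F = (\<lambda>v. ?\<pi> (\<Sum>i<m. scalar (lookup (w i) v) * p i))"
      using term_cases[OF F] by (elim exE conjE) (rule that)
    have "w i = 0" if "i < m" for i using koszul_dual_star_above[of "w i" n] w n that by blast
    then show ?thesis unfolding F' by simp
  qed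
  have exact: "\<exists>g \<in> koszul_term {?f} (Suc (Suc n)). koszul_diff {?f} g = F"
    if F: "F \<in> koszul_term {?f} (Suc n)" and dF: "koszul_diff {?f} F = (\<lambda>_. ?\<pi> 0)" for n F
  proof -
    obtain m :: nat and p w where w: "\<forall>i<m. w i \<in> koszul_dual_star {?f} (Suc n)"
      and F': "F = (\<lambda>v. ?\<pi> (\<Sum>i<m. scalar (lookup (w i) v) * p i))"
      using term_cases[OF F] by (elim exE conjE) (rule that)
    have zero: ?thesis if "F = (\<lambda>_. ?\<pi> 0)"
      by (rule bexI[OF _ zero_term]) (simp add: diff that)
    consider "n = 0" | "n = 1" | "n \<ge> 2" by linarith
    then show ?thesis
    proof cases
      case 1
      define T where "T v = (\<Sum>i<m. scalar (lookup (w i) v) * p i)" for v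
      \<comment> \<open>Only words of length one carry coefficients; the syzygy determines these,
        and elsewhere both sides of the lift must be seen to vanish.\<close>
      have T0: "T v = 0" if "length v \<noteq> 1" for v
      proof -
        have "lookup (w i) v = 0" if "i < m" for i
          using w that \<open>length v \<noteq> 1\<close> lookup_homogeneous[of "w i" 1 v] by (simp add: koszul_dual_star_def 1)
        then show ?thesis by (simp add: T_def)
      qed
      have FT: "F = (\<lambda>v. ?\<pi> (T v))" by (simp add: F' T_def)
      have "(\<Sum>l\<in>UNIV. T [l] * gen l) \<in> relation_ideal B"
        using fun_cong[OF dF[unfolded FT diff], of "[]"] by (simp add: \<pi>_0 \<pi>_zero_iff)
      then obtain t where t: "\<And>l. T [l] - t * linear_form (\<lambda>\<mu>. B \<mu> l) \<in> relation_ideal B"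
        by (rule right_syzygy) blast
      have "?\<pi> (\<Sum>l\<in>UNIV. scalar (lookup ?f (l # v)) * t * gen l) = ?\<pi> (T v)" for v
      proof (cases "length v = 1")
        case True
        then obtain \<nu> where v: "v = [\<nu>]" by (auto simp: length_Suc_conv)
        have "(\<Sum>l\<in>UNIV. scalar (lookup ?f (l # v)) * t * gen l) = t * linear_form (\<lambda>\<mu>. B \<mu> \<nu>)"
          by (simp add: v lookup_bilinear_relation mult_linear_form)
        then show ?thesis
          using tensor_ideal_diff_sym[OF tensor_ideal_Idl t[of \<nu>]] by (simp add: v \<pi>_eq_iff)
      next
        case False
        then have "lookup ?f (l # v) = 0" for l
          using lookup_homogeneous[OF bilinear_relation_homogeneous, of "l # v" B] by simp
        then show ?thesis by (simp add: T0[OF False])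
      qed
      then have "koszul_diff {?f} (\<lambda>v. ?\<pi> (scalar (lookup ?f v) * t)) = F"
        unfolding diff FT by (rule ext)
      then show ?thesis using term2[of t] 1 by (auto simp: numeral_2_eq_2)
    next
      case 2
      have "\<forall>i. \<exists>c. i < m \<longrightarrow> w i = scalar c * ?f"
        using w koszul_dual_star_2 by (auto simp: 2 numeral_2_eq_2)
      from choice[OF this] obtain c where c: "\<And>i. i < m \<Longrightarrow> w i = scalar (c i) * ?f" by blast
      define t where "t = (\<Sum>i<m. scalar (c i) * p i)"
      have "scalar (lookup (w i) v) * p i = scalar (lookup ?f v) * (scalar (c i) * p i)" if "i < m" for i v
        by (simp add: c[OF that] lookup_scalar_mult mult.commute[of "c i"] flip: mult.assoc)
      then have F2: "F = (\<lambda>v. ?\<pi> (scalar (lookup ?f v) * t))"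
        unfolding F' t_def sum_distrib_left by (intro ext arg_cong[of _ _ ?\<pi>] sum.cong) auto
      \<comment> \<open>Any letter will do, since every column of \<open>B\<close> can be
        cancelled.\<close>
      obtain \<nu> :: 'n where True by simp
      have "(\<Sum>l\<in>UNIV. scalar (lookup ?f [l, \<nu>]) * t * gen l) \<in> relation_ideal B"
        using fun_cong[OF dF[unfolded F2 diff], of "[\<nu>]"] by (simp add: \<pi>_0 \<pi>_zero_iff)
      then have "t * linear_form (\<lambda>\<mu>. B \<mu> \<nu>) \<in> relation_ideal B"
        by (simp add: lookup_bilinear_relation mult_linear_form)
      then have "t \<in> relation_ideal B" by (rule mult_column_cancel)
      then have "?\<pi> (scalar c * t) = ?\<pi> 0" for c
        by (simp add: \<pi>_eq_iff tensor_ideal_left[OF tensor_ideal_Idl])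
      then have "F = (\<lambda>_. ?\<pi> 0)" unfolding F2 by (rule ext)
      then show ?thesis by (rule zero)
    next
      case 3
      then show ?thesis using high[OF F] zero by simp
    qed
  qed
  show ?thesis
    unfolding koszul_def using exact bilinear_relation_homogeneous by (auto simp: \<pi>_0)
qed

end

section \<open>The classification\<close>

text \<open>A vector killed by the Gram matrix is orthogonal to every vector on the left, so the
  matrix has trivial kernel; a one-sided inverse of a square matrix is two-sided.\<close>

lemma matrix_of_form:
  fixes b :: "'k::field ^ 'n::finite \<Rightarrow> 'k ^ 'n \<Rightarrow> 'k"
  assumes b: "bilinear_form b" and nd: "nondegenerate b" and card: "CARD('n) \<ge> 2"
  shows "\<exists>B'. nondegenerate_matrix (\<lambda>\<mu> \<nu>. b (axis \<mu> 1) (axis \<nu> 1)) B'"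
proof -
  define B :: "'k ^ 'n ^ 'n" where "B = (\<chi> \<mu> \<nu>. b (axis \<mu> 1) (axis \<nu> 1))"
  have lin2: "Vector_Spaces.linear (*s) (*) (\<lambda>v. b u v)" for u using b by (simp add: bilinear_form_def)
  have lin1: "Vector_Spaces.linear (*s) (*) (\<lambda>u. b u v)" for v using b by (simp add: bilinear_form_def)
  have expand: "v = (\<Sum>\<nu>\<in>UNIV. (v $ \<nu>) *s axis \<nu> 1)" for v :: "'k ^ 'n"
    by (simp add: vec_eq_iff axis_def if_distrib[of "\<lambda>x. _ * x"] cong: if_cong)
  have sum2: "b u (\<Sum>\<nu>\<in>UNIV. c \<nu> *s x \<nu>) = (\<Sum>\<nu>\<in>UNIV. c \<nu> * b u (x \<nu>))" for u c and x :: "'n \<Rightarrow> 'k ^ 'n"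
  proof -
    interpret l: Vector_Spaces.linear "(*s)" "(*)" "\<lambda>v. b u v" by (rule lin2)
    show ?thesis by (simp add: l.sum l.scale)
  qed
  have sum1: "b (\<Sum>\<nu>\<in>UNIV. c \<nu> *s x \<nu>) v = (\<Sum>\<nu>\<in>UNIV. c \<nu> * b (x \<nu>) v)" for v c and x :: "'n \<Rightarrow> 'k ^ 'n"
  proof -
    interpret l: Vector_Spaces.linear "(*s)" "(*)" "\<lambda>u. b u v" by (rule lin1)
    show ?thesis by (simp add: l.sum l.scale)
  qed
  have "v = 0" if "B *v v = 0" for v
  proof -
    have "b u v = 0" for u
    proof -
      have "b (axis \<mu> 1) v = 0" for \<mu>
      proof -
        have "b (axis \<mu> 1) v = (\<Sum>\<nu>\<in>UNIV. v $ \<nu> * b (axis \<mu> 1) (axis \<nu> 1))"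
          using arg_cong[OF expand[of v], of "b (axis \<mu> 1)"] unfolding sum2 .
        also have "\<dots> = (B *v v) $ \<mu>" by (simp add: B_def matrix_vector_mult_def mult.commute)
        finally show ?thesis using that by simp
      qed
      moreover have "b u v = (\<Sum>\<mu>\<in>UNIV. u $ \<mu> * b (axis \<mu> 1) v)"
        using arg_cong[OF expand[of u], of "\<lambda>u. b u v"] unfolding sum1 .
      ultimately show ?thesis by simp
    qed
    then show ?thesis using nd by (auto simp: nondegenerate_def)
  qed
  then obtain C :: "'k ^ 'n ^ 'n" where C: "C ** B = mat 1" using matrix_left_invertible_ker[of B] by blast
  then have C': "B ** C = mat 1" by (simp add: matrix_left_right_inverse)
  have "nondegenerate_matrix (\<lambda>\<mu> \<nu>. b (axis \<mu> 1) (axis \<nu> 1)) (\<lambda>\<mu> \<nu>. C $ \<mu> $ \<nu>)"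
  proof
    fix \<mu> \<rho>
    show "(\<Sum>\<nu>\<in>UNIV. b (axis \<mu> 1) (axis \<nu> 1) * C $ \<nu> $ \<rho>) = (if \<mu> = \<rho> then 1 else 0)"
      using arg_cong[OF C', of "\<lambda>X. X $ \<mu> $ \<rho>"] by (simp add: B_def matrix_matrix_mult_def mat_def)
    show "(\<Sum>\<nu>\<in>UNIV. C $ \<mu> $ \<nu> * b (axis \<nu> 1) (axis \<rho> 1)) = (if \<mu> = \<rho> then 1 else 0)"
      using arg_cong[OF C, of "\<lambda>X. X $ \<mu> $ \<rho>"] by (simp add: B_def matrix_matrix_mult_def mat_def)
  qed (rule card)
  then show ?thesis by blast
qed

text \<open>The form is u^T M v. A right inverse of the square matrix is also a left inverse, and
  the two sides give the two halves of nondegeneracy.\<close>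

lemma form_of_matrix:
  fixes B B' :: "'n::finite \<Rightarrow> 'n \<Rightarrow> 'k::field"
  assumes inv: "\<And>\<mu> m. (\<Sum>l\<in>UNIV. B \<mu> l * B' l m) = (if \<mu> = m then 1 else 0)"
  obtains b :: "'k ^ 'n \<Rightarrow> 'k ^ 'n \<Rightarrow> 'k" where "bilinear_form b" "nondegenerate b"
    "form_relation b = bilinear_relation B"
proof -
  define M :: "'k ^ 'n ^ 'n" where "M = (\<chi> \<mu> \<nu>. B \<mu> \<nu>)"
  define M' :: "'k ^ 'n ^ 'n" where "M' = (\<chi> \<mu> \<nu>. B' \<mu> \<nu>)"
  define b where "b u v = (\<Sum>\<mu>\<in>UNIV. u $ \<mu> * (M *v v) $ \<mu>)" for u v :: "'k ^ 'n"
  have MM': "M ** M' = mat 1"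
    by (simp add: vec_eq_iff M_def M'_def matrix_matrix_mult_def mat_def inv)
  then have M'M: "M' ** M = mat 1" by (simp add: matrix_left_right_inverse)
  have b_axis: "b (axis \<mu> 1) v = (M *v v) $ \<mu>" for \<mu> v
    by (simp add: b_def axis_def if_distrib[of "\<lambda>x. x * _"] cong: if_cong)
  have Mv: "M *v (u + v) = M *v u + M *v v" "M *v (c *s u) = c *s (M *v u)" for u v c
    by (simp_all add: matrix_vector_right_distrib vec.scale)
  have "bilinear_form b"
    unfolding bilinear_form_def
  proof (intro conjI allI)
    have vs: "vector_space ((*) :: 'k \<Rightarrow> 'k \<Rightarrow> 'k)" by unfold_locales (auto simp: algebra_simps)
    fix w
    show "Vector_Spaces.linear (*s) (*) (\<lambda>v. b w v)"
      unfolding Vector_Spaces.linear_iff using vs vec.vector_space_axioms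
      by (simp add: b_def Mv algebra_simps sum.distrib sum_distrib_left)
    show "Vector_Spaces.linear (*s) (*) (\<lambda>u. b u w)"
      unfolding Vector_Spaces.linear_iff using vs vec.vector_space_axioms
      by (simp add: b_def algebra_simps sum.distrib sum_distrib_left)
  qed
  moreover have "nondegenerate b"
    unfolding nondegenerate_def
  proof (intro conjI allI impI)
    fix u assume u: "\<forall>v. b u v = 0"
    have "u $ \<mu> = 0" for \<mu>
    proof -
      have "b u (M' *v axis \<mu> 1) = (\<Sum>\<nu>\<in>UNIV. u $ \<nu> * axis \<mu> 1 $ \<nu>)"
        by (simp add: b_def matrix_vector_mul_assoc MM')
      also have "\<dots> = u $ \<mu>" by (simp add: axis_def if_distrib[of "\<lambda>x. _ * x"] cong: if_cong)
      finally show ?thesis using u by simp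
    qed
    then show "u = 0" by (simp add: vec_eq_iff)
  next
    fix v assume v: "\<forall>u. b u v = 0"
    then have "M *v v = 0" using b_axis[of _ v] by (simp add: vec_eq_iff)
    then have "M' *v (M *v v) = 0" by simp
    then show "v = 0" by (simp add: matrix_vector_mul_assoc M'M)
  qed
  moreover have "form_relation b = bilinear_relation B"
  proof -
    have "b (axis \<mu> 1) (axis \<nu> 1) = B \<mu> \<nu>" for \<mu> \<nu>
      unfolding b_axis by (simp add: M_def matrix_vector_mult_def axis_def if_distrib[of "\<lambda>x. _ * x"] cong: if_cong)
    then show ?thesis by (simp add: form_relation_def bilinear_relation_def)
  qed
  ultimately show thesis by (rule that)
qed

text \<open>The residue map followed by the given isomorphism; being injective, the isomorphism
  leaves the kernel unchanged.\<close>

lemma presentation_of_has_presentation: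
  fixes S :: "('n::finite list \<Rightarrow>\<^sub>0 'k::field) set"
  assumes S: "\<And>s. s \<in> S \<Longrightarrow> \<exists>n\<ge>2. s \<in> homogeneous n" and pres: "has_presentation A gr x S" and A: "ring A"
  obtains \<pi> where "presentation A \<pi> (Idl\<^bsub>tensor_algebra\<^esub> S)" "\<And>n. gr n = \<pi> ` homogeneous n"
proof -
  interpret Q: presentation "presented_algebra S" "residue_class S" "Idl\<^bsub>tensor_algebra\<^esub> S"
    by (rule presentation_residue_class[OF S])
  interpret A: ring A by (rule A)
  obtain h where h: "h \<in> ring_iso (presented_algebra S) A"
    and smult: "\<forall>c. \<forall>p \<in> carrier (presented_algebra S). h (c \<odot>\<^bsub>presented_algebra S\<^esub> p) = c \<odot>\<^bsub>A\<^esub> h p"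
    and grh: "\<forall>n. h ` presented_grading S n = gr n"
    using pres unfolding has_presentation_def by blast
  have hom: "h \<in> ring_hom (presented_algebra S) A" and bij: "bij_betw h (carrier (presented_algebra S)) (carrier A)"
    using h by (auto simp: ring_iso_def)
  have zero: "h \<zero>\<^bsub>presented_algebra S\<^esub> = \<zero>\<^bsub>A\<^esub>"
    by (rule ring_hom_zero[OF hom Q.ring_axioms A])
  show thesis
  proof (rule that[of "\<lambda>p. h (residue_class S p)"])
    show "presentation A (\<lambda>p. h (residue_class S p)) (Idl\<^bsub>tensor_algebra\<^esub> S)"
    proof
      show "carrier A = range (\<lambda>p. h (residue_class S p))"
        using bij_betw_imp_surj_on[OF bij] by (simp add: Q.\<pi>_surj image_image)
      fix p q :: "'n list \<Rightarrow>\<^sub>0 'k" and c n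
      show "h (residue_class S (p + q)) = h (residue_class S p) \<oplus>\<^bsub>A\<^esub> h (residue_class S q)"
        by (simp add: Q.\<pi>_add ring_hom_add[OF hom])
      show "h (residue_class S (p * q)) = h (residue_class S p) \<otimes>\<^bsub>A\<^esub> h (residue_class S q)"
        by (simp add: Q.\<pi>_mult ring_hom_mult[OF hom])
      show "h (residue_class S 1) = \<one>\<^bsub>A\<^esub>" by (simp add: Q.\<pi>_one ring_hom_one[OF hom])
      show "c \<odot>\<^bsub>A\<^esub> h (residue_class S p) = h (residue_class S (scalar c * p))"
        using smult by (simp flip: Q.\<pi>_smult)
      show "h (residue_class S p) = \<zero>\<^bsub>A\<^esub> \<longleftrightarrow> p \<in> Idl\<^bsub>tensor_algebra\<^esub> S"
        using inj_on_eq_iff[OF bij_betw_imp_inj_on[OF bij], of "residue_class S p" "\<zero>\<^bsub>presented_algebra S\<^esub>"] zero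
        by (simp add: Q.\<pi>_zero_iff)
      show "0 \<in> Idl\<^bsub>tensor_algebra\<^esub> S" by (rule Q.zero_in_I)
      show "component n p \<in> Idl\<^bsub>tensor_algebra\<^esub> S" if "p \<in> Idl\<^bsub>tensor_algebra\<^esub> S"
        using that by (rule Q.component_I)
      show "component n p = 0" if "p \<in> Idl\<^bsub>tensor_algebra\<^esub> S" "n < 2"
        using that by (rule Q.component_I_low)
    qed
    show "gr n = (\<lambda>p. h (residue_class S p)) ` homogeneous n" for n
      using grh[rule_format, of n] by (simp add: presented_grading_def image_image)
  qed
qed

text \<open>Algebra, grading and generators depend on the set of relations only through the ideal it
  generates.\<close>

lemma has_presentation_cong:
  assumes I: "Idl\<^bsub>tensor_algebra\<^esub> S = Idl\<^bsub>tensor_algebra\<^esub> S'" and pres: "has_presentation A gr x S"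
  shows "has_presentation A gr x S'"
proof -
  have r: "residue_class S' = residue_class S" by (simp add: residue_class_def[abs_def] I)
  have "presented_algebra S' = presented_algebra S" "presented_grading S' = presented_grading S"
    "presented_gen S' = presented_gen S"
    by (simp_all add: presented_algebra_def presented_grading_def[abs_def] presented_gen_def[abs_def] r I)
  then show ?thesis using pres by (simp add: has_presentation_def)
qed

text \<open>A subset of least cardinality among those that generate the syzygies; \<open>S\<close>
  itself does by \<open>rquot_Idl_decompose\<close>.\<close>

lemma (in presentation) exists_minimal_presentation:
  assumes I: "I = Idl\<^bsub>tensor_algebra\<^esub> S" and fin: "finite S"
    and hom: "\<And>s. s \<in> S \<Longrightarrow> \<exists>n\<ge>2. s \<in> homogeneous n"
  obtains R where "R \<subseteq> S" "minimal_presentation A \<pi> I R"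
proof -
  have "generates_syzygies S"
    unfolding generates_syzygies_def
  proof (intro allI impI)
    fix q assume "(\<Sum>l\<in>UNIV. q l * gen l) \<in> I"
    then have q: "(\<Sum>l\<in>UNIV. q l * gen l) \<in> Idl\<^bsub>tensor_algebra\<^esub> S" by (simp add: I)
    show "\<exists>t. \<forall>l. q l - (\<Sum>s\<in>S. t s * rquot l s) \<in> I"
    proof (rule rquot_Idl_decompose[OF q fin])
      fix s assume "s \<in> S"
      then obtain n where "n \<ge> 2" "s \<in> homogeneous n" using hom by blast
      then show "lookup s [] = 0" using lookup_homogeneous[of s n "[]"] by auto
    qed (auto simp: I)
  qed
  then obtain R where R: "R \<subseteq> S" "generates_syzygies R"
    and least: "\<And>R'. R' \<subseteq> S \<Longrightarrow> generates_syzygies R' \<Longrightarrow> card R \<le> card R'"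
    using ex_has_least_nat[of "\<lambda>R. R \<subseteq> S \<and> generates_syzygies R" S card] by blast
  have finR: "finite R" using R(1) fin by (rule finite_subset)
  have "minimal_presentation A \<pi> I R"
  proof (intro minimal_presentation.intro minimal_presentation_axioms.intro presentation_axioms finR R(2))
    show "R \<subseteq> I" using R(1) Idl_self by (auto simp: I)
    show "\<exists>n\<ge>2. s \<in> homogeneous n" if "s \<in> R" for s using that R(1) hom by blast
    show "\<not> generates_syzygies (R - {s})" if "s \<in> R" for s
    proof
      assume "generates_syzygies (R - {s})"
      then have "card R \<le> card (R - {s})" using least[of "R - {s}"] R(1) by blast
      then show False using card_Diff1_less[OF finR that] by linarith
    qed
  qed
  then show thesis using that R(1) by blast
qed

theorem theorem3:
  fixes s :: nat
    and universe_embedding :: "'k::{alg_closed_field, field_char_0} \<Rightarrow> 'm"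
  assumes "s \<ge> 1"
    and "CARD('n::finite) = s + 1"
    and "inj universe_embedding"
  shows "(\<forall>b :: 'k ^ 'n \<Rightarrow> 'k ^ 'n \<Rightarrow> 'k. bilinear_form b \<and> nondegenerate b \<longrightarrow>
            koszul {form_relation b} \<and>
            global_dim TYPE('m) (presented_algebra {form_relation b}) = 2 \<and>
            gorenstein TYPE('m) (presented_algebra {form_relation b}) (presented_grading {form_relation b}))
       \<and> (\<forall>(A :: ('k, 'c) module) gr (x :: 'n \<Rightarrow> 'c).
            connected_graded_algebra A gr \<and>
            (\<exists>S :: ('n list \<Rightarrow>\<^sub>0 'k) set. finite S \<and> (\<forall>r\<in>S. \<exists>n\<ge>2. r \<in> homogeneous n) \<and>
               has_presentation A gr x S) \<and>
            global_dim TYPE('m) A = 2 \<and> gorenstein TYPE('m) A gr \<longrightarrow>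
            (\<exists>b :: 'k ^ 'n \<Rightarrow> 'k ^ 'n \<Rightarrow> 'k. bilinear_form b \<and> nondegenerate b \<and>
               has_presentation A gr x {form_relation b}))"
proof (intro conjI[where P = "\<forall>b. _ b"] allI impI)
  \<comment> \<open>Characteristic zero makes the field infinite and hence also 'm, as the codings
    of free modules require.\<close>
  have "infinite (UNIV :: 'k set)" by (rule infinite_UNIV_char_0)
  then have U: "infinite (UNIV :: 'm set)"
    using finite_imageD[of universe_embedding UNIV] assms(3) finite_subset[OF subset_UNIV] by blast
  {
    fix b :: "'k ^ 'n \<Rightarrow> 'k ^ 'n \<Rightarrow> 'k"
    assume b: "bilinear_form b \<and> nondegenerate b"
    define B where "B \<mu> \<nu> = b (axis \<mu> 1) (axis \<nu> 1)" for \<mu> \<nu>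
    have f: "form_relation b = bilinear_relation B"
      by (simp add: form_relation_def bilinear_relation_def B_def)
    obtain B' where B': "nondegenerate_matrix B B'"
      using matrix_of_form[of b] b assms(1,2) unfolding B_def[abs_def] by auto
    interpret nondegenerate_matrix B B' by (rule B')
    interpret F: form_presentation "presented_algebra {bilinear_relation B}" "residue_class {bilinear_relation B}"
      "relation_ideal B" B B'
      by (intro form_presentation.intro form_presentation_axioms.intro B' refl presentation_residue_class)
         (use bilinear_relation_homogeneous in auto)
    have gr: "presented_grading {bilinear_relation B} n = residue_class {bilinear_relation B} ` homogeneous n" for n
      by (rule presented_grading_def)
    show "koszul {form_relation b} \<and> global_dim TYPE('m) (presented_algebra {form_relation b}) = 2 \<and>
      gorenstein TYPE('m) (presented_algebra {form_relation b}) (presented_grading {form_relation b})"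
      unfolding f using is_koszul F.global_dim_eq_2[OF gr U assms(3)] F.is_gorenstein[OF gr U assms(3)] by blast
  next
    fix A :: "('k, 'c) module" and gr and x :: "'n \<Rightarrow> 'c"
    assume H: "connected_graded_algebra A gr \<and>
            (\<exists>S :: ('n list \<Rightarrow>\<^sub>0 'k) set. finite S \<and> (\<forall>r\<in>S. \<exists>n\<ge>2. r \<in> homogeneous n) \<and>
               has_presentation A gr x S) \<and>
            global_dim TYPE('m) A = 2 \<and> gorenstein TYPE('m) A gr"
    then obtain S :: "('n list \<Rightarrow>\<^sub>0 'k) set" where S: "finite S" "\<And>r. r \<in> S \<Longrightarrow> \<exists>n\<ge>2. r \<in> homogeneous n"
      "has_presentation A gr x S" by blast
    have ringA: "ring A" using H by (simp add: connected_graded_algebra_def k_algebra_def)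
    obtain \<pi> where pres: "presentation A \<pi> (Idl\<^bsub>tensor_algebra\<^esub> S)" and gr: "\<And>n. gr n = \<pi> ` homogeneous n"
      by (rule presentation_of_has_presentation[OF S(2,3) ringA]) (assumption, rule that)
    interpret presentation A \<pi> "Idl\<^bsub>tensor_algebra\<^esub> S" by (rule pres)
    obtain R where R: "R \<subseteq> S" and "minimal_presentation A \<pi> (Idl\<^bsub>tensor_algebra\<^esub> S) R"
      by (rule exists_minimal_presentation[OF refl S(1,2)]) blast
    then interpret minimal_presentation A \<pi> "Idl\<^bsub>tensor_algebra\<^esub> S" R by blast
    let ?N = "encode_module universe_embedding (trivial_module A gr)"
    have N: "trivial_like ?N (universe_embedding 1)" by (rule trivial_like_encode[OF gr assms(3)])
    have "proj_dim A ?N \<le> global_dim TYPE('m) A"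
      using N by (intro proj_dim_le_global_dim) (simp add: trivial_like_def)
    then have "proj_dim A ?N \<le> enat 2" using H by (simp add: numeral_eq_enat)
    \<comment> \<open>This resolution of length two serves for injectivity of \<open>rel_map\<close>
      only; the one from the Gorenstein hypothesis is obtained separately and may be longer.\<close>
    then obtain P' d' e' where P': "projective_resolution A ?N P' d' e'"
      "\<forall>i>2. carrier (P' i) = {\<zero>\<^bsub>P' i :: ('c, 'm) module\<^esub>}"
      by (rule proj_dim_leD)
    have inj: "\<forall>F\<in>carrier rel_module. rel_map F = \<zero>\<^bsub>row_module\<^esub> \<longrightarrow> F = \<zero>\<^bsub>rel_module\<^esub>"
      using rel_map_injective[OF P'(1) N] P'(2) by simp
    obtain D :: nat and P :: "nat \<Rightarrow> ('c, 'm) module" and d e h where D: "global_dim TYPE('m) A = enat D"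
      and res: "projective_resolution A (trivial_module A gr) P d e"
      and h: "h \<in> module_homs A (ext_module A P d D) (trivial_module A gr)"
        "bij_betw h (carrier (ext_module A P d D)) (carrier (trivial_module A gr))"
    proof -
      have "gorenstein TYPE('m) A gr" using H by simp
      then show thesis unfolding gorenstein_def by (elim conjE exE bexE) (rule that)
    qed
    have "D = 2" using D H by (simp add: numeral_eq_enat)
    obtain r v where r: "R = {r}" and v: "\<And>m. gen m - (\<Sum>l\<in>UNIV. rquot l r * v m l) \<in> Idl\<^bsub>tensor_algebra\<^esub> S"
      by (rule single_relation[OF inj gr res h[unfolded \<open>D = 2\<close>]]) blast
    obtain n where n: "n \<ge> 2" "r \<in> homogeneous n" using hom r by blast
    \<comment> \<open>The first fact forces the single relation to be quadratic, the second inverts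
      its coefficient matrix.\<close>
    note mat = scalar_matrix_of_relation[OF component_I_low n(2,1) v]
    have r2: "r \<in> homogeneous 2" using n mat(1) by simp
    have "I = Idl\<^bsub>tensor_algebra\<^esub> {r}" if "I = Idl\<^bsub>tensor_algebra\<^esub> S" for I
      using ideal_of_single_relation[OF r r2] that by simp
    then have Ir: "Idl\<^bsub>tensor_algebra\<^esub> S = Idl\<^bsub>tensor_algebra\<^esub> {r}" by blast
    obtain b :: "'k ^ 'n \<Rightarrow> 'k ^ 'n \<Rightarrow> 'k" where b: "bilinear_form b" "nondegenerate b"
      "form_relation b = bilinear_relation (\<lambda>\<mu> \<nu>. lookup r [\<mu>, \<nu>])"
      by (rule form_of_matrix[of "\<lambda>\<mu> \<nu>. lookup r [\<mu>, \<nu>]" "\<lambda>l m. lookup (v m l) []"])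
         (use mat(2) in auto)
    have "form_relation b = r"
      using b(3) homogeneous_2_eq_bilinear_relation[OF r2] by simp
    then show "\<exists>b :: 'k ^ 'n \<Rightarrow> 'k ^ 'n \<Rightarrow> 'k. bilinear_form b \<and> nondegenerate b \<and>
      has_presentation A gr x {form_relation b}"
      using b(1,2) has_presentation_cong[OF Ir S(3)] by blast
  }
qed

end
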